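(* Let $(M,d,\mathbf m)$ be a complete metric measure space with $\mathbf m$ a Radon measure and let $p\in(1,\infty)$. Assume that the $L^p$-Lipschitz module $L^p_{\mathrm{lip}}(T^*M)$ is weakly reflexive. Let $L^p_{\mathrm{lip}_0}(T^*M)$ be the module generated by all $\omega\in L^p_{\mathrm{lip}}(T^*M)$ for which there is a sequence $f_n\in D(\mathcal F_p^{\mathrm{lip}})$ with $f_n\to0$ in $L^0(\mathbf m)$ and $d_{\mathrm{lip}}f_n\to\omega$ strongly in $L^p_{\mathrm{lip}}(T^*M)$. Then $L^p_{\mathrm{lip}_0}(T^*M)$ is a submodule of $L^p_{\mathrm{lip}}(T^*M)$ such that $$L^p(T^*M)\cong L^p_{\mathrm{lip}}(T^*M)\big/L^p_{\mathrm{lip}_0}(T^*M)$$ (isometrically, as $L^p(\mathbf m)$-normed modules). In addition, $d_{\mathrm{lip}}$ is closable as an operator from $L^0(\mathbf m)$ to $L^p_{\mathrm{lip}}(T^*M)$ if and only if $L^p_{\mathrm{lip}_0}(T^*M)$ is trivial, in which case $L^p(T^*M)\cong L^p_{\mathrm{lip}}(T^*M)$ and $|Df|_{*,p}=\operatorname{lip}f$ $\mathbf m$-a.e. for all $f\in D(\mathcal F_p^{\mathrm{lip}})$.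
   Context: Convergence in $L^0(\mathbf m)$ (the space of measurable functions) means $\mathbf m$-a.e. convergence. For a Lipschitz function $f$ on $M$, $\operatorname{lip}f(x)=\limsup_{y\to x}\frac{|f(y)-f(x)|}{d(y,x)}$. $D(\mathcal F_p^{\mathrm{lip}})$ is the set of $f\in\mathrm{Lip}(M,d)$ with $\operatorname{lip}f\in L^p(\mathbf m)$, and $\mathcal F_p^{\mathrm{lip}}(f)=\operatorname{lip}f$; this is subadditive and absolutely homogeneous. Module generated by a functional: given a linear subspace $D(\mathcal F)\subset L^0(\mathbf m)$ and $\mathcal F:D(\mathcal F)\to L^p_+(\mathbf m)$ (non-negative $L^p$ functions), $f\mapsto g_f$, with $g_{f+h}\le g_f+g_h$, $g_{\lambda f}=|\lambda|g_f$ a.e., let $\mathsf{Pfm}$ be the set of families $\{(f_i,A_i)\}_{i\in\mathbb N}$ with $(A_i)$ a Borel partition of $M$, $f_i\in D(\mathcal F)$, $\sum_i\int_{A_i}g_{f_i}^pd\mathbf m<\infty$, modulo $\{(f_i,A_i)\}\sim\{(h_j,B_j)\}$ iff $g_{f_i-h_j}=0$ a.e. on $A_i\cap B_j$ for all $i,j$. With $[(f_i,A_i)]+[(h_j,B_j)]=[(f_i+h_j,A_i\cap B_j)]$, $\lambda[(f_i,A_i)]=[(\lambda f_i,A_i)]$, $(\sum_ja_j\chi_{B_j})[(f_i,A_i)]=[(a_jf_i,A_i\cap B_j)]$, pointwise norm $|[(f_i,A_i)]|=g_{f_i}$ on $A_i$ and norm $\||v|\|_{L^p}$, the completion of $\mathsf{Pfm}/\!\sim$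 is an $L^p(\mathbf m)$-normed module $\mathcal M_{\mathcal F}$ (Banach space with $L^\infty(\mathbf m)$-multiplication, pointwise norm $|\cdot|$ satisfying $\|v\|=\||v|\|_{L^p}$, $|fv|=|f||v|$, and locality and glueing over countable Borel families). Set $d_{\mathcal F}f=[(f,M)]$. A submodule is a closed subspace which is itself an $L^p(\mathbf m)$-normed module; the submodule generated by a set is the smallest one containing it; quotients carry the quotient norm. $L^p_{\mathrm{lip}}(T^*M)=\mathcal M_{\mathcal F_p^{\mathrm{lip}}}$ and $d_{\mathrm{lip}}f=d_{\mathcal F_p^{\mathrm{lip}}}f$. Lower relaxation: $D(\mathcal F_p)$ is the set of $f\in L^0(\mathbf m)$ for which there are $f_n\in D(\mathcal F_p^{\mathrm{lip}})$ with $f_n\to f$ in $L^0(\mathbf m)$ and $(\operatorname{lip}f_n)$ bounded in $L^p(\mathbf m)$. For such $f$, the relaxed slope $\mathcal F_p(f)=|Df|_{*,p}$ is the ($\mathbf m$-a.e.) largest $G\in L^p(\mathbf m)$ such that $G\le\tilde G$ a.e. whenever $D(\mathcal F_p^{\mathrm{lip}})\ni f_n\to f$ in $L^0(\mathbf m)$ and $\operatorname{lip}f_n\rightharpoonup\tilde G$ weakly in $L^p(\mathbf m)$. $L^p(T^*M)=\mathcal M_{\mathcal F_p}$ is the $L^p$-cotangent module. $L^p_{\mathrm{lip}}(T^*M)$ is weakly reflexive if every bounded sequence $(d_{\mathrm{lip}}f_n)$ in it with $D(\mathcal F_p^{\mathrm{lip}})\ni f_n\to f$ in $L^0(\mathbf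 m)$ has a weakly convergent subsequence. $d_{\mathrm{lip}}$ is closable if $D(\mathcal F_p^{\mathrm{lip}})\ni f_n\to0$ in $L^0(\mathbf m)$ and $d_{\mathrm{lip}}f_n\to\omega$ imply $\omega=0$. *)

theory Defs
  imports "HOL-Analysis.Analysis"
begin

text \<open>
  Elements of \<open>L\<^sup>0\<close>, \<open>L\<^sup>p\<close> and \<open>L\<^sup>\<infinity>\<close> are represented by functions rather than by classes modulo
  almost everywhere equality; pointwise (in)equalities are stated almost everywhere. Objects
  determined only up to a null set (pointwise norms, relaxed slopes) are given by a chosen
  representative.
\<close>

definition radon_measure :: "'a::topological_space measure \<Rightarrow> bool" where
  "radon_measure m \<longleftrightarrow>
     sets m = sets borel \<and>
     (\<forall>x. \<exists>U. open U \<and> x \<in> U \<and> emeasure m U < \<infinity>) \<and>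
     (\<forall>B\<in>sets borel. emeasure m B = (SUP K\<in>{K. K \<subseteq> B \<and> compact K}. emeasure m K))"

definition Lp :: "'a measure \<Rightarrow> real \<Rightarrow> ('a \<Rightarrow> real) set" where
  "Lp m p = {f \<in> borel_measurable m. integrable m (\<lambda>x. \<bar>f x\<bar> powr p)}"

definition Lp_norm :: "'a measure \<Rightarrow> real \<Rightarrow> ('a \<Rightarrow> real) \<Rightarrow> real" where
  "Lp_norm m p f = (LINT x|m. \<bar>f x\<bar> powr p) powr (1 / p)"

definition Linf :: "'a measure \<Rightarrow> ('a \<Rightarrow> real) set" where
  "Linf m = {f \<in> borel_measurable m. \<exists>C. AE x in m. \<bar>f x\<bar> \<le> C}"

definition L0_converges :: "'a measure \<Rightarrow> (nat \<Rightarrow> 'a \<Rightarrow> real) \<Rightarrow> ('a \<Rightarrow> real) \<Rightarrow> bool" where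
  "L0_converges m F f \<longleftrightarrow> (AE x in m. (\<lambda>n. F n x) \<longlonglongrightarrow> f x)"

text \<open>The almost everywhere largest element of \<open>L\<^sup>p\<close> lying below every member of \<open>S\<close>.\<close>

definition Lp_ess_inf :: "'a measure \<Rightarrow> real \<Rightarrow> ('a \<Rightarrow> real) set \<Rightarrow> 'a \<Rightarrow> real" where
  "Lp_ess_inf m p S = (SOME G. G \<in> Lp m p \<and> (\<forall>F\<in>S. AE x in m. G x \<le> F x) \<and>
     (\<forall>H\<in>Lp m p. (\<forall>F\<in>S. AE x in m. H x \<le> F x) \<longrightarrow> (AE x in m. H x \<le> G x)))"


section \<open>Normed modules\<close>

record ('a, 'v) nmodule =
  mcarrier :: "'v set"
  madd :: "'v \<Rightarrow> 'v \<Rightarrow> 'v"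
  mzero :: "'v"
  mscale :: "real \<Rightarrow> 'v \<Rightarrow> 'v"
  mmult :: "('a \<Rightarrow> real) \<Rightarrow> 'v \<Rightarrow> 'v"
  mpnorm :: "'v \<Rightarrow> 'a \<Rightarrow> real"
  mnorm :: "'v \<Rightarrow> real"

definition mdiff :: "('a, 'v) nmodule \<Rightarrow> 'v \<Rightarrow> 'v \<Rightarrow> 'v" where
  "mdiff N u v = madd N u (mscale N (- 1) v)"

primrec msum :: "('a, 'v) nmodule \<Rightarrow> (nat \<Rightarrow> 'v) \<Rightarrow> nat \<Rightarrow> 'v" where
  "msum N v 0 = mzero N"
| "msum N v (Suc n) = madd N (msum N v n) (v n)"

definition mconverges :: "('a, 'v) nmodule \<Rightarrow> (nat \<Rightarrow> 'v) \<Rightarrow> 'v \<Rightarrow> bool" where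
  "mconverges N X v \<longleftrightarrow> (\<lambda>n. mnorm N (mdiff N (X n) v)) \<longlonglongrightarrow> 0"

definition mCauchy :: "('a, 'v) nmodule \<Rightarrow> (nat \<Rightarrow> 'v) \<Rightarrow> bool" where
  "mCauchy N X \<longleftrightarrow> (\<forall>n. X n \<in> mcarrier N) \<and>
     (\<forall>e>0. \<exists>K. \<forall>i\<ge>K. \<forall>j\<ge>K. mnorm N (mdiff N (X i) (X j)) < e)"

definition bounded_functional :: "('a, 'v) nmodule \<Rightarrow> ('v \<Rightarrow> real) \<Rightarrow> bool" where
  "bounded_functional N \<phi> \<longleftrightarrow>
     (\<forall>u\<in>mcarrier N. \<forall>v\<in>mcarrier N. \<phi> (madd N u v) = \<phi> u + \<phi> v) \<and>
     (\<forall>c. \<forall>v\<in>mcarrier N. \<phi> (mscale N c v) = c * \<phi> v) \<and>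
     (\<exists>C. \<forall>v\<in>mcarrier N. \<bar>\<phi> v\<bar> \<le> C * mnorm N v)"

definition mweakly_converges :: "('a, 'v) nmodule \<Rightarrow> (nat \<Rightarrow> 'v) \<Rightarrow> 'v \<Rightarrow> bool" where
  "mweakly_converges N X v \<longleftrightarrow> (\<forall>n. X n \<in> mcarrier N) \<and> v \<in> mcarrier N \<and>
     (\<forall>\<phi>. bounded_functional N \<phi> \<longrightarrow> (\<lambda>n. \<phi> (X n)) \<longlonglongrightarrow> \<phi> v)"

locale Lp_normed_module =
  fixes m :: "'a measure" and p :: real and N :: "('a, 'v) nmodule"
  assumes zero_closed: "mzero N \<in> mcarrier N"
    and add_closed: "\<lbrakk>u \<in> mcarrier N; v \<in> mcarrier N\<rbrakk> \<Longrightarrow> madd N u v \<in> mcarrier N"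
    and scale_closed: "v \<in> mcarrier N \<Longrightarrow> mscale N c v \<in> mcarrier N"
    and add_assoc: "\<lbrakk>u \<in> mcarrier N; v \<in> mcarrier N; w \<in> mcarrier N\<rbrakk> \<Longrightarrow>
          madd N (madd N u v) w = madd N u (madd N v w)"
    and add_commute: "\<lbrakk>u \<in> mcarrier N; v \<in> mcarrier N\<rbrakk> \<Longrightarrow> madd N u v = madd N v u"
    and add_zero: "v \<in> mcarrier N \<Longrightarrow> madd N v (mzero N) = v"
    and diff_self: "v \<in> mcarrier N \<Longrightarrow> mdiff N v v = mzero N"
    and scale_add_right: "\<lbrakk>u \<in> mcarrier N; v \<in> mcarrier N\<rbrakk> \<Longrightarrow>
          mscale N c (madd N u v) = madd N (mscale N c u) (mscale N c v)"
    and scale_add_left: "v \<in> mcarrier N \<Longrightarrow>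
          mscale N (b + c) v = madd N (mscale N b v) (mscale N c v)"
    and scale_scale: "v \<in> mcarrier N \<Longrightarrow> mscale N b (mscale N c v) = mscale N (b * c) v"
    and scale_one: "v \<in> mcarrier N \<Longrightarrow> mscale N 1 v = v"
    and norm_eq_zero: "v \<in> mcarrier N \<Longrightarrow> mnorm N v = 0 \<longleftrightarrow> v = mzero N"
    and norm_triangle: "\<lbrakk>u \<in> mcarrier N; v \<in> mcarrier N\<rbrakk> \<Longrightarrow>
          mnorm N (madd N u v) \<le> mnorm N u + mnorm N v"
    and norm_scale: "v \<in> mcarrier N \<Longrightarrow> mnorm N (mscale N c v) = \<bar>c\<bar> * mnorm N v"
    and complete: "mCauchy N X \<Longrightarrow> \<exists>v\<in>mcarrier N. mconverges N X v"
    and mult_closed: "\<lbrakk>f \<in> Linf m; v \<in> mcarrier N\<rbrakk> \<Longrightarrow> mmult N f v \<in> mcarrier N"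
    and mult_cong_AE: "\<lbrakk>f \<in> Linf m; g \<in> Linf m; AE x in m. f x = g x; v \<in> mcarrier N\<rbrakk> \<Longrightarrow>
          mmult N f v = mmult N g v"
    and mult_add_right: "\<lbrakk>f \<in> Linf m; u \<in> mcarrier N; v \<in> mcarrier N\<rbrakk> \<Longrightarrow>
          mmult N f (madd N u v) = madd N (mmult N f u) (mmult N f v)"
    and mult_add_left: "\<lbrakk>f \<in> Linf m; g \<in> Linf m; v \<in> mcarrier N\<rbrakk> \<Longrightarrow>
          mmult N (\<lambda>x. f x + g x) v = madd N (mmult N f v) (mmult N g v)"
    and mult_mult: "\<lbrakk>f \<in> Linf m; g \<in> Linf m; v \<in> mcarrier N\<rbrakk> \<Longrightarrow>
          mmult N f (mmult N g v) = mmult N (\<lambda>x. f x * g x) v"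
    and mult_const: "v \<in> mcarrier N \<Longrightarrow> mmult N (\<lambda>_. c) v = mscale N c v"
    and pnorm_in_Lp: "v \<in> mcarrier N \<Longrightarrow> mpnorm N v \<in> Lp m p"
    and pnorm_nonneg: "v \<in> mcarrier N \<Longrightarrow> AE x in m. 0 \<le> mpnorm N v x"
    and norm_eq_Lp_norm: "v \<in> mcarrier N \<Longrightarrow> mnorm N v = Lp_norm m p (mpnorm N v)"
    and pnorm_mult: "\<lbrakk>f \<in> Linf m; v \<in> mcarrier N\<rbrakk> \<Longrightarrow>
          AE x in m. mpnorm N (mmult N f v) x = \<bar>f x\<bar> * mpnorm N v x"
    and locality: "\<lbrakk>v \<in> mcarrier N; \<And>i::nat. A i \<in> sets m;
          \<And>i. mmult N (indicator (A i)) v = mzero N\<rbrakk> \<Longrightarrow>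
          mmult N (indicator (\<Union>i. A i)) v = mzero N"
    and glueing: "\<lbrakk>\<And>i::nat. V i \<in> mcarrier N; \<And>i. A i \<in> sets m;
          \<And>i j. mmult N (indicator (A i \<inter> A j)) (V i) = mmult N (indicator (A i \<inter> A j)) (V j);
          \<And>n. mnorm N (msum N (\<lambda>i. mmult N (indicator (A i)) (V i)) n) \<le> C\<rbrakk> \<Longrightarrow>
          \<exists>v\<in>mcarrier N. (\<forall>i. mmult N (indicator (A i)) v = mmult N (indicator (A i)) (V i)) \<and>
            ereal (mnorm N v) \<le>
              liminf (\<lambda>n. ereal (mnorm N (msum N (\<lambda>i. mmult N (indicator (A i)) (V i)) n)))"

text \<open>\<open>L\<^sup>p\<close> as an instance of the structure; its carrier consists of functions, so here \<open>mnorm\<close> is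
  only a seminorm. Bounded functionals nevertheless factor through the classes.\<close>

definition Lp_space :: "'a measure \<Rightarrow> real \<Rightarrow> ('a, 'a \<Rightarrow> real) nmodule" where
  "Lp_space m p = \<lparr>
     mcarrier = Lp m p,
     madd = (\<lambda>f g x. f x + g x),
     mzero = (\<lambda>x. 0),
     mscale = (\<lambda>c f x. c * f x),
     mmult = (\<lambda>f g x. f x * g x),
     mpnorm = (\<lambda>f x. \<bar>f x\<bar>),
     mnorm = Lp_norm m p\<rparr>"

definition submodule :: "'a measure \<Rightarrow> real \<Rightarrow> ('a, 'v) nmodule \<Rightarrow> 'v set \<Rightarrow> bool" where
  "submodule m p N W \<longleftrightarrow>
     W \<subseteq> mcarrier N \<and> mzero N \<in> W \<and>
     (\<forall>u\<in>W. \<forall>v\<in>W. madd N u v \<in> W) \<and> (\<forall>c. \<forall>v\<in>W. mscale N c v \<in> W) \<and>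
     (\<forall>X. \<forall>v\<in>mcarrier N. (\<forall>n. X n \<in> W) \<and> mconverges N X v \<longrightarrow> v \<in> W) \<and>
     Lp_normed_module m p (N\<lparr>mcarrier := W\<rparr>)"

definition generated_submodule ::
    "'a measure \<Rightarrow> real \<Rightarrow> ('a, 'v) nmodule \<Rightarrow> 'v set \<Rightarrow> 'v set" where
  "generated_submodule m p N S = \<Inter>{W. submodule m p N W \<and> S \<subseteq> W}"

definition quotient_rel :: "('a, 'v) nmodule \<Rightarrow> 'v set \<Rightarrow> ('v \<times> 'v) set" where
  "quotient_rel N W = {(u, v). u \<in> mcarrier N \<and> v \<in> mcarrier N \<and> mdiff N u v \<in> W}"

text \<open>A coset \<open>C = v + W\<close> carries the quotient norm \<open>INF w\<in>W. \<parallel>v + w\<parallel>\<close>; the corresponding pointwise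
  norm is the essential infimum of \<open>\<bar>v + w\<bar>\<close> over \<open>w \<in> W\<close>.\<close>

definition quotient_module ::
    "'a measure \<Rightarrow> real \<Rightarrow> ('a, 'v) nmodule \<Rightarrow> 'v set \<Rightarrow> ('a, 'v set) nmodule" where
  "quotient_module m p N W = \<lparr>
     mcarrier = mcarrier N // quotient_rel N W,
     madd = (\<lambda>C D. \<Union>u\<in>C. \<Union>v\<in>D. quotient_rel N W `` {madd N u v}),
     mzero = quotient_rel N W `` {mzero N},
     mscale = (\<lambda>c C. \<Union>v\<in>C. quotient_rel N W `` {mscale N c v}),
     mmult = (\<lambda>f C. \<Union>v\<in>C. quotient_rel N W `` {mmult N f v}),
     mpnorm = (\<lambda>C. Lp_ess_inf m p (mpnorm N ` C)),
     mnorm = (\<lambda>C. INF v\<in>C. mnorm N v)\<rparr>"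

definition Lp_module_isomorphic ::
    "'a measure \<Rightarrow> real \<Rightarrow> ('a, 'v) nmodule \<Rightarrow> ('a, 'w) nmodule \<Rightarrow> bool" where
  "Lp_module_isomorphic m p N N' \<longleftrightarrow>
     Lp_normed_module m p N \<and> Lp_normed_module m p N' \<and>
     (\<exists>T. bij_betw T (mcarrier N) (mcarrier N') \<and>
        (\<forall>u\<in>mcarrier N. \<forall>v\<in>mcarrier N. T (madd N u v) = madd N' (T u) (T v)) \<and>
        (\<forall>c. \<forall>v\<in>mcarrier N. T (mscale N c v) = mscale N' c (T v)) \<and>
        (\<forall>f\<in>Linf m. \<forall>v\<in>mcarrier N. T (mmult N f v) = mmult N' f (T v)) \<and>
        (\<forall>v\<in>mcarrier N. mnorm N' (T v) = mnorm N v) \<and>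
        (\<forall>v\<in>mcarrier N. AE x in m. mpnorm N' (T v) x = mpnorm N v x))"


section \<open>Completion\<close>

definition null_diff_rel :: "('a, 'v) nmodule \<Rightarrow> ((nat \<Rightarrow> 'v) \<times> (nat \<Rightarrow> 'v)) set" where
  "null_diff_rel N = {(X, Y). mCauchy N X \<and> mCauchy N Y \<and>
     (\<lambda>n. mnorm N (mdiff N (X n) (Y n))) \<longlonglongrightarrow> 0}"

definition simple_approx :: "'a measure \<Rightarrow> ('a \<Rightarrow> real) \<Rightarrow> (nat \<Rightarrow> 'a \<Rightarrow> real) set" where
  "simple_approx m f = {s. (\<forall>n. simple_function m (s n)) \<and>
     (\<forall>e>0. \<forall>\<^sub>F n in sequentially. AE x in m. \<bar>s n x - f x\<bar> \<le> e)}"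

text \<open>Classes of Cauchy sequences. Of the multiplication of \<open>N\<close> only that by simple functions is used;
  it is extended to \<open>L\<^sup>\<infinity>\<close> by continuity.\<close>

definition completion ::
    "'a measure \<Rightarrow> real \<Rightarrow> ('a, 'v) nmodule \<Rightarrow> ('a, (nat \<Rightarrow> 'v) set) nmodule" where
  "completion m p N = \<lparr>
     mcarrier = {X. mCauchy N X} // null_diff_rel N,
     madd = (\<lambda>C D. \<Union>X\<in>C. \<Union>Y\<in>D. null_diff_rel N `` {\<lambda>n. madd N (X n) (Y n)}),
     mzero = null_diff_rel N `` {\<lambda>n. mzero N},
     mscale = (\<lambda>c C. \<Union>X\<in>C. null_diff_rel N `` {\<lambda>n. mscale N c (X n)}),
     mmult = (\<lambda>f C. \<Union>X\<in>C. \<Union>s\<in>simple_approx m f.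
               null_diff_rel N `` {\<lambda>n. mmult N (s n) (X n)}),
     mpnorm = (\<lambda>C. SOME G. G \<in> Lp m p \<and>
               (\<exists>X\<in>C. (\<lambda>n. Lp_norm m p (\<lambda>x. mpnorm N (X n) x - G x)) \<longlonglongrightarrow> 0)),
     mnorm = (\<lambda>C. THE c. \<exists>X\<in>C. (\<lambda>n. mnorm N (X n)) \<longlonglongrightarrow> c)\<rparr>"

definition completion_embed :: "('a, 'v) nmodule \<Rightarrow> 'v \<Rightarrow> (nat \<Rightarrow> 'v) set" where
  "completion_embed N v = null_diff_rel N `` {\<lambda>n. v}"


section \<open>The module generated by a functional\<close>

text \<open>A family \<open>(f\<^sub>i, A\<^sub>i)\<close> is a function on \<open>nat\<close>; \<open>D\<close> is the domain of the functional and
  \<open>g f\<close> its value at \<open>f\<close>. Doubly indexed families are enumerated by \<open>prod_decode\<close>.\<close>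

type_synonym 'a family = "nat \<Rightarrow> ('a \<Rightarrow> real) \<times> 'a set"

definition borel_partition :: "'a measure \<Rightarrow> (nat \<Rightarrow> 'a set) \<Rightarrow> bool" where
  "borel_partition m A \<longleftrightarrow> (\<forall>i. A i \<in> sets m) \<and> disjoint_family A \<and> (\<Union>i. A i) = space m"

definition Pfm :: "'a measure \<Rightarrow> real \<Rightarrow> ('a \<Rightarrow> real) set \<Rightarrow> (('a \<Rightarrow> real) \<Rightarrow> 'a \<Rightarrow> real) \<Rightarrow>
    'a family set" where
  "Pfm m p D g = {F. borel_partition m (\<lambda>i. snd (F i)) \<and> (\<forall>i. fst (F i) \<in> D) \<and>
     (\<Sum>i. \<integral>\<^sup>+x\<in>snd (F i). ennreal (\<bar>g (fst (F i)) x\<bar> powr p) \<partial>m) < \<infinity>}"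

definition Pfm_rel :: "'a measure \<Rightarrow> real \<Rightarrow> ('a \<Rightarrow> real) set \<Rightarrow> (('a \<Rightarrow> real) \<Rightarrow> 'a \<Rightarrow> real) \<Rightarrow>
    ('a family \<times> 'a family) set" where
  "Pfm_rel m p D g = {(F, H). F \<in> Pfm m p D g \<and> H \<in> Pfm m p D g \<and>
     (\<forall>i j. AE x in m. x \<in> snd (F i) \<inter> snd (H j) \<longrightarrow>
        g (\<lambda>y. fst (F i) y - fst (H j) y) x = 0)}"

definition Pfm_add :: "'a family \<Rightarrow> 'a family \<Rightarrow> 'a family" where
  "Pfm_add F H = (\<lambda>k. case prod_decode k of (i, j) \<Rightarrow>
     (\<lambda>x. fst (F i) x + fst (H j) x, snd (F i) \<inter> snd (H j)))"

definition Pfm_scale :: "real \<Rightarrow> 'a family \<Rightarrow> 'a family" where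
  "Pfm_scale c F = (\<lambda>i. (\<lambda>x. c * fst (F i) x, snd (F i)))"

definition Pfm_mult :: "(nat \<Rightarrow> real) \<Rightarrow> (nat \<Rightarrow> 'a set) \<Rightarrow> 'a family \<Rightarrow> 'a family" where
  "Pfm_mult a B F = (\<lambda>k. case prod_decode k of (i, j) \<Rightarrow>
     (\<lambda>x. a j * fst (F i) x, snd (F i) \<inter> B j))"

text \<open>The ways of writing a simple function as \<open>\<Sum>j. a\<^sub>j \<chi>\<^bsub>B\<^sub>j\<^esub>\<close> with a partition \<open>B\<close>.\<close>

definition simple_reps :: "'a measure \<Rightarrow> ('a \<Rightarrow> real) \<Rightarrow> ((nat \<Rightarrow> real) \<times> (nat \<Rightarrow> 'a set)) set" where
  "simple_reps m s = {(a, B). borel_partition m B \<and> (\<forall>j. \<forall>x\<in>B j. s x = a j)}"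

definition Pfm_pnorm :: "(('a \<Rightarrow> real) \<Rightarrow> 'a \<Rightarrow> real) \<Rightarrow> 'a family \<Rightarrow> 'a \<Rightarrow> real" where
  "Pfm_pnorm g F x = g (fst (F (THE i. x \<in> snd (F i)))) x"

definition single_family :: "'a measure \<Rightarrow> ('a \<Rightarrow> real) \<Rightarrow> 'a family" where
  "single_family m f = (\<lambda>i. (f, if i = 0 then space m else {}))"

definition Pfm_quotient ::
    "'a measure \<Rightarrow> real \<Rightarrow> ('a \<Rightarrow> real) set \<Rightarrow> (('a \<Rightarrow> real) \<Rightarrow> 'a \<Rightarrow> real) \<Rightarrow>
     ('a, 'a family set) nmodule" where
  "Pfm_quotient m p D g = \<lparr>
     mcarrier = Pfm m p D g // Pfm_rel m p D g,
     madd = (\<lambda>C E. \<Union>F\<in>C. \<Union>H\<in>E. Pfm_rel m p D g `` {Pfm_add F H}),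
     mzero = Pfm_rel m p D g `` {single_family m (\<lambda>x. 0)},
     mscale = (\<lambda>c C. \<Union>F\<in>C. Pfm_rel m p D g `` {Pfm_scale c F}),
     mmult = (\<lambda>s C. \<Union>F\<in>C. \<Union>(a, B)\<in>simple_reps m s. Pfm_rel m p D g `` {Pfm_mult a B F}),
     mpnorm = (\<lambda>C. Pfm_pnorm g (SOME F. F \<in> C)),
     mnorm = (\<lambda>C. Lp_norm m p (Pfm_pnorm g (SOME F. F \<in> C)))\<rparr>"

type_synonym 'a generated = "(nat \<Rightarrow> 'a family set) set"

definition generated_module ::
    "'a measure \<Rightarrow> real \<Rightarrow> ('a \<Rightarrow> real) set \<Rightarrow> (('a \<Rightarrow> real) \<Rightarrow> 'a \<Rightarrow> real) \<Rightarrow>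
     ('a, 'a generated) nmodule" where
  "generated_module m p D g = completion m p (Pfm_quotient m p D g)"

definition generated_diff ::
    "'a measure \<Rightarrow> real \<Rightarrow> ('a \<Rightarrow> real) set \<Rightarrow> (('a \<Rightarrow> real) \<Rightarrow> 'a \<Rightarrow> real) \<Rightarrow>
     ('a \<Rightarrow> real) \<Rightarrow> 'a generated" where
  "generated_diff m p D g f =
     completion_embed (Pfm_quotient m p D g) (Pfm_rel m p D g `` {single_family m f})"


section \<open>The Lipschitz module and the cotangent module\<close>

text \<open>The upper limit is taken in \<open>ennreal\<close>, so that the slope is \<open>0\<close> at isolated points.\<close>

definition lip :: "('a::metric_space \<Rightarrow> real) \<Rightarrow> 'a \<Rightarrow> real" where
  "lip f x = enn2real (Limsup (at x) (\<lambda>y. ennreal (\<bar>f y - f x\<bar> / dist y x)))"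

definition D_lip :: "'a::metric_space measure \<Rightarrow> real \<Rightarrow> ('a \<Rightarrow> real) set" where
  "D_lip m p = {f. (\<exists>C. C-lipschitz_on UNIV f) \<and> lip f \<in> Lp m p}"

definition Lp_lip :: "'a::metric_space measure \<Rightarrow> real \<Rightarrow> ('a, 'a generated) nmodule" where
  "Lp_lip m p = generated_module m p (D_lip m p) lip"

definition d_lip :: "'a::metric_space measure \<Rightarrow> real \<Rightarrow> ('a \<Rightarrow> real) \<Rightarrow> 'a generated" where
  "d_lip m p = generated_diff m p (D_lip m p) lip"

definition D_relaxed :: "'a::metric_space measure \<Rightarrow> real \<Rightarrow> ('a \<Rightarrow> real) set" where
  "D_relaxed m p = {f \<in> borel_measurable m. \<exists>F. (\<forall>n. F n \<in> D_lip m p) \<and> L0_converges m F f \<and>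
     (\<exists>C. \<forall>n. Lp_norm m p (lip (F n)) \<le> C)}"

definition relaxed_slope ::
    "'a::metric_space measure \<Rightarrow> real \<Rightarrow> ('a \<Rightarrow> real) \<Rightarrow> 'a \<Rightarrow> real" where
  "relaxed_slope m p f = Lp_ess_inf m p
     {G. \<exists>F. (\<forall>n. F n \<in> D_lip m p) \<and> L0_converges m F f \<and>
        mweakly_converges (Lp_space m p) (\<lambda>n. lip (F n)) G}"

definition Lp_cotangent :: "'a::metric_space measure \<Rightarrow> real \<Rightarrow> ('a, 'a generated) nmodule" where
  "Lp_cotangent m p = generated_module m p (D_relaxed m p) (relaxed_slope m p)"

definition weakly_reflexive :: "'a::metric_space measure \<Rightarrow> real \<Rightarrow> bool" where
  "weakly_reflexive m p \<longleftrightarrow>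
     (\<forall>F f. (\<forall>n. F n \<in> D_lip m p) \<and> f \<in> borel_measurable m \<and> L0_converges m F f \<and>
        (\<exists>C. \<forall>n. mnorm (Lp_lip m p) (d_lip m p (F n)) \<le> C) \<longrightarrow>
      (\<exists>r \<omega>. strict_mono (r :: nat \<Rightarrow> nat) \<and>
         mweakly_converges (Lp_lip m p) (\<lambda>n. d_lip m p (F (r n))) \<omega>))"

definition d_lip_closable :: "'a::metric_space measure \<Rightarrow> real \<Rightarrow> bool" where
  "d_lip_closable m p \<longleftrightarrow>
     (\<forall>F. \<forall>\<omega>\<in>mcarrier (Lp_lip m p). (\<forall>n. F n \<in> D_lip m p) \<and> L0_converges m F (\<lambda>x. 0) \<and>
        mconverges (Lp_lip m p) (\<lambda>n. d_lip m p (F n)) \<omega> \<longrightarrow> \<omega> = mzero (Lp_lip m p))"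

definition Lp_lip0 :: "'a::metric_space measure \<Rightarrow> real \<Rightarrow> 'a generated set" where
  "Lp_lip0 m p = generated_submodule m p (Lp_lip m p)
     {\<omega> \<in> mcarrier (Lp_lip m p). \<exists>F. (\<forall>n. F n \<in> D_lip m p) \<and> L0_converges m F (\<lambda>x. 0) \<and>
        mconverges (Lp_lip m p) (\<lambda>n. d_lip m p (F n)) \<omega>}"

end

theory Submission
  imports Defs
begin

text \<open>
  \<open>L\<^sup>p(T\<^sup>*M)\<close> and the quotient are compared through limit forms: \<open>\<omega>\<close> is a limit form of \<open>f\<close> if
  \<open>d\<^sub>l\<^sub>i\<^sub>p f\<^sub>n \<rightarrow> \<omega>\<close> strongly for some \<open>f\<^sub>n \<rightarrow> f\<close> almost everywhere. By weak reflexivity and Mazur's lemma every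
  \<open>f\<close> in the relaxed domain has a limit form, and every weak limit of slopes \<open>lip f\<^sub>n\<close> dominates the
  pointwise norm of one. Hence the relaxed slope of \<open>f\<close> is the essential infimum of \<open>\<bar>\<omega>\<bar>\<close> over its
  limit forms. These make up a coset of the space \<open>\<Omega>\<^sub>0\<close> of limit forms of \<open>0\<close>, and the infimum does not
  drop when \<open>\<Omega>\<^sub>0\<close> is replaced by the submodule it generates: the elements \<open>w\<close> for which the essential
  infimum of \<open>\<bar>w + \<sigma>\<bar>\<close> over \<open>\<sigma> \<in> \<Omega>\<^sub>0\<close> vanishes already form a submodule. So sending \<open>f\<close> to the class of
  its limit forms preserves pointwise norms, and the universal property of generated modules
  turns it into an isomorphism.
\<close>

section \<open>Spaces of p-integrable functions\<close>

text \<open>The main obstacle is that \<open>limit_forms\<close> of zero is only known to be a real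
  vector space: nothing makes a bounded multiple of a limit form a limit form, so passing to the
  generated submodule could lower the pointwise norm of a coset. It does not, because the vanishing
  of an essential infimum is a local condition. If w has this property and s equals a on a set, then
  on that set s w + a \<sigma> coincides with a (w + \<sigma>), and a \<sigma> is again a limit form
  of zero; so simple multiples of w keep the property, and uniform limits follow. For such w and a
  limit form \<omega> of f, the relaxed slope R satisfies R f \<le> |\<omega> + \<sigma>| \<le>
  |\<omega> + w| + |\<sigma> - w|, and letting \<sigma> vary gives R f \<le> |\<omega> + w|. The
  second obstacle is that the slope of a convex combination is only bounded by the combination of
  the slopes. The selection in Mazur's lemma therefore carries, next to the differentials, majorants
  of the slopes that still converge weakly to the given limit.\<close>

lemma rapid_subsequence:
  fixes P :: "nat \<Rightarrow> nat \<Rightarrow> real \<Rightarrow> bool" and e :: "nat \<Rightarrow> real"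
  assumes "\<And>e. 0 < e \<Longrightarrow> \<exists>K. \<forall>i\<ge>K. \<forall>j\<ge>K. P i j e" and "\<And>k. 0 < e k"
  obtains r :: "nat \<Rightarrow> nat" where "strict_mono r" "\<And>k i j. r k \<le> i \<Longrightarrow> r k \<le> j \<Longrightarrow> P i j (e k)"
proof -
  have "\<exists>r. \<forall>k. (\<forall>i\<ge>r k. \<forall>j\<ge>r k. P i j (e k)) \<and> r k < r (Suc k)"
  proof (rule dependent_nat_choice)
    show "\<exists>K. \<forall>i\<ge>K. \<forall>j\<ge>K. P i j (e 0)" using assms by blast
    fix K n
    obtain K' where "\<forall>i\<ge>K'. \<forall>j\<ge>K'. P i j (e (Suc n))" using assms by blast
    then show "\<exists>y. (\<forall>i\<ge>y. \<forall>j\<ge>y. P i j (e (Suc n))) \<and> K < y"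
      by (intro exI[of _ "max K' (Suc K)"]) auto
  qed
  then show ?thesis using that by (auto simp: strict_mono_Suc_iff)
qed

section \<open>Elementary calculus of p-integrable functions and Minkowski's inequality\<close>

context
  fixes m :: "'a measure" and p :: real
  assumes p1: "1 < p"
begin

lemma Lp_measurable: "f \<in> Lp m p \<Longrightarrow> f \<in> borel_measurable m"
  by (simp add: Lp_def)

lemma Lp_integrable: "f \<in> Lp m p \<Longrightarrow> integrable m (\<lambda>x. \<bar>f x\<bar> powr p)"
  by (simp add: Lp_def)

lemma LpI: "f \<in> borel_measurable m \<Longrightarrow> integrable m (\<lambda>x. \<bar>f x\<bar> powr p) \<Longrightarrow> f \<in> Lp m p"
  by (simp add: Lp_def)

lemma Lp_bound:
  assumes "f \<in> Lp m p" "g \<in> borel_measurable m" "AE x in m. \<bar>g x\<bar> \<le> \<bar>f x\<bar>"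
  shows "g \<in> Lp m p"
proof (rule LpI)
  show "integrable m (\<lambda>x. \<bar>g x\<bar> powr p)"
    by (rule Bochner_Integration.integrable_bound[OF Lp_integrable[OF assms(1)]])
      (use assms p1 in \<open>auto elim!: eventually_mono intro!: powr_mono2\<close>)
qed fact

lemma Lp_zero: "(\<lambda>x. 0) \<in> Lp m p"
  using p1 by (auto simp: Lp_def)

lemma Lp_abs: "f \<in> Lp m p \<Longrightarrow> (\<lambda>x. \<bar>f x\<bar>) \<in> Lp m p"
  by (auto simp: Lp_def)

lemma Lp_scale: "f \<in> Lp m p \<Longrightarrow> (\<lambda>x. c * f x) \<in> Lp m p"
  by (auto simp: Lp_def abs_mult powr_mult)

lemma Lp_add:
  assumes f: "f \<in> Lp m p" and g: "g \<in> Lp m p"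
  shows "(\<lambda>x. f x + g x) \<in> Lp m p"
proof (rule LpI)
  have [measurable]: "f \<in> borel_measurable m" "g \<in> borel_measurable m"
    using f g by (auto simp: Lp_def)
  show "(\<lambda>x. f x + g x) \<in> borel_measurable m" by simp
  have "integrable m (\<lambda>x. 2 powr p * (\<bar>f x\<bar> powr p + \<bar>g x\<bar> powr p))"
    using Lp_integrable[OF f] Lp_integrable[OF g] by auto
  then show "integrable m (\<lambda>x. \<bar>f x + g x\<bar> powr p)"
  proof (rule Bochner_Integration.integrable_bound)
    show "AE x in m. norm (\<bar>f x + g x\<bar> powr p) \<le> norm (2 powr p * (\<bar>f x\<bar> powr p + \<bar>g x\<bar> powr p))"
    proof (rule AE_I2)
      fix x
      have "\<bar>f x + g x\<bar> powr p \<le> (2 * max \<bar>f x\<bar> \<bar>g x\<bar>) powr p"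
        using p1 by (intro powr_mono2) auto
      also have "\<dots> = 2 powr p * max \<bar>f x\<bar> \<bar>g x\<bar> powr p"
        by (simp add: powr_mult)
      also have "\<dots> \<le> 2 powr p * (\<bar>f x\<bar> powr p + \<bar>g x\<bar> powr p)"
        by (intro mult_left_mono) (auto simp: max_def)
      finally show "norm (\<bar>f x + g x\<bar> powr p) \<le> norm (2 powr p * (\<bar>f x\<bar> powr p + \<bar>g x\<bar> powr p))"
        by simp
    qed
  qed simp
qed

lemma Lp_diff:
  assumes "f \<in> Lp m p" "g \<in> Lp m p"
  shows "(\<lambda>x. f x - g x) \<in> Lp m p"
  using Lp_add[OF assms(1) Lp_scale[OF assms(2), of "-1"]] by simp

lemma Lp_min:
  assumes "f \<in> Lp m p" "g \<in> Lp m p"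
  shows "(\<lambda>x. min (f x) (g x)) \<in> Lp m p"
proof (rule Lp_bound)
  show "(\<lambda>x. \<bar>f x\<bar> + \<bar>g x\<bar>) \<in> Lp m p"
    by (intro Lp_add Lp_abs assms)
qed (use assms in \<open>auto simp: Lp_def\<close>)

lemma Lp_pos_part:
  assumes "f \<in> Lp m p"
  shows "(\<lambda>x. max 0 (f x)) \<in> Lp m p"
  by (rule Lp_bound[OF assms]) (use assms in \<open>auto simp: Lp_def\<close>)

lemma LinfE:
  assumes "f \<in> Linf m"
  obtains C where "0 \<le> C" "AE x in m. \<bar>f x\<bar> \<le> C"
proof -
  obtain C where "AE x in m. \<bar>f x\<bar> \<le> C"
    using assms by (auto simp: Linf_def)
  then show ?thesis
    by (intro that[of "\<bar>C\<bar>"]) (auto elim: eventually_mono)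
qed

lemma Lp_mult_Linf:
  assumes f: "f \<in> Linf m" and g: "g \<in> Lp m p"
  shows "(\<lambda>x. f x * g x) \<in> Lp m p"
proof -
  obtain C where C: "0 \<le> C" "AE x in m. \<bar>f x\<bar> \<le> C" by (rule LinfE[OF f])
  show ?thesis
  proof (rule Lp_bound[OF Lp_scale[OF g, of C]])
    show "AE x in m. \<bar>f x * g x\<bar> \<le> \<bar>C * g x\<bar>"
      using C(2) by eventually_elim (use C(1) in \<open>auto simp: abs_mult intro!: mult_right_mono\<close>)
  qed (use f g in \<open>auto simp: Lp_def Linf_def\<close>)
qed

lemma Lp_mult_indicator:
  assumes f: "f \<in> Lp m p" and "A \<in> sets m"
  shows "(\<lambda>x. indicator A x * f x) \<in> Lp m p"
  by (rule Lp_bound[OF f]) (use assms in \<open>auto simp: Lp_def indicator_def\<close>)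

lemma Lp_norm_nonneg: "0 \<le> Lp_norm m p f"
  by (simp add: Lp_norm_def)

lemma Lp_norm_powr:
  shows "Lp_norm m p f powr p = (LINT x|m. \<bar>f x\<bar> powr p)"
  using p1 by (simp add: Lp_norm_def powr_powr)

lemma Lp_norm_le_iff:
  assumes "0 \<le> c"
  shows "Lp_norm m p f \<le> c \<longleftrightarrow> (LINT x|m. \<bar>f x\<bar> powr p) \<le> c powr p"
proof -
  have "Lp_norm m p f \<le> c \<longleftrightarrow> Lp_norm m p f powr p \<le> c powr p"
    using assms p1 Lp_norm_nonneg[of f]
    by (intro iffI powr_mono2) (auto dest: powr_less_mono2[of p c "Lp_norm m p f", rotated 2] simp: not_less[symmetric])
  then show ?thesis by (simp add: Lp_norm_powr)
qed

lemma Lp_norm_cong_AE: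
  assumes "AE x in m. f x = g x" "f \<in> borel_measurable m" "g \<in> borel_measurable m"
  shows "Lp_norm m p f = Lp_norm m p g"
proof -
  have "(LINT x|m. \<bar>f x\<bar> powr p) = (LINT x|m. \<bar>g x\<bar> powr p)"
    by (rule integral_cong_AE) (use assms in \<open>auto elim: eventually_mono\<close>)
  then show ?thesis by (simp add: Lp_norm_def)
qed

text \<open>Membership of \<open>g\<close> in \<open>Lp\<close> is what makes this true: a p-th
  power that is not integrable has Bochner integral 0, hence \<open>Lp_norm\<close> 0.\<close>

lemma Lp_norm_mono:
  assumes "AE x in m. \<bar>f x\<bar> \<le> \<bar>g x\<bar>" "f \<in> borel_measurable m" "g \<in> Lp m p"
  shows "Lp_norm m p f \<le> Lp_norm m p g"
proof -
  have "(LINT x|m. \<bar>f x\<bar> powr p) \<le> (LINT x|m. \<bar>g x\<bar> powr p)"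
  proof (rule integral_mono_AE)
    show "AE x in m. \<bar>f x\<bar> powr p \<le> \<bar>g x\<bar> powr p"
      using assms(1) by eventually_elim (use p1 in \<open>auto intro!: powr_mono2\<close>)
  qed (use Lp_bound[OF assms(3,2,1)] assms(3) in \<open>auto simp: Lp_def\<close>)
  then show ?thesis
    using p1 by (auto simp: Lp_norm_def intro!: powr_mono2)
qed

lemma Lp_norm_abs: "Lp_norm m p (\<lambda>x. \<bar>f x\<bar>) = Lp_norm m p f"
  by (simp add: Lp_norm_def)

lemma Lp_norm_zero: "Lp_norm m p (\<lambda>x. 0) = 0"
  using p1 by (simp add: Lp_norm_def)

lemma Lp_norm_scale: "Lp_norm m p (\<lambda>x. c * f x) = \<bar>c\<bar> * Lp_norm m p f"
proof -
  have "(LINT x|m. \<bar>c * f x\<bar> powr p) = \<bar>c\<bar> powr p * (LINT x|m. \<bar>f x\<bar> powr p)"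
    by (simp add: abs_mult powr_mult)
  then show ?thesis
    using p1 by (simp add: Lp_norm_def powr_mult powr_powr)
qed

lemma Lp_norm_commute: "Lp_norm m p (\<lambda>x. f x - g x) = Lp_norm m p (\<lambda>x. g x - f x)"
  by (simp add: Lp_norm_def abs_minus_commute)

lemma Lp_norm_eq_0_iff:
  assumes "f \<in> Lp m p"
  shows "Lp_norm m p f = 0 \<longleftrightarrow> (AE x in m. f x = 0)"
proof -
  have "Lp_norm m p f = 0 \<longleftrightarrow> (LINT x|m. \<bar>f x\<bar> powr p) = 0"
    by (simp add: Lp_norm_def)
  also have "\<dots> \<longleftrightarrow> (AE x in m. \<bar>f x\<bar> powr p = 0)"
    by (rule integral_nonneg_eq_0_iff_AE) (use assms in \<open>auto simp: Lp_def\<close>)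
  finally show ?thesis by simp
qed

text \<open>The convexity fact applied is for the open half-line. If one argument vanishes, what
  remains is (s b)^p \<le> s b^p, which holds because s^p \<le> s for s \<le> 1.\<close>

lemma powr_convex_nonneg:
  fixes a b s t :: real
  assumes "0 \<le> a" "0 \<le> b" "0 < s" "0 < t" "s + t = 1"
  shows "(s * a + t * b) powr p \<le> s * a powr p + t * b powr p"
proof -
  have aux: "(s * b) powr p \<le> s * b powr p" if "0 < s" "s \<le> 1" for s b :: real
  proof -
    have "s powr p \<le> s powr 1"
      using that p1 by (intro powr_mono') auto
    then show ?thesis using that by (simp add: powr_mult mult_right_mono)
  qed
  consider "a = 0" | "b = 0" | "0 < a" "0 < b" using assms by linarith
  then show ?thesis
  proof cases
    case 1
    then show ?thesis using aux[of t b] assms by simp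
  next
    case 2
    then show ?thesis using aux[of s a] assms by simp
  next
    case 3
    have "convex_on {0<..} (\<lambda>x::real. x powr p)"
      using p1 by (intro powr_convex) simp
    moreover have s: "s = 1 - t" using assms by simp
    ultimately show ?thesis
      unfolding s using convex_onD[of "{0<..}" "\<lambda>x::real. x powr p" t a b] 3 assms by auto
  qed
qed

text \<open>Minkowski from convexity alone, with no dual exponent: |f + g| / (a + b) is at most the
  convex combination of |f| / a and |g| / b with weights a / (a + b) and b / (a + b), and
  integrating p-th powers bounds its p-th moment by 1.\<close>

lemma Lp_norm_triangle:
  assumes f: "f \<in> Lp m p" and g: "g \<in> Lp m p"
  shows "Lp_norm m p (\<lambda>x. f x + g x) \<le> Lp_norm m p f + Lp_norm m p g"
proof -
  let ?a = "Lp_norm m p f" and ?b = "Lp_norm m p g"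
  have fg: "(\<lambda>x. f x + g x) \<in> Lp m p" by (rule Lp_add[OF f g])
  have [measurable]: "f \<in> borel_measurable m" "g \<in> borel_measurable m"
    using f g by (auto simp: Lp_def)
  consider "?a = 0" | "?b = 0" | "0 < ?a" "0 < ?b"
    using Lp_norm_nonneg[of f] Lp_norm_nonneg[of g] by linarith
  then show ?thesis
  proof cases
    case 1
    then have "AE x in m. f x = 0" using Lp_norm_eq_0_iff[OF f] by simp
    then have "Lp_norm m p (\<lambda>x. f x + g x) = ?b"
      by (intro Lp_norm_cong_AE) (auto elim: eventually_mono)
    then show ?thesis using 1 by simp
  next
    case 2
    then have "AE x in m. g x = 0" using Lp_norm_eq_0_iff[OF g] by simp
    then have "Lp_norm m p (\<lambda>x. f x + g x) = ?a"
      by (intro Lp_norm_cong_AE) (auto elim: eventually_mono)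
    then show ?thesis using 2 by simp
  next
    case 3
    define s where "s = ?a / (?a + ?b)"
    define t where "t = ?b / (?a + ?b)"
    have st: "0 < s" "0 < t" "s + t = 1"
      using 3 by (auto simp: s_def t_def add_divide_distrib[symmetric])
    have pw: "\<bar>f x + g x\<bar> powr p / (?a + ?b) powr p
        \<le> s * (\<bar>f x\<bar> powr p / ?a powr p) + t * (\<bar>g x\<bar> powr p / ?b powr p)" for x
    proof -
      have "\<bar>f x + g x\<bar> / (?a + ?b) \<le> s * (\<bar>f x\<bar> / ?a) + t * (\<bar>g x\<bar> / ?b)"
        using 3 by (simp add: s_def t_def add_divide_distrib[symmetric] divide_right_mono)
      then have "(\<bar>f x + g x\<bar> / (?a + ?b)) powr p \<le> (s * (\<bar>f x\<bar> / ?a) + t * (\<bar>g x\<bar> / ?b)) powr p"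
        using 3 p1 by (intro powr_mono2) auto
      also have "\<dots> \<le> s * (\<bar>f x\<bar> / ?a) powr p + t * (\<bar>g x\<bar> / ?b) powr p"
        using 3 st by (intro powr_convex_nonneg) auto
      finally show ?thesis using 3 by (simp add: powr_divide)
    qed
    have "(LINT x|m. \<bar>f x + g x\<bar> powr p / (?a + ?b) powr p)
        \<le> (LINT x|m. s * (\<bar>f x\<bar> powr p / ?a powr p) + t * (\<bar>g x\<bar> powr p / ?b powr p))"
    proof (rule integral_mono)
      show "\<bar>f x + g x\<bar> powr p / (?a + ?b) powr p
        \<le> s * (\<bar>f x\<bar> powr p / ?a powr p) + t * (\<bar>g x\<bar> powr p / ?b powr p)" for x
        by (rule pw)
    qed (use Lp_integrable[OF fg] Lp_integrable[OF f] Lp_integrable[OF g] in auto)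
    also have "\<dots> = s * ((LINT x|m. \<bar>f x\<bar> powr p) / ?a powr p) + t * ((LINT x|m. \<bar>g x\<bar> powr p) / ?b powr p)"
      using Lp_integrable[OF f] Lp_integrable[OF g] by simp
    also have "\<dots> = 1" using 3 st by (simp add: Lp_norm_powr[symmetric])
    finally have "(LINT x|m. \<bar>f x + g x\<bar> powr p) \<le> (?a + ?b) powr p"
      using 3 by (simp add: divide_le_eq)
    then show ?thesis using 3 by (subst Lp_norm_le_iff) auto
  qed
qed

lemma Lp_norm_diff_triangle:
  assumes f: "f \<in> Lp m p" and g: "g \<in> Lp m p" and h: "h \<in> Lp m p"
  shows "Lp_norm m p (\<lambda>x. f x - h x) \<le> Lp_norm m p (\<lambda>x. f x - g x) + Lp_norm m p (\<lambda>x. g x - h x)"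
  using Lp_norm_triangle[OF Lp_diff[OF f g] Lp_diff[OF g h]] by simp

lemma Lp_norm_rev_triangle:
  assumes f: "f \<in> Lp m p" and g: "g \<in> Lp m p"
  shows "\<bar>Lp_norm m p f - Lp_norm m p g\<bar> \<le> Lp_norm m p (\<lambda>x. f x - g x)"
  using Lp_norm_diff_triangle[OF f g Lp_zero] Lp_norm_diff_triangle[OF g f Lp_zero] 
  by (simp add: Lp_norm_commute[of f g])

lemma Lp_norm_tendsto:
  assumes "\<And>n. F n \<in> Lp m p" "f \<in> Lp m p" "(\<lambda>n. Lp_norm m p (\<lambda>x. F n x - f x)) \<longlonglongrightarrow> 0"
  shows "(\<lambda>n. Lp_norm m p (F n)) \<longlonglongrightarrow> Lp_norm m p f"
proof (rule LIM_zero_cancel, rule Lim_null_comparison[OF _ assms(3)])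
  show "\<forall>\<^sub>F n in sequentially. norm (Lp_norm m p (F n) - Lp_norm m p f) \<le> Lp_norm m p (\<lambda>x. F n x - f x)"
    using assms by (auto intro!: always_eventually Lp_norm_rev_triangle)
qed

text \<open>The positive part of f - g is dominated by |F n - f| + |G n - g|, so its norm is 0 and
  no almost everywhere convergent subsequence has to be extracted. Almost every inequality between
  pointwise norms is later passed to the limit this way.\<close>

lemma Lp_limit_mono:
  assumes F: "\<And>n. F n \<in> Lp m p" and G: "\<And>n. G n \<in> Lp m p"
    and f: "f \<in> Lp m p" and g: "g \<in> Lp m p"
    and le: "\<And>n. AE x in m. F n x \<le> G n x"
    and Ff: "(\<lambda>n. Lp_norm m p (\<lambda>x. F n x - f x)) \<longlonglongrightarrow> 0"
    and Gg: "(\<lambda>n. Lp_norm m p (\<lambda>x. G n x - g x)) \<longlonglongrightarrow> 0"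
  shows "AE x in m. f x \<le> g x"
proof -
  let ?d = "\<lambda>x. max 0 (f x - g x)"
  have d: "?d \<in> Lp m p" by (intro Lp_pos_part Lp_diff f g)
  have bd: "Lp_norm m p ?d \<le> Lp_norm m p (\<lambda>x. F n x - f x) + Lp_norm m p (\<lambda>x. G n x - g x)" for n
  proof -
    have "Lp_norm m p ?d \<le> Lp_norm m p (\<lambda>x. \<bar>F n x - f x\<bar> + \<bar>G n x - g x\<bar>)"
    proof (rule Lp_norm_mono)
      show "AE x in m. \<bar>?d x\<bar> \<le> \<bar>\<bar>F n x - f x\<bar> + \<bar>G n x - g x\<bar>\<bar>"
        using le[of n] by eventually_elim auto
    qed (use d in \<open>auto intro!: Lp_add Lp_abs Lp_diff F G f g simp: Lp_measurable\<close>)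
    also have "\<dots> \<le> Lp_norm m p (\<lambda>x. F n x - f x) + Lp_norm m p (\<lambda>x. G n x - g x)"
      using Lp_norm_triangle[OF Lp_abs[OF Lp_diff[OF F f]] Lp_abs[OF Lp_diff[OF G g]]]
      by (simp add: Lp_norm_abs)
    finally show ?thesis .
  qed
  have "Lp_norm m p ?d \<le> 0"
    by (rule LIMSEQ_le_const[where X = "\<lambda>n. Lp_norm m p (\<lambda>x. F n x - f x) + Lp_norm m p (\<lambda>x. G n x - g x)"])
      (use bd tendsto_add[OF Ff Gg] in auto)
  then have "Lp_norm m p ?d = 0" using Lp_norm_nonneg[of ?d] by linarith
  then have "AE x in m. ?d x = 0" using Lp_norm_eq_0_iff[OF d] by simp
  then show ?thesis by eventually_elim (auto simp: max_def split: if_splits)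
qed

text \<open>Left unsimplified so that it matches the convergence premise of
  \<open>Lp_limit_mono\<close> for a constant sequence.\<close>

lemma Lp_limit_const: "(\<lambda>n::nat. Lp_norm m p (\<lambda>x. f x - f x)) \<longlonglongrightarrow> 0"
  by (simp add: Lp_norm_zero)

lemma Lp_limit_add:
  assumes F: "\<And>n. F n \<in> Lp m p" and G: "\<And>n. G n \<in> Lp m p" and f: "f \<in> Lp m p" and g: "g \<in> Lp m p"
    and Ff: "(\<lambda>n. Lp_norm m p (\<lambda>x. F n x - f x)) \<longlonglongrightarrow> 0"
    and Gg: "(\<lambda>n. Lp_norm m p (\<lambda>x. G n x - g x)) \<longlonglongrightarrow> 0"
  shows "(\<lambda>n. Lp_norm m p (\<lambda>x. (F n x + G n x) - (f x + g x))) \<longlonglongrightarrow> 0"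
proof (rule Lim_null_comparison)
  show "(\<lambda>n. Lp_norm m p (\<lambda>x. F n x - f x) + Lp_norm m p (\<lambda>x. G n x - g x)) \<longlonglongrightarrow> 0"
    using tendsto_add[OF Ff Gg] by simp
  have "Lp_norm m p (\<lambda>x. (F n x + G n x) - (f x + g x)) \<le> Lp_norm m p (\<lambda>x. F n x - f x) + Lp_norm m p (\<lambda>x. G n x - g x)" for n
    using Lp_norm_triangle[OF Lp_diff[OF F f] Lp_diff[OF G g], of n n] by (simp add: algebra_simps)
  then show "\<forall>\<^sub>F n in sequentially. norm (Lp_norm m p (\<lambda>x. (F n x + G n x) - (f x + g x)))
      \<le> Lp_norm m p (\<lambda>x. F n x - f x) + Lp_norm m p (\<lambda>x. G n x - g x)"
    by (simp add: Lp_norm_nonneg)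
qed

lemma Lp_limit_unique:
  assumes F: "\<And>n. F n \<in> Lp m p" and f: "f \<in> Lp m p" and g: "g \<in> Lp m p"
    and Ff: "(\<lambda>n. Lp_norm m p (\<lambda>x. F n x - f x)) \<longlonglongrightarrow> 0"
    and Gg: "(\<lambda>n. Lp_norm m p (\<lambda>x. F n x - g x)) \<longlonglongrightarrow> 0"
  shows "AE x in m. f x = g x"
  using Lp_limit_mono[OF F F f g _ Ff Gg] Lp_limit_mono[OF F F g f _ Gg Ff] by auto

section \<open>Dominated convergence and completeness in L^p\<close>

lemma Lp_dominated_convergence:
  assumes F: "\<And>n. F n \<in> borel_measurable m" and f: "f \<in> borel_measurable m" and w: "w \<in> Lp m p"
    and le: "\<And>n. AE x in m. \<bar>F n x\<bar> \<le> w x"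
    and lim: "AE x in m. (\<lambda>n. F n x) \<longlonglongrightarrow> f x"
  shows "f \<in> Lp m p" "(\<lambda>n. Lp_norm m p (\<lambda>x. F n x - f x)) \<longlonglongrightarrow> 0"
proof -
  have all: "AE x in m. \<forall>n. \<bar>F n x\<bar> \<le> w x" using le by (simp add: AE_all_countable)
  have fw: "AE x in m. \<bar>f x\<bar> \<le> w x"
    using all lim
  proof eventually_elim
    case (elim x)
    show ?case by (rule LIMSEQ_le_const2[OF tendsto_rabs[OF elim(2)]]) (use elim(1) in auto)
  qed
  show fL: "f \<in> Lp m p"
    by (rule Lp_bound[OF w f]) (use fw in \<open>auto elim: eventually_mono\<close>)
  have "(\<lambda>n. LINT x|m. \<bar>F n x - f x\<bar> powr p) \<longlonglongrightarrow> (LINT x|m. 0)"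
  proof (rule integral_dominated_convergence)
    show "integrable m (\<lambda>x. \<bar>2 * w x\<bar> powr p)"
      by (rule Lp_integrable[OF Lp_scale[OF w]])
    show "AE x in m. (\<lambda>n. \<bar>F n x - f x\<bar> powr p) \<longlonglongrightarrow> 0"
      using lim
    proof eventually_elim
      case (elim x)
      have "(\<lambda>n. \<bar>F n x - f x\<bar> powr p) \<longlonglongrightarrow> \<bar>f x - f x\<bar> powr p"
        using p1 by (intro tendsto_powr2 tendsto_intros elim) auto
      then show ?case by simp
    qed
    show "AE x in m. norm (\<bar>F n x - f x\<bar> powr p) \<le> \<bar>2 * w x\<bar> powr p" for n
      using le[of n] fw by eventually_elim (use p1 in \<open>auto intro!: powr_mono2\<close>)
  qed (use F f in auto)
  then have "(\<lambda>n. (LINT x|m. \<bar>F n x - f x\<bar> powr p) powr (1/p)) \<longlonglongrightarrow> 0 powr (1/p)"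
    using p1 by (intro tendsto_powr2) (auto intro!: tendsto_intros)
  then show "(\<lambda>n. Lp_norm m p (\<lambda>x. F n x - f x)) \<longlonglongrightarrow> 0"
    using p1 by (simp add: Lp_norm_def)
qed

lemma Lp_complete:
  assumes F: "\<And>n. F n \<in> Lp m p"
    and C: "\<And>e. 0 < e \<Longrightarrow> \<exists>K. \<forall>i\<ge>K. \<forall>j\<ge>K. Lp_norm m p (\<lambda>x. F i x - F j x) < e"
  obtains f where "f \<in> Lp m p" "(\<lambda>n. Lp_norm m p (\<lambda>x. F n x - f x)) \<longlonglongrightarrow> 0"
proof -
  have [measurable]: "F n \<in> borel_measurable m" for n using F by (simp add: Lp_def)
  obtain r where r: "strict_mono r"
    "\<And>k i j. r k \<le> i \<Longrightarrow> r k \<le> j \<Longrightarrow> Lp_norm m p (\<lambda>x. F i x - F j x) < (1/4)^k"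
    by (rule rapid_subsequence[of "\<lambda>i j e. Lp_norm m p (\<lambda>x. F i x - F j x) < e" "\<lambda>k. (1/4)^k"])
      (use C in auto)
  \<comment> \<open>Consecutive distances are below 4^-k. Blown up by 2^k the differences still have
    norms below 2^-k, so their p-th powers are summable almost everywhere; in particular |D k x|
    \<le> 1 eventually, which makes the original differences at most 2^-k.\<close>
  define D where "D k x = 2^k * (F (r (Suc k)) x - F (r k) x)" for k x
  have D: "D k \<in> Lp m p" for k unfolding D_def by (intro Lp_scale Lp_diff F)
  have [measurable]: "D k \<in> borel_measurable m" for k using D by (simp add: Lp_def)
  have Dn: "(\<integral>\<^sup>+x. ennreal (\<bar>D k x\<bar> powr p) \<partial>m) \<le> ennreal ((1/2)^k)" for k
  proof -
    have "Lp_norm m p (D k) \<le> 2^k * (1/4)^k"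
      unfolding D_def Lp_norm_scale using r(2)[of k "r (Suc k)" "r k"] strict_monoD[OF r(1), of k "Suc k"]
      by (auto intro!: mult_left_mono)
    also have "\<dots> = (1/2)^k" by (simp flip: power_mult_distrib)
    finally have "(LINT x|m. \<bar>D k x\<bar> powr p) \<le> ((1/2)^k) powr p"
      by (subst (asm) Lp_norm_le_iff) auto
    also have "\<dots> \<le> ((1/2)^k) powr 1"
      using p1 by (intro powr_mono') (auto simp: power_le_one)
    finally show ?thesis
      by (subst nn_integral_eq_integral[OF Lp_integrable[OF D]]) (auto intro!: ennreal_leI)
  qed
  have "(\<integral>\<^sup>+x. (\<Sum>k. ennreal (\<bar>D k x\<bar> powr p)) \<partial>m) = (\<Sum>k. \<integral>\<^sup>+x. ennreal (\<bar>D k x\<bar> powr p) \<partial>m)"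
    by (rule nn_integral_suminf) simp
  also have "\<dots> \<le> (\<Sum>k. ennreal ((1/2)^k))"
    by (intro suminf_le Dn) auto
  also have "\<dots> = ennreal (\<Sum>k. (1/2)^k)"
    by (intro suminf_ennreal2) (auto intro!: summable_geometric)
  also have "\<dots> < \<infinity>" by simp
  finally have "AE x in m. (\<Sum>k. ennreal (\<bar>D k x\<bar> powr p)) \<noteq> \<infinity>"
    by (intro nn_integral_PInf_AE) auto
  then have ae: "AE x in m. convergent (\<lambda>k. F (r k) x)"
  proof eventually_elim
    case (elim x)
    then have "summable (\<lambda>k. \<bar>D k x\<bar> powr p)"
      by (intro summable_suminf_not_top) (auto simp: top_unique)
    then have "(\<lambda>k. \<bar>D k x\<bar> powr p) \<longlonglongrightarrow> 0" by (rule summable_LIMSEQ_zero)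
    then have "\<forall>\<^sub>F k in sequentially. \<bar>D k x\<bar> powr p < 1" by (rule order_tendstoD) simp
    then have ev: "\<forall>\<^sub>F k in sequentially. norm (F (r (Suc k)) x - F (r k) x) \<le> (1/2)^k"
    proof eventually_elim
      case (elim k)
      have "\<bar>D k x\<bar> \<le> 1"
      proof (rule ccontr)
        assume "\<not> \<bar>D k x\<bar> \<le> 1"
        then have "1 \<le> \<bar>D k x\<bar> powr p" using p1 by (intro ge_one_powr_ge_zero) auto
        then show False using elim by simp
      qed
      then have "2^k * \<bar>F (r (Suc k)) x - F (r k) x\<bar> \<le> 1" by (simp only: D_def abs_mult) simp
      then show ?case by (simp add: power_one_over pos_le_divide_eq mult.commute)
    qed
    have "summable (\<lambda>k. F (r (Suc k)) x - F (r k) x)"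
      by (rule summable_comparison_test_ev[OF ev]) (auto intro!: summable_geometric)
    then have "convergent (\<lambda>n. \<Sum>k<n. F (r (Suc k)) x - F (r k) x)"
      by (simp add: summable_iff_convergent)
    then have "convergent (\<lambda>n. F (r n) x - F (r 0) x)"
      by (simp add: sum_lessThan_telescope[of "\<lambda>k. F (r k) x"])
    then show ?case by (simp add: convergent_diff_const_right_iff)
  qed
  define f where "f x = lim (\<lambda>k. F (r k) x)" for x
  have [measurable]: "f \<in> borel_measurable m" unfolding f_def by measurable
  have lim: "AE x in m. (\<lambda>k. F (r k) x) \<longlonglongrightarrow> f x"
    using ae by eventually_elim (simp add: f_def convergent_LIMSEQ_iff)
  \<comment> \<open>Fatou along the subsequence. The one bound serves twice: it puts F i - f into
    \<open>Lp\<close> for some i, hence f as well, and it gives convergence of the whole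
    sequence.\<close>
  have nnb: "(\<integral>\<^sup>+x. ennreal (\<bar>F i x - f x\<bar> powr p) \<partial>m) \<le> ennreal (e powr p)"
    if "0 < e" and K: "\<forall>i\<ge>K. \<forall>j\<ge>K. Lp_norm m p (\<lambda>x. F i x - F j x) < e" and "K \<le> i" for e K i
  proof -
    have "(\<integral>\<^sup>+x. ennreal (\<bar>F i x - f x\<bar> powr p) \<partial>m)
        = (\<integral>\<^sup>+x. liminf (\<lambda>k. ennreal (\<bar>F i x - F (r k) x\<bar> powr p)) \<partial>m)"
    proof (rule nn_integral_cong_AE, use lim in eventually_elim)
      case (elim x)
      have "(\<lambda>k. ennreal (\<bar>F i x - F (r k) x\<bar> powr p)) \<longlonglongrightarrow> ennreal (\<bar>F i x - f x\<bar> powr p)"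
        using p1 by (intro tendsto_ennrealI tendsto_powr2 tendsto_intros elim) auto
      then show ?case by (intro lim_imp_Liminf[symmetric]) auto
    qed
    also have "\<dots> \<le> liminf (\<lambda>k. \<integral>\<^sup>+x. ennreal (\<bar>F i x - F (r k) x\<bar> powr p) \<partial>m)"
      by (rule nn_integral_liminf) simp
    also have "\<dots> \<le> ennreal (e powr p)"
    proof (rule Liminf_le)
      show "\<forall>\<^sub>F k in sequentially. (\<integral>\<^sup>+x. ennreal (\<bar>F i x - F (r k) x\<bar> powr p) \<partial>m) \<le> ennreal (e powr p)"
        using eventually_ge_at_top[of K]
      proof eventually_elim
        case (elim k)
        then have "K \<le> r k" using seq_suble[OF r(1), of k] by simp
        then have "Lp_norm m p (\<lambda>x. F i x - F (r k) x) \<le> e" using K \<open>K \<le> i\<close> by (simp add: less_imp_le)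
        then have "(LINT x|m. \<bar>F i x - F (r k) x\<bar> powr p) \<le> e powr p"
          using \<open>0 < e\<close> by (subst (asm) Lp_norm_le_iff) auto
        then show ?case
          by (subst nn_integral_eq_integral[OF Lp_integrable[OF Lp_diff[OF F F]]]) (auto intro!: ennreal_leI)
      qed
    qed simp
    finally show ?thesis .
  qed
  have dL: "(\<lambda>x. F i x - f x) \<in> Lp m p"
    if "0 < e" and K: "\<forall>i\<ge>K. \<forall>j\<ge>K. Lp_norm m p (\<lambda>x. F i x - F j x) < e" and "K \<le> i" for e K i
    using nnb[OF that] 
    by (intro LpI integrableI_bounded) (auto intro: order.strict_trans1)
  obtain K where K: "\<forall>i\<ge>K. \<forall>j\<ge>K. Lp_norm m p (\<lambda>x. F i x - F j x) < 1" using C[of 1] by auto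
  have fL: "f \<in> Lp m p"
    using Lp_diff[OF F[of K] dL[OF _ K order_refl]] by simp
  show ?thesis
  proof (rule that[OF fL], rule LIMSEQ_I)
    fix e :: real assume "0 < e"
    then obtain K where K: "\<forall>i\<ge>K. \<forall>j\<ge>K. Lp_norm m p (\<lambda>x. F i x - F j x) < e / 2" using C[of "e/2"] by auto
    show "\<exists>K. \<forall>n\<ge>K. norm (Lp_norm m p (\<lambda>x. F n x - f x) - 0) < e"
    proof (intro exI[of _ K] allI impI)
      fix n assume "K \<le> n"
      have "(LINT x|m. \<bar>F n x - f x\<bar> powr p) \<le> (e/2) powr p"
        using nnb[OF _ K \<open>K \<le> n\<close>] \<open>0 < e\<close> nn_integral_eq_integral[OF Lp_integrable[OF dL[OF _ K \<open>K \<le> n\<close>]]]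
        by simp
      then have "Lp_norm m p (\<lambda>x. F n x - f x) \<le> e / 2"
        using \<open>0 < e\<close> by (subst Lp_norm_le_iff) auto
      then show "norm (Lp_norm m p (\<lambda>x. F n x - f x) - 0) < e"
        using \<open>0 < e\<close> Lp_norm_nonneg[of "\<lambda>x. F n x - f x"] by simp
    qed
  qed
qed

end

section \<open>Duality, weak limits and uniform boundedness in L^p\<close>

context
  fixes m :: "'a measure" and p :: real
  assumes p1: "1 < p"
begin

text \<open>The duality pairing of \<open>u\<close> with |w|^(p-1), an element of the dual space.
  Indexing the functionals by \<open>w\<close> in L^p keeps the conjugate exponent out of sight. The
  weight is non-negative, so the pairing is monotone in \<open>u\<close>, and a non-negative
  \<open>w\<close> paired with itself gives the p-th power of its norm.\<close>

definition Lp_pairing :: "('a \<Rightarrow> real) \<Rightarrow> ('a \<Rightarrow> real) \<Rightarrow> real" where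
  "Lp_pairing w u = (LINT x|m. \<bar>w x\<bar> powr (p - 1) * u x)"

text \<open>Young's inequality for the exponents p and p / (p - 1), with the two factors below 1
  rounded up to 1.\<close>

lemma Young_powr:
  fixes a b :: real
  assumes "0 \<le> a" "0 \<le> b"
  shows "a powr (p - 1) * b \<le> b powr p + a powr p"
proof -
  have q: "1 < p / (p - 1)" "1 / p + 1 / (p / (p - 1)) = 1"
    using p1 by (auto simp: field_simps)
  have "b * a powr (p - 1) \<le> b powr p / p + (a powr (p - 1)) powr (p / (p - 1)) / (p / (p - 1))"
    by (rule Youngs_inequality) (use p1 q assms in auto)
  also have "(a powr (p - 1)) powr (p / (p - 1)) = a powr p"
    using p1 by (simp add: powr_powr)
  also have "b powr p / p + a powr p / (p / (p - 1)) \<le> b powr p / 1 + a powr p / 1"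
    using p1 q by (intro add_mono divide_left_mono) auto
  finally show ?thesis by (simp add: mult.commute)
qed

lemma Lp_pairing_integrable:
  assumes w: "w \<in> Lp m p" and u: "u \<in> Lp m p"
  shows "integrable m (\<lambda>x. \<bar>w x\<bar> powr (p - 1) * u x)"
proof (rule Bochner_Integration.integrable_bound)
  show "integrable m (\<lambda>x. \<bar>u x\<bar> powr p + \<bar>w x\<bar> powr p)"
    using w u by (auto simp: Lp_def)
  have "\<bar>\<bar>w x\<bar> powr (p - 1) * u x\<bar> \<le> \<bar>u x\<bar> powr p + \<bar>w x\<bar> powr p" for x
    using Young_powr[of "\<bar>w x\<bar>" "\<bar>u x\<bar>"] by (simp add: abs_mult)
  then show "AE x in m. norm (\<bar>w x\<bar> powr (p - 1) * u x) \<le> norm (\<bar>u x\<bar> powr p + \<bar>w x\<bar> powr p)"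
    by (auto intro: order_trans)
qed (use w u in \<open>auto simp: Lp_def\<close>)

lemma Lp_pairing_add:
  assumes "w \<in> Lp m p" "u \<in> Lp m p" "v \<in> Lp m p"
  shows "Lp_pairing w (\<lambda>x. u x + v x) = Lp_pairing w u + Lp_pairing w v"
  using Lp_pairing_integrable[OF assms(1,2)] Lp_pairing_integrable[OF assms(1,3)]
  by (simp add: Lp_pairing_def algebra_simps)

lemma Lp_pairing_scale: "Lp_pairing w (\<lambda>x. c * u x) = c * Lp_pairing w u"
  by (simp add: Lp_pairing_def mult.left_commute)

lemma Lp_pairing_mono:
  assumes "w \<in> Lp m p" "u \<in> Lp m p" "v \<in> Lp m p" "AE x in m. u x \<le> v x"
  shows "Lp_pairing w u \<le> Lp_pairing w v"
  unfolding Lp_pairing_def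
  by (rule integral_mono_AE[OF Lp_pairing_integrable[OF assms(1,2)] Lp_pairing_integrable[OF assms(1,3)]])
    (use assms(4) in \<open>auto elim!: eventually_mono intro!: mult_left_mono\<close>)

lemma Lp_pairing_cong_AE:
  assumes "w \<in> Lp m p" "u \<in> Lp m p" "v \<in> Lp m p" "AE x in m. u x = v x"
  shows "Lp_pairing w u = Lp_pairing w v"
proof (rule antisym)
  show "Lp_pairing w u \<le> Lp_pairing w v"
    by (rule Lp_pairing_mono[OF assms(1-3)]) (use assms(4) in \<open>auto elim: eventually_mono\<close>)
  show "Lp_pairing w v \<le> Lp_pairing w u"
    by (rule Lp_pairing_mono[OF assms(1,3,2)]) (use assms(4) in \<open>auto elim: eventually_mono\<close>)
qed

lemma Lp_pairing_self:
  assumes "AE x in m. 0 \<le> w x" "w \<in> borel_measurable m"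
  shows "Lp_pairing w w = Lp_norm m p w powr p"
  unfolding Lp_pairing_def Lp_norm_powr[OF p1]
proof (rule integral_cong_AE)
  show "AE x in m. \<bar>w x\<bar> powr (p - 1) * w x = \<bar>w x\<bar> powr p"
    using assms(1)
  proof eventually_elim
    case (elim x)
    show ?case
    proof (cases "w x = 0")
      case False
      then show ?thesis using elim powr_add[of "w x" "p - 1" 1] by simp
    qed simp
  qed
qed (use assms in auto)

text \<open>A crude form of Hoelder's inequality: normalise \<open>u\<close> to norm 1 and integrate
  \<open>Young_powr\<close>. The constant is 2 when \<open>w\<close> has norm 1.\<close>

lemma Lp_pairing_bound:
  assumes w: "w \<in> Lp m p" and u: "u \<in> Lp m p"
  shows "\<bar>Lp_pairing w u\<bar> \<le> (1 + Lp_norm m p w powr p) * Lp_norm m p u"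
proof -
  have *: "Lp_pairing w u \<le> (1 + Lp_norm m p w powr p) * Lp_norm m p u" if u: "u \<in> Lp m p" for u
  proof (cases "Lp_norm m p u = 0")
    case True
    then have "AE x in m. u x = 0" using Lp_norm_eq_0_iff[OF p1 u] by simp
    then have "Lp_pairing w u = Lp_pairing w (\<lambda>x. 0)"
      by (intro Lp_pairing_cong_AE w u Lp_zero p1)
    then show ?thesis using True by (simp add: Lp_pairing_def)
  next
    case False
    define t where "t = Lp_norm m p u"
    have t: "0 < t" using False Lp_norm_nonneg[OF p1, of m u] unfolding t_def by linarith
    define v where "v x = (1 / t) * u x" for x
    have v: "v \<in> Lp m p" unfolding v_def by (intro Lp_scale p1 u)
    have v1: "Lp_norm m p v = 1"
      unfolding v_def Lp_norm_scale[OF p1] using t by (simp add: t_def)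
    have "Lp_pairing w v \<le> (LINT x|m. \<bar>v x\<bar> powr p + \<bar>w x\<bar> powr p)"
      unfolding Lp_pairing_def
    proof (rule integral_mono)
      show "\<bar>w x\<bar> powr (p - 1) * v x \<le> \<bar>v x\<bar> powr p + \<bar>w x\<bar> powr p" for x
      proof -
        have "\<bar>w x\<bar> powr (p - 1) * v x \<le> \<bar>w x\<bar> powr (p - 1) * \<bar>v x\<bar>"
          by (intro mult_left_mono) auto
        then show ?thesis using Young_powr[of "\<bar>w x\<bar>" "\<bar>v x\<bar>"] by simp
      qed
    qed (use w v Lp_pairing_integrable[OF w v] in \<open>auto simp: Lp_def\<close>)
    also have "\<dots> = 1 + Lp_norm m p w powr p"
      using v w v1 Lp_norm_powr[OF p1, of m v] by (simp add: Lp_def Lp_norm_powr[OF p1])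
    finally have "Lp_pairing w v \<le> 1 + Lp_norm m p w powr p" .
    moreover have "Lp_pairing w v = (1 / t) * Lp_pairing w u"
      unfolding v_def by (rule Lp_pairing_scale)
    ultimately show ?thesis
      using t by (simp add: t_def[symmetric] divide_le_eq)
  qed
  have "- Lp_pairing w u \<le> (1 + Lp_norm m p w powr p) * Lp_norm m p u"
    using *[OF Lp_scale[OF p1 u, of "-1"]] Lp_pairing_scale[of w "-1" u] Lp_norm_scale[OF p1, of m "-1" u]
    by simp
  then show ?thesis using *[OF u] by simp
qed

lemma bounded_functional_Lp_iff:
  "bounded_functional (Lp_space m p) \<phi> \<longleftrightarrow>
     (\<forall>u\<in>Lp m p. \<forall>v\<in>Lp m p. \<phi> (\<lambda>x. u x + v x) = \<phi> u + \<phi> v) \<and>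
     (\<forall>c. \<forall>v\<in>Lp m p. \<phi> (\<lambda>x. c * v x) = c * \<phi> v) \<and>
     (\<exists>C. \<forall>v\<in>Lp m p. \<bar>\<phi> v\<bar> \<le> C * Lp_norm m p v)"
  by (simp add: bounded_functional_def Lp_space_def)

lemma bounded_functional_Lp_pairing:
  assumes "w \<in> Lp m p"
  shows "bounded_functional (Lp_space m p) (Lp_pairing w)"
  unfolding bounded_functional_Lp_iff
  by (intro conjI ballI allI exI[of _ "1 + Lp_norm m p w powr p"] Lp_pairing_add Lp_pairing_scale
      Lp_pairing_bound assms)

lemma bounded_functional_Lp_diff:
  assumes "bounded_functional (Lp_space m p) \<phi>" "u \<in> Lp m p" "v \<in> Lp m p"
  shows "\<phi> (\<lambda>x. u x - v x) = \<phi> u - \<phi> v"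
proof -
  have "\<phi> (\<lambda>x. u x + (-1) * v x) = \<phi> u + (-1) * \<phi> v"
    using assms Lp_scale[OF p1 assms(3), of "-1"] by (simp only: bounded_functional_Lp_iff)
  then show ?thesis by simp
qed

lemma bounded_functional_Lp_tendsto:
  assumes b: "bounded_functional (Lp_space m p) \<phi>" and F: "\<And>n. F n \<in> Lp m p" "f \<in> Lp m p"
    and lim: "(\<lambda>n. Lp_norm m p (\<lambda>x. F n x - f x)) \<longlonglongrightarrow> 0"
  shows "(\<lambda>n. \<phi> (F n)) \<longlonglongrightarrow> \<phi> f"
proof -
  obtain C where C: "\<And>v. v \<in> Lp m p \<Longrightarrow> \<bar>\<phi> v\<bar> \<le> C * Lp_norm m p v"
    using b unfolding bounded_functional_Lp_iff by blast
  have "(\<lambda>n. C * Lp_norm m p (\<lambda>x. F n x - f x)) \<longlonglongrightarrow> 0"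
    using tendsto_mult_left[OF lim, of C] by simp
  then show ?thesis
    by (rule LIM_zero_cancel[OF Lim_null_comparison[rotated]])
      (use C[OF Lp_diff[OF p1 F(1) F(2)]] bounded_functional_Lp_diff[OF b F] in auto)
qed

text \<open>Test both sequences against the positive part of f - g. Monotonicity of the pairing
  survives the weak limits and forces the p-th power of the norm of that positive part to be at most
  0.\<close>

lemma Lp_weak_limit_mono:
  assumes F: "\<And>n. F n \<in> Lp m p" and G: "\<And>n. G n \<in> Lp m p"
    and f: "f \<in> Lp m p" and g: "g \<in> Lp m p"
    and le: "\<And>n. AE x in m. F n x \<le> G n x"
    and Ff: "\<And>\<phi>. bounded_functional (Lp_space m p) \<phi> \<Longrightarrow> (\<lambda>n. \<phi> (F n)) \<longlonglongrightarrow> \<phi> f"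
    and Gg: "\<And>\<phi>. bounded_functional (Lp_space m p) \<phi> \<Longrightarrow> (\<lambda>n. \<phi> (G n)) \<longlonglongrightarrow> \<phi> g"
  shows "AE x in m. f x \<le> g x"
proof -
  let ?d = "\<lambda>x. max 0 (f x - g x)"
  have d: "?d \<in> Lp m p" by (intro Lp_pos_part Lp_diff f g p1)
  note b = bounded_functional_Lp_pairing[OF d]
  have "Lp_pairing ?d f \<le> Lp_pairing ?d g"
    by (rule LIMSEQ_le[OF Ff[OF b] Gg[OF b]]) (use Lp_pairing_mono[OF d F G le] in auto)
  then have "Lp_pairing ?d (\<lambda>x. f x - g x) \<le> 0"
    using bounded_functional_Lp_diff[OF b f g] by simp
  \<comment> \<open>Where f - g is negative it differs from its positive part, but there the weight
    is 0 to the power p - 1, that is, 0.\<close>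
  moreover have "Lp_pairing ?d (\<lambda>x. f x - g x) = Lp_pairing ?d ?d"
    unfolding Lp_pairing_def by (rule Bochner_Integration.integral_cong) (auto simp: max_def)
  moreover have "Lp_pairing ?d ?d = Lp_norm m p ?d powr p"
    by (rule Lp_pairing_self) (use Lp_measurable[OF p1 d] in auto)
  ultimately have "Lp_norm m p ?d = 0" by (metis less_eq_real_def powr_eq_0_iff powr_ge_zero order_antisym)
  then have "AE x in m. ?d x = 0" using Lp_norm_eq_0_iff[OF p1 d] by simp
  then show ?thesis by eventually_elim (auto simp: max_def split: if_splits)
qed

text \<open>For nonnegative functions no gliding hump is needed in the uniform boundedness principle:
  the functionals norming a rapidly growing subsequence are positive and can simply be added.\<close>

lemma Lp_weakly_bounded_nonneg:
  assumes F: "\<And>n. F n \<in> Lp m p" and nonneg: "\<And>n. AE x in m. 0 \<le> F n x"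
    and wb: "\<And>\<phi>. bounded_functional (Lp_space m p) \<phi> \<Longrightarrow> Bseq (\<lambda>n. \<phi> (F n))"
  shows "\<exists>C. \<forall>n. Lp_norm m p (F n) \<le> C"
proof (rule ccontr)
  assume "\<not> ?thesis"
  \<comment> \<open>A growth of 4^k still leaves 2^k after multiplication by the weight 2^-k of the
    series below.\<close>
  then have "\<forall>k. \<exists>n. 4^k < Lp_norm m p (F n)" by (meson not_le)
  then obtain r where r: "\<And>k. 4^k < Lp_norm m p (F (r k))" by metis
  define t where "t k = Lp_norm m p (F (r k))" for k
  have t: "0 < t k" "4^k < t k" for k
    using less_trans[OF zero_less_power[of "4::real" k] r[of k]] r[of k] by (auto simp: t_def)
  define w where "w k x = (1 / t k) * F (r k) x" for k x
  have w: "w k \<in> Lp m p" for k unfolding w_def by (intro Lp_scale F p1)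
  have w1: "Lp_norm m p (w k) = 1" for k
    unfolding w_def Lp_norm_scale[OF p1] using t(1)[of k] by (simp add: t_def)
  have wnn: "AE x in m. 0 \<le> w k x" for k
    using nonneg[of "r k"] by eventually_elim (use t(1)[of k] in \<open>simp add: w_def\<close>)
  \<comment> \<open>Each \<open>w k\<close> has norm 1, so its pairing with \<open>u\<close> is at
    most twice the norm of \<open>u\<close>, and the geometric weights give absolute convergence
    with total bound 4.\<close>
  define \<phi> where "\<phi> u = (\<Sum>k. (1/2)^k * Lp_pairing (w k) u)" for u
  have bd: "\<bar>(1/2)^k * Lp_pairing (w k) u\<bar> \<le> (1/2)^k * (2 * Lp_norm m p u)" if "u \<in> Lp m p" for k u
    using Lp_pairing_bound[OF w that, of k] w1[of k] by (simp add: abs_mult)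
  have sg: "summable (\<lambda>k. (1/2)^k * (2 * Lp_norm m p u))" for u
    by (intro summable_mult2 summable_geometric) simp
  have sm: "summable (\<lambda>k. (1/2)^k * Lp_pairing (w k) u)" if "u \<in> Lp m p" for u
    by (rule summable_comparison_test[OF _ sg[of u]]) (use bd[OF that] in auto)
  have b: "bounded_functional (Lp_space m p) \<phi>"
    unfolding bounded_functional_Lp_iff
  proof (intro conjI ballI allI)
    show "\<phi> (\<lambda>x. u x + v x) = \<phi> u + \<phi> v" if "u \<in> Lp m p" "v \<in> Lp m p" for u v
      unfolding \<phi>_def suminf_add[OF sm[OF that(1)] sm[OF that(2)]]
      by (simp add: Lp_pairing_add[OF w that] distrib_left)
    show "\<phi> (\<lambda>x. c * v x) = c * \<phi> v" if "v \<in> Lp m p" for c v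
      unfolding \<phi>_def suminf_mult[OF sm[OF that], symmetric]
      by (simp add: Lp_pairing_scale mult.left_commute)
    show "\<exists>C. \<forall>v\<in>Lp m p. \<bar>\<phi> v\<bar> \<le> C * Lp_norm m p v"
    proof (intro exI ballI)
      fix v assume v: "v \<in> Lp m p"
      have s': "summable (\<lambda>k. \<bar>(1/2)^k * Lp_pairing (w k) v\<bar>)"
        by (rule summable_comparison_test[OF _ sg[of v]]) (use bd[OF v] in auto)
      have "\<bar>\<phi> v\<bar> \<le> (\<Sum>k. \<bar>(1/2)^k * Lp_pairing (w k) v\<bar>)"
        unfolding \<phi>_def by (rule summable_rabs[OF s'])
      also have "\<dots> \<le> (\<Sum>k. (1/2)^k * (2 * Lp_norm m p v))"
        by (rule suminf_le[OF bd[OF v] s' sg])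
      also have "\<dots> = 4 * Lp_norm m p v"
        using suminf_mult2[OF summable_geometric[of "1/2::real"], of "2 * Lp_norm m p v"] suminf_geometric[of "1/2::real"] by simp
      finally show "\<bar>\<phi> v\<bar> \<le> 4 * Lp_norm m p v" .
    qed
  qed
  obtain K where K: "\<And>n. \<bar>\<phi> (F n)\<bar> \<le> K" using wb[OF b] by (auto simp: Bseq_def)
  have "2^k \<le> K" for k
  proof -
    have nn: "0 \<le> Lp_pairing (w j) (F (r k))" for j
      unfolding Lp_pairing_def by (rule integral_nonneg_AE) (use nonneg[of "r k"] in \<open>auto elim: eventually_mono\<close>)
    have "F (r k) = (\<lambda>x. t k * w k x)" using t(1)[of k] by (simp add: w_def)
    then have "Lp_pairing (w k) (F (r k)) = t k * Lp_pairing (w k) (w k)"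
      by (metis Lp_pairing_scale)
    also have "\<dots> = t k" by (subst Lp_pairing_self) (use wnn w1 Lp_measurable[OF p1 w] in auto)
    finally have "(1/2)^k * t k = (1/2)^k * Lp_pairing (w k) (F (r k))" by simp
    also have "\<dots> \<le> \<phi> (F (r k))"
      unfolding \<phi>_def using sum_le_suminf[OF sm[OF F], of "{k}"] nn by simp
    also have "\<dots> \<le> K" using K[of "r k"] by simp
    finally have "(1/2)^k * t k \<le> K" .
    moreover have "(1/2)^k * 4^k \<le> (1/2)^k * t k" using t(2)[of k] by simp
    moreover have "(1/2)^k * 4^k = (2::real)^k" by (simp flip: power_mult_distrib)
    ultimately show ?thesis by linarith
  qed
  moreover obtain k where "K < 2^k" using real_arch_pow[of 2 K] by auto
  ultimately show False by (meson not_le)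
qed

section \<open>Essential infima in L^p\<close>

lemma Lp_directed_inf:
  assumes S: "S \<subseteq> Lp m p" "S \<noteq> {}" and nonneg: "\<And>f. f \<in> S \<Longrightarrow> AE x in m. 0 \<le> f x"
    and dir: "\<And>f g. f \<in> S \<Longrightarrow> g \<in> S \<Longrightarrow> \<exists>h\<in>S. AE x in m. h x \<le> min (f x) (g x)"
  obtains G H where "G \<in> Lp m p" "\<And>n::nat. H n \<in> S"
    "(\<lambda>n. Lp_norm m p (\<lambda>x. H n x - G x)) \<longlonglongrightarrow> 0"
    "\<And>f. f \<in> S \<Longrightarrow> AE x in m. G x \<le> f x" "AE x in m. 0 \<le> G x"
proof -
  \<comment> \<open>The infimum function is found by minimising the norm: directedness turns a
    minimising sequence into a decreasing one, and its limit must lie below every member because the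
    norm is strictly monotone on non-negative functions.\<close>
  define a where "a = (INF f\<in>S. Lp_norm m p f)"
  have bdd: "bdd_below (Lp_norm m p ` S)" by (rule bdd_belowI[of _ 0]) (auto simp: Lp_norm_nonneg[OF p1])
  have a_le: "a \<le> Lp_norm m p f" if "f \<in> S" for f
    unfolding a_def by (rule cINF_lower[OF bdd that])
  have ex: "\<exists>f\<in>S. Lp_norm m p f < a + e" if "0 < e" for e
    using cInf_lessD[of "Lp_norm m p ` S" "a + e"] S(2) that by (auto simp: a_def)
  have a0: "0 \<le> a" unfolding a_def by (rule cINF_greatest[OF S(2)]) (simp add: Lp_norm_nonneg[OF p1])
  \<comment> \<open>Each new term lies below both its predecessor and a fresh near-minimiser;
    passing to something smaller can only lower the norm of a non-negative function.\<close>
  have "\<exists>H. \<forall>n. (H n \<in> S \<and> Lp_norm m p (H n) < a + 1 / Suc n) \<and> (AE x in m. H (Suc n) x \<le> H n x)"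
  proof (rule dependent_nat_choice)
    show "\<exists>f. f \<in> S \<and> Lp_norm m p f < a + 1 / Suc 0" using ex[of 1] by auto
    fix f n assume f: "f \<in> S \<and> Lp_norm m p f < a + 1 / Suc n"
    obtain g where g: "g \<in> S" "Lp_norm m p g < a + 1 / Suc (Suc n)"
      using ex[of "1 / Suc (Suc n)"] by auto
    obtain h where h: "h \<in> S" "AE x in m. h x \<le> min (f x) (g x)" using dir f g by blast
    have "Lp_norm m p h \<le> Lp_norm m p g"
    proof (rule Lp_norm_mono[OF p1])
      show "AE x in m. \<bar>h x\<bar> \<le> \<bar>g x\<bar>"
        using h(2) nonneg[OF h(1)] by eventually_elim auto
    qed (use h g S in \<open>auto simp: Lp_def\<close>)
    then show "\<exists>y. (y \<in> S \<and> Lp_norm m p y < a + 1 / Suc (Suc n)) \<and> (AE x in m. y x \<le> f x)"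
      using h g by (intro exI[of _ h]) (auto elim: eventually_mono)
  qed
  then obtain H where H: "\<And>n. H n \<in> S" "\<And>n. Lp_norm m p (H n) < a + 1 / Suc n"
    "\<And>n. AE x in m. H (Suc n) x \<le> H n x" by blast
  have HL: "H n \<in> Lp m p" for n using H(1) S by auto
  have [measurable]: "H n \<in> borel_measurable m" for n using HL by (simp add: Lp_def)
  have dec: "AE x in m. decseq (\<lambda>n. H n x) \<and> (\<forall>n. 0 \<le> H n x)"
  proof -
    have "AE x in m. \<forall>n. H (Suc n) x \<le> H n x" using H(3) by (simp add: AE_all_countable)
    moreover have "AE x in m. \<forall>n. 0 \<le> H n x" using nonneg[OF H(1)] by (simp add: AE_all_countable)
    ultimately show ?thesis by eventually_elim (auto simp: decseq_Suc_iff)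
  qed
  define G where "G x = lim (\<lambda>n. H n x)" for x
  have [measurable]: "G \<in> borel_measurable m" unfolding G_def by measurable
  have lim: "AE x in m. (\<lambda>n. H n x) \<longlonglongrightarrow> G x"
    using dec
  proof eventually_elim
    case (elim x)
    then have "convergent (\<lambda>n. H n x)"
      by (metis convergentI decseq_convergent)
    then show ?case by (simp add: G_def convergent_LIMSEQ_iff)
  qed
  have H0: "AE x in m. \<bar>H n x\<bar> \<le> H 0 x" for n
    using dec by eventually_elim (auto simp: decseq_def)
  note dom = Lp_dominated_convergence[OF p1 _ _ HL[of 0] H0 lim]
  have GL: "G \<in> Lp m p" by (rule dom(1)) auto
  have HG: "(\<lambda>n. Lp_norm m p (\<lambda>x. H n x - G x)) \<longlonglongrightarrow> 0" by (rule dom(2)) auto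
  have G0: "AE x in m. 0 \<le> G x"
    using lim dec by eventually_elim (auto intro: LIMSEQ_le_const)
  have "Lp_norm m p G \<le> a"
  proof (rule LIMSEQ_le[OF Lp_norm_tendsto[OF p1 HL GL HG]])
    show "(\<lambda>n. a + 1 / Suc n) \<longlonglongrightarrow> a"
      using tendsto_add[OF tendsto_const[of a] LIMSEQ_inverse_real_of_nat] by (simp add: inverse_eq_divide)
  qed (use H(2) in \<open>auto intro: less_imp_le\<close>)
  have "AE x in m. G x \<le> f x" if f: "f \<in> S" for f
  proof -
    have fL: "f \<in> Lp m p" using f S by auto
    have [measurable]: "f \<in> borel_measurable m" using fL by (simp add: Lp_def)
    \<comment> \<open>This is the L^p limit of the minima of \<open>H n\<close> and
      \<open>f\<close>, each of which dominates a member of \<open>S\<close>, so its norm is at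
      least \<open>a\<close>. It lies below \<open>G\<close>, whose norm is at most
      \<open>a\<close>; hence the two agree almost everywhere.\<close>
    let ?k = "\<lambda>x. min (G x) (f x)"
    have kL: "?k \<in> Lp m p" by (intro Lp_min p1 GL fL)
    have "(\<lambda>n. Lp_norm m p (\<lambda>x. min (H n x) (f x) - ?k x)) \<longlonglongrightarrow> 0"
    proof (rule Lp_dominated_convergence(2)[OF p1 _ _ HL[of 0]])
      show "AE x in m. \<bar>min (H n x) (f x)\<bar> \<le> H 0 x" for n
        using H0[of n] dec nonneg[OF f] by eventually_elim (auto simp: min_def)
      show "AE x in m. (\<lambda>n. min (H n x) (f x)) \<longlonglongrightarrow> ?k x"
        using lim by eventually_elim (auto intro!: tendsto_intros)
    qed auto
    then have "(\<lambda>n. Lp_norm m p (\<lambda>x. min (H n x) (f x))) \<longlonglongrightarrow> Lp_norm m p ?k"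
      by (intro Lp_norm_tendsto p1 Lp_min HL fL kL)
    moreover have "a \<le> Lp_norm m p (\<lambda>x. min (H n x) (f x))" for n
    proof -
      obtain h where h: "h \<in> S" "AE x in m. h x \<le> min (H n x) (f x)" using dir[OF H(1) f] by blast
      have "Lp_norm m p h \<le> Lp_norm m p (\<lambda>x. min (H n x) (f x))"
      proof (rule Lp_norm_mono[OF p1])
        show "AE x in m. \<bar>h x\<bar> \<le> \<bar>min (H n x) (f x)\<bar>"
          using h(2) nonneg[OF h(1)] by eventually_elim auto
        show "h \<in> borel_measurable m" using h S by (auto simp: Lp_def)
      qed (intro Lp_min p1 HL fL)
      then show ?thesis using a_le[OF h(1)] by simp
    qed
    ultimately have "a \<le> Lp_norm m p ?k" by (intro LIMSEQ_le_const) auto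
    then have "Lp_norm m p G \<le> Lp_norm m p ?k" using \<open>Lp_norm m p G \<le> a\<close> by simp
    then have "Lp_norm m p G powr p \<le> Lp_norm m p ?k powr p"
      using p1 by (intro powr_mono2) (auto simp: Lp_norm_nonneg[OF p1])
    then have "(LINT x|m. \<bar>G x\<bar> powr p - \<bar>?k x\<bar> powr p) \<le> 0"
      using Lp_integrable[OF p1 GL] Lp_integrable[OF p1 kL] by (simp add: Lp_norm_powr[OF p1])
    moreover have nn: "AE x in m. 0 \<le> \<bar>G x\<bar> powr p - \<bar>?k x\<bar> powr p"
      using G0 nonneg[OF f] by eventually_elim (use p1 in \<open>auto intro!: powr_mono2\<close>)
    ultimately have "(LINT x|m. \<bar>G x\<bar> powr p - \<bar>?k x\<bar> powr p) = 0"
      using integral_nonneg_AE[OF nn] by simp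
    then have "AE x in m. \<bar>G x\<bar> powr p - \<bar>?k x\<bar> powr p = 0"
      using integral_nonneg_eq_0_iff_AE[OF _ nn] Lp_integrable[OF p1 GL] Lp_integrable[OF p1 kL] by simp
    then show ?thesis using G0 nonneg[OF f]
    proof eventually_elim
      case (elim x)
      show ?case
      proof (rule ccontr)
        assume "\<not> G x \<le> f x"
        then have "f x powr p < G x powr p" using elim p1 by (intro powr_less_mono2) auto
        then show False using elim \<open>\<not> G x \<le> f x\<close> by (simp add: min_def)
      qed
    qed
  qed
  then show ?thesis using that[OF GL H(1) HG _ G0] by blast
qed

text \<open>\<open>S\<close> itself need not be directed, so the minimisation is carried out on
  \<open>U\<close>, the functions lying above every lower bound of \<open>S\<close>.
  \<open>U\<close> contains \<open>S\<close>, is closed under minima and is non-negative because 0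
  is a lower bound. Its infimum is below all of \<open>S\<close>, and, as a limit of members of
  \<open>U\<close>, above every lower bound.\<close>

lemma Lp_ess_inf_spec:
  assumes S: "S \<subseteq> Lp m p" "S \<noteq> {}" and nonneg: "\<And>f. f \<in> S \<Longrightarrow> AE x in m. 0 \<le> f x"
  shows "Lp_ess_inf m p S \<in> Lp m p"
    and "\<And>f. f \<in> S \<Longrightarrow> AE x in m. Lp_ess_inf m p S x \<le> f x"
    and "\<And>h. h \<in> Lp m p \<Longrightarrow> (\<And>f. f \<in> S \<Longrightarrow> AE x in m. h x \<le> f x) \<Longrightarrow> AE x in m. h x \<le> Lp_ess_inf m p S x"
proof -
  define U where "U = {k \<in> Lp m p. \<forall>h\<in>Lp m p. (\<forall>f\<in>S. AE x in m. h x \<le> f x) \<longrightarrow> (AE x in m. h x \<le> k x)}"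
  have SU: "S \<subseteq> U" using S by (auto simp: U_def)
  obtain G H where G: "G \<in> Lp m p" "\<And>n::nat. H n \<in> U"
    "(\<lambda>n. Lp_norm m p (\<lambda>x. H n x - G x)) \<longlonglongrightarrow> 0"
    "\<And>f. f \<in> U \<Longrightarrow> AE x in m. G x \<le> f x"
  proof (rule Lp_directed_inf[of U])
    show "U \<subseteq> Lp m p" "U \<noteq> {}" using SU S by (auto simp: U_def)
    show "AE x in m. 0 \<le> f x" if "f \<in> U" for f
      using that nonneg Lp_zero[OF p1, of m] by (auto simp: U_def)
    show "\<exists>h\<in>U. AE x in m. h x \<le> min (f x) (g x)" if "f \<in> U" "g \<in> U" for f g
    proof (rule bexI[of _ "\<lambda>x. min (f x) (g x)"])
      show "(\<lambda>x. min (f x) (g x)) \<in> U"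
        unfolding U_def
      proof (intro CollectI conjI ballI impI Lp_min p1)
        fix h assume "h \<in> Lp m p" "\<forall>f\<in>S. AE x in m. h x \<le> f x"
        then have "AE x in m. h x \<le> f x" "AE x in m. h x \<le> g x" using that by (auto simp: U_def)
        then show "AE x in m. h x \<le> min (f x) (g x)" by eventually_elim auto
      qed (use that in \<open>auto simp: U_def\<close>)
    qed auto
  qed blast
  have "\<exists>G. G \<in> Lp m p \<and> (\<forall>F\<in>S. AE x in m. G x \<le> F x) \<and>
     (\<forall>H\<in>Lp m p. (\<forall>F\<in>S. AE x in m. H x \<le> F x) \<longrightarrow> (AE x in m. H x \<le> G x))"
  proof (intro exI[of _ G] conjI ballI impI)
    fix h assume h: "h \<in> Lp m p" "\<forall>F\<in>S. AE x in m. h x \<le> F x"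
    have H: "H n \<in> Lp m p" "AE x in m. h x \<le> H n x" for n
      using G(2)[of n] h by (auto simp: U_def)
    from Lp_limit_mono[OF p1 h(1) H(1) h(1) G(1) H(2) Lp_limit_const[OF p1] G(3)]
    show "AE x in m. h x \<le> G x" .
  qed (use G SU in auto)
  then have *: "Lp_ess_inf m p S \<in> Lp m p \<and> (\<forall>F\<in>S. AE x in m. Lp_ess_inf m p S x \<le> F x) \<and>
     (\<forall>H\<in>Lp m p. (\<forall>F\<in>S. AE x in m. H x \<le> F x) \<longrightarrow> (AE x in m. H x \<le> Lp_ess_inf m p S x))"
    unfolding Lp_ess_inf_def by (rule someI_ex)
  show "Lp_ess_inf m p S \<in> Lp m p"
    "\<And>f. f \<in> S \<Longrightarrow> AE x in m. Lp_ess_inf m p S x \<le> f x"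
    "\<And>h. h \<in> Lp m p \<Longrightarrow> (\<And>f. f \<in> S \<Longrightarrow> AE x in m. h x \<le> f x) \<Longrightarrow> AE x in m. h x \<le> Lp_ess_inf m p S x"
    using * by auto
qed

end

section \<open>Modules with a pointwise norm\<close>

text \<open>\<open>S\<close> is the algebra of multipliers: simple functions before completion, \<open>L\<^sup>\<infinity>\<close> afterwards.\<close>

locale premodule =
  fixes m :: "'a measure" and p :: real and S :: "('a \<Rightarrow> real) set" and N :: "('a, 'v) nmodule"
  assumes p1: "1 < p"
    and S_Linf: "S \<subseteq> Linf m"
    and S_const: "(\<lambda>_. c) \<in> S"
    and S_indicator: "A \<in> sets m \<Longrightarrow> indicator A \<in> S"
    and S_add: "\<lbrakk>f \<in> S; g \<in> S\<rbrakk> \<Longrightarrow> (\<lambda>x. f x + g x) \<in> S"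
    and S_mult: "\<lbrakk>f \<in> S; g \<in> S\<rbrakk> \<Longrightarrow> (\<lambda>x. f x * g x) \<in> S"
    and zero_closed [simp]: "mzero N \<in> mcarrier N"
    and add_closed [simp]: "\<lbrakk>u \<in> mcarrier N; v \<in> mcarrier N\<rbrakk> \<Longrightarrow> madd N u v \<in> mcarrier N"
    and mult_closed [simp]: "\<lbrakk>f \<in> S; v \<in> mcarrier N\<rbrakk> \<Longrightarrow> mmult N f v \<in> mcarrier N"
    and add_assoc: "\<lbrakk>u \<in> mcarrier N; v \<in> mcarrier N; w \<in> mcarrier N\<rbrakk> \<Longrightarrow>
          madd N (madd N u v) w = madd N u (madd N v w)"
    and add_commute: "\<lbrakk>u \<in> mcarrier N; v \<in> mcarrier N\<rbrakk> \<Longrightarrow> madd N u v = madd N v u"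
    and add_zero: "v \<in> mcarrier N \<Longrightarrow> madd N v (mzero N) = v"
    and mult_add_right: "\<lbrakk>f \<in> S; u \<in> mcarrier N; v \<in> mcarrier N\<rbrakk> \<Longrightarrow>
          mmult N f (madd N u v) = madd N (mmult N f u) (mmult N f v)"
    and mult_add_left: "\<lbrakk>f \<in> S; g \<in> S; v \<in> mcarrier N\<rbrakk> \<Longrightarrow>
          mmult N (\<lambda>x. f x + g x) v = madd N (mmult N f v) (mmult N g v)"
    and mult_mult: "\<lbrakk>f \<in> S; g \<in> S; v \<in> mcarrier N\<rbrakk> \<Longrightarrow>
          mmult N f (mmult N g v) = mmult N (\<lambda>x. f x * g x) v"
    and mult_one: "v \<in> mcarrier N \<Longrightarrow> mmult N (\<lambda>_. 1) v = v"
    and scale_eq: "v \<in> mcarrier N \<Longrightarrow> mscale N c v = mmult N (\<lambda>_. c) v"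
    and pnorm_in_Lp: "v \<in> mcarrier N \<Longrightarrow> mpnorm N v \<in> Lp m p"
    and pnorm_nonneg: "v \<in> mcarrier N \<Longrightarrow> AE x in m. 0 \<le> mpnorm N v x"
    and pnorm_triangle: "\<lbrakk>u \<in> mcarrier N; v \<in> mcarrier N\<rbrakk> \<Longrightarrow>
          AE x in m. mpnorm N (madd N u v) x \<le> mpnorm N u x + mpnorm N v x"
    and pnorm_mult: "\<lbrakk>f \<in> S; v \<in> mcarrier N\<rbrakk> \<Longrightarrow>
          AE x in m. mpnorm N (mmult N f v) x = \<bar>f x\<bar> * mpnorm N v x"
    and pnorm_eq_zero: "\<lbrakk>v \<in> mcarrier N; AE x in m. mpnorm N v x = 0\<rbrakk> \<Longrightarrow> v = mzero N"
    and norm_eq_Lp_norm: "v \<in> mcarrier N \<Longrightarrow> mnorm N v = Lp_norm m p (mpnorm N v)"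
begin

abbreviation V where "V \<equiv> mcarrier N"
abbreviation zero ("\<zero>") where "\<zero> \<equiv> mzero N"
abbreviation add (infixl "\<oplus>" 65) where "u \<oplus> v \<equiv> madd N u v"
abbreviation diff (infixl "\<ominus>" 65) where "u \<ominus> v \<equiv> mdiff N u v"
abbreviation scale (infixr "\<odot>" 70) where "c \<odot> v \<equiv> mscale N c v"
abbreviation mult (infixr "\<star>" 70) where "f \<star> v \<equiv> mmult N f v"
abbreviation pn where "pn v \<equiv> mpnorm N v"
abbreviation nm where "nm v \<equiv> mnorm N v"

declare S_const [simp] S_indicator [simp]

lemma S_uminus: "f \<in> S \<Longrightarrow> (\<lambda>x. - f x) \<in> S"
  using S_mult[OF S_const[of "-1"]] by simp

lemma S_diff: "\<lbrakk>f \<in> S; g \<in> S\<rbrakk> \<Longrightarrow> (\<lambda>x. f x - g x) \<in> S"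
  using S_add[OF _ S_uminus, of f g] by simp

lemma scale_closed [simp]: "v \<in> V \<Longrightarrow> c \<odot> v \<in> V"
  by (simp add: scale_eq)

lemma diff_closed [simp]: "\<lbrakk>u \<in> V; v \<in> V\<rbrakk> \<Longrightarrow> u \<ominus> v \<in> V"
  by (simp add: mdiff_def)

lemma scale_add_right: "\<lbrakk>u \<in> V; v \<in> V\<rbrakk> \<Longrightarrow> c \<odot> (u \<oplus> v) = c \<odot> u \<oplus> c \<odot> v"
  by (simp add: scale_eq mult_add_right)

lemma scale_add_left: "v \<in> V \<Longrightarrow> (b + c) \<odot> v = b \<odot> v \<oplus> c \<odot> v"
  using mult_add_left[of "\<lambda>_. b" "\<lambda>_. c" v] by (simp add: scale_eq)

lemma scale_mult: "\<lbrakk>f \<in> S; v \<in> V\<rbrakk> \<Longrightarrow> c \<odot> (f \<star> v) = (\<lambda>x. c * f x) \<star> v"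
  by (simp add: scale_eq mult_mult)

lemma mult_scale: "\<lbrakk>f \<in> S; v \<in> V\<rbrakk> \<Longrightarrow> f \<star> (c \<odot> v) = (\<lambda>x. c * f x) \<star> v"
  by (simp add: scale_eq mult_mult mult.commute)

lemma scale_scale: "v \<in> V \<Longrightarrow> b \<odot> c \<odot> v = (b * c) \<odot> v"
  by (simp add: scale_eq mult_mult)

lemma scale_one [simp]: "v \<in> V \<Longrightarrow> 1 \<odot> v = v"
  by (simp add: scale_eq mult_one)

lemma zero_mult [simp]: "v \<in> V \<Longrightarrow> (\<lambda>_. 0) \<star> v = \<zero>"
proof (rule pnorm_eq_zero)
  assume "v \<in> V"
  then show "AE x in m. pn ((\<lambda>_. 0) \<star> v) x = 0"
    using pnorm_mult[of "\<lambda>_. 0" v] by simp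
qed simp

lemma zero_scale [simp]: "v \<in> V \<Longrightarrow> 0 \<odot> v = \<zero>"
  by (simp add: scale_eq)

lemma diff_self [simp]: "v \<in> V \<Longrightarrow> v \<ominus> v = \<zero>"
  using scale_add_left[of v 1 "-1"] by (simp add: mdiff_def)

lemma add_zero' [simp]: "v \<in> V \<Longrightarrow> v \<oplus> \<zero> = v" "v \<in> V \<Longrightarrow> \<zero> \<oplus> v = v"
  using add_zero add_commute[of v \<zero>] by auto

lemma mult_zero [simp]: "f \<in> S \<Longrightarrow> f \<star> \<zero> = \<zero>"
  using mult_mult[of f "\<lambda>_. 0" \<zero>] by simp

lemma scale_zero [simp]: "c \<odot> \<zero> = \<zero>"
  by (simp add: scale_eq)

lemma diff_zero [simp]: "v \<in> V \<Longrightarrow> v \<ominus> \<zero> = v"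
  by (simp add: mdiff_def)

lemma add_left_commute: "\<lbrakk>u \<in> V; v \<in> V; w \<in> V\<rbrakk> \<Longrightarrow> u \<oplus> (v \<oplus> w) = v \<oplus> (u \<oplus> w)"
  by (metis add_assoc add_commute)

lemmas add_ac = add_assoc add_commute add_left_commute

lemma add_diff_add: "\<lbrakk>u \<in> V; v \<in> V; u' \<in> V; v' \<in> V\<rbrakk> \<Longrightarrow> (u \<oplus> v) \<ominus> (u' \<oplus> v') = (u \<ominus> u') \<oplus> (v \<ominus> v')"
  by (simp add: mdiff_def scale_add_right add_ac)

lemma diff_add_cancel [simp]: "\<lbrakk>u \<in> V; v \<in> V\<rbrakk> \<Longrightarrow> (u \<ominus> v) \<oplus> v = u"
  using diff_self[of v] by (simp add: mdiff_def add_assoc add_commute[of "(-1) \<odot> v" v])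

lemma add_diff_cancel [simp]: "\<lbrakk>u \<in> V; v \<in> V\<rbrakk> \<Longrightarrow> u \<oplus> (v \<ominus> u) = v"
  using diff_add_cancel[of v u] by (simp add: add_commute)

lemma diff_add_diff: "\<lbrakk>u \<in> V; v \<in> V; w \<in> V\<rbrakk> \<Longrightarrow> (u \<ominus> v) \<oplus> (v \<ominus> w) = u \<ominus> w"
  using add_assoc[of "u \<ominus> v" v "(-1) \<odot> w"] by (simp add: mdiff_def[of N v w] mdiff_def[of N u w])

lemma diff_eq_zero_iff: "\<lbrakk>u \<in> V; v \<in> V\<rbrakk> \<Longrightarrow> u \<ominus> v = \<zero> \<longleftrightarrow> u = v"
  by (metis add_zero'(2) diff_add_cancel diff_self)

lemma mult_diff_right: "\<lbrakk>f \<in> S; u \<in> V; v \<in> V\<rbrakk> \<Longrightarrow> f \<star> (u \<ominus> v) = f \<star> u \<ominus> f \<star> v"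
  by (simp add: mdiff_def mult_add_right scale_mult mult_scale)

lemma scale_diff_right: "\<lbrakk>u \<in> V; v \<in> V\<rbrakk> \<Longrightarrow> c \<odot> (u \<ominus> v) = c \<odot> u \<ominus> c \<odot> v"
  by (simp add: scale_eq mult_diff_right)

lemma mult_diff_left: "\<lbrakk>f \<in> S; g \<in> S; v \<in> V\<rbrakk> \<Longrightarrow> (\<lambda>x. f x - g x) \<star> v = f \<star> v \<ominus> g \<star> v"
  using mult_add_left[of f "\<lambda>x. - g x" v] by (simp add: mdiff_def scale_mult S_uminus)

lemma minus_diff: "\<lbrakk>u \<in> V; v \<in> V\<rbrakk> \<Longrightarrow> (-1) \<odot> (u \<ominus> v) = v \<ominus> u"
  by (simp add: mdiff_def scale_add_right scale_scale add_commute)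

lemma pnorm_measurable [measurable]: "v \<in> V \<Longrightarrow> pn v \<in> borel_measurable m"
  using pnorm_in_Lp by (simp add: Lp_def)

lemma pnorm_scale: "v \<in> V \<Longrightarrow> AE x in m. pn (c \<odot> v) x = \<bar>c\<bar> * pn v x"
  using pnorm_mult[of "\<lambda>_. c" v] by (simp add: scale_eq)

lemma pnorm_zero: "AE x in m. pn \<zero> x = 0"
  using pnorm_scale[of \<zero> 0] by simp

lemma pnorm_diff_commute: "\<lbrakk>u \<in> V; v \<in> V\<rbrakk> \<Longrightarrow> AE x in m. pn (u \<ominus> v) x = pn (v \<ominus> u) x"
  using pnorm_scale[of "u \<ominus> v" "-1"] by (simp add: minus_diff) (auto elim: eventually_mono)

lemma pnorm_diff_triangle:
  "\<lbrakk>u \<in> V; v \<in> V; w \<in> V\<rbrakk> \<Longrightarrow> AE x in m. pn (u \<ominus> w) x \<le> pn (u \<ominus> v) x + pn (v \<ominus> w) x"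
  using pnorm_triangle[of "u \<ominus> v" "v \<ominus> w"] by (simp add: diff_add_diff)

lemma pnorm_rev_triangle:
  assumes "u \<in> V" "v \<in> V"
  shows "AE x in m. \<bar>pn u x - pn v x\<bar> \<le> pn (u \<ominus> v) x"
  using pnorm_diff_triangle[of u v \<zero>] pnorm_diff_triangle[of v u \<zero>] pnorm_diff_commute[of u v] assms
  by simp (elim AE_mp, auto)

lemma eq_iff_pnorm: "\<lbrakk>u \<in> V; v \<in> V\<rbrakk> \<Longrightarrow> u = v \<longleftrightarrow> (AE x in m. pn (u \<ominus> v) x = 0)"
  using pnorm_eq_zero[of "u \<ominus> v"] pnorm_zero diff_eq_zero_iff[of u v] by auto

lemma pnorm_diff_mult:
  "\<lbrakk>f \<in> S; g \<in> S; v \<in> V\<rbrakk> \<Longrightarrow> AE x in m. pn (f \<star> v \<ominus> g \<star> v) x = \<bar>f x - g x\<bar> * pn v x"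
  using pnorm_mult[OF S_diff, of f g v] by (simp add: mult_diff_left)

lemma mult_cong_AE: "\<lbrakk>f \<in> S; g \<in> S; AE x in m. f x = g x; v \<in> V\<rbrakk> \<Longrightarrow> f \<star> v = g \<star> v"
  by (subst eq_iff_pnorm) (use pnorm_diff_mult[of f g v] in auto)

text \<open>The bridge between the two languages of localisation: equality after multiplication by
  an indicator in the module axioms, vanishing of a pointwise norm on a set in the
  estimates.\<close>

lemma indicator_mult_eq_iff:
  assumes "u \<in> V" "v \<in> V" "A \<in> sets m"
  shows "indicator A \<star> u = indicator A \<star> v \<longleftrightarrow> (AE x in m. x \<in> A \<longrightarrow> pn (u \<ominus> v) x = 0)"
proof -
  have *: "AE x in m. pn (indicator A \<star> u \<ominus> indicator A \<star> v) x = indicator A x * pn (u \<ominus> v) x"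
    using pnorm_mult[of "indicator A" "u \<ominus> v"] assms by (simp add: mult_diff_right)
  have "indicator A \<star> u = indicator A \<star> v \<longleftrightarrow> (AE x in m. pn (indicator A \<star> u \<ominus> indicator A \<star> v) x = 0)"
    using assms by (simp add: eq_iff_pnorm)
  also have "\<dots> \<longleftrightarrow> (AE x in m. indicator A x * pn (u \<ominus> v) x = 0)"
    using * by (intro iffI) (elim AE_mp, auto)+
  also have "\<dots> \<longleftrightarrow> (AE x in m. x \<in> A \<longrightarrow> pn (u \<ominus> v) x = 0)"
    by (intro iffI; elim eventually_mono) (auto simp: indicator_def split: if_splits)
  finally show ?thesis .
qed

lemma norm_nonneg: "v \<in> V \<Longrightarrow> 0 \<le> nm v"
  by (simp add: norm_eq_Lp_norm Lp_norm_nonneg[OF p1])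

lemma norm_mono:
  "\<lbrakk>u \<in> V; g \<in> Lp m p; AE x in m. pn u x \<le> g x\<rbrakk> \<Longrightarrow> nm u \<le> Lp_norm m p g"
  unfolding norm_eq_Lp_norm
  by (rule Lp_norm_mono[OF p1]) (use pnorm_nonneg[of u] in auto)

lemma norm_mono': "\<lbrakk>u \<in> V; v \<in> V; AE x in m. pn u x \<le> pn v x\<rbrakk> \<Longrightarrow> nm u \<le> nm v"
  using norm_mono[of u "pn v"] by (simp add: norm_eq_Lp_norm pnorm_in_Lp)

lemma norm_triangle: "\<lbrakk>u \<in> V; v \<in> V\<rbrakk> \<Longrightarrow> nm (u \<oplus> v) \<le> nm u + nm v"
  using norm_mono[of "u \<oplus> v" "\<lambda>x. pn u x + pn v x"] pnorm_triangle[of u v]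
    Lp_norm_triangle[OF p1, of "pn u" m "pn v"] Lp_add[OF p1, of "pn u" m "pn v"]
  by (simp add: norm_eq_Lp_norm pnorm_in_Lp)

lemma norm_scale: "v \<in> V \<Longrightarrow> nm (c \<odot> v) = \<bar>c\<bar> * nm v"
  using pnorm_scale[of v c] Lp_norm_scale[OF p1, of m "\<bar>c\<bar>" "pn v"]
    Lp_norm_cong_AE[OF p1, where m = m and f = "pn (c \<odot> v)" and g = "\<lambda>x. \<bar>c\<bar> * pn v x"]
  by (simp add: norm_eq_Lp_norm)

lemma norm_eq_zero: "v \<in> V \<Longrightarrow> nm v = 0 \<longleftrightarrow> v = \<zero>"
  using Lp_norm_eq_0_iff[OF p1 pnorm_in_Lp, of v] pnorm_eq_zero[of v] pnorm_zero
  by (auto simp: norm_eq_Lp_norm)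

lemma norm_zero [simp]: "nm \<zero> = 0"
  by (simp add: norm_eq_zero)

lemma norm_diff_commute: "\<lbrakk>u \<in> V; v \<in> V\<rbrakk> \<Longrightarrow> nm (u \<ominus> v) = nm (v \<ominus> u)"
  using norm_scale[of "u \<ominus> v" "-1"] by (simp add: minus_diff)

lemma norm_diff_triangle: "\<lbrakk>u \<in> V; v \<in> V; w \<in> V\<rbrakk> \<Longrightarrow> nm (u \<ominus> w) \<le> nm (u \<ominus> v) + nm (v \<ominus> w)"
  using norm_triangle[of "u \<ominus> v" "v \<ominus> w"] by (simp add: diff_add_diff)

lemma norm_rev_triangle: "\<lbrakk>u \<in> V; v \<in> V\<rbrakk> \<Longrightarrow> \<bar>nm u - nm v\<bar> \<le> nm (u \<ominus> v)"
  using norm_diff_triangle[of u v \<zero>] norm_diff_triangle[of v u \<zero>] by (simp add: norm_diff_commute[of u v])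

lemma norm_mult_le:
  assumes "f \<in> S" "v \<in> V" "AE x in m. \<bar>f x\<bar> \<le> c" 
  shows "nm (f \<star> v) \<le> c * nm v"
proof (cases "0 \<le> c")
  case True
  have "nm (f \<star> v) \<le> Lp_norm m p (\<lambda>x. c * pn v x)"
  proof (rule norm_mono)
    show "AE x in m. pn (f \<star> v) x \<le> c * pn v x"
      using pnorm_mult[OF assms(1,2)] pnorm_nonneg[OF assms(2)] assms(3)
      by eventually_elim (simp add: mult_right_mono)
  qed (use assms in \<open>auto intro!: Lp_scale p1 pnorm_in_Lp\<close>)
  then show ?thesis using True assms by (simp add: Lp_norm_scale[OF p1] norm_eq_Lp_norm)
next
  \<comment> \<open>An absolute value can have a negative almost everywhere bound only if the
    measure is null, and then the whole module is zero.\<close>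
  case False
  have "AE x in m. False" using assms(3) by (rule eventually_mono) (use False in linarith)
  then have "u = \<zero>" if "u \<in> V" for u using that by (intro pnorm_eq_zero) (auto elim: eventually_mono)
  from this[of "f \<star> v"] this[of v] have "f \<star> v = \<zero>" "v = \<zero>" using assms by simp_all
  then show ?thesis using assms by simp
qed

text \<open>Joint continuity of multiplication. It is applied with uniform approximations of a
  bounded function as multipliers: \<open>K\<close> bounds them and \<open>e\<close> is the uniform
  error.\<close>

lemma norm_mult_diff_le:
  assumes s: "s \<in> S" and t: "t \<in> S" and u: "u \<in> V" and v: "v \<in> V"
    and K: "AE x in m. \<bar>s x\<bar> \<le> K" and e: "AE x in m. \<bar>s x - t x\<bar> \<le> e"
  shows "nm (s \<star> u \<ominus> t \<star> v) \<le> K * nm (u \<ominus> v) + e * nm v"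
proof -
  have "nm (s \<star> u \<ominus> t \<star> v) \<le> nm (s \<star> u \<ominus> s \<star> v) + nm (s \<star> v \<ominus> t \<star> v)"
    using s t u v by (intro norm_diff_triangle) auto
  also have "s \<star> u \<ominus> s \<star> v = s \<star> (u \<ominus> v)" using s u v by (simp add: mult_diff_right)
  also have "s \<star> v \<ominus> t \<star> v = (\<lambda>x. s x - t x) \<star> v" by (rule mult_diff_left[OF s t v, symmetric])
  also have "nm (s \<star> (u \<ominus> v)) + nm ((\<lambda>x. s x - t x) \<star> v) \<le> K * nm (u \<ominus> v) + e * nm v"
    using norm_mult_le[OF s _ K, of "u \<ominus> v"] norm_mult_le[OF S_diff[OF s t] v e] u v by simp
  finally show ?thesis .
qed

lemma norm_mult_bounded:
  assumes "f \<in> S"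
  obtains c where "0 \<le> c" "\<And>v. v \<in> V \<Longrightarrow> nm (f \<star> v) \<le> c * nm v"
proof -
  have "f \<in> Linf m" using assms S_Linf by auto
  then obtain c where "0 \<le> c" "AE x in m. \<bar>f x\<bar> \<le> c" by (rule LinfE[OF p1])
  then show ?thesis using that norm_mult_le[OF assms] by blast
qed

lemma mconverges_norm:
  assumes "\<And>n. X n \<in> V" "v \<in> V" "mconverges N X v"
  shows "(\<lambda>n. nm (X n)) \<longlonglongrightarrow> nm v"
proof (rule LIM_zero_cancel, rule Lim_null_comparison)
  show "(\<lambda>n. nm (X n \<ominus> v)) \<longlonglongrightarrow> 0" using assms by (simp add: mconverges_def)
qed (use assms norm_rev_triangle in auto)

lemma mconverges_pnorm:
  assumes "\<And>n. X n \<in> V" "v \<in> V" "mconverges N X v"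
  shows "(\<lambda>n. Lp_norm m p (\<lambda>x. pn (X n) x - pn v x)) \<longlonglongrightarrow> 0"
proof (rule Lim_null_comparison)
  show "(\<lambda>n. nm (X n \<ominus> v)) \<longlonglongrightarrow> 0" using assms by (simp add: mconverges_def)
  have "Lp_norm m p (\<lambda>x. pn (X n) x - pn v x) \<le> nm (X n \<ominus> v)" for n
  proof -
    have "Lp_norm m p (\<lambda>x. pn (X n) x - pn v x) \<le> Lp_norm m p (pn (X n \<ominus> v))"
      using pnorm_rev_triangle[of "X n" v] assms
      by (intro Lp_norm_mono[OF p1] pnorm_in_Lp) (auto elim: eventually_mono)
    then show ?thesis using assms by (simp add: norm_eq_Lp_norm)
  qed
  then show "\<forall>\<^sub>F n in sequentially. norm (Lp_norm m p (\<lambda>x. pn (X n) x - pn v x)) \<le> nm (X n \<ominus> v)"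
    by (simp add: Lp_norm_nonneg[OF p1])
qed

lemma mconverges_unique:
  assumes X: "\<And>n. X n \<in> V" and u: "u \<in> V" and v: "v \<in> V" and "mconverges N X u" "mconverges N X v"
  shows "u = v"
proof -
  have "(\<lambda>n. nm (X n \<ominus> u) + nm (X n \<ominus> v)) \<longlonglongrightarrow> 0"
    using tendsto_add[of "\<lambda>n. nm (X n \<ominus> u)" 0 _ "\<lambda>n. nm (X n \<ominus> v)" 0] assms by (simp add: mconverges_def)
  moreover have "nm (u \<ominus> v) \<le> nm (X n \<ominus> u) + nm (X n \<ominus> v)" for n
    using norm_diff_triangle[OF u X v, of n] norm_diff_commute[OF u X, of n] by simp
  ultimately have "nm (u \<ominus> v) \<le> 0" by (intro LIMSEQ_le_const) auto
  then have "nm (u \<ominus> v) = 0" using norm_nonneg[of "u \<ominus> v"] u v by simp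
  then show ?thesis using u v by (simp add: norm_eq_zero diff_eq_zero_iff)
qed

lemma mconverges_const: "v \<in> V \<Longrightarrow> mconverges N (\<lambda>_. v) v"
  by (simp add: mconverges_def)

lemma mconverges_add:
  assumes X: "\<And>n. X n \<in> V" "u \<in> V" and Y: "\<And>n. Y n \<in> V" "v \<in> V"
    and "mconverges N X u" "mconverges N Y v"
  shows "mconverges N (\<lambda>n. X n \<oplus> Y n) (u \<oplus> v)"
  unfolding mconverges_def
proof (rule Lim_null_comparison)
  show "(\<lambda>n. nm (X n \<ominus> u) + nm (Y n \<ominus> v)) \<longlonglongrightarrow> 0"
    using tendsto_add[of "\<lambda>n. nm (X n \<ominus> u)" 0 _ "\<lambda>n. nm (Y n \<ominus> v)" 0] assms by (simp add: mconverges_def)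
  show "\<forall>\<^sub>F n in sequentially. norm (nm ((X n \<oplus> Y n) \<ominus> (u \<oplus> v))) \<le> nm (X n \<ominus> u) + nm (Y n \<ominus> v)"
    using assms norm_triangle by (simp add: add_diff_add norm_nonneg)
qed

lemma mconverges_mult:
  assumes X: "\<And>n. X n \<in> V" "u \<in> V" and f: "f \<in> S" and "mconverges N X u"
  shows "mconverges N (\<lambda>n. f \<star> X n) (f \<star> u)"
proof -
  obtain c where c: "\<And>v. v \<in> V \<Longrightarrow> nm (f \<star> v) \<le> c * nm v" using norm_mult_bounded[OF f] by blast
  have "(\<lambda>n. c * nm (X n \<ominus> u)) \<longlonglongrightarrow> 0"
    using tendsto_mult_left[of "\<lambda>n. nm (X n \<ominus> u)" 0 _ c] assms by (simp add: mconverges_def)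
  moreover have "\<forall>\<^sub>F n in sequentially. norm (nm (f \<star> X n \<ominus> f \<star> u)) \<le> c * nm (X n \<ominus> u)"
    using c[of "X _ \<ominus> u"] X f by (simp add: mult_diff_right[symmetric] norm_nonneg)
  ultimately show ?thesis
    unfolding mconverges_def by (rule Lim_null_comparison[rotated])
qed

lemma mconverges_scale:
  assumes X: "\<And>n. X n \<in> V" "u \<in> V" and "mconverges N X u"
  shows "mconverges N (\<lambda>n. c \<odot> X n) (c \<odot> u)"
  using mconverges_mult[OF X S_const[of c] assms(3)] X by (simp add: scale_eq)

lemma mconverges_Cauchy:
  assumes X: "\<And>n. X n \<in> V" "u \<in> V" and lim: "mconverges N X u"
  shows "mCauchy N X"
  unfolding mCauchy_def
proof (intro conjI allI impI X)
  fix e :: real assume "0 < e"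
  then obtain K where K: "\<And>n. K \<le> n \<Longrightarrow> nm (X n \<ominus> u) < e/2"
    using order_tendstoD(2)[OF lim[unfolded mconverges_def], of "e/2"] by (auto simp: eventually_sequentially)
  show "\<exists>K. \<forall>i\<ge>K. \<forall>j\<ge>K. nm (X i \<ominus> X j) < e"
  proof (intro exI allI impI)
    fix i j assume "K \<le> i" "K \<le> j"
    then show "nm (X i \<ominus> X j) < e"
      using K[of i] K[of j] norm_diff_triangle[OF X(1) X(2) X(1), of i j] norm_diff_commute[OF X(1) X(2), of j]
      by simp
  qed
qed

lemma mCauchy_subseq_mconverges:
  assumes X: "mCauchy N X" and u: "u \<in> V" and r: "strict_mono (r :: nat \<Rightarrow> nat)" and lim: "mconverges N (X \<circ> r) u"
  shows "mconverges N X u"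
  unfolding mconverges_def
proof (rule LIMSEQ_I)
  fix e :: real assume e: "0 < e"
  have XV: "\<And>n. X n \<in> V" using X by (simp add: mCauchy_def)
  have "\<exists>K. \<forall>i\<ge>K. \<forall>j\<ge>K. nm (X i \<ominus> X j) < e/2"
    using X half_gt_zero[OF e] by (simp only: mCauchy_def)
  then obtain K where K: "\<And>i j. K \<le> i \<Longrightarrow> K \<le> j \<Longrightarrow> nm (X i \<ominus> X j) < e/2" by blast
  have "\<forall>\<^sub>F n in sequentially. nm (X (r n) \<ominus> u) < e/2"
    using order_tendstoD(2)[OF lim[unfolded mconverges_def], of "e/2"] e by simp
  then obtain n where n: "K \<le> n" "nm (X (r n) \<ominus> u) < e/2"
    by (metis (mono_tags, lifting) eventually_sequentially nle_le)
  have "K \<le> r n" using n seq_suble[OF r, of n] by simp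
  then have "nm (X i \<ominus> u) < e" if "K \<le> i" for i
    using K[OF that, of "r n"] n norm_diff_triangle[OF XV XV u, of i "r n"] by simp
  then show "\<exists>K. \<forall>n\<ge>K. norm (nm (X n \<ominus> u) - 0) < e"
    using XV u by (intro exI[of _ K]) (auto simp: norm_nonneg)
qed

text \<open>Completeness needs checking only for sequences with geometrically decreasing steps. In a
  quotient these are the sequences whose representatives can be chosen one after the other.\<close>

lemma completeI_rapid:
  assumes rapid: "\<And>X. \<lbrakk>\<And>n. X n \<in> V; \<And>n. nm (X (Suc n) \<ominus> X n) < (1/2)^n\<rbrakk> \<Longrightarrow> \<exists>v\<in>V. mconverges N X v"
    and X: "mCauchy N X"
  shows "\<exists>v\<in>V. mconverges N X v"
proof -
  have C: "\<exists>K. \<forall>i\<ge>K. \<forall>j\<ge>K. nm (X i \<ominus> X j) < e" if "0 < e" for e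
    using X that by (simp add: mCauchy_def)
  have e: "0 < (1/2 :: real)^k" for k by simp
  obtain r where r: "strict_mono r" "\<And>k i j. r k \<le> i \<Longrightarrow> r k \<le> j \<Longrightarrow> nm (X i \<ominus> X j) < (1/2)^k"
    by (rule rapid_subsequence[where P = "\<lambda>i j e. nm (X i \<ominus> X j) < e" and e = "\<lambda>k. (1/2)^k", OF C e]) (assumption, rule that)
  have "\<exists>v\<in>V. mconverges N (X \<circ> r) v"
  proof (rule rapid)
    show "nm ((X \<circ> r) (Suc n) \<ominus> (X \<circ> r) n) < (1/2)^n" for n
      using r(2)[of n "r (Suc n)" "r n"] strict_monoD[OF r(1), of n "Suc n"] by simp
  qed (use X in \<open>auto simp: mCauchy_def\<close>)
  then show ?thesis using mCauchy_subseq_mconverges[OF X _ r(1)] by blast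
qed

lemma rapid_Cauchy:
  assumes X: "\<And>n. X n \<in> V" and r: "\<And>n. nm (X (Suc n) \<ominus> X n) \<le> (1/2)^n"
  shows "mCauchy N X"
proof -
  \<comment> \<open>The bound is the exact partial geometric sum; with the subtracted term kept, the
    induction closes without loss.\<close>
  have *: "nm (X (k + d) \<ominus> X k) \<le> 2 * (1/2)^k - 2 * (1/2)^(k + d)" for k d
  proof (induction d)
    case (Suc d)
    show ?case
      using norm_diff_triangle[OF X X X, of "Suc (k + d)" k "k + d"] r[of "k + d"] Suc by simp
  qed (simp add: X)
  have **: "nm (X i \<ominus> X k) \<le> 2 * (1/2)^k" if "k \<le> i" for i k
  proof -
    have "nm (X i \<ominus> X k) \<le> 2 * (1/2)^k - 2 * (1/2)^i" using *[of k "i - k"] that by simp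
    also have "\<dots> \<le> 2 * (1/2)^k" by simp
    finally show ?thesis .
  qed
  show ?thesis
    unfolding mCauchy_def
  proof (intro conjI allI impI X)
    fix e :: real assume "0 < e"
    then obtain K where K: "(1/2)^K < e/4" using real_arch_pow_inv[of "e/4" "1/2"] by auto
    show "\<exists>K. \<forall>i\<ge>K. \<forall>j\<ge>K. nm (X i \<ominus> X j) < e"
    proof (intro exI allI impI)
      fix i j assume "K \<le> i" "K \<le> j"
      then show "nm (X i \<ominus> X j) < e"
        using **[of K i] **[of K j] norm_diff_triangle[OF X X X, of i j K] norm_diff_commute[OF X X, of j K] K
        by simp
    qed
  qed
qed

end

lemma disjointed_Union_le: "A j \<subseteq> (\<Union>i\<le>j. disjointed A i)"
  using finite_UN_disjointed_eq[of A "Suc j"] by (auto simp: atLeast0LessThan lessThan_Suc_atMost)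

lemma disjoint_familyD: "disjoint_family B \<Longrightarrow> x \<in> B i \<Longrightarrow> x \<in> B j \<Longrightarrow> i = j"
  by (auto simp: disjoint_family_on_def)

section \<open>Locality and glueing in complete modules\<close>

locale complete_module = premodule m p "Linf m" N for m :: "'a measure" and p :: real and N :: "('a, 'v) nmodule" +
  assumes complete: "mCauchy N X \<Longrightarrow> \<exists>v\<in>mcarrier N. mconverges N X v"
begin

lemma msum_closed: "(\<And>i. v i \<in> V) \<Longrightarrow> msum N v n \<in> V"
  by (induction n) auto

text \<open>The reverse triangle inequality bounds the difference of |u + v| and |u| by |v|, and
  symmetrically; at each point one of the two bounds is 0.\<close>

lemma pnorm_disjoint_add:
  assumes "u \<in> V" "v \<in> V" "AE x in m. pn u x = 0 \<or> pn v x = 0"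
  shows "AE x in m. pn (u \<oplus> v) x = pn u x + pn v x"
proof -
  have 1: "AE x in m. \<bar>pn (u \<oplus> v) x - pn u x\<bar> \<le> pn v x"
    using pnorm_rev_triangle[of "u \<oplus> v" u] assms
    by (simp add: add_commute[of u v] mdiff_def add_assoc) (simp flip: mdiff_def)
  have 2: "AE x in m. \<bar>pn (u \<oplus> v) x - pn v x\<bar> \<le> pn u x"
    using pnorm_rev_triangle[of "u \<oplus> v" v] assms
    by (simp add: mdiff_def add_assoc) (simp flip: mdiff_def)
  show ?thesis using 1 2 assms(3) by eventually_elim auto
qed

lemma locality:
  fixes A :: "nat \<Rightarrow> 'a set"
  assumes v: "v \<in> V" and A: "\<And>i. A i \<in> sets m" and z: "\<And>i. indicator (A i) \<star> v = \<zero>"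
  shows "indicator (\<Union>i. A i) \<star> v = \<zero>"
proof -
  have "indicator (A i) \<star> v = indicator (A i) \<star> \<zero>" for i using z A by simp
  then have "AE x in m. x \<in> A i \<longrightarrow> pn v x = 0" for i
    using indicator_mult_eq_iff[of v \<zero> "A i"] v A by simp
  then have "AE x in m. \<forall>i. x \<in> A i \<longrightarrow> pn v x = 0" unfolding AE_all_countable by blast
  then have "AE x in m. x \<in> (\<Union>i. A i) \<longrightarrow> pn v x = 0" by eventually_elim auto
  then have "indicator (\<Union>i. A i) \<star> v = indicator (\<Union>i. A i) \<star> \<zero>"
    using indicator_mult_eq_iff[of v \<zero> "\<Union>i. A i"] v A by auto
  then show ?thesis using A by simp
qed

text \<open>For disjoint sets the p-th powers of the norms add up, so the p-th power of the distance
  of two partial sums is a block of the series \<open>a\<close>. The bound \<open>C\<close> makes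
  this series converge, and the partial sums are Cauchy.\<close>

lemma glueing_disjoint:
  fixes W :: "nat \<Rightarrow> 'v"
  assumes W: "\<And>i. W i \<in> V" and B: "\<And>i. B i \<in> sets m" and disj: "disjoint_family B"
    and bd: "\<And>n. nm (msum N (\<lambda>i. indicator (B i) \<star> W i) n) \<le> C"
  obtains v where "v \<in> V" "mconverges N (msum N (\<lambda>i. indicator (B i) \<star> W i)) v"
    "\<And>i. indicator (B i) \<star> v = indicator (B i) \<star> W i"
proof -
  define z where "z i = indicator (B i) \<star> W i" for i
  define s where "s = msum N z"
  have z: "z i \<in> V" for i by (simp add: z_def W B)
  have s: "s n \<in> V" for n unfolding s_def by (rule msum_closed[OF z])
  have zp: "AE x in m. pn (z i) x = indicator (B i) x * pn (W i) x" for i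
    using pnorm_mult[of "indicator (B i)" "W i"] W B by (simp add: z_def)
  have part: "AE x in m. pn (s (k + d) \<ominus> s k) x = (\<Sum>i\<in>{k..<k + d}. pn (z i) x)" for k d
  proof (induction d)
    case 0
    then show ?case using pnorm_zero s by simp
  next
    case (Suc d)
    have eq: "s (k + Suc d) \<ominus> s k = (s (k + d) \<ominus> s k) \<oplus> z (k + d)"
      using s z by (simp add: s_def[symmetric] mdiff_def add_ac) (simp add: s_def add_ac z msum_closed)
    have "AE x in m. pn (s (k + d) \<ominus> s k) x = 0 \<or> pn (z (k + d)) x = 0"
    proof -
      have "AE x in m. \<forall>i. pn (z i) x = indicator (B i) x * pn (W i) x" using zp by (simp add: AE_all_countable)
      then show ?thesis using Suc
      proof eventually_elim
        case (elim x)
        show ?case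
        proof (cases "x \<in> B (k + d)")
          case True
          note x = this
          then have "x \<notin> B i" if "i < k + d" for i
            using disjoint_familyD[OF disj x, of i] that by auto
          then show ?thesis using elim by simp
        qed (use elim in simp)
      qed
    qed
    from pnorm_disjoint_add[OF _ z this] have "AE x in m. pn (s (k + Suc d) \<ominus> s k) x = pn (s (k + d) \<ominus> s k) x + pn (z (k + d)) x"
      unfolding eq using s by simp
    then show ?case using Suc by eventually_elim simp
  qed
  define a where "a i = (LINT x|m. \<bar>pn (z i) x\<bar> powr p)" for i
  have dist: "nm (s (k + d) \<ominus> s k) powr p = (\<Sum>i\<in>{k..<k + d}. a i)" for k d
  proof -
    have "nm (s (k + d) \<ominus> s k) powr p = (LINT x|m. \<bar>pn (s (k + d) \<ominus> s k) x\<bar> powr p)"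
      using s by (simp add: norm_eq_Lp_norm Lp_norm_powr[OF p1])
    also have "\<dots> = (LINT x|m. (\<Sum>i\<in>{k..<k + d}. \<bar>pn (z i) x\<bar> powr p))"
    proof (rule integral_cong_AE)
      have "AE x in m. \<forall>i. pn (z i) x = indicator (B i) x * pn (W i) x" using zp by (simp add: AE_all_countable)
      then show "AE x in m. \<bar>pn (s (k + d) \<ominus> s k) x\<bar> powr p = (\<Sum>i\<in>{k..<k + d}. \<bar>pn (z i) x\<bar> powr p)"
        using part[of k d]
      proof eventually_elim
        case (elim x)
        show ?case
        proof (cases "\<exists>j\<in>{k..<k + d}. x \<in> B j")
          case True
          then obtain j where j: "j \<in> {k..<k + d}" "x \<in> B j" by blast
          then have nB: "x \<notin> B i" if "i \<noteq> j" for i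
            using disjoint_familyD[OF disj j(2), of i] that by auto
          have "(\<Sum>i\<in>{k..<k + d}. pn (z i) x) = (\<Sum>i\<in>{k..<k + d}. if i = j then pn (z j) x else 0)"
            using elim nB by (intro sum.cong) auto
          also have "\<dots> = pn (z j) x" using j by simp
          finally have 1: "(\<Sum>i\<in>{k..<k + d}. pn (z i) x) = pn (z j) x" .
          have "(\<Sum>i\<in>{k..<k + d}. \<bar>pn (z i) x\<bar> powr p) = (\<Sum>i\<in>{k..<k + d}. if i = j then \<bar>pn (z j) x\<bar> powr p else 0)"
            using elim nB by (intro sum.cong) auto
          also have "\<dots> = \<bar>pn (z j) x\<bar> powr p" using j by simp
          finally show ?thesis using 1 elim by simp
        qed (use elim in simp)
      qed
    qed (use s z in auto)
    also have "\<dots> = (\<Sum>i\<in>{k..<k + d}. a i)"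
      unfolding a_def by (rule Bochner_Integration.integral_sum) (use Lp_integrable[OF p1 pnorm_in_Lp[OF z]] in auto)
    finally show ?thesis .
  qed
  have a0: "0 \<le> a i" for i unfolding a_def by (intro Bochner_Integration.integral_nonneg) simp
  have "sum a {..<n} \<le> C powr p" for n
  proof -
    have "s n \<ominus> s 0 = s n" using s by (simp add: s_def)
    then have "sum a {..<n} = nm (s n) powr p"
      using dist[of 0 n] by (simp add: atLeast0LessThan)
    also have "\<dots> \<le> C powr p"
      using bd[of n] p1 norm_nonneg[OF s] by (intro powr_mono2) (auto simp: s_def z_def[abs_def])
    finally show ?thesis .
  qed
  then have "summable a" by (intro bounded_imp_summable[where B = "C powr p"] a0) (metis lessThan_Suc_atMost)
  have "mCauchy N s"
    unfolding mCauchy_def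
  proof (intro conjI allI impI s)
    fix e :: real assume e: "0 < e"
    then obtain K where K: "\<And>i j. K \<le> i \<Longrightarrow> norm (sum a {i..<j}) < e powr p"
      using \<open>summable a\<close> unfolding summable_Cauchy by (metis powr_gt_zero order_less_irrefl)
    have *: "nm (s i \<ominus> s j) < e" if "K \<le> j" "j \<le> i" for i j
    proof -
      have "nm (s i \<ominus> s j) powr p < e powr p"
        using dist[of j "i - j"] K[OF that(1), of i] that by simp
      then show ?thesis
        using e p1 by (meson not_le powr_mono2 less_imp_le order.trans zero_less_one)
    qed
    show "\<exists>K. \<forall>i\<ge>K. \<forall>j\<ge>K. nm (s i \<ominus> s j) < e"
    proof (intro exI allI impI)
      fix i j assume "K \<le> i" "K \<le> j"
      then show "nm (s i \<ominus> s j) < e"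
        using *[of i j] *[of j i] norm_diff_commute[OF s s, of i j] by (cases "i \<le> j") auto
    qed
  qed
  then obtain v where v: "v \<in> V" "mconverges N s v" using complete by blast
  \<comment> \<open>Multiplied by the indicator of \<open>B i\<close>, the partial sums are constant
    from index i + 1 on, and multiplication is continuous.\<close>
  have "indicator (B i) \<star> v = indicator (B i) \<star> W i" for i
  proof -
    have 1: "indicator (B i) \<star> z j = (if j = i then z i else \<zero>)" for j
    proof -
      have "indicator (B i) \<star> z j = (\<lambda>x. indicator (B i) x * indicator (B j) x) \<star> W j"
        by (simp add: z_def mult_mult W B)
      also have "(\<lambda>x. indicator (B i) x * indicator (B j) x :: real) = (if i = j then indicator (B i) else (\<lambda>_. 0))"
        using disj by (auto simp: disjoint_family_on_def indicator_def fun_eq_iff)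
      finally show ?thesis by (auto simp: z_def W)
    qed
    have 2: "indicator (B i) \<star> s n = (if i < n then z i else \<zero>)" for n
    proof (induction n)
      case (Suc n)
      have "indicator (B i) \<star> s (Suc n) = indicator (B i) \<star> s n \<oplus> indicator (B i) \<star> z n"
        using mult_add_right[OF _ s z, of "indicator (B i)" n n] B by (simp add: s_def)
      then show ?case using Suc 1[of n] z by (auto simp: less_Suc_eq)
    qed (simp add: s_def B)
    have "mconverges N (\<lambda>n. indicator (B i) \<star> s n) (indicator (B i) \<star> v)"
      by (rule mconverges_mult) (use s v B in auto)
    then have "(\<lambda>n. nm (indicator (B i) \<star> s n \<ominus> indicator (B i) \<star> v)) \<longlonglongrightarrow> 0"
      by (simp add: mconverges_def)
    moreover have "\<forall>\<^sub>F n in sequentially. nm (indicator (B i) \<star> s n \<ominus> indicator (B i) \<star> v) = nm (z i \<ominus> indicator (B i) \<star> v)"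
      using eventually_gt_at_top[of i] by eventually_elim (simp add: 2)
    ultimately have "(\<lambda>n::nat. nm (z i \<ominus> indicator (B i) \<star> v)) \<longlonglongrightarrow> 0"
      by (rule Lim_transform_eventually)
    then have "nm (z i \<ominus> indicator (B i) \<star> v) = 0" by (simp add: LIMSEQ_const_iff)
    then show ?thesis using z v B by (simp add: norm_eq_zero diff_eq_zero_iff z_def)
  qed
  then show ?thesis using that v by (simp add: s_def z_def[abs_def])
qed

text \<open>The sets may overlap, so the pieces are first cut down to the disjoint sets
  \<open>B\<close>. On \<open>B j\<close> with j < n compatibility makes the n-th overlapping sum a
  multiple of \<open>W j\<close> by a factor at least 1; hence the disjoint sums have smaller
  pointwise norms and inherit both the bound and the lower limit estimate. A point of
  \<open>A j\<close> lies in some \<open>B i\<close>, where the glued element agrees with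
  \<open>W i\<close> and therefore with \<open>W j\<close>.\<close>

lemma glueing:
  fixes W :: "nat \<Rightarrow> 'v" and A :: "nat \<Rightarrow> 'a set"
  assumes W: "\<And>i. W i \<in> V" and A: "\<And>i. A i \<in> sets m"
    and comp: "\<And>i j. indicator (A i \<inter> A j) \<star> W i = indicator (A i \<inter> A j) \<star> W j"
    and bd: "\<And>n. nm (msum N (\<lambda>i. indicator (A i) \<star> W i) n) \<le> C"
  shows "\<exists>v\<in>V. (\<forall>i. indicator (A i) \<star> v = indicator (A i) \<star> W i) \<and>
            ereal (nm v) \<le> liminf (\<lambda>n. ereal (nm (msum N (\<lambda>i. indicator (A i) \<star> W i) n)))"
proof -
  define B where "B = disjointed A"
  have B: "B i \<in> sets m" for i unfolding B_def using sets.range_disjointed_sets[of A m] A by auto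
  have disj: "disjoint_family B" unfolding B_def by (rule disjoint_family_disjointed)
  have BA: "B i \<subseteq> A i" for i unfolding B_def by (rule disjointed_subset)
  let ?t = "msum N (\<lambda>i. indicator (A i) \<star> W i)" and ?s = "msum N (\<lambda>i. indicator (B i) \<star> W i)"
  have t: "?t n \<in> V" and s: "?s n \<in> V" for n by (auto intro!: msum_closed simp: W A B)
  have agree: "AE x in m. x \<in> A i \<inter> A j \<longrightarrow> pn (W i \<ominus> W j) x = 0" for i j
    using comp[of i j] indicator_mult_eq_iff[OF W W, of "A i \<inter> A j" i j] A by auto
  \<comment> \<open>The multiplicity with which the first n sets cover a point.\<close>
  define c where "c n x = (\<Sum>j<n. indicator (A j) x :: real)" for n x
  have c: "c n \<in> Linf m" for n
  proof (induction n)
    case (Suc n)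
    then show ?case using S_add[OF Suc S_indicator[OF A[of n]]] by (simp add: c_def)
  qed (simp add: c_def)
  have tB: "indicator (B i) \<star> ?t n = (\<lambda>x. indicator (B i) x * c n x) \<star> W i" for i n
  proof (induction n)
    case 0
    then show ?case using B W by (simp add: c_def)
  next
    case (Suc n)
    have "indicator (B i) \<star> indicator (A n) \<star> W n = indicator (B i \<inter> A n) \<star> W n"
      using B A W by (simp add: mult_mult indicator_inter_arith[abs_def] fun_eq_iff)
    also have "\<dots> = indicator (B i \<inter> A n) \<star> W i"
      by (subst indicator_mult_eq_iff) (use B A W BA[of i] agree[of n i] in \<open>auto elim!: eventually_mono\<close>)
    also have "\<dots> = (\<lambda>x. indicator (B i) x * indicator (A n) x) \<star> W i"
      by (simp add: indicator_inter_arith[abs_def])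
    finally have "indicator (B i) \<star> indicator (A n) \<star> W n = (\<lambda>x. indicator (B i) x * indicator (A n) x) \<star> W i" .
    then have "indicator (B i) \<star> ?t (Suc n) = (\<lambda>x. indicator (B i) x * c n x) \<star> W i \<oplus> (\<lambda>x. indicator (B i) x * indicator (A n) x) \<star> W i"
      using Suc mult_add_right[OF S_indicator[OF B[of i]] t, of "indicator (A n) \<star> W n" n] A W by simp
    also have "\<dots> = (\<lambda>x. indicator (B i) x * c n x + indicator (B i) x * indicator (A n) x) \<star> W i"
      using mult_add_left[of "\<lambda>x. indicator (B i) x * c n x" "\<lambda>x. indicator (B i) x * indicator (A n) x" "W i"] 
        S_mult[OF S_indicator[OF B[of i]] c] S_mult[OF S_indicator[OF B[of i]] S_indicator[OF A[of n]]] W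
      by simp
    finally show ?case by (simp add: c_def distrib_left)
  qed
  have st: "nm (?s n) \<le> nm (?t n)" for n
  proof (rule norm_mono'[OF s t])
    have sp: "AE x in m. pn (?s n) x = (\<Sum>i<n. indicator (B i) x * pn (W i) x)"
    proof (induction n)
      case 0
      then show ?case using pnorm_zero by simp
    next
      case (Suc n)
      have zp: "AE x in m. pn (indicator (B n) \<star> W n) x = indicator (B n) x * pn (W n) x"
        using pnorm_mult[of "indicator (B n)" "W n"] W B by simp
      have "AE x in m. pn (?s n) x = 0 \<or> pn (indicator (B n) \<star> W n) x = 0"
        using zp Suc
      proof eventually_elim
        case (elim x)
        show ?case
        proof (cases "x \<in> B n")
          case True
          note x = this
          then have "x \<notin> B i" if "i < n" for i
            using disjoint_familyD[OF disj x, of i] that by auto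
          then show ?thesis using elim by simp
        qed (use elim in simp)
      qed
      from pnorm_disjoint_add[OF s _ this] show ?case
        using Suc zp W B by simp (elim AE_mp, auto)
    qed
    have "AE x in m. \<forall>i. pn (indicator (B i) \<star> ?t n) x = \<bar>indicator (B i) x\<bar> * pn (?t n) x"
      unfolding AE_all_countable by (intro allI pnorm_mult) (use B t in auto)
    moreover have "AE x in m. \<forall>i. pn ((\<lambda>x. indicator (B i) x * c n x) \<star> W i) x = \<bar>indicator (B i) x * c n x\<bar> * pn (W i) x"
      unfolding AE_all_countable by (intro allI pnorm_mult S_mult c S_indicator B W)
    moreover have "AE x in m. \<forall>i. 0 \<le> pn (W i) x"
      unfolding AE_all_countable by (intro allI pnorm_nonneg W)
    ultimately show "AE x in m. pn (?s n) x \<le> pn (?t n) x"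
      using sp pnorm_nonneg[OF t[of n]]
    proof eventually_elim
      case (elim x)
      show ?case
      proof (cases "\<exists>j<n. x \<in> B j")
        case True
        then obtain j where j: "j < n" "x \<in> B j" by blast
        then have nB: "x \<notin> B i" if "i \<noteq> j" for i
          using disjoint_familyD[OF disj j(2), of i] that by auto
        have "(\<Sum>i<n. indicator (B i) x * pn (W i) x) = (\<Sum>i<n. if i = j then pn (W j) x else 0)"
          using nB j by (intro sum.cong) auto
        then have 1: "pn (?s n) x = pn (W j) x" using j elim by simp
        have "1 = (\<Sum>i\<in>{j}. indicator (A i) x :: real)" using j BA[of j] by auto
        also have "\<dots> \<le> c n x" unfolding c_def by (rule sum_mono2) (use j in auto)
        finally have cn: "1 \<le> c n x" .
        then have "1 * pn (W j) x \<le> c n x * pn (W j) x" using elim by (intro mult_right_mono) auto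
        also have "\<dots> = pn (?t n) x"
          using elim(1)[THEN spec, of j] elim(2)[THEN spec, of j] j cn by (simp add: tB)
        finally show ?thesis using 1 by simp
      next
        case False
        then have "(\<Sum>i<n. indicator (B i) x * pn (W i) x) = 0" by (intro sum.neutral) auto
        then show ?thesis using elim by simp
      qed
    qed
  qed
  obtain v where v: "v \<in> V" "mconverges N ?s v" "\<And>i. indicator (B i) \<star> v = indicator (B i) \<star> W i"
    by (rule glueing_disjoint[of W B C]) (use W B disj order_trans[OF st bd] in auto)
  have "indicator (A j) \<star> v = indicator (A j) \<star> W j" for j
  proof (subst indicator_mult_eq_iff)
    have "AE x in m. x \<in> B i \<longrightarrow> pn (v \<ominus> W i) x = 0" for i
      using indicator_mult_eq_iff[OF v(1) W B] v(3) by blast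
    then have "AE x in m. \<forall>i. x \<in> B i \<longrightarrow> pn (v \<ominus> W i) x = 0" unfolding AE_all_countable by blast
    moreover have "AE x in m. \<forall>i. x \<in> A i \<inter> A j \<longrightarrow> pn (W i \<ominus> W j) x = 0" unfolding AE_all_countable using agree by blast
    moreover have "AE x in m. \<forall>i. pn (v \<ominus> W j) x \<le> pn (v \<ominus> W i) x + pn (W i \<ominus> W j) x"
      unfolding AE_all_countable by (intro allI pnorm_diff_triangle v W)
    moreover have "AE x in m. 0 \<le> pn (v \<ominus> W j) x" by (intro pnorm_nonneg diff_closed v W)
    ultimately show "AE x in m. x \<in> A j \<longrightarrow> pn (v \<ominus> W j) x = 0"
    proof eventually_elim
      case (elim x)
      show ?case
      proof
        assume x: "x \<in> A j"
        then obtain i where "x \<in> B i" using disjointed_Union_le[of A j] by (auto simp: B_def)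
        then show "pn (v \<ominus> W j) x = 0" using elim x BA by (smt (verit) IntI subsetD)
      qed
    qed
  qed (use v W A in auto)
  moreover have "ereal (nm v) \<le> liminf (\<lambda>n. ereal (nm (?t n)))"
  proof -
    have "(\<lambda>n. ereal (nm (?s n))) \<longlonglongrightarrow> ereal (nm v)"
      using mconverges_norm[OF s v(1,2)] by simp
    then have "ereal (nm v) = liminf (\<lambda>n. ereal (nm (?s n)))" by (intro lim_imp_Liminf[symmetric]) auto
    also have "\<dots> \<le> liminf (\<lambda>n. ereal (nm (?t n)))" by (intro Liminf_mono) (simp add: st)
    finally show ?thesis .
  qed
  ultimately show ?thesis using v by auto
qed

theorem Lp_normed_module: "Lp_normed_module m p N"
proof
  show "u \<oplus> v = v \<oplus> u" if "u \<in> V" "v \<in> V" for u v using that by (rule add_commute)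
  show "mmult N (\<lambda>_. c) v = c \<odot> v" if "v \<in> V" for v c using that by (simp add: scale_eq)
  show "nm v = 0 \<longleftrightarrow> v = \<zero>" if "v \<in> V" for v using that by (rule norm_eq_zero)
  show "nm v = Lp_norm m p (pn v)" if "v \<in> V" for v using that by (rule norm_eq_Lp_norm)
  show "AE x in m. pn (f \<star> v) x = \<bar>f x\<bar> * pn v x" if "f \<in> Linf m" "v \<in> V" for f v
    using that by (rule pnorm_mult)
  show "indicator (\<Union>i. A i) \<star> v = \<zero>"
    if "v \<in> V" "\<And>i::nat. A i \<in> sets m" "\<And>i. indicator (A i) \<star> v = \<zero>" for A v
    using that by (rule locality)
  show "\<exists>v\<in>V. (\<forall>i. indicator (A i) \<star> v = indicator (A i) \<star> W i) \<and>
      ereal (nm v) \<le> liminf (\<lambda>n. ereal (nm (msum N (\<lambda>i. indicator (A i) \<star> W i) n)))"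
    if "\<And>i::nat. W i \<in> V" "\<And>i. A i \<in> sets m"
      "\<And>i j. indicator (A i \<inter> A j) \<star> W i = indicator (A i \<inter> A j) \<star> W j"
      "\<And>n. nm (msum N (\<lambda>i. indicator (A i) \<star> W i) n) \<le> C" for W A C
    using that by (rule glueing)
  show "f \<star> v = g \<star> v" if "f \<in> Linf m" "g \<in> Linf m" "AE x in m. f x = g x" "v \<in> V" for f g v
    using that by (rule mult_cong_AE)
qed (simp_all add: add_assoc scale_add_right scale_add_left scale_scale
    norm_triangle norm_scale complete mult_add_right mult_add_left mult_mult pnorm_in_Lp pnorm_nonneg)

end

section \<open>Submodules and quotients\<close>

text \<open>A short list that already characterises submodules: real scaling is multiplication by
  constants, the algebraic axioms and the pointwise norm restrict, and closedness gives
  completeness, from which locality and glueing follow.\<close>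

definition closed_subspace :: "'a measure \<Rightarrow> ('a, 'v) nmodule \<Rightarrow> 'v set \<Rightarrow> bool" where
  "closed_subspace m N W \<longleftrightarrow> W \<subseteq> mcarrier N \<and> mzero N \<in> W \<and>
     (\<forall>u\<in>W. \<forall>v\<in>W. madd N u v \<in> W) \<and> (\<forall>f\<in>Linf m. \<forall>v\<in>W. mmult N f v \<in> W) \<and>
     (\<forall>X. \<forall>v\<in>mcarrier N. (\<forall>n. X n \<in> W) \<and> mconverges N X v \<longrightarrow> v \<in> W)"

lemma closed_subspaceI:
  assumes "W \<subseteq> mcarrier N" "mzero N \<in> W" "\<And>u v. u \<in> W \<Longrightarrow> v \<in> W \<Longrightarrow> madd N u v \<in> W"
    "\<And>f v. f \<in> Linf m \<Longrightarrow> v \<in> W \<Longrightarrow> mmult N f v \<in> W"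
    "\<And>X v. v \<in> mcarrier N \<Longrightarrow> (\<And>n. X n \<in> W) \<Longrightarrow> mconverges N X v \<Longrightarrow> v \<in> W"
  shows "closed_subspace m N W"
  using assms unfolding closed_subspace_def by blast

lemma closed_subspaceD:
  assumes "closed_subspace m N W"
  shows "v \<in> W \<Longrightarrow> v \<in> mcarrier N" "mzero N \<in> W" "u \<in> W \<Longrightarrow> v \<in> W \<Longrightarrow> madd N u v \<in> W"
    "f \<in> Linf m \<Longrightarrow> v \<in> W \<Longrightarrow> mmult N f v \<in> W"
    "v \<in> mcarrier N \<Longrightarrow> (\<And>n. X n \<in> W) \<Longrightarrow> mconverges N X v \<Longrightarrow> v \<in> W"
  using assms unfolding closed_subspace_def by blast+

lemma nmodule_restrict_simps [simp]:
  "mdiff (N\<lparr>mcarrier := W\<rparr>) = mdiff N"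
  "mconverges (N\<lparr>mcarrier := W\<rparr>) = mconverges N"
  by (simp_all add: mdiff_def mconverges_def fun_eq_iff)

context complete_module
begin

lemma closed_subspace_scale: "closed_subspace m N W \<Longrightarrow> v \<in> W \<Longrightarrow> c \<odot> v \<in> W"
  using closed_subspaceD(1,4)[of m N W] by (simp add: scale_eq)

lemma closed_subspace_carrier: "closed_subspace m N V"
  by (rule closed_subspaceI) auto

lemma closed_subspace_zero: "closed_subspace m N {\<zero>}"
proof (rule closed_subspaceI)
  fix X v assume v: "v \<in> V" and X: "\<And>n::nat. X n \<in> {\<zero>}" and lim: "mconverges N X v"
  have "X = (\<lambda>_. \<zero>)" using X by auto
  then show "v \<in> {\<zero>}" using mconverges_unique[of X v \<zero>] v lim mconverges_const[of \<zero>] by auto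
qed auto

lemma complete_module_restrict:
  assumes W: "closed_subspace m N W"
  shows "complete_module m p (N\<lparr>mcarrier := W\<rparr>)"
proof
  note D = closed_subspaceD[OF W]
  let ?N = "N\<lparr>mcarrier := W\<rparr>"
  show "madd ?N u v = madd ?N v u" if "u \<in> mcarrier ?N" "v \<in> mcarrier ?N" for u v
    using that D(1) by (simp add: add_commute)
  show "v = mzero ?N" if "v \<in> mcarrier ?N" "AE x in m. mpnorm ?N v x = 0" for v
    using that D(1) pnorm_eq_zero[of v] by simp
  show "mmult ?N f v \<in> mcarrier ?N" if "f \<in> Linf m" "v \<in> mcarrier ?N" for f v
    using that D(4) by simp
  show "\<exists>v\<in>mcarrier ?N. mconverges ?N X v" if X: "mCauchy ?N X" for X
  proof -
    have XW: "\<And>n. X n \<in> W" and "mCauchy N X" using X D(1) by (auto simp: mCauchy_def)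
    then obtain v where "v \<in> V" "mconverges N X v" using complete by blast
    then show ?thesis using D(5)[OF _ XW] by auto
  qed
qed (use closed_subspaceD[OF W] in \<open>simp_all add: p1 S_add S_mult add_assoc mult_add_right
    mult_add_left mult_mult mult_one scale_eq pnorm_in_Lp pnorm_nonneg pnorm_triangle pnorm_mult
    norm_eq_Lp_norm\<close>)

lemma submodule_iff: "submodule m p N W \<longleftrightarrow> closed_subspace m N W"
proof
  assume W: "closed_subspace m N W"
  interpret W: complete_module m p "N\<lparr>mcarrier := W\<rparr>" by (rule complete_module_restrict[OF W])
  show "submodule m p N W"
    unfolding submodule_def
  proof (intro conjI allI ballI impI)
    show "Lp_normed_module m p (N\<lparr>mcarrier := W\<rparr>)" by (rule W.Lp_normed_module)
    show "v \<in> W" if "v \<in> V" "(\<forall>n. X n \<in> W) \<and> mconverges N X v" for X v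
      using that closed_subspaceD(5)[OF W that(1)] by blast
  qed (use closed_subspaceD(1-3)[OF W] closed_subspace_scale[OF W] in auto)
next
  assume W: "submodule m p N W"
  then interpret W: Lp_normed_module m p "N\<lparr>mcarrier := W\<rparr>" by (simp add: submodule_def)
  show "closed_subspace m N W"
    unfolding closed_subspace_def
    using W W.mult_closed unfolding submodule_def by (intro conjI ballI allI impI) (simp_all, blast?)
qed

lemma closed_subspace_generated:
  assumes S: "S \<subseteq> V"
  shows "closed_subspace m N (generated_submodule m p N S)"
proof (rule closed_subspaceI)
  have "submodule m p N V" by (simp add: submodule_iff closed_subspace_carrier)
  then show "generated_submodule m p N S \<subseteq> V" using S by (auto simp: generated_submodule_def)
  show "v \<in> generated_submodule m p N S"
    if "v \<in> V" "\<And>n. X n \<in> generated_submodule m p N S" "mconverges N X v" for X v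
    unfolding generated_submodule_def
  proof (rule InterI)
    fix W assume *: "W \<in> {W. submodule m p N W \<and> S \<subseteq> W}"
    then have "closed_subspace m N W" by (simp add: submodule_iff)
    then show "v \<in> W"
      by (rule closed_subspaceD(5)) (use that * in \<open>auto simp: generated_submodule_def\<close>)
  qed
qed (simp_all add: generated_submodule_def submodule_iff, (meson closed_subspaceD(2-4))+)

lemma generated_submodule_superset: "S \<subseteq> generated_submodule m p N S"
  by (auto simp: generated_submodule_def)

lemma generated_submodule_least: "closed_subspace m N W \<Longrightarrow> S \<subseteq> W \<Longrightarrow> generated_submodule m p N S \<subseteq> W"
  by (auto simp: generated_submodule_def submodule_iff)

text \<open>Membership may be tested on countably many pieces. Finite unions are handled
  algebraically; the remainder (1 - indicator) |v| tends to 0 in L^p by dominated convergence with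
  |v| as majorant.\<close>

lemma closed_subspace_partition:
  fixes A :: "nat \<Rightarrow> 'a set"
  assumes W: "closed_subspace m N W" and v: "v \<in> V" and A: "\<And>i. A i \<in> sets m" "(\<Union>i. A i) = space m"
    and AW: "\<And>i. indicator (A i) \<star> v \<in> W"
  shows "v \<in> W"
proof (rule closed_subspaceD(5)[OF W v])
  let ?U = "\<lambda>n. \<Union>i<n. A i"
  have U: "?U n \<in> sets m" for n using A by auto
  show "indicator (?U n) \<star> v \<in> W" for n
  proof (induction n)
    case 0
    then show ?case using closed_subspaceD(2)[OF W] v by (simp add: indicator_def)
  next
    case (Suc n)
    \<comment> \<open>The sets only have to cover the space, so the part of \<open>A n\<close>
      already counted is removed by the factor 1 - indicator.\<close>
    have eq: "(indicator (?U (Suc n)) :: 'a \<Rightarrow> real)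
        = (\<lambda>x. indicator (?U n) x + (1 - indicator (?U n) x) * indicator (A n) x)"
      by (auto simp: indicator_def fun_eq_iff less_Suc_eq split: if_splits)
    have c: "(\<lambda>x. 1 - indicator (?U n) x) \<in> Linf m" using S_diff[OF S_const S_indicator[OF U]] .
    have "indicator (?U (Suc n)) \<star> v = indicator (?U n) \<star> v \<oplus> (\<lambda>x. 1 - indicator (?U n) x) \<star> indicator (A n) \<star> v"
      unfolding eq using mult_add_left[OF S_indicator[OF U] S_mult[OF c S_indicator[OF A(1)]] v] c A v by (simp add: mult_mult)
    then show ?case using Suc AW c closed_subspaceD(3,4)[OF W] by metis
  qed
  have "(\<lambda>n. Lp_norm m p (\<lambda>x. (indicator (?U n) x - 1) * pn v x - 0)) \<longlonglongrightarrow> 0"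
  proof (rule Lp_dominated_convergence(2)[OF p1 _ _ Lp_abs[OF p1 pnorm_in_Lp[OF v]]])
    show "AE x in m. (\<lambda>n. (indicator (?U n) x - 1) * pn v x) \<longlonglongrightarrow> 0"
    proof (rule AE_I2)
      fix x assume "x \<in> space m"
      then obtain i where "x \<in> A i" using A by auto
      then have "(indicator (?U n) x - 1) * pn v x = 0" if "i < n" for n
        using that by (auto simp: indicator_def)
      then have "\<forall>\<^sub>F n in sequentially. (indicator (?U n) x - 1) * pn v x = 0"
        by (rule eventually_mono[OF eventually_gt_at_top[of i]])
      then show "(\<lambda>n. (indicator (?U n) x - 1) * pn v x) \<longlonglongrightarrow> 0"
        by (simp add: tendsto_eventually)
    qed
  qed (use v A in \<open>auto simp: indicator_def\<close>)
  moreover have "nm (indicator (?U n) \<star> v \<ominus> v) = Lp_norm m p (\<lambda>x. (indicator (?U n) x - 1) * pn v x - 0)" for n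
  proof -
    have "AE x in m. pn (indicator (?U n) \<star> v \<ominus> v) x = \<bar>indicator (?U n) x - 1\<bar> * pn v x"
      using pnorm_diff_mult[OF S_indicator[OF U] S_const v, of n 1] v by (simp add: mult_one)
    then have "nm (indicator (?U n) \<star> v \<ominus> v) = Lp_norm m p (\<lambda>x. \<bar>indicator (?U n) x - 1\<bar> * pn v x)"
      using v U by (simp add: norm_eq_Lp_norm) (intro Lp_norm_cong_AE p1, auto)
    also have "\<dots> = Lp_norm m p (\<lambda>x. (indicator (?U n) x - 1) * pn v x - 0)"
      by (simp add: Lp_norm_def abs_mult)
    finally show ?thesis .
  qed
  ultimately show "mconverges N (\<lambda>n. indicator (?U n) \<star> v) v" by (simp add: mconverges_def)
qed

end

section \<open>The quotient by a closed subspace\<close>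

lemma UN_const: "A \<noteq> {} \<Longrightarrow> (\<And>x. x \<in> A \<Longrightarrow> F x = C) \<Longrightarrow> (\<Union>x\<in>A. F x) = C"
  by force

lemma UN_const2: "A \<noteq> {} \<Longrightarrow> B \<noteq> {} \<Longrightarrow> (\<And>x y. x \<in> A \<Longrightarrow> y \<in> B \<Longrightarrow> F x y = C) \<Longrightarrow> (\<Union>x\<in>A. \<Union>y\<in>B. F x y) = C"
  by force

locale module_quotient = complete_module m p N for m :: "'a measure" and p :: real and N :: "('a, 'v) nmodule" +
  fixes W :: "'v set"
  assumes W: "closed_subspace m N W"
begin

abbreviation Q where "Q \<equiv> quotient_module m p N W"
definition coset where "coset v = quotient_rel N W `` {v}"

lemma W_zero: "\<zero> \<in> W"
  and W_add: "\<lbrakk>u \<in> W; v \<in> W\<rbrakk> \<Longrightarrow> u \<oplus> v \<in> W" and W_mult: "\<lbrakk>f \<in> Linf m; v \<in> W\<rbrakk> \<Longrightarrow> f \<star> v \<in> W"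
  and W_closed: "\<lbrakk>v \<in> V; \<And>n. X n \<in> W; mconverges N X v\<rbrakk> \<Longrightarrow> v \<in> W"
  using closed_subspaceD[OF W] by blast+

lemma W_diff_commute: "\<lbrakk>u \<in> V; v \<in> V; u \<ominus> v \<in> W\<rbrakk> \<Longrightarrow> v \<ominus> u \<in> W"
  using closed_subspace_scale[OF W, of "u \<ominus> v" "-1"] by (simp add: minus_diff)

lemma equiv_quotient_rel: "equiv V (quotient_rel N W)"
proof (rule equivI)
  show "quotient_rel N W \<subseteq> V \<times> V" by (auto simp: quotient_rel_def)
  show "refl_on V (quotient_rel N W)" by (auto simp: refl_on_def quotient_rel_def W_zero)
  show "sym (quotient_rel N W)" by (auto simp: sym_def quotient_rel_def W_diff_commute)
  show "trans (quotient_rel N W)"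
    unfolding trans_def quotient_rel_def using W_add by (auto simp: diff_add_diff dest: W_add)
qed

lemma mem_coset_iff: "v \<in> V \<Longrightarrow> u \<in> coset v \<longleftrightarrow> u \<in> V \<and> u \<ominus> v \<in> W"
  by (auto simp: coset_def quotient_rel_def W_diff_commute)

lemma coset_self: "v \<in> V \<Longrightarrow> v \<in> coset v"
  by (simp add: mem_coset_iff W_zero)

lemma coset_nonempty: "v \<in> V \<Longrightarrow> coset v \<noteq> {}"
  using coset_self by blast

lemma coset_eq_iff: "\<lbrakk>u \<in> V; v \<in> V\<rbrakk> \<Longrightarrow> coset u = coset v \<longleftrightarrow> u \<ominus> v \<in> W"
  unfolding coset_def by (subst eq_equiv_class_iff[OF equiv_quotient_rel]) (auto simp: quotient_rel_def)

lemma carrier_Q: "mcarrier Q = coset ` V"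
  by (auto simp: quotient_module_def quotient_def coset_def)

lemma coset_in_Q [simp]: "v \<in> V \<Longrightarrow> coset v \<in> mcarrier Q"
  by (simp add: carrier_Q)

lemma mem_QE: assumes "C \<in> mcarrier Q" obtains v where "v \<in> V" "C = coset v"
  using assms by (auto simp: carrier_Q)

lemma Q_add: assumes "u \<in> V" "v \<in> V" shows "madd Q (coset u) (coset v) = coset (u \<oplus> v)"
proof -
  have "(\<Union>u'\<in>coset u. \<Union>v'\<in>coset v. coset (u' \<oplus> v')) = coset (u \<oplus> v)"
  proof (rule UN_const2)
    fix u' v' assume "u' \<in> coset u" "v' \<in> coset v"
    then show "coset (u' \<oplus> v') = coset (u \<oplus> v)"
      using assms W_add by (simp add: mem_coset_iff coset_eq_iff add_diff_add)
  qed (use assms coset_nonempty in blast)+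
  then show ?thesis by (simp add: quotient_module_def coset_def)
qed

lemma Q_scale: assumes "v \<in> V" shows "mscale Q c (coset v) = coset (c \<odot> v)"
proof -
  have "coset (c \<odot> v') = coset (c \<odot> v)" if "v' \<in> coset v" for v'
    using that assms closed_subspace_scale[OF W] by (simp add: mem_coset_iff coset_eq_iff scale_diff_right[symmetric])
  then have "(\<Union>v'\<in>coset v. coset (c \<odot> v')) = coset (c \<odot> v)"
    by (rule UN_const[OF coset_nonempty[OF assms]])
  then show ?thesis by (simp add: quotient_module_def coset_def)
qed

lemma Q_mult: assumes "v \<in> V" "f \<in> Linf m" shows "mmult Q f (coset v) = coset (f \<star> v)"
proof -
  have "coset (f \<star> v') = coset (f \<star> v)" if "v' \<in> coset v" for v'
    using that assms W_mult by (simp add: mem_coset_iff coset_eq_iff mult_diff_right[symmetric])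
  then have "(\<Union>v'\<in>coset v. coset (f \<star> v')) = coset (f \<star> v)"
    by (rule UN_const[OF coset_nonempty[OF assms(1)]])
  then show ?thesis by (simp add: quotient_module_def coset_def)
qed

lemma Q_zero: "mzero Q = coset \<zero>"
  by (simp add: quotient_module_def coset_def)

lemma Q_diff: "\<lbrakk>u \<in> V; v \<in> V\<rbrakk> \<Longrightarrow> mdiff Q (coset u) (coset v) = coset (u \<ominus> v)"
  by (simp add: mdiff_def Q_scale Q_add)

lemma Q_norm: "mnorm Q (coset v) = (INF u\<in>coset v. nm u)"
  by (simp add: quotient_module_def)

lemma Q_pnorm: "mpnorm Q (coset v) = Lp_ess_inf m p (pn ` coset v)"
  by (simp add: quotient_module_def)

lemma Q_pnorm_spec:
  assumes v: "v \<in> V"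
  shows Q_pnorm_in_Lp: "mpnorm Q (coset v) \<in> Lp m p"
    and Q_pnorm_le: "\<And>u. u \<in> coset v \<Longrightarrow> AE x in m. mpnorm Q (coset v) x \<le> pn u x"
    and Q_pnorm_greatest: "\<And>h. h \<in> Lp m p \<Longrightarrow> (\<And>u. u \<in> coset v \<Longrightarrow> AE x in m. h x \<le> pn u x) \<Longrightarrow>
      AE x in m. h x \<le> mpnorm Q (coset v) x"
proof -
  have 1: "pn ` coset v \<subseteq> Lp m p" and 2: "pn ` coset v \<noteq> {}"
    and 3: "AE x in m. 0 \<le> f x" if "f \<in> pn ` coset v" for f
    using v coset_self[OF v] that pnorm_in_Lp pnorm_nonneg by (auto simp: mem_coset_iff)
  note L = Lp_ess_inf_spec[OF p1 1 2 3]
  have ne: "\<exists>f. f \<in> pn ` coset v" using coset_self[OF v] by blast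
  show "mpnorm Q (coset v) \<in> Lp m p" unfolding Q_pnorm using L(1) ne by blast
  show "AE x in m. mpnorm Q (coset v) x \<le> pn u x" if "u \<in> coset v" for u unfolding Q_pnorm using L(2) that by blast
  show "AE x in m. h x \<le> mpnorm Q (coset v) x"
    if "h \<in> Lp m p" "\<And>u. u \<in> coset v \<Longrightarrow> AE x in m. h x \<le> pn u x" for h
    unfolding Q_pnorm using L(3) ne that by blast
qed

text \<open>Splitting along \<open>{\<bar>u\<bar> \<le> \<bar>u'\<bar>}\<close> shows that the pointwise norms of a coset are closed under minima.\<close>

lemma coset_min:
  assumes v: "v \<in> V" and u: "u \<in> coset v" and u': "u' \<in> coset v"
  obtains w where "w \<in> coset v" "AE x in m. pn w x = min (pn u x) (pn u' x)"
proof -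
  have V: "u \<in> V" "u' \<in> V" using v u u' by (auto simp: mem_coset_iff)
  define A where "A = {x \<in> space m. pn u x \<le> pn u' x}"
  have [measurable]: "pn u \<in> borel_measurable m" "pn u' \<in> borel_measurable m" using V by auto
  have A: "A \<in> sets m" unfolding A_def by measurable
  have c: "(\<lambda>x. 1 - indicator A x) \<in> Linf m" using S_diff[OF S_const S_indicator[OF A]] .
  define w where "w = indicator A \<star> (u \<ominus> u') \<oplus> u'"
  have wV: "w \<in> V" using V A by (simp add: w_def)
  have "u \<ominus> u' \<in> W" using V v u u' W_diff_commute[of u' v] W_add[of "u \<ominus> v" "v \<ominus> u'"]
    by (simp add: mem_coset_iff diff_add_diff)
  then have "indicator A \<star> (u \<ominus> u') \<oplus> (u' \<ominus> v) \<in> W"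
    using W_add W_mult A u' v by (simp add: mem_coset_iff)
  moreover have "w \<ominus> v = indicator A \<star> (u \<ominus> u') \<oplus> (u' \<ominus> v)"
    using add_diff_add[of "indicator A \<star> (u \<ominus> u')" u' \<zero> v] V A v by (simp add: w_def)
  ultimately have wc: "w \<in> coset v" using v wV by (simp add: mem_coset_iff)
  have wu': "w \<ominus> u' = indicator A \<star> (u \<ominus> u')"
    using add_diff_add[of "indicator A \<star> (u \<ominus> u')" u' \<zero> u'] V A by (simp add: w_def)
  have "w \<ominus> u = (w \<ominus> u') \<oplus> (u' \<ominus> u)" using V wV by (simp add: diff_add_diff)
  also have "\<dots> = indicator A \<star> (u \<ominus> u') \<ominus> (u \<ominus> u')"
    using minus_diff[OF V] by (simp only: wu' mdiff_def[of N "indicator A \<star> (u \<ominus> u')" "u \<ominus> u'"])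
  finally have wu: "w \<ominus> u = indicator A \<star> (u \<ominus> u') \<ominus> (u \<ominus> u')" .
  have 1: "AE x in m. pn (w \<ominus> u') x = indicator A x * pn (u \<ominus> u') x"
    unfolding wu' using pnorm_mult[OF S_indicator[OF A], of "u \<ominus> u'"] V by simp
  have 2: "AE x in m. pn (w \<ominus> u) x = \<bar>indicator A x - 1\<bar> * pn (u \<ominus> u') x"
    unfolding wu using pnorm_diff_mult[OF S_indicator[OF A] S_const, of "u \<ominus> u'" 1] V by (simp add: mult_one)
  have "AE x in m. pn w x = min (pn u x) (pn u' x)"
    using 1 2 pnorm_rev_triangle[OF wV V(1)] pnorm_rev_triangle[OF wV V(2)] AE_space
  proof eventually_elim
    case (elim x)
    then show ?case by (cases "pn u x \<le> pn u' x") (auto simp: A_def)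
  qed
  then show ?thesis using that wc by blast
qed

text \<open>By \<open>coset_min\<close> the pointwise norms of a coset are directed downwards, so
  the essential infimum is an L^p limit of norms of actual representatives. Estimates for the
  quotient norm are proved for such sequences and passed to the limit.\<close>

lemma Q_pnorm_sequence:
  assumes v: "v \<in> V"
  obtains h where "\<And>n::nat. h n \<in> coset v" "(\<lambda>n. Lp_norm m p (\<lambda>x. pn (h n) x - mpnorm Q (coset v) x)) \<longlonglongrightarrow> 0"
proof -
  have S: "pn ` coset v \<subseteq> Lp m p" "pn ` coset v \<noteq> {}"
    using v coset_nonempty[OF v] pnorm_in_Lp by (auto simp: mem_coset_iff)
  have nonneg: "AE x in m. 0 \<le> f x" if "f \<in> pn ` coset v" for f
    using v that pnorm_nonneg by (auto simp: mem_coset_iff)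
  have dir: "\<exists>h\<in>pn ` coset v. AE x in m. h x \<le> min (f x) (g x)" if fg: "f \<in> pn ` coset v" "g \<in> pn ` coset v" for f g
  proof -
    obtain u u' where u: "u \<in> coset v" "u' \<in> coset v" "f = pn u" "g = pn u'" using fg by blast
    obtain w where "w \<in> coset v" "AE x in m. pn w x = min (pn u x) (pn u' x)" by (rule coset_min[OF v u(1,2)])
    then have "w \<in> coset v" "AE x in m. pn w x \<le> min (f x) (g x)" by (auto simp: u elim!: eventually_mono)
    then show ?thesis by blast
  qed
  obtain G H where GH: "G \<in> Lp m p" "\<And>n::nat. H n \<in> pn ` coset v" "(\<lambda>n. Lp_norm m p (\<lambda>x. H n x - G x)) \<longlonglongrightarrow> 0"
    "\<And>f. f \<in> pn ` coset v \<Longrightarrow> AE x in m. G x \<le> f x" "AE x in m. 0 \<le> G x"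
    by (rule Lp_directed_inf[OF p1 S]) (erule nonneg, erule (1) dir, rule that)
  have "\<forall>n. \<exists>u. u \<in> coset v \<and> H n = pn u" using GH(2) by blast
  from choice[OF this] obtain h where h: "\<And>n. h n \<in> coset v" "\<And>n. H n = pn (h n)" by blast
  have 1: "AE x in m. G x \<le> mpnorm Q (coset v) x"
    by (rule Q_pnorm_greatest[OF v GH(1)]) (use GH(4) in blast)
  have HL: "H n \<in> Lp m p" for n using GH(2) S by blast
  have le: "AE x in m. mpnorm Q (coset v) x \<le> H n x" for n using Q_pnorm_le[OF v h(1)] h(2) by simp
  have 2: "AE x in m. mpnorm Q (coset v) x \<le> G x"
    by (rule Lp_limit_mono[OF p1 Q_pnorm_in_Lp[OF v] HL Q_pnorm_in_Lp[OF v] GH(1) le Lp_limit_const[OF p1] GH(3)])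
  have "Lp_norm m p (\<lambda>x. pn (h n) x - mpnorm Q (coset v) x) = Lp_norm m p (\<lambda>x. H n x - G x)" for n
    using 1 2 by (intro Lp_norm_cong_AE p1 Lp_measurable[OF p1] Lp_diff pnorm_in_Lp HL GH Q_pnorm_in_Lp v)
      (use h v in \<open>auto simp: mem_coset_iff elim!: AE_mp\<close>)
  then have "(\<lambda>n. Lp_norm m p (\<lambda>x. pn (h n) x - mpnorm Q (coset v) x)) \<longlonglongrightarrow> 0" using GH(3) by simp
  then show ?thesis using that h(1) by blast
qed

lemma Q_pnorm_nonneg: "v \<in> V \<Longrightarrow> AE x in m. 0 \<le> mpnorm Q (coset v) x"
  by (rule Q_pnorm_greatest[OF _ Lp_zero[OF p1]]) (simp_all add: mem_coset_iff pnorm_nonneg)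

lemma Q_pnorm_le_self: "v \<in> V \<Longrightarrow> AE x in m. mpnorm Q (coset v) x \<le> pn v x"
  by (rule Q_pnorm_le[OF _ coset_self])

lemma Q_norm_eq: 
  assumes v: "v \<in> V"
  shows "mnorm Q (coset v) = Lp_norm m p (mpnorm Q (coset v))"
proof (rule antisym)
  have bdd: "bdd_below (nm ` coset v)"
    using v by (intro bdd_belowI[of _ 0]) (auto simp: mem_coset_iff norm_nonneg)
  obtain h where h: "\<And>n::nat. h n \<in> coset v"
      "(\<lambda>n. Lp_norm m p (\<lambda>x. pn (h n) x - mpnorm Q (coset v) x)) \<longlonglongrightarrow> 0"
    by (rule Q_pnorm_sequence[OF v]) (rule that)
  have hV: "h n \<in> V" for n using h(1) v by (simp add: mem_coset_iff)
  have "(\<lambda>n. nm (h n)) \<longlonglongrightarrow> Lp_norm m p (mpnorm Q (coset v))"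
    using Lp_norm_tendsto[OF p1 pnorm_in_Lp[OF hV] Q_pnorm_in_Lp[OF v] h(2)] hV by (simp add: norm_eq_Lp_norm)
  then show "mnorm Q (coset v) \<le> Lp_norm m p (mpnorm Q (coset v))"
    unfolding Q_norm by (rule LIMSEQ_le_const) (use h(1) cINF_lower[OF bdd] in auto)
  show "Lp_norm m p (mpnorm Q (coset v)) \<le> mnorm Q (coset v)"
    unfolding Q_norm
  proof (rule cINF_greatest[OF coset_nonempty[OF v]])
    fix u assume u: "u \<in> coset v"
    then have uV: "u \<in> V" using v by (simp add: mem_coset_iff)
    have "AE x in m. \<bar>mpnorm Q (coset v) x\<bar> \<le> \<bar>pn u x\<bar>"
      using Q_pnorm_le[OF v u] Q_pnorm_nonneg[OF v] by eventually_elim auto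
    then show "Lp_norm m p (mpnorm Q (coset v)) \<le> nm u"
      using Lp_measurable[OF p1 Q_pnorm_in_Lp[OF v]] uV pnorm_in_Lp
      by (simp add: norm_eq_Lp_norm Lp_norm_mono[OF p1])
  qed
qed

lemma Q_norm_le: "u \<in> V \<Longrightarrow> mnorm Q (coset u) \<le> nm u"
  unfolding Q_norm using coset_self
  by (intro cINF_lower bdd_belowI[of _ 0]) (auto simp: mem_coset_iff norm_nonneg)

lemma Q_pnorm_triangle:
  assumes u: "u \<in> V" and v: "v \<in> V"
  shows "AE x in m. mpnorm Q (coset (u \<oplus> v)) x \<le> mpnorm Q (coset u) x + mpnorm Q (coset v) x"
proof -
  obtain h where h: "\<And>n::nat. h n \<in> coset u"
      "(\<lambda>n. Lp_norm m p (\<lambda>x. pn (h n) x - mpnorm Q (coset u) x)) \<longlonglongrightarrow> 0" by (rule Q_pnorm_sequence[OF u]) (rule that)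
  obtain k where k: "\<And>n::nat. k n \<in> coset v"
      "(\<lambda>n. Lp_norm m p (\<lambda>x. pn (k n) x - mpnorm Q (coset v) x)) \<longlonglongrightarrow> 0" by (rule Q_pnorm_sequence[OF v]) (rule that)
  have hV: "h n \<in> V" and kV: "k n \<in> V" for n using h(1) k(1) u v by (simp_all add: mem_coset_iff)
  have hk: "h n \<oplus> k n \<in> coset (u \<oplus> v)" for n
    using h(1)[of n] k(1)[of n] u v by (simp add: mem_coset_iff add_diff_add W_add)
  let ?q = "mpnorm Q (coset (u \<oplus> v))" and ?a = "mpnorm Q (coset u)" and ?b = "mpnorm Q (coset v)"
  have qL: "?q \<in> Lp m p" "?a \<in> Lp m p" "?b \<in> Lp m p" using u v by (auto intro: Q_pnorm_in_Lp)
  have le: "AE x in m. ?q x \<le> pn (h n) x + pn (k n) x" for n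
    using Q_pnorm_le[OF _ hk[of n]] u v pnorm_triangle[OF hV kV, of n n] by simp (elim AE_mp, auto)
  note hL = pnorm_in_Lp[OF hV] and kL = pnorm_in_Lp[OF kV]
  show ?thesis
    by (rule Lp_limit_mono[OF p1 qL(1) Lp_add[OF p1 hL kL] qL(1) Lp_add[OF p1 qL(2,3)] le
          Lp_limit_const[OF p1] Lp_limit_add[OF p1 hL kL qL(2,3) h(2) k(2)]])
qed

text \<open>One inequality multiplies a minimising sequence of the coset of \<open>v\<close> by
  \<open>f\<close>. For the other, a representative of the coset of f v need not be f times a
  representative of \<open>v\<close>; it becomes one after division by \<open>f\<close> where |f| is
  bounded away from 0, and these sets exhaust the set where \<open>f\<close> does not
  vanish.\<close>

lemma Q_pnorm_mult:
  assumes f: "f \<in> Linf m" and v: "v \<in> V"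
  shows "AE x in m. mpnorm Q (coset (f \<star> v)) x = \<bar>f x\<bar> * mpnorm Q (coset v) x"
proof -
  let ?q = "mpnorm Q (coset (f \<star> v))" and ?a = "mpnorm Q (coset v)"
  have fm [measurable]: "f \<in> borel_measurable m" using f by (simp add: Linf_def)
  have qL: "?q \<in> Lp m p" "?a \<in> Lp m p" using f v by (auto intro: Q_pnorm_in_Lp)
  have af: "(\<lambda>x. \<bar>f x\<bar>) \<in> Linf m" using f by (auto simp: Linf_def)
  obtain C where C: "0 \<le> C" "AE x in m. \<bar>f x\<bar> \<le> C" by (rule LinfE[OF p1 f])
  have "AE x in m. ?q x \<le> \<bar>f x\<bar> * ?a x"
  proof -
    obtain h where h: "\<And>n::nat. h n \<in> coset v" "(\<lambda>n. Lp_norm m p (\<lambda>x. pn (h n) x - ?a x)) \<longlonglongrightarrow> 0"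
      by (rule Q_pnorm_sequence[OF v]) (rule that)
    have hV: "h n \<in> V" for n using h(1) v by (simp add: mem_coset_iff)
    have fh: "f \<star> h n \<in> coset (f \<star> v)" for n
      using h(1)[of n] f v by (simp add: mem_coset_iff mult_diff_right[symmetric] W_mult)
    show ?thesis
    proof (rule Lp_limit_mono[OF p1 qL(1) Lp_mult_Linf[OF p1 af pnorm_in_Lp[OF hV]] qL(1) Lp_mult_Linf[OF p1 af qL(2)]])
      show "AE x in m. ?q x \<le> \<bar>f x\<bar> * pn (h n) x" for n
        using Q_pnorm_le[OF _ fh[of n]] f v pnorm_mult[OF f hV[of n]] by simp (elim AE_mp, auto)
      show "(\<lambda>n::nat. Lp_norm m p (\<lambda>x. ?q x - ?q x)) \<longlonglongrightarrow> 0" by (rule Lp_limit_const[OF p1])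
      show "(\<lambda>n. Lp_norm m p (\<lambda>x. \<bar>f x\<bar> * pn (h n) x - \<bar>f x\<bar> * ?a x)) \<longlonglongrightarrow> 0"
      proof (rule Lim_null_comparison)
        show "(\<lambda>n. C * Lp_norm m p (\<lambda>x. pn (h n) x - ?a x)) \<longlonglongrightarrow> 0"
          using tendsto_mult_left[OF h(2), of C] by simp
        have "Lp_norm m p (\<lambda>x. \<bar>f x\<bar> * pn (h n) x - \<bar>f x\<bar> * ?a x) \<le> Lp_norm m p (\<lambda>x. C * (pn (h n) x - ?a x))" for n
        proof (rule Lp_norm_mono[OF p1])
          show "AE x in m. \<bar>\<bar>f x\<bar> * pn (h n) x - \<bar>f x\<bar> * ?a x\<bar> \<le> \<bar>C * (pn (h n) x - ?a x)\<bar>"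
            using C(2) by eventually_elim (use C(1) in \<open>auto simp: abs_mult right_diff_distrib[symmetric] intro!: mult_right_mono\<close>)
        qed (use hV qL Lp_measurable[OF p1 qL(2)] in \<open>auto intro!: Lp_scale Lp_diff pnorm_in_Lp p1\<close>)
        then show "\<forall>\<^sub>F n in sequentially. norm (Lp_norm m p (\<lambda>x. \<bar>f x\<bar> * pn (h n) x - \<bar>f x\<bar> * ?a x))
            \<le> C * Lp_norm m p (\<lambda>x. pn (h n) x - ?a x)"
          using C(1) by (simp add: Lp_norm_nonneg[OF p1] Lp_norm_scale[OF p1])
      qed
    qed
  qed
  moreover have "AE x in m. \<bar>f x\<bar> * ?a x \<le> ?q x"
  proof (rule Q_pnorm_greatest)
    fix u assume u: "u \<in> coset (f \<star> v)"
    then have uV: "u \<in> V" and uW: "u \<ominus> f \<star> v \<in> W" using f v by (simp_all add: mem_coset_iff)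
    have "AE x in m. 1 / Suc n \<le> \<bar>f x\<bar> \<longrightarrow> \<bar>f x\<bar> * ?a x \<le> pn u x" for n
    proof -
      define A where "A = {x \<in> space m. 1 / Suc n \<le> \<bar>f x\<bar>}"
      have A [measurable]: "A \<in> sets m" unfolding A_def by measurable
      define g where "g x = indicator A x / f x" for x
      have "AE x in m. \<bar>g x\<bar> \<le> Suc n"
      proof (rule AE_I2)
        fix x assume "x \<in> space m"
        show "\<bar>g x\<bar> \<le> Suc n"
        proof (cases "x \<in> A")
          case True
          then have "1 / real (Suc n) \<le> \<bar>f x\<bar>" by (simp add: A_def)
          moreover from this have "0 < \<bar>f x\<bar>" by (rule less_le_trans[rotated]) simp
          ultimately have "1 / \<bar>f x\<bar> \<le> Suc n" by (simp add: field_simps)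
          then show ?thesis using True by (simp add: g_def abs_divide)
        qed (simp add: g_def)
      qed
      then have g: "g \<in> Linf m" unfolding Linf_def g_def by auto
      have c: "(\<lambda>x. 1 - indicator A x) \<in> Linf m" using S_diff[OF S_const S_indicator[OF A]] .
      have gf: "(\<lambda>x. g x * f x) = indicator A"
        by (auto simp: g_def A_def indicator_def fun_eq_iff)
      have cA: "(\<lambda>x. 1 - indicator A x) \<star> v = v \<ominus> indicator A \<star> v"
        using mult_diff_left[OF S_const S_indicator[OF A] v, of 1] v by (simp add: mult_one)
      \<comment> \<open>Dividing only on \<open>A\<close> keeps the factor \<open>g\<close> bounded;
        off \<open>A\<close> the element \<open>v\<close> itself is used, and the sum is again a
        representative of \<open>v\<close>.\<close>
      let ?w = "g \<star> u \<oplus> (\<lambda>x. 1 - indicator A x) \<star> v"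
      have wV: "?w \<in> V" using g c uV v by simp
      have "g \<star> (u \<ominus> f \<star> v) \<in> W" using W_mult g uW by blast
      moreover have "g \<star> (u \<ominus> f \<star> v) = g \<star> u \<ominus> indicator A \<star> v"
        using g f v uV by (simp add: mult_diff_right mult_mult gf)
      moreover have "?w \<ominus> v = g \<star> u \<ominus> indicator A \<star> v"
      proof -
        have "v = indicator A \<star> v \<oplus> (v \<ominus> indicator A \<star> v)" using v A by simp
        then have "?w \<ominus> v = (g \<star> u \<oplus> (v \<ominus> indicator A \<star> v)) \<ominus> (indicator A \<star> v \<oplus> (v \<ominus> indicator A \<star> v))"
          by (simp add: cA)
        also have "\<dots> = g \<star> u \<ominus> indicator A \<star> v"
          using g uV v A by (simp del: add_diff_cancel add: add_diff_add)
        finally show ?thesis .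
      qed
      ultimately have "?w \<in> coset v" using v wV by (simp add: mem_coset_iff)
      note le = Q_pnorm_le[OF v this]
      have "AE x in m. pn ?w x \<le> pn (g \<star> u) x + pn ((\<lambda>x. 1 - indicator A x) \<star> v) x"
        by (rule pnorm_triangle) (use g c uV v in auto)
      then show ?thesis
        using le pnorm_mult[OF g uV] pnorm_mult[OF c v] AE_space
      proof eventually_elim
        case (elim x)
        show ?case
        proof
          assume "1 / real (Suc n) \<le> \<bar>f x\<bar>"
          moreover from this have "0 < \<bar>f x\<bar>" by (rule less_le_trans[rotated]) simp
          ultimately have "?a x \<le> \<bar>1 / f x\<bar> * pn u x" "0 < \<bar>f x\<bar>"
            using elim by (auto simp: A_def g_def)
          then show "\<bar>f x\<bar> * ?a x \<le> pn u x" by (simp add: abs_divide field_simps)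
        qed
      qed
    qed
    then have "AE x in m. \<forall>n. 1 / real (Suc n) \<le> \<bar>f x\<bar> \<longrightarrow> \<bar>f x\<bar> * ?a x \<le> pn u x"
      unfolding AE_all_countable by blast
    then show "AE x in m. \<bar>f x\<bar> * ?a x \<le> pn u x"
      using pnorm_nonneg[OF uV]
    proof eventually_elim
      case (elim x)
      show ?case
      proof (cases "f x = 0")
        case False
        then obtain n where "inverse (Suc n) < \<bar>f x\<bar>" using reals_Archimedean[of "\<bar>f x\<bar>"] by auto
        then show ?thesis using elim(1)[THEN spec, of n] by (simp add: inverse_eq_divide)
      qed (use elim in simp)
    qed
  qed (use f v Lp_mult_Linf[OF p1 af qL(2)] in auto)
  ultimately show ?thesis by eventually_elim auto
qed

theorem complete_quotient: "complete_module m p Q"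
proof -
  have pm: "premodule m p (Linf m) Q"
  proof (rule premodule.intro)
    show "1 < p" by (rule p1)
    show "(\<lambda>_. c) \<in> Linf m" for c by simp
    show "indicator A \<in> Linf m" if "A \<in> sets m" for A using that by simp
    show "(\<lambda>x. f x + g x) \<in> Linf m" if "f \<in> Linf m" "g \<in> Linf m" for f g using that by (rule S_add)
    show "(\<lambda>x. f x * g x) \<in> Linf m" if "f \<in> Linf m" "g \<in> Linf m" for f g using that by (rule S_mult)
    show "mzero Q \<in> mcarrier Q" by (simp add: Q_zero)
    show "madd Q C D \<in> mcarrier Q" if "C \<in> mcarrier Q" "D \<in> mcarrier Q" for C D
      using that by (elim mem_QE) (simp add: Q_add)
    show "mmult Q f C \<in> mcarrier Q" if "f \<in> Linf m" "C \<in> mcarrier Q" for f C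
      using that by (elim mem_QE) (simp add: Q_mult)
    show "madd Q (madd Q C D) E = madd Q C (madd Q D E)" if "C \<in> mcarrier Q" "D \<in> mcarrier Q" "E \<in> mcarrier Q" for C D E
      using that by (elim mem_QE) (simp add: Q_add add_assoc)
    show "madd Q C D = madd Q D C" if "C \<in> mcarrier Q" "D \<in> mcarrier Q" for C D
      using that by (elim mem_QE) (simp add: Q_add add_commute)
    show "madd Q C (mzero Q) = C" if "C \<in> mcarrier Q" for C
      using that by (elim mem_QE) (simp add: Q_add Q_zero)
    show "mmult Q f (madd Q C D) = madd Q (mmult Q f C) (mmult Q f D)"
      if "f \<in> Linf m" "C \<in> mcarrier Q" "D \<in> mcarrier Q" for f C D
      using that by (elim mem_QE) (simp add: Q_add Q_mult mult_add_right)
    show "mmult Q (\<lambda>x. f x + g x) C = madd Q (mmult Q f C) (mmult Q g C)"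
      if "f \<in> Linf m" "g \<in> Linf m" "C \<in> mcarrier Q" for f g C
      using that by (elim mem_QE) (simp add: Q_add Q_mult mult_add_left S_add)
    show "mmult Q f (mmult Q g C) = mmult Q (\<lambda>x. f x * g x) C"
      if "f \<in> Linf m" "g \<in> Linf m" "C \<in> mcarrier Q" for f g C
      using that by (elim mem_QE) (simp add: Q_mult mult_mult S_mult)
    show "mmult Q (\<lambda>_. 1) C = C" if "C \<in> mcarrier Q" for C
      using that by (elim mem_QE) (simp add: Q_mult mult_one)
    show "mscale Q c C = mmult Q (\<lambda>_. c) C" if "C \<in> mcarrier Q" for c C
      using that by (elim mem_QE) (simp add: Q_mult Q_scale scale_eq)
    show "mpnorm Q C \<in> Lp m p" if "C \<in> mcarrier Q" for C
      using that by (elim mem_QE) (simp add: Q_pnorm_in_Lp)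
    show "AE x in m. 0 \<le> mpnorm Q C x" if "C \<in> mcarrier Q" for C
      using that by (elim mem_QE) (simp add: Q_pnorm_nonneg)
    show "AE x in m. mpnorm Q (madd Q C D) x \<le> mpnorm Q C x + mpnorm Q D x"
      if "C \<in> mcarrier Q" "D \<in> mcarrier Q" for C D
      using that by (elim mem_QE) (simp add: Q_add Q_pnorm_triangle)
    show "AE x in m. mpnorm Q (mmult Q f C) x = \<bar>f x\<bar> * mpnorm Q C x" if "f \<in> Linf m" "C \<in> mcarrier Q" for f C
      using that by (elim mem_QE) (simp add: Q_mult Q_pnorm_mult)
    show "mnorm Q C = Lp_norm m p (mpnorm Q C)" if "C \<in> mcarrier Q" for C
      using that by (elim mem_QE) (simp add: Q_norm_eq)
    show "C = mzero Q" if C: "C \<in> mcarrier Q" "AE x in m. mpnorm Q C x = 0" for C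
    proof -
      obtain v where v: "v \<in> V" "C = coset v" using C(1) by (rule mem_QE)
      obtain h where h: "\<And>n::nat. h n \<in> coset v" "(\<lambda>n. Lp_norm m p (\<lambda>x. pn (h n) x - mpnorm Q (coset v) x)) \<longlonglongrightarrow> 0"
        by (rule Q_pnorm_sequence[OF v(1)]) (rule that)
      have hV: "h n \<in> V" for n using h(1) v by (simp add: mem_coset_iff)
      have "Lp_norm m p (\<lambda>x. pn (h n) x - mpnorm Q (coset v) x) = nm (h n)" for n
        unfolding norm_eq_Lp_norm[OF hV] using C(2) v hV
        by (intro Lp_norm_cong_AE p1 borel_measurable_diff Lp_measurable[OF p1] pnorm_in_Lp Q_pnorm_in_Lp)
          (auto elim: eventually_mono)
      then have h0: "(\<lambda>n. nm (h n)) \<longlonglongrightarrow> 0" using h(2) by simp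
      \<comment> \<open>A vanishing quotient norm means that representatives \<open>h n\<close> of
        the coset tend to 0, so the elements v - h n of \<open>W\<close> tend to \<open>v\<close>,
        and \<open>W\<close> is closed.\<close>
      have "v \<in> W"
      proof (rule W_closed[OF v(1)])
        show vh: "v \<ominus> h n \<in> W" for n
          using W_diff_commute[OF hV v(1)] h(1) v(1) by (simp add: mem_coset_iff)
        have "nm ((v \<ominus> h n) \<ominus> v) = nm (h n)" for n
        proof -
          have "(v \<ominus> h n) \<ominus> v = (v \<oplus> (-1) \<odot> h n) \<ominus> (v \<oplus> \<zero>)" using v by (simp add: mdiff_def)
          also have "\<dots> = (-1) \<odot> h n" using v hV by (subst add_diff_add) auto
          finally show ?thesis using hV norm_scale[of "h n" "-1"] by simp
        qed
        then show "mconverges N (\<lambda>n. v \<ominus> h n) v" using h0 by (simp add: mconverges_def)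
      qed
      then show ?thesis using v by (simp add: Q_zero coset_eq_iff)
    qed
  qed simp
  interpret Q: premodule m p "Linf m" Q by (rule pm)
  show ?thesis
  proof (intro complete_module.intro pm complete_module_axioms.intro, rule Q.completeI_rapid)
    fix X assume X: "\<And>n::nat. X n \<in> mcarrier Q" and r: "\<And>n. mnorm Q (mdiff Q (X (Suc n)) (X n)) < (1/2)^n"
    \<comment> \<open>Lifting a rapid sequence: the quotient norm of a step is an infimum, so the
      step has a representative \<open>w\<close> of norm below 2^-n, and adding it to the previous
      lift keeps the lifted sequence rapid.\<close>
    have "\<exists>v. \<forall>n. (v n \<in> V \<and> X n = coset (v n)) \<and> nm (v (Suc n) \<ominus> v n) < (1/2)^n"
    proof (rule dependent_nat_choice)
      show "\<exists>v. v \<in> V \<and> X 0 = coset v" using X[of 0] by (auto elim: mem_QE)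
      fix v n assume v: "v \<in> V \<and> X n = coset v"
      obtain u where u: "u \<in> V" "X (Suc n) = coset u" using X by (rule mem_QE)
      have "(INF w\<in>coset (u \<ominus> v). nm w) < (1/2)^n" using r[of n] u v by (simp add: Q_diff Q_norm)
      then obtain w where w: "w \<in> coset (u \<ominus> v)" "nm w < (1/2)^n"
        using cInf_lessD[of "nm ` coset (u \<ominus> v)" "(1/2)^n"] coset_nonempty[of "u \<ominus> v"] u v by auto
      have wV: "w \<in> V" using w u v by (simp add: mem_coset_iff)
      show "\<exists>y. (y \<in> V \<and> X (Suc n) = coset y) \<and> nm (y \<ominus> v) < (1/2)^n"
      proof (intro exI conjI)
        show "w \<oplus> v \<in> V" using wV v by simp
        have "(w \<oplus> v) \<ominus> u = (w \<oplus> v) \<ominus> ((u \<ominus> v) \<oplus> v)" using u v by simp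
        also have "\<dots> = w \<ominus> (u \<ominus> v)" using u v wV by (subst add_diff_add) auto
        finally show "X (Suc n) = coset (w \<oplus> v)"
          using w u v wV W_diff_commute[of "w \<oplus> v" u] by (simp add: mem_coset_iff coset_eq_iff)
        have "(w \<oplus> v) \<ominus> v = (w \<oplus> v) \<ominus> (\<zero> \<oplus> v)" using v by simp
        also have "\<dots> = w" using v wV by (subst add_diff_add) auto
        finally show "nm ((w \<oplus> v) \<ominus> v) < (1/2)^n" using w by simp
      qed
    qed
    then obtain v where v: "\<And>n. v n \<in> V" "\<And>n. X n = coset (v n)" "\<And>n. nm (v (Suc n) \<ominus> v n) < (1/2)^n" by blast
    have "mCauchy N v" by (rule rapid_Cauchy) (use v in \<open>auto intro: less_imp_le\<close>)
    then obtain z where z: "z \<in> V" "mconverges N v z" using complete by blast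
    have "(\<lambda>n. mnorm Q (mdiff Q (X n) (coset z))) \<longlonglongrightarrow> 0"
      by (rule Lim_null_comparison[OF _ z(2)[unfolded mconverges_def]])
        (use v z Q_norm_le Q.norm_nonneg in \<open>auto simp: Q_diff\<close>)
    then show "\<exists>C\<in>mcarrier Q. mconverges Q X C" using z by (auto simp: mconverges_def)
  qed
qed

end

section \<open>The pre-module of partition families\<close>

text \<open>A family is treated as the map sending a point to the function prescribed there. All operations are
  pointwise in this map.\<close>

definition family_at :: "'a family \<Rightarrow> 'a \<Rightarrow> 'a \<Rightarrow> real" where
  "family_at F x = fst (F (THE i. x \<in> snd (F i)))"

lemma Pfm_pnorm_eq: "Pfm_pnorm g F x = g (family_at F x) x"
  by (simp add: Pfm_pnorm_def family_at_def)

lemma family_at_eq: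
  assumes "borel_partition m (\<lambda>i. snd (F i))" "x \<in> snd (F i)"
  shows "family_at F x = fst (F i)"
proof -
  have "(THE i. x \<in> snd (F i)) = i"
    using assms disjoint_familyD[of "\<lambda>i. snd (F i)" x] unfolding borel_partition_def by (intro the_equality) blast+
  then show ?thesis by (simp add: family_at_def)
qed

lemma borel_partitionE:
  assumes "borel_partition m A" "x \<in> space m" obtains i where "x \<in> A i"
  using assms unfolding borel_partition_def by blast

lemma borel_partition_Int:
  assumes A: "borel_partition m A" and B: "borel_partition m B"
  shows "borel_partition m (\<lambda>k. case prod_decode k of (i, j) \<Rightarrow> A i \<inter> B j)"
  unfolding borel_partition_def
proof (intro conjI allI)
  show "(case prod_decode k of (i, j) \<Rightarrow> A i \<inter> B j) \<in> sets m" for k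
    using A B by (auto simp: borel_partition_def split: prod.split)
  show "disjoint_family (\<lambda>k. case prod_decode k of (i, j) \<Rightarrow> A i \<inter> B j)"
    unfolding disjoint_family_on_def
  proof (intro ballI impI)
    fix k l :: nat assume "k \<noteq> l"
    obtain i j i' j' where kl: "prod_decode k = (i, j)" "prod_decode l = (i', j')" by fastforce
    then have "i \<noteq> i' \<or> j \<noteq> j'" using \<open>k \<noteq> l\<close> by (metis prod_decode_inverse)
    then show "(case prod_decode k of (i, j) \<Rightarrow> A i \<inter> B j) \<inter> (case prod_decode l of (i, j) \<Rightarrow> A i \<inter> B j) = {}"
      using A B kl disjoint_familyD[of A] disjoint_familyD[of B] by (fastforce simp: borel_partition_def)
  qed
  show "(\<Union>k. case prod_decode k of (i, j) \<Rightarrow> A i \<inter> B j) = space m"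
  proof (intro set_eqI iffI)
    fix x assume "x \<in> (\<Union>k. case prod_decode k of (i, j) \<Rightarrow> A i \<inter> B j)"
    then show "x \<in> space m" using A by (auto simp: borel_partition_def split_def)
  next
    fix x assume x: "x \<in> space m"
    obtain i where i: "x \<in> A i" by (rule borel_partitionE[OF A x])
    obtain j where "x \<in> B j" by (rule borel_partitionE[OF B x])
    then have "x \<in> (case prod_decode (prod_encode (i, j)) of (i, j) \<Rightarrow> A i \<inter> B j)" using i by simp
    then show "x \<in> (\<Union>k. case prod_decode k of (i, j) \<Rightarrow> A i \<inter> B j)" by (rule UN_I[OF UNIV_I])
  qed
qed

lemma family_at_add:
  assumes F: "borel_partition m (\<lambda>i. snd (F i))" and H: "borel_partition m (\<lambda>i. snd (H i))" and x: "x \<in> space m"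
  shows "family_at (Pfm_add F H) x = (\<lambda>y. family_at F x y + family_at H x y)"
proof -
  obtain i where i: "x \<in> snd (F i)" by (rule borel_partitionE[OF F x])
  obtain j where j: "x \<in> snd (H j)" by (rule borel_partitionE[OF H x])
  have "borel_partition m (\<lambda>k. snd (Pfm_add F H k))"
    using borel_partition_Int[OF F H] by (simp add: Pfm_add_def split_def)
  from family_at_eq[OF this, of x "prod_encode (i, j)"] show ?thesis
    using i j family_at_eq[OF F i] family_at_eq[OF H j] by (simp add: Pfm_add_def)
qed

lemma family_at_scale:
  assumes F: "borel_partition m (\<lambda>i. snd (F i))" and x: "x \<in> space m"
  shows "family_at (Pfm_scale c F) x = (\<lambda>y. c * family_at F x y)"
proof -
  obtain i where i: "x \<in> snd (F i)" by (rule borel_partitionE[OF F x])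
  have "borel_partition m (\<lambda>k. snd (Pfm_scale c F k))" using F by (simp add: Pfm_scale_def)
  from family_at_eq[OF this, of x i] show ?thesis
    using i family_at_eq[OF F i] by (simp add: Pfm_scale_def)
qed

lemma family_at_mult:
  assumes F: "borel_partition m (\<lambda>i. snd (F i))" and s: "(a, B) \<in> simple_reps m s" and x: "x \<in> space m"
  shows "family_at (Pfm_mult a B F) x = (\<lambda>y. s x * family_at F x y)"
proof -
  have B: "borel_partition m B" using s by (simp add: simple_reps_def)
  obtain i where i: "x \<in> snd (F i)" by (rule borel_partitionE[OF F x])
  obtain j where j: "x \<in> B j" by (rule borel_partitionE[OF B x])
  have "borel_partition m (\<lambda>k. snd (Pfm_mult a B F k))"
    using borel_partition_Int[OF F B] by (simp add: Pfm_mult_def split_def)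
  from family_at_eq[OF this, of x "prod_encode (i, j)"] show ?thesis
    using i j s family_at_eq[OF F i] by (simp add: Pfm_mult_def simple_reps_def)
qed

lemma borel_partition_single: "borel_partition m (\<lambda>i. snd (single_family m f i))"
  by (auto simp: borel_partition_def single_family_def disjoint_family_on_def)

lemma family_at_single: "x \<in> space m \<Longrightarrow> family_at (single_family m f) x = f"
  using family_at_eq[OF borel_partition_single, of x m f 0] by (simp add: single_family_def)

lemma simple_reps_nonempty:
  assumes s: "simple_function m s"
  shows "simple_reps m s \<noteq> {}"
proof -
  have fin: "finite (s ` space m)" using s by (simp add: simple_function_def)
  obtain h where h: "bij_betw h {0..<card (s ` space m)} (s ` space m)"
    using ex_bij_betw_nat_finite[OF fin] by blast
  define n where "n = card (s ` space m)"
  \<comment> \<open>The level sets of the finitely many values, padded with empty sets because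
    partitions are indexed by all natural numbers.\<close>
  define B where "B j = (if j < n then s -` {h j} \<inter> space m else {})" for j
  have inj: "inj_on h {0..<n}" and im: "h ` {0..<n} = s ` space m" using h by (auto simp: bij_betw_def n_def)
  have "borel_partition m B"
    unfolding borel_partition_def
  proof (intro conjI allI)
    show "B j \<in> sets m" for j
    proof (cases "j < n")
      case True
      then have "h j \<in> s ` space m" unfolding im[symmetric] by simp
      then obtain x where "x \<in> space m" "h j = s x" by blast
      then show ?thesis using s True by (simp add: B_def simple_function_def)
    qed (simp add: B_def)
    show "disjoint_family B"
      using inj by (auto simp: disjoint_family_on_def B_def inj_on_def)
    show "(\<Union>j. B j) = space m"
    proof safe
      fix x assume x: "x \<in> space m"
      then have "s x \<in> h ` {0..<n}" unfolding im by blast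
      then obtain j where "j < n" "s x = h j" by auto
      then show "x \<in> (\<Union>j. B j)" using x by (auto simp: B_def intro!: exI[of _ j])
    qed (auto simp: B_def split: if_splits)
  qed
  then have "(h, B) \<in> simple_reps m s" by (auto simp: simple_reps_def B_def split: if_splits)
  then show ?thesis by blast
qed

lemma simple_function_Linf:
  fixes s :: "'a \<Rightarrow> real"
  assumes s: "simple_function m s"
  shows "s \<in> Linf m"
proof -
  have "finite (s ` space m)" using s by (simp add: simple_function_def)
  then have "finite (abs ` s ` space m)" by simp
  then obtain C where "\<And>y. y \<in> abs ` s ` space m \<Longrightarrow> y \<le> C" using bdd_above_finite unfolding bdd_above_def by meson
  then have "AE x in m. \<bar>s x\<bar> \<le> C" by (intro AE_I2) auto
  then show ?thesis using borel_measurable_simple_function[OF s] by (auto simp: Linf_def)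
qed

text \<open>Shared by \<open>lip\<close> on the Lipschitz domain and by the relaxed slope on its
  domain, so that the generated module and its universal property are established once.\<close>

locale subadditive_functional =
  fixes m :: "'a measure" and p :: real and D :: "('a \<Rightarrow> real) set" and g :: "('a \<Rightarrow> real) \<Rightarrow> 'a \<Rightarrow> real"
  assumes p1: "1 < p"
    and D_zero: "(\<lambda>x. 0) \<in> D"
    and D_add: "\<lbrakk>f \<in> D; h \<in> D\<rbrakk> \<Longrightarrow> (\<lambda>x. f x + h x) \<in> D"
    and D_scale: "f \<in> D \<Longrightarrow> (\<lambda>x. c * f x) \<in> D"
    and g_in_Lp: "f \<in> D \<Longrightarrow> g f \<in> Lp m p"
    and g_nonneg: "f \<in> D \<Longrightarrow> AE x in m. 0 \<le> g f x"
    and g_add: "\<lbrakk>f \<in> D; h \<in> D\<rbrakk> \<Longrightarrow> AE x in m. g (\<lambda>y. f y + h y) x \<le> g f x + g h x"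
    and g_scale: "f \<in> D \<Longrightarrow> AE x in m. g (\<lambda>y. c * f y) x = \<bar>c\<bar> * g f x"
begin

abbreviation P where "P \<equiv> Pfm m p D g"
abbreviation M where "M \<equiv> Pfm_quotient m p D g"
definition cls where "cls F = Pfm_rel m p D g `` {F}"

lemma D_diff: "\<lbrakk>f \<in> D; h \<in> D\<rbrakk> \<Longrightarrow> (\<lambda>x. f x - h x) \<in> D"
  using D_add[OF _ D_scale, of f h "-1"] by simp

lemma g_zero: "AE x in m. g (\<lambda>y. 0) x = 0"
  using g_scale[OF D_zero, of 0] by simp

lemma g_diff_commute: "\<lbrakk>f \<in> D; h \<in> D\<rbrakk> \<Longrightarrow> AE x in m. g (\<lambda>y. f y - h y) x = g (\<lambda>y. h y - f y) x"
  using g_scale[OF D_diff, of h f "-1"] by simp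

lemma g_diff_triangle:
  "\<lbrakk>f \<in> D; h \<in> D; k \<in> D\<rbrakk> \<Longrightarrow> AE x in m. g (\<lambda>y. f y - k y) x \<le> g (\<lambda>y. f y - h y) x + g (\<lambda>y. h y - k y) x"
  using g_add[OF D_diff D_diff, of f h h k] by simp

lemma g_rev_triangle:
  assumes "f \<in> D" "h \<in> D"
  shows "AE x in m. \<bar>g f x - g h x\<bar> \<le> g (\<lambda>y. f y - h y) x"
  using g_diff_triangle[OF assms D_zero] g_diff_triangle[OF assms(2,1) D_zero] g_diff_commute[OF assms]
  by eventually_elim auto

lemma P_partition: "F \<in> P \<Longrightarrow> borel_partition m (\<lambda>i. snd (F i))"
  and P_mem: "F \<in> P \<Longrightarrow> fst (F i) \<in> D"
  by (auto simp: Pfm_def)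

text \<open>The exceptional null set in the hypothesis depends on the functions, while the functions
  in the conclusion vary with the point. Only countably many triples occur, so one null set
  suffices.\<close>

lemma AE_family:
  assumes "F \<in> P" "H \<in> P" "K \<in> P"
    and "\<And>f h k. \<lbrakk>f \<in> D; h \<in> D; k \<in> D\<rbrakk> \<Longrightarrow> AE x in m. R f h k x"
  shows "AE x in m. R (family_at F x) (family_at H x) (family_at K x) x"
proof -
  have "AE x in m. \<forall>i j k. R (fst (F i)) (fst (H j)) (fst (K k)) x"
    unfolding AE_all_countable using assms by (blast intro: P_mem)
  then show ?thesis by eventually_elim (simp add: family_at_def)
qed

lemma family_measurable:
  assumes part: "borel_partition m (\<lambda>i. snd (F i))" and D: "\<And>i. fst (F i) \<in> D"
  shows "(\<lambda>x. g (family_at F x) x) \<in> borel_measurable m"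
proof (rule measurable_piecewise_restrict2)
  show "snd (F i) \<in> sets m" for i using part by (simp add: borel_partition_def)
  show "space m = (\<Union>i. snd (F i))" using part by (simp add: borel_partition_def)
  show "\<exists>h\<in>borel_measurable m. \<forall>x\<in>snd (F i). g (family_at F x) x = h x" for i
    using family_at_eq[OF part] g_in_Lp[OF D[of i]] by (intro bexI[of _ "g (fst (F i))"]) (auto simp: Lp_def)
qed

text \<open>The series over the pieces is one integral over the disjoint union, so summability says
  that the pointwise slope of the family lies in L^p.\<close>

lemma P_iff:
  "F \<in> P \<longleftrightarrow> borel_partition m (\<lambda>i. snd (F i)) \<and> (\<forall>i. fst (F i) \<in> D) \<and> (\<lambda>x. g (family_at F x) x) \<in> Lp m p"
proof -
  have "(\<Sum>i. \<integral>\<^sup>+x\<in>snd (F i). ennreal (\<bar>g (fst (F i)) x\<bar> powr p) \<partial>m) < \<infinity> \<longleftrightarrow> (\<lambda>x. g (family_at F x) x) \<in> Lp m p"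
    if part: "borel_partition m (\<lambda>i. snd (F i))" and D: "\<And>i. fst (F i) \<in> D"
  proof -
    have [measurable]: "(\<lambda>x. g (family_at F x) x) \<in> borel_measurable m" by (rule family_measurable[OF that])
    have A: "snd (F i) \<in> sets m" for i using part by (simp add: borel_partition_def)
    have "(\<Sum>i. \<integral>\<^sup>+x\<in>snd (F i). ennreal (\<bar>g (fst (F i)) x\<bar> powr p) \<partial>m)
        = (\<Sum>i. \<integral>\<^sup>+x\<in>snd (F i). ennreal (\<bar>g (family_at F x) x\<bar> powr p) \<partial>m)"
      using family_at_eq[OF part]
      by (intro suminf_cong nn_integral_cong) (auto simp: indicator_def)
    also have "\<dots> = (\<integral>\<^sup>+x\<in>(\<Union>i. snd (F i)). ennreal (\<bar>g (family_at F x) x\<bar> powr p) \<partial>m)"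
      using part by (intro nn_integral_disjoint_family[symmetric] A) (auto simp: borel_partition_def)
    also have "(\<Union>i. snd (F i)) = space m" using part by (simp add: borel_partition_def)
    also have "(\<integral>\<^sup>+x\<in>space m. ennreal (\<bar>g (family_at F x) x\<bar> powr p) \<partial>m) = (\<integral>\<^sup>+x. ennreal (\<bar>g (family_at F x) x\<bar> powr p) \<partial>m)"
      by (intro nn_integral_cong) simp
    finally show ?thesis by (simp add: Lp_def integrable_iff_bounded)
  qed
  then show ?thesis by (auto simp: Pfm_def)
qed

lemma P_memI:
  assumes part: "borel_partition m (\<lambda>i. snd (F i))" and D: "\<And>i. fst (F i) \<in> D"
    and w: "w \<in> Lp m p" and le: "AE x in m. g (family_at F x) x \<le> w x"
  shows "F \<in> P"
  unfolding P_iff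
proof (intro conjI allI part D Lp_bound[OF p1 w] family_measurable)
  have "AE x in m. \<forall>i. 0 \<le> g (fst (F i)) x" unfolding AE_all_countable using g_nonneg[OF D] by blast
  then show "AE x in m. \<bar>g (family_at F x) x\<bar> \<le> \<bar>w x\<bar>"
    using le by eventually_elim (auto simp: family_at_def)
qed

lemma P_in_Lp: "F \<in> P \<Longrightarrow> (\<lambda>x. g (family_at F x) x) \<in> Lp m p"
  by (simp add: P_iff)

lemma P_add: 
  assumes F: "F \<in> P" and H: "H \<in> P" shows "Pfm_add F H \<in> P"
proof (rule P_memI)
  show "borel_partition m (\<lambda>i. snd (Pfm_add F H i))"
    using borel_partition_Int[OF P_partition[OF F] P_partition[OF H]] by (simp add: Pfm_add_def split_def)
  show "fst (Pfm_add F H i) \<in> D" for i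
    using P_mem[OF F] P_mem[OF H] by (auto simp: Pfm_add_def split_def intro: D_add)
  show "(\<lambda>x. g (family_at F x) x + g (family_at H x) x) \<in> Lp m p"
    by (intro Lp_add p1 P_in_Lp F H)
  have "AE x in m. g (\<lambda>y. family_at F x y + family_at H x y) x \<le> g (family_at F x) x + g (family_at H x) x"
    by (rule AE_family[OF F H F]) (rule g_add)
  then show "AE x in m. g (family_at (Pfm_add F H) x) x \<le> g (family_at F x) x + g (family_at H x) x"
    using AE_space by eventually_elim (simp add: family_at_add[OF P_partition[OF F] P_partition[OF H]])
qed

lemma P_scale:
  assumes F: "F \<in> P" shows "Pfm_scale c F \<in> P"
proof (rule P_memI)
  show "borel_partition m (\<lambda>i. snd (Pfm_scale c F i))"
    using P_partition[OF F] by (simp add: Pfm_scale_def)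
  show "fst (Pfm_scale c F i) \<in> D" for i
    using P_mem[OF F] by (auto simp: Pfm_scale_def intro: D_scale)
  show "(\<lambda>x. \<bar>c\<bar> * g (family_at F x) x) \<in> Lp m p"
    by (intro Lp_scale p1 P_in_Lp F)
  have "AE x in m. g (\<lambda>y. c * family_at F x y) x = \<bar>c\<bar> * g (family_at F x) x"
    by (rule AE_family[OF F F F]) (rule g_scale)
  then show "AE x in m. g (family_at (Pfm_scale c F) x) x \<le> \<bar>c\<bar> * g (family_at F x) x"
    using AE_space by eventually_elim (simp add: family_at_scale[OF P_partition[OF F]])
qed

text \<open>The same device for a coefficient that varies with the point: a simple function takes
  finitely many values.\<close>

lemma AE_family_simple:
  assumes s: "simple_function m s" and F: "F \<in> P" and H: "H \<in> P"
    and R: "\<And>c f h. \<lbrakk>f \<in> D; h \<in> D\<rbrakk> \<Longrightarrow> AE x in m. R (c::real) f h x"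
  shows "AE x in m. R (s x) (family_at F x) (family_at H x) x"
proof -
  have "countable (s ` space m)" using s by (auto simp: simple_function_def intro: countable_finite)
  then have "AE x in m. \<forall>c\<in>s ` space m. R c (family_at F x) (family_at H x) x"
    by (subst AE_ball_countable) (use AE_family[OF F H F R] in auto)
  then show ?thesis using AE_space by eventually_elim auto
qed

lemma AE_g_simple:
  assumes s: "simple_function m s" and F: "F \<in> P"
  shows "AE x in m. g (\<lambda>y. s x * family_at F x y) x = \<bar>s x\<bar> * g (family_at F x) x"
  by (rule AE_family_simple[OF s F F]) (rule g_scale)

lemma P_mult:
  assumes F: "F \<in> P" and s: "simple_function m s" and aB: "(a, B) \<in> simple_reps m s" shows "Pfm_mult a B F \<in> P"
proof (rule P_memI)
  have B: "borel_partition m B" using aB by (simp add: simple_reps_def)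
  show "borel_partition m (\<lambda>i. snd (Pfm_mult a B F i))"
    using borel_partition_Int[OF P_partition[OF F] B] by (simp add: Pfm_mult_def split_def)
  show "fst (Pfm_mult a B F i) \<in> D" for i
    using P_mem[OF F] by (auto simp: Pfm_mult_def split_def intro: D_scale)
  have "(\<lambda>x. \<bar>s x\<bar>) \<in> Linf m" using simple_function_Linf[OF s] by (auto simp: Linf_def)
  then show "(\<lambda>x. \<bar>s x\<bar> * g (family_at F x) x) \<in> Lp m p"
    by (intro Lp_mult_Linf p1 P_in_Lp F)
  show "AE x in m. g (family_at (Pfm_mult a B F) x) x \<le> \<bar>s x\<bar> * g (family_at F x) x"
    using AE_g_simple[OF s F] AE_space
    by eventually_elim (simp add: family_at_mult[OF P_partition[OF F] aB])
qed

lemma P_single: assumes f: "f \<in> D" shows "single_family m f \<in> P"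
proof (rule P_memI[OF borel_partition_single _ g_in_Lp[OF f]])
  show "AE x in m. g (family_at (single_family m f) x) x \<le> g f x"
    by (rule AE_I2) (simp add: family_at_single)
qed (simp add: single_family_def f)

lemma Pfm_rel_iff:
  "(F, H) \<in> Pfm_rel m p D g \<longleftrightarrow> F \<in> P \<and> H \<in> P \<and> (AE x in m. g (\<lambda>y. family_at F x y - family_at H x y) x = 0)"
proof -
  have "(\<forall>i j. AE x in m. x \<in> snd (F i) \<inter> snd (H j) \<longrightarrow> g (\<lambda>y. fst (F i) y - fst (H j) y) x = 0)
    \<longleftrightarrow> (AE x in m. g (\<lambda>y. family_at F x y - family_at H x y) x = 0)" (is "?l \<longleftrightarrow> ?r")
    if F: "F \<in> P" and H: "H \<in> P"
  proof
    assume ?l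
    then have "AE x in m. \<forall>i j. x \<in> snd (F i) \<inter> snd (H j) \<longrightarrow> g (\<lambda>y. fst (F i) y - fst (H j) y) x = 0"
      unfolding AE_all_countable .
    then show ?r
      using AE_space
    proof eventually_elim
      case (elim x)
      obtain i where i: "x \<in> snd (F i)" by (rule borel_partitionE[OF P_partition[OF F] elim(2)])
      obtain j where j: "x \<in> snd (H j)" by (rule borel_partitionE[OF P_partition[OF H] elim(2)])
      show ?case
        using elim(1) i j family_at_eq[OF P_partition[OF F] i] family_at_eq[OF P_partition[OF H] j] by simp
    qed
  next
    assume r: ?r
    show ?l
    proof (intro allI)
      fix i j
      show "AE x in m. x \<in> snd (F i) \<inter> snd (H j) \<longrightarrow> g (\<lambda>y. fst (F i) y - fst (H j) y) x = 0"
        using r by eventually_elim (auto simp: family_at_eq[OF P_partition[OF F]] family_at_eq[OF P_partition[OF H]])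
    qed
  qed
  then show ?thesis unfolding Pfm_rel_def mem_Collect_eq prod.case by blast
qed

lemma equiv_Pfm_rel: "equiv P (Pfm_rel m p D g)"
proof (rule equivI)
  show "Pfm_rel m p D g \<subseteq> P \<times> P" by (auto simp: Pfm_rel_def)
  show "refl_on P (Pfm_rel m p D g)" by (auto simp: refl_on_def Pfm_rel_iff g_zero)
  show "sym (Pfm_rel m p D g)"
  proof (rule symI)
    fix F H assume FH: "(F, H) \<in> Pfm_rel m p D g"
    then have P: "F \<in> P" "H \<in> P" and 0: "AE x in m. g (\<lambda>y. family_at F x y - family_at H x y) x = 0"
      by (auto simp: Pfm_rel_iff)
    have "AE x in m. g (\<lambda>y. family_at F x y - family_at H x y) x = g (\<lambda>y. family_at H x y - family_at F x y) x"
      by (rule AE_family[OF P P(1)]) (rule g_diff_commute)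
    then have "AE x in m. g (\<lambda>y. family_at H x y - family_at F x y) x = 0"
      using 0 by eventually_elim simp
    then show "(H, F) \<in> Pfm_rel m p D g" using P by (simp add: Pfm_rel_iff)
  qed
  show "trans (Pfm_rel m p D g)"
  proof (rule transI)
    fix F H K assume FH: "(F, H) \<in> Pfm_rel m p D g" and HK: "(H, K) \<in> Pfm_rel m p D g"
    then have P: "F \<in> P" "H \<in> P" "K \<in> P"
      and 0: "AE x in m. g (\<lambda>y. family_at F x y - family_at H x y) x = 0"
        "AE x in m. g (\<lambda>y. family_at H x y - family_at K x y) x = 0"
      by (auto simp: Pfm_rel_iff)
    have 1: "AE x in m. g (\<lambda>y. family_at F x y - family_at K x y) x
        \<le> g (\<lambda>y. family_at F x y - family_at H x y) x + g (\<lambda>y. family_at H x y - family_at K x y) x"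
      by (rule AE_family[OF P]) (rule g_diff_triangle)
    have 2: "AE x in m. 0 \<le> g (\<lambda>y. family_at F x y - family_at K x y) x"
      by (rule AE_family[OF P]) (rule g_nonneg[OF D_diff])
    have "AE x in m. g (\<lambda>y. family_at F x y - family_at K x y) x = 0"
      using 1 2 0 by eventually_elim simp
    then show "(F, K) \<in> Pfm_rel m p D g" using P by (simp add: Pfm_rel_iff)
  qed
qed

lemma cls_eq_iff: "\<lbrakk>F \<in> P; H \<in> P\<rbrakk> \<Longrightarrow> cls F = cls H \<longleftrightarrow> (AE x in m. g (\<lambda>y. family_at F x y - family_at H x y) x = 0)"
  unfolding cls_def by (subst eq_equiv_class_iff[OF equiv_Pfm_rel]) (auto simp: Pfm_rel_iff)

lemma mem_cls_iff: "F \<in> P \<Longrightarrow> H \<in> cls F \<longleftrightarrow> H \<in> P \<and> cls F = cls H"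
  using cls_eq_iff[of F H] by (auto simp: cls_def[of F] Pfm_rel_iff)

text \<open>The two sides of a module identity are indexed by different encodings of pairs and are
  not equal as families. Agreement of \<open>family_at\<close> at every point is enough, which turns
  the axioms into identities between functions.\<close>

lemma cls_cong: "\<lbrakk>F \<in> P; H \<in> P; \<And>x. x \<in> space m \<Longrightarrow> family_at F x = family_at H x\<rbrakk> \<Longrightarrow> cls F = cls H"
  by (subst cls_eq_iff, assumption, assumption) (use g_zero AE_space in eventually_elim, simp)

lemma carrier_M: "mcarrier M = cls ` P"
  by (auto simp: Pfm_quotient_def quotient_def cls_def)

lemma cls_in_M: "F \<in> P \<Longrightarrow> cls F \<in> mcarrier M"
  by (simp add: carrier_M)

lemma mem_ME: assumes "C \<in> mcarrier M" obtains F where "F \<in> P" "C = cls F"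
  using assms by (auto simp: carrier_M)

lemma cls_nonempty: "F \<in> P \<Longrightarrow> cls F \<noteq> {}"
  using mem_cls_iff[of F F] by blast

lemma cls_add_cong:
  assumes F: "F \<in> P" "F' \<in> P" "cls F = cls F'" and H: "H \<in> P"
  shows "cls (Pfm_add F H) = cls (Pfm_add F' H)" "cls (Pfm_add H F) = cls (Pfm_add H F')"
proof -
  have "AE x in m. g (\<lambda>y. family_at F x y - family_at F' x y) x = 0" using F by (simp add: cls_eq_iff)
  then have "AE x in m. g (\<lambda>y. family_at (Pfm_add F H) x y - family_at (Pfm_add F' H) x y) x = 0"
      "AE x in m. g (\<lambda>y. family_at (Pfm_add H F) x y - family_at (Pfm_add H F') x y) x = 0"
    using AE_space by (eventually_elim, simp add: family_at_add[OF P_partition P_partition] F H)+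
  then show "cls (Pfm_add F H) = cls (Pfm_add F' H)" "cls (Pfm_add H F) = cls (Pfm_add H F')"
    using F H by (simp_all add: cls_eq_iff P_add)
qed

lemma M_add: assumes F: "F \<in> P" and H: "H \<in> P" shows "madd M (cls F) (cls H) = cls (Pfm_add F H)"
proof -
  have "(\<Union>F'\<in>cls F. \<Union>H'\<in>cls H. cls (Pfm_add F' H')) = cls (Pfm_add F H)"
  proof (rule UN_const2)
    fix F' H' assume F': "F' \<in> cls F" and H': "H' \<in> cls H"
    then have P: "F' \<in> P" "H' \<in> P" and eq: "cls F' = cls F" "cls H' = cls H" using F H by (auto simp: mem_cls_iff)
    show "cls (Pfm_add F' H') = cls (Pfm_add F H)"
      using cls_add_cong(1)[OF P(1) F eq(1) P(2)] cls_add_cong(2)[OF P(2) H eq(2) F] by simp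
  qed (use F H cls_nonempty in blast)+
  then show ?thesis by (simp add: Pfm_quotient_def cls_def)
qed

lemma cls_mult_cong:
  assumes F: "F \<in> P" "F' \<in> P" "cls F = cls F'" and s: "simple_function m s"
    and aB: "(a, B) \<in> simple_reps m s" "(a', B') \<in> simple_reps m s"
  shows "cls (Pfm_mult a B F) = cls (Pfm_mult a' B' F')"
proof (subst cls_eq_iff[OF P_mult[OF F(1) s aB(1)] P_mult[OF F(2) s aB(2)]])
  have 0: "AE x in m. g (\<lambda>y. family_at F x y - family_at F' x y) x = 0"
    using F by (simp add: cls_eq_iff)
  have "AE x in m. g (\<lambda>y. s x * (family_at F x y - family_at F' x y)) x = \<bar>s x\<bar> * g (\<lambda>y. family_at F x y - family_at F' x y) x"
    by (rule AE_family_simple[OF s F(1,2)]) (rule g_scale[OF D_diff])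
  then show "AE x in m. g (\<lambda>y. family_at (Pfm_mult a B F) x y - family_at (Pfm_mult a' B' F') x y) x = 0"
    using 0 AE_space
    by eventually_elim (simp add: family_at_mult[OF P_partition[OF F(1)] aB(1)] family_at_mult[OF P_partition[OF F(2)] aB(2)]
        right_diff_distrib)
qed

lemma M_mult: 
  assumes F: "F \<in> P" and s: "simple_function m s" and aB: "(a, B) \<in> simple_reps m s"
  shows "mmult M s (cls F) = cls (Pfm_mult a B F)"
proof -
  have "(\<Union>F'\<in>cls F. \<Union>aB'\<in>simple_reps m s. cls (Pfm_mult (fst aB') (snd aB') F')) = cls (Pfm_mult a B F)"
  proof (rule UN_const2)
    fix F' aB' assume F': "F' \<in> cls F" and "aB' \<in> simple_reps m s"
    then have aB': "(fst aB', snd aB') \<in> simple_reps m s" by simp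
    show "cls (Pfm_mult (fst aB') (snd aB') F') = cls (Pfm_mult a B F)"
      using F F' by (intro cls_mult_cong[OF _ F _ s aB' aB]) (auto simp: mem_cls_iff)
  qed (use F cls_nonempty aB in blast)+
  then show ?thesis by (simp add: Pfm_quotient_def cls_def split_def)
qed

lemma M_scale: assumes F: "F \<in> P" shows "mscale M c (cls F) = cls (Pfm_scale c F)"
proof -
  have "cls (Pfm_scale c F') = cls (Pfm_scale c F)" if F': "F' \<in> cls F" for F'
  proof -
    have P: "F' \<in> P" using F F' by (simp add: mem_cls_iff)
    have 0: "AE x in m. g (\<lambda>y. family_at F' x y - family_at F x y) x = 0"
      using F P F' cls_eq_iff[OF P F] by (simp add: mem_cls_iff)
    have "AE x in m. g (\<lambda>y. c * (family_at F' x y - family_at F x y)) x = \<bar>c\<bar> * g (\<lambda>y. family_at F' x y - family_at F x y) x"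
      by (rule AE_family[OF P F F]) (rule g_scale[OF D_diff])
    then have "AE x in m. g (\<lambda>y. family_at (Pfm_scale c F') x y - family_at (Pfm_scale c F) x y) x = 0"
      using 0 AE_space
      by eventually_elim (simp add: family_at_scale[OF P_partition[OF F]] family_at_scale[OF P_partition[OF P]] right_diff_distrib)
    then show ?thesis by (simp add: cls_eq_iff P_scale F P)
  qed
  then have "(\<Union>F'\<in>cls F. cls (Pfm_scale c F')) = cls (Pfm_scale c F)"
    by (rule UN_const[OF cls_nonempty[OF F]])
  then show ?thesis by (simp add: Pfm_quotient_def cls_def)
qed

lemma M_zero: "mzero M = cls (single_family m (\<lambda>x. 0))"
  by (simp add: Pfm_quotient_def cls_def)

text \<open>The norm of a class is read off from a chosen representative; the reverse triangle
  inequality for \<open>g\<close> shows that any other gives the same values almost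
  everywhere.\<close>

lemma M_pnorm: assumes F: "F \<in> P" shows "AE x in m. mpnorm M (cls F) x = g (family_at F x) x"
proof -
  define H where "H = (SOME H. H \<in> cls F)"
  have "H \<in> cls F" by (simp add: H_def some_in_eq cls_nonempty[OF F])
  then have H: "H \<in> P" "cls F = cls H" using F by (auto simp: mem_cls_iff)
  have "AE x in m. g (\<lambda>y. family_at F x y - family_at H x y) x = 0" using H F by (simp add: cls_eq_iff)
  moreover have "AE x in m. \<bar>g (family_at F x) x - g (family_at H x) x\<bar> \<le> g (\<lambda>y. family_at F x y - family_at H x y) x"
    by (rule AE_family[OF F H(1) F]) (rule g_rev_triangle)
  ultimately show ?thesis
    by eventually_elim (simp add: Pfm_quotient_def Pfm_pnorm_eq H_def[symmetric])
qed

lemma M_pnorm_in_Lp: assumes F: "F \<in> P" shows "mpnorm M (cls F) \<in> Lp m p"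
proof -
  define H where "H = (SOME H. H \<in> cls F)"
  have "H \<in> cls F" by (simp add: H_def some_in_eq cls_nonempty[OF F])
  then have "H \<in> P" using F by (auto simp: mem_cls_iff)
  moreover have "mpnorm M (cls F) = (\<lambda>x. g (family_at H x) x)"
    by (simp add: Pfm_quotient_def Pfm_pnorm_eq fun_eq_iff H_def)
  ultimately show ?thesis using P_in_Lp by simp
qed

theorem premodule_Pfm_quotient: "premodule m p {s. simple_function m s} M"
proof (rule premodule.intro)
  let ?S = "{s :: 'a \<Rightarrow> real. simple_function m s}"
  have MI: "\<exists>aB. aB \<in> simple_reps m s" if "s \<in> ?S" for s using simple_reps_nonempty that by blast
  have mult: "mmult M s (cls F) \<in> mcarrier M \<and> (\<exists>H\<in>P. mmult M s (cls F) = cls H \<and> (\<forall>x\<in>space m. family_at H x = (\<lambda>y. s x * family_at F x y)))"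
    if sF: "s \<in> ?S" "F \<in> P" for s F
  proof -
    obtain a B where aB: "(a, B) \<in> simple_reps m s" using MI[OF sF(1)] by auto
    have s: "simple_function m s" using sF by simp
    show ?thesis using M_mult[OF sF(2) s aB] P_mult[OF sF(2) s aB] family_at_mult[OF P_partition[OF sF(2)] aB]
      by (auto intro: cls_in_M)
  qed
  \<comment> \<open>Records only the effect of multiplication on \<open>family_at\<close>, hiding
    the chosen representation of \<open>s\<close> by values and a partition.\<close>
  have multE: "\<exists>H\<in>P. mmult M s (cls F) = cls H \<and> (\<forall>x\<in>space m. family_at H x = (\<lambda>y. s x * family_at F x y))"
    if "s \<in> ?S" "F \<in> P" for s F using mult[OF that] by blast
  note fa = family_at_add[OF P_partition P_partition] 
  show "1 < p" by (rule p1)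
  show "?S \<subseteq> Linf m" using simple_function_Linf by blast
  show "(\<lambda>_. c) \<in> ?S" for c by simp
  show "indicator A \<in> ?S" if "A \<in> sets m" for A using that by simp
  show add_S: "(\<lambda>x. f x + h x) \<in> ?S" if "f \<in> ?S" "h \<in> ?S" for f h using that by (simp add: simple_function_add)
  show mult_S: "(\<lambda>x. f x * h x) \<in> ?S" if "f \<in> ?S" "h \<in> ?S" for f h using that by (simp add: simple_function_mult)
  show "mzero M \<in> mcarrier M" by (simp add: M_zero cls_in_M P_single D_zero)
  show "madd M C E \<in> mcarrier M" if "C \<in> mcarrier M" "E \<in> mcarrier M" for C E
    using that by (elim mem_ME) (simp add: M_add cls_in_M P_add)
  show "mmult M s C \<in> mcarrier M" if "s \<in> ?S" "C \<in> mcarrier M" for s C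
    using mult that by (elim mem_ME) blast
  show "madd M (madd M C E) G = madd M C (madd M E G)" if "C \<in> mcarrier M" "E \<in> mcarrier M" "G \<in> mcarrier M" for C E G
    using that by (elim mem_ME) (simp add: M_add P_add, intro cls_cong, auto simp: P_add fa add.assoc)
  show "madd M C E = madd M E C" if "C \<in> mcarrier M" "E \<in> mcarrier M" for C E
    using that by (elim mem_ME) (simp add: M_add P_add, intro cls_cong, auto simp: P_add fa add.commute)
  show "madd M C (mzero M) = C" if "C \<in> mcarrier M" for C
    using that by (elim mem_ME) (simp add: M_add M_zero P_add P_single D_zero, intro cls_cong,
        auto simp: P_add fa P_single D_zero family_at_single)
  show "mmult M s (madd M C E) = madd M (mmult M s C) (mmult M s E)"
    if s: "s \<in> ?S" and CE: "C \<in> mcarrier M" "E \<in> mcarrier M" for s C E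
  proof -
    obtain F H where P: "F \<in> P" "C = cls F" "H \<in> P" "E = cls H" using CE by (elim mem_ME)
    obtain F' where F': "F' \<in> P" "mmult M s (cls F) = cls F'" "\<forall>x\<in>space m. family_at F' x = (\<lambda>y. s x * family_at F x y)"
      using multE[OF s P(1)] by blast
    obtain H' where H': "H' \<in> P" "mmult M s (cls H) = cls H'" "\<forall>x\<in>space m. family_at H' x = (\<lambda>y. s x * family_at H x y)"
      using multE[OF s P(3)] by blast
    obtain K where K: "K \<in> P" "mmult M s (cls (Pfm_add F H)) = cls K"
      "\<forall>x\<in>space m. family_at K x = (\<lambda>y. s x * family_at (Pfm_add F H) x y)"
      using multE[OF s P_add[OF P(1,3)]] by blast
    show ?thesis
      using P F' H' K by (simp add: M_add) (intro cls_cong, auto simp: P_add fa distrib_left)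
  qed
  show "mmult M (\<lambda>x. s x + t x) C = madd M (mmult M s C) (mmult M t C)"
    if st: "s \<in> ?S" "t \<in> ?S" and C: "C \<in> mcarrier M" for s t C
  proof -
    obtain F where P: "F \<in> P" "C = cls F" using C by (elim mem_ME)
    obtain F' where F': "F' \<in> P" "mmult M s (cls F) = cls F'" "\<forall>x\<in>space m. family_at F' x = (\<lambda>y. s x * family_at F x y)"
      using multE[OF st(1) P(1)] by blast
    obtain H' where H': "H' \<in> P" "mmult M t (cls F) = cls H'" "\<forall>x\<in>space m. family_at H' x = (\<lambda>y. t x * family_at F x y)"
      using multE[OF st(2) P(1)] by blast
    obtain K where K: "K \<in> P" "mmult M (\<lambda>x. s x + t x) (cls F) = cls K"
      "\<forall>x\<in>space m. family_at K x = (\<lambda>y. (s x + t x) * family_at F x y)"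
      using multE[OF add_S[OF st] P(1)] by blast
    show ?thesis
      using P F' H' K by (simp add: M_add) (intro cls_cong, auto simp: P_add fa distrib_right)
  qed
  show "mmult M s (mmult M t C) = mmult M (\<lambda>x. s x * t x) C"
    if st: "s \<in> ?S" "t \<in> ?S" and C: "C \<in> mcarrier M" for s t C
  proof -
    obtain F where P: "F \<in> P" "C = cls F" using C by (elim mem_ME)
    obtain H' where H': "H' \<in> P" "mmult M t (cls F) = cls H'" "\<forall>x\<in>space m. family_at H' x = (\<lambda>y. t x * family_at F x y)"
      using multE[OF st(2) P(1)] by blast
    obtain F' where F': "F' \<in> P" "mmult M s (cls H') = cls F'" "\<forall>x\<in>space m. family_at F' x = (\<lambda>y. s x * family_at H' x y)"
      using multE[OF st(1) H'(1)] by blast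
    obtain K where K: "K \<in> P" "mmult M (\<lambda>x. s x * t x) (cls F) = cls K"
      "\<forall>x\<in>space m. family_at K x = (\<lambda>y. (s x * t x) * family_at F x y)"
      using multE[OF mult_S[OF st] P(1)] by blast
    show ?thesis
      using P F' H' K by simp (intro cls_cong, auto simp: mult.assoc)
  qed
  show "mmult M (\<lambda>_. 1) C = C" if C: "C \<in> mcarrier M" for C
  proof -
    obtain F where P: "F \<in> P" "C = cls F" using C by (elim mem_ME)
    obtain K where K: "K \<in> P" "mmult M (\<lambda>_. 1) (cls F) = cls K"
      "\<forall>x\<in>space m. family_at K x = (\<lambda>y. 1 * family_at F x y)"
      using multE[of "\<lambda>_. 1" F] P(1) by auto
    show ?thesis using P K by simp (intro cls_cong, auto)
  qed
  show "mscale M c C = mmult M (\<lambda>_. c) C" if C: "C \<in> mcarrier M" for c C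
  proof -
    obtain F where P: "F \<in> P" "C = cls F" using C by (elim mem_ME)
    obtain K where K: "K \<in> P" "mmult M (\<lambda>_. c) (cls F) = cls K"
      "\<forall>x\<in>space m. family_at K x = (\<lambda>y. c * family_at F x y)"
      using multE[of "\<lambda>_. c" F] P(1) by auto
    show ?thesis using P K by (simp add: M_scale) (intro cls_cong, auto simp: P_scale family_at_scale[OF P_partition])
  qed
  show "mpnorm M C \<in> Lp m p" if "C \<in> mcarrier M" for C
    using that by (elim mem_ME) (simp add: M_pnorm_in_Lp)
  show "AE x in m. 0 \<le> mpnorm M C x" if C: "C \<in> mcarrier M" for C
  proof -
    obtain F where P: "F \<in> P" "C = cls F" using C by (elim mem_ME)
    have "AE x in m. 0 \<le> g (family_at F x) x" by (rule AE_family[OF P(1) P(1) P(1)]) (rule g_nonneg)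
    then show ?thesis using M_pnorm[OF P(1)] unfolding P(2) by eventually_elim simp
  qed
  show "AE x in m. mpnorm M (madd M C E) x \<le> mpnorm M C x + mpnorm M E x"
    if CE: "C \<in> mcarrier M" "E \<in> mcarrier M" for C E
  proof -
    obtain F H where P: "F \<in> P" "C = cls F" "H \<in> P" "E = cls H" using CE by (elim mem_ME)
    have "AE x in m. g (\<lambda>y. family_at F x y + family_at H x y) x \<le> g (family_at F x) x + g (family_at H x) x"
      by (rule AE_family[OF P(1) P(3) P(1)]) (rule g_add)
    then show ?thesis
      using M_pnorm[OF P(1)] M_pnorm[OF P(3)] M_pnorm[OF P_add[OF P(1,3)]] AE_space unfolding P(2,4) M_add[OF P(1,3)]
      by eventually_elim (simp add: fa P)
  qed
  show "AE x in m. mpnorm M (mmult M s C) x = \<bar>s x\<bar> * mpnorm M C x" if s: "s \<in> ?S" and C: "C \<in> mcarrier M" for s C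
  proof -
    obtain F where P: "F \<in> P" "C = cls F" using C by (elim mem_ME)
    obtain K where K: "K \<in> P" "mmult M s (cls F) = cls K" "\<forall>x\<in>space m. family_at K x = (\<lambda>y. s x * family_at F x y)"
      using multE[OF s P(1)] by blast
    have "AE x in m. g (\<lambda>y. s x * family_at F x y) x = \<bar>s x\<bar> * g (family_at F x) x"
      by (rule AE_g_simple) (use s P in auto)
    then show ?thesis
      using M_pnorm[OF P(1)] M_pnorm[OF K(1)] AE_space unfolding P(2) K(2)
      by eventually_elim (simp add: K(3))
  qed
  show "C = mzero M" if C: "C \<in> mcarrier M" and z: "AE x in m. mpnorm M C x = 0" for C
  proof -
    obtain F where P: "F \<in> P" "C = cls F" using C by (elim mem_ME)
    have "AE x in m. g (\<lambda>y. family_at F x y - family_at (single_family m (\<lambda>x. 0)) x y) x = 0"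
      using M_pnorm[OF P(1)] z AE_space unfolding P(2) by eventually_elim (simp add: family_at_single)
    then show ?thesis using P by (simp add: M_zero cls_eq_iff P_single D_zero)
  qed
  show "mnorm M C = Lp_norm m p (mpnorm M C)" for C by (simp add: Pfm_quotient_def)
qed

end

section \<open>Completion\<close>

lemma floor_abs_bound: "\<bar>y\<bar> \<le> K \<Longrightarrow> \<lfloor>y\<rfloor> \<in> {- (\<lceil>K\<rceil> + 1)..\<lceil>K\<rceil> + 1}" for y K :: real
  unfolding atLeastAtMost_iff by linarith

lemma ex_small_factor:
  fixes a e :: real
  assumes "0 \<le> a" "0 < e"
  obtains d where "0 < d" "a * d < e"
proof (rule that)
  show "0 < e / (a + 1)" "a * (e / (a + 1)) < e" using assms by (auto simp: field_simps)
qed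

lemma simple_approx_nonempty:
  fixes f :: "'a \<Rightarrow> real"
  assumes f: "f \<in> Linf m"
  shows "simple_approx m f \<noteq> {}"
proof -
  obtain C where C: "AE x in m. \<bar>f x\<bar> \<le> C" using f by (auto simp: Linf_def)
  have fm [measurable]: "f \<in> borel_measurable m" using f by (simp add: Linf_def)
  \<comment> \<open>Rounding down to the grid of width 1 / (n + 1). On the null set where |f|
    exceeds C the value is 0, which keeps the range finite.\<close>
  define s where "s n x = (if \<bar>f x\<bar> \<le> C then of_int \<lfloor>f x * Suc n\<rfloor> / Suc n else (0::real))" for n :: nat and x
  have "simple_function m (s n)" for n
  proof (rule simple_function_borel_measurable)
    show "s n \<in> borel_measurable m" unfolding s_def by measurable
    let ?K = "\<lceil>C * Suc n\<rceil> + 1"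
    have "s n ` space m \<subseteq> (\<lambda>k. of_int k / Suc n) ` {-?K..?K} \<union> {0}"
    proof
      fix y assume "y \<in> s n ` space m"
      then obtain x where y: "y = s n x" by blast
      show "y \<in> (\<lambda>k. of_int k / Suc n) ` {-?K..?K} \<union> {0}"
      proof (cases "\<bar>f x\<bar> \<le> C")
        case True
        then have "\<bar>f x\<bar> * Suc n \<le> C * Suc n" by (intro mult_right_mono) auto
        then have "\<bar>f x * Suc n\<bar> \<le> C * Suc n" by (simp add: abs_mult)
        then have "\<lfloor>f x * Suc n\<rfloor> \<in> {-?K..?K}" by (rule floor_abs_bound)
        then show ?thesis using True y by (simp add: s_def)
      qed (simp add: y s_def)
    qed
    then show "finite (s n ` space m)" by (rule finite_subset) auto
  qed
  moreover have "\<forall>\<^sub>F n in sequentially. AE x in m. \<bar>s n x - f x\<bar> \<le> e" if e: "0 < e" for e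
  proof -
    obtain k where k: "inverse (Suc k) < e" using reals_Archimedean[OF e] by blast
    show ?thesis
      using eventually_ge_at_top[of k]
    proof eventually_elim
      case (elim n)
      show ?case
        using C
      proof eventually_elim
        case (elim x)
        have fl: "\<bar>of_int \<lfloor>f x * Suc n\<rfloor> - f x * Suc n\<bar> \<le> 1" by linarith
        have "s n x - f x = (of_int \<lfloor>f x * Suc n\<rfloor> - f x * Suc n) / Suc n"
          using elim by (simp add: s_def diff_divide_distrib del: of_nat_Suc)
        then have "\<bar>s n x - f x\<bar> \<le> 1 / Suc n"
          using fl by (simp add: abs_divide divide_right_mono del: of_nat_Suc)
        also have "\<dots> \<le> 1 / Suc k" using \<open>k \<le> n\<close> by (intro divide_left_mono) auto
        finally show ?case using k by (simp add: inverse_eq_divide)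
      qed
    qed
  qed
  ultimately have "s \<in> simple_approx m f" by (simp add: simple_approx_def)
  then show ?thesis by blast
qed

lemma simple_approx_simple: "s \<in> simple_approx m f \<Longrightarrow> simple_function m (s n)"
  and simple_approx_close: "s \<in> simple_approx m f \<Longrightarrow> 0 < e \<Longrightarrow> \<forall>\<^sub>F n in sequentially. AE x in m. \<bar>s n x - f x\<bar> \<le> e"
  by (auto simp: simple_approx_def)

lemma simple_approx_bounded:
  assumes f: "f \<in> Linf m" and s: "s \<in> simple_approx m f"
  obtains C where "0 \<le> C" "\<forall>\<^sub>F n in sequentially. AE x in m. \<bar>s n x\<bar> \<le> C" "AE x in m. \<bar>f x\<bar> \<le> C"
proof -
  obtain C where C: "AE x in m. \<bar>f x\<bar> \<le> C" using f by (auto simp: Linf_def)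
  have "\<forall>\<^sub>F n in sequentially. AE x in m. \<bar>s n x\<bar> \<le> \<bar>C\<bar> + 1"
    using simple_approx_close[OF s zero_less_one]
  proof eventually_elim
    case (elim n)
    then show ?case using C by eventually_elim auto
  qed
  moreover have "AE x in m. \<bar>f x\<bar> \<le> \<bar>C\<bar> + 1" using C by eventually_elim auto
  ultimately show ?thesis using that[of "\<bar>C\<bar> + 1"] by auto
qed

lemma simple_approx_const: "(\<lambda>n x. c) \<in> simple_approx m (\<lambda>x. c)"
  by (auto simp: simple_approx_def)

lemma simple_approx_add:
  assumes s: "s \<in> simple_approx m f" and t: "t \<in> simple_approx m g"
  shows "(\<lambda>n x. s n x + t n x) \<in> simple_approx m (\<lambda>x. f x + g x)"
proof -
  have "\<forall>\<^sub>F n in sequentially. AE x in m. \<bar>s n x + t n x - (f x + g x)\<bar> \<le> e" if "0 < e" for e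
    using simple_approx_close[OF s half_gt_zero[OF that]] simple_approx_close[OF t half_gt_zero[OF that]]
  proof eventually_elim
    case (elim n)
    then show ?case by eventually_elim linarith
  qed
  then show ?thesis using s t by (auto simp: simple_approx_def simple_function_add)
qed

lemma simple_approx_mult:
  assumes f: "f \<in> Linf m" and g: "g \<in> Linf m" and s: "s \<in> simple_approx m f" and t: "t \<in> simple_approx m g"
  shows "(\<lambda>n x. s n x * t n x) \<in> simple_approx m (\<lambda>x. f x * g x)"
proof -
  obtain C where C: "0 \<le> C" "\<forall>\<^sub>F n in sequentially. AE x in m. \<bar>s n x\<bar> \<le> C" by (rule simple_approx_bounded[OF f s])
  obtain K where K: "0 \<le> K" "AE x in m. \<bar>g x\<bar> \<le> K" by (rule simple_approx_bounded[OF g t])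
  have "\<forall>\<^sub>F n in sequentially. AE x in m. \<bar>s n x * t n x - f x * g x\<bar> \<le> e" if "0 < e" for e
  proof -
    \<comment> \<open>The error of a product is at most (C + K) d; the added 1 keeps the denominator
      positive.\<close>
    define d where "d = e / (C + K + 1)"
    have d: "0 < d" "d * (C + K) \<le> e"
      using that C K by (auto simp: d_def divide_le_eq field_simps)
    show ?thesis
      using simple_approx_close[OF s d(1)] simple_approx_close[OF t d(1)] C(2)
    proof eventually_elim
      case (elim n)
      then show ?case using K(2)
      proof eventually_elim
        case (elim x)
        have "s n x * t n x - f x * g x = s n x * (t n x - g x) + g x * (s n x - f x)" by (simp add: algebra_simps)
        then have "\<bar>s n x * t n x - f x * g x\<bar> \<le> \<bar>s n x\<bar> * \<bar>t n x - g x\<bar> + \<bar>g x\<bar> * \<bar>s n x - f x\<bar>"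
          by (simp flip: abs_mult)
        also have "\<dots> \<le> C * d + K * d" using elim C K d by (intro add_mono mult_mono) auto
        finally show ?case using d by (simp add: algebra_simps)
      qed
    qed
  qed
  then show ?thesis using s t by (auto simp: simple_approx_def simple_function_mult)
qed

lemma Linf_const: "(\<lambda>_. c) \<in> Linf m" by (auto simp: Linf_def)

lemma Linf_indicator: "A \<in> sets m \<Longrightarrow> indicator A \<in> Linf m"
  by (auto simp: Linf_def intro!: exI[of _ 1] AE_I2 simp: indicator_def)

lemma Linf_add:
  assumes "f \<in> Linf m" "g \<in> Linf m" shows "(\<lambda>x. f x + g x) \<in> Linf m"
proof -
  obtain C K where "AE x in m. \<bar>f x\<bar> \<le> C" "AE x in m. \<bar>g x\<bar> \<le> K" using assms by (auto simp: Linf_def)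
  then have "AE x in m. \<bar>f x + g x\<bar> \<le> C + K" by eventually_elim auto
  then show ?thesis using assms by (auto simp: Linf_def)
qed

lemma Linf_mult:
  assumes "f \<in> Linf m" "g \<in> Linf m" shows "(\<lambda>x. f x * g x) \<in> Linf m"
proof -
  obtain C K where "AE x in m. \<bar>f x\<bar> \<le> C" "AE x in m. \<bar>g x\<bar> \<le> K" using assms by (auto simp: Linf_def)
  then have "AE x in m. \<bar>f x * g x\<bar> \<le> C * K" by eventually_elim (auto simp: abs_mult intro!: mult_mono)
  then show ?thesis using assms by (auto simp: Linf_def)
qed

section \<open>Operations and norms on classes of Cauchy sequences\<close>

locale simple_premodule = premodule m p "{s. simple_function m s}" N for m :: "'a measure" and p :: real and N :: "('a, 'v) nmodule"
begin

abbreviation C where "C \<equiv> completion m p N"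
definition cls where "cls X = null_diff_rel N `` {X}"
abbreviation Cauchy where "Cauchy X \<equiv> mCauchy N X"

lemma Cauchy_mem: "Cauchy X \<Longrightarrow> X n \<in> V"
  by (simp add: mCauchy_def)

lemma CauchyD: "Cauchy X \<Longrightarrow> 0 < e \<Longrightarrow> \<exists>K. \<forall>i\<ge>K. \<forall>j\<ge>K. nm (X i \<ominus> X j) < e"
  by (simp add: mCauchy_def)

lemma Cauchy_bounded: 
  assumes X: "Cauchy X"
  obtains B where "0 \<le> B" "\<forall>\<^sub>F n in sequentially. nm (X n) \<le> B"
proof -
  obtain K where K: "\<forall>i\<ge>K. \<forall>j\<ge>K. nm (X i \<ominus> X j) < 1" using CauchyD[OF X zero_less_one] by blast
  have "nm (X n) \<le> nm (X K) + 1" if "K \<le> n" for n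
    using K that norm_rev_triangle[OF Cauchy_mem[OF X] Cauchy_mem[OF X], of n K] by (smt (verit) order_refl)
  then have "\<forall>\<^sub>F n in sequentially. nm (X n) \<le> nm (X K) + 1" by (auto simp: eventually_sequentially)
  then show ?thesis using that norm_nonneg[OF Cauchy_mem[OF X, of K]] by (metis add_nonneg_nonneg zero_le_one)
qed

lemma Cauchy_const: "v \<in> V \<Longrightarrow> Cauchy (\<lambda>_. v)"
  by (simp add: mCauchy_def)

lemma Cauchy_add:
  assumes X: "Cauchy X" and Y: "Cauchy Y"
  shows "Cauchy (\<lambda>n. X n \<oplus> Y n)"
  unfolding mCauchy_def
proof (intro conjI allI impI)
  note mem = Cauchy_mem[OF X] Cauchy_mem[OF Y]
  show "X n \<oplus> Y n \<in> V" for n using mem by simp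
  fix e :: real assume "0 < e"
  then have e: "0 < e/2" by simp
  obtain K where K: "\<forall>i\<ge>K. \<forall>j\<ge>K. nm (X i \<ominus> X j) < e/2" using CauchyD[OF X e] by blast
  obtain L where L: "\<forall>i\<ge>L. \<forall>j\<ge>L. nm (Y i \<ominus> Y j) < e/2" using CauchyD[OF Y e] by blast
  show "\<exists>K. \<forall>i\<ge>K. \<forall>j\<ge>K. nm ((X i \<oplus> Y i) \<ominus> (X j \<oplus> Y j)) < e"
  proof (intro exI[of _ "max K L"] allI impI)
    fix i j assume "max K L \<le> i" "max K L \<le> j"
    then have "nm (X i \<ominus> X j) < e/2" "nm (Y i \<ominus> Y j) < e/2" using K L by auto
    then show "nm ((X i \<oplus> Y i) \<ominus> (X j \<oplus> Y j)) < e"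
      using norm_triangle[of "X i \<ominus> X j" "Y i \<ominus> Y j"] mem by (simp add: add_diff_add)
  qed
qed

lemma Cauchy_mult:
  assumes f: "f \<in> Linf m" and s: "s \<in> simple_approx m f" and X: "Cauchy X"
  shows "Cauchy (\<lambda>n. s n \<star> X n)"
  unfolding mCauchy_def
proof (intro conjI allI impI)
  note mem = Cauchy_mem[OF X]
  note ss = simple_approx_simple[OF s]
  show "s n \<star> X n \<in> V" for n using mem ss by simp
  fix e :: real assume e: "0 < e"
  obtain B where B: "0 \<le> B" "\<forall>\<^sub>F n in sequentially. nm (X n) \<le> B" by (rule Cauchy_bounded[OF X])
  obtain c where c: "0 \<le> c" "\<forall>\<^sub>F n in sequentially. AE x in m. \<bar>s n x\<bar> \<le> c" by (rule simple_approx_bounded[OF f s])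
  \<comment> \<open>Here \<open>c\<close> eventually bounds the multipliers and \<open>B\<close> the
    norms of \<open>X n\<close>. Two multipliers that are \<open>d\<close>-close to \<open>f\<close>
    differ by at most 2 d, so the distance of two products is at most c d + 2 d B.\<close>
  obtain d where d: "0 < d" "(c + 2 * B) * d < e" by (rule ex_small_factor[of "c + 2 * B" e]) (use c B e in auto)
  then have d: "0 < d" "c * d + 2 * d * B < e" by (simp_all add: algebra_simps)
  obtain K where K: "\<forall>i\<ge>K. \<forall>j\<ge>K. nm (X i \<ominus> X j) < d" using CauchyD[OF X d(1)] by blast
  have "\<forall>\<^sub>F n in sequentially. nm (X n) \<le> B \<and> (AE x in m. \<bar>s n x\<bar> \<le> c) \<and> (AE x in m. \<bar>s n x - f x\<bar> \<le> d) \<and> K \<le> n"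
    by (intro eventually_conj B c simple_approx_close[OF s d(1)] eventually_ge_at_top)
  then obtain L where L: "\<And>n. L \<le> n \<Longrightarrow> nm (X n) \<le> B \<and> (AE x in m. \<bar>s n x\<bar> \<le> c) \<and> (AE x in m. \<bar>s n x - f x\<bar> \<le> d) \<and> K \<le> n"
    by (auto simp: eventually_sequentially)
  show "\<exists>K. \<forall>i\<ge>K. \<forall>j\<ge>K. nm (s i \<star> X i \<ominus> s j \<star> X j) < e"
  proof (intro exI[of _ L] allI impI)
    fix i j assume i: "L \<le> i" and j: "L \<le> j"
    have "AE x in m. \<bar>s i x - f x\<bar> \<le> d" "AE x in m. \<bar>s j x - f x\<bar> \<le> d" using L i j by blast+
    then have "AE x in m. \<bar>s i x - s j x\<bar> \<le> 2 * d" by eventually_elim auto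
    then have "nm (s i \<star> X i \<ominus> s j \<star> X j) \<le> c * nm (X i \<ominus> X j) + 2 * d * nm (X j)"
      using L[OF i] ss by (intro norm_mult_diff_le mem) auto
    also have "\<dots> \<le> c * d + 2 * d * B"
      using L[OF i] L[OF j] K c d by (intro add_mono mult_left_mono) (auto intro: less_imp_le)
    finally show "nm (s i \<star> X i \<ominus> s j \<star> X j) < e" using d by simp
  qed
qed

lemma Cauchy_scale:
  assumes X: "Cauchy X" shows "Cauchy (\<lambda>n. c \<odot> X n)"
  using Cauchy_mult[OF Linf_const simple_approx_const X, of c] Cauchy_mem[OF X] by (simp add: scale_eq)

lemma Cauchy_diff: "Cauchy X \<Longrightarrow> Cauchy Y \<Longrightarrow> Cauchy (\<lambda>n. X n \<ominus> Y n)"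
  unfolding mdiff_def by (intro Cauchy_add Cauchy_scale)

lemma null_diff_iff: "(X, Y) \<in> null_diff_rel N \<longleftrightarrow> Cauchy X \<and> Cauchy Y \<and> (\<lambda>n. nm (X n \<ominus> Y n)) \<longlonglongrightarrow> 0"
  by (simp add: null_diff_rel_def)

lemma equiv_null_diff: "equiv {X. Cauchy X} (null_diff_rel N)"
proof (rule equivI)
  show "null_diff_rel N \<subseteq> {X. Cauchy X} \<times> {X. Cauchy X}" by (auto simp: null_diff_iff)
  show "refl_on {X. Cauchy X} (null_diff_rel N)" by (auto simp: refl_on_def null_diff_iff Cauchy_mem)
  show "sym (null_diff_rel N)"
  proof (rule symI)
    fix X Y assume *: "(X, Y) \<in> null_diff_rel N"
    then have "nm (X n \<ominus> Y n) = nm (Y n \<ominus> X n)" for n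
      by (intro norm_diff_commute) (auto simp: null_diff_iff Cauchy_mem)
    then show "(Y, X) \<in> null_diff_rel N" using * by (simp add: null_diff_iff)
  qed
  show "trans (null_diff_rel N)"
  proof (rule transI)
    fix X Y Z assume *: "(X, Y) \<in> null_diff_rel N" "(Y, Z) \<in> null_diff_rel N"
    then have mem: "X n \<in> V" "Y n \<in> V" "Z n \<in> V" for n by (auto simp: null_diff_iff Cauchy_mem)
    have "(\<lambda>n. nm (X n \<ominus> Z n)) \<longlonglongrightarrow> 0"
    proof (rule Lim_null_comparison)
      show "(\<lambda>n. nm (X n \<ominus> Y n) + nm (Y n \<ominus> Z n)) \<longlonglongrightarrow> 0"
        using * tendsto_add[of "\<lambda>n. nm (X n \<ominus> Y n)" 0 _ "\<lambda>n. nm (Y n \<ominus> Z n)" 0] by (simp add: null_diff_iff)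
      show "\<forall>\<^sub>F n in sequentially. norm (nm (X n \<ominus> Z n)) \<le> nm (X n \<ominus> Y n) + nm (Y n \<ominus> Z n)"
        using mem norm_diff_triangle by (simp add: norm_nonneg)
    qed
    then show "(X, Z) \<in> null_diff_rel N" using * by (simp add: null_diff_iff)
  qed
qed

lemma cls_eq_iff: "\<lbrakk>Cauchy X; Cauchy Y\<rbrakk> \<Longrightarrow> cls X = cls Y \<longleftrightarrow> (\<lambda>n. nm (X n \<ominus> Y n)) \<longlonglongrightarrow> 0"
  unfolding cls_def by (subst eq_equiv_class_iff[OF equiv_null_diff]) (auto simp: null_diff_iff)

lemma mem_cls_iff: "Cauchy X \<Longrightarrow> Y \<in> cls X \<longleftrightarrow> Cauchy Y \<and> cls X = cls Y"
  using cls_eq_iff[of X Y] by (auto simp: cls_def[of X] null_diff_iff)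

lemma carrier_C: "mcarrier C = cls ` {X. Cauchy X}"
  by (auto simp: completion_def quotient_def cls_def)

lemma cls_in_C: "Cauchy X \<Longrightarrow> cls X \<in> mcarrier C"
  by (simp add: carrier_C)

lemma mem_CE: assumes "A \<in> mcarrier C" obtains X where "Cauchy X" "A = cls X"
  using assms by (auto simp: carrier_C)

lemma cls_nonempty: "Cauchy X \<Longrightarrow> cls X \<noteq> {}"
  using mem_cls_iff[of X X] by blast

lemma C_add: assumes X: "Cauchy X" and Y: "Cauchy Y" shows "madd C (cls X) (cls Y) = cls (\<lambda>n. X n \<oplus> Y n)"
proof -
  have "(\<Union>X'\<in>cls X. \<Union>Y'\<in>cls Y. cls (\<lambda>n. X' n \<oplus> Y' n)) = cls (\<lambda>n. X n \<oplus> Y n)"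
  proof (rule UN_const2)
    fix X' Y' assume X': "X' \<in> cls X" and Y': "Y' \<in> cls Y"
    then have c: "Cauchy X'" "Cauchy Y'" and eq: "cls X' = cls X" "cls Y' = cls Y" using X Y by (auto simp: mem_cls_iff)
    have mem: "X n \<in> V" "X' n \<in> V" "Y n \<in> V" "Y' n \<in> V" for n using X Y c by (auto simp: Cauchy_mem)
    show "cls (\<lambda>n. X' n \<oplus> Y' n) = cls (\<lambda>n. X n \<oplus> Y n)"
    proof (subst cls_eq_iff[OF Cauchy_add[OF c] Cauchy_add[OF X Y]], rule Lim_null_comparison)
      show "(\<lambda>n. nm (X' n \<ominus> X n) + nm (Y' n \<ominus> Y n)) \<longlonglongrightarrow> 0"
        using eq X Y c tendsto_add[of "\<lambda>n. nm (X' n \<ominus> X n)" 0 _ "\<lambda>n. nm (Y' n \<ominus> Y n)" 0] by (simp add: cls_eq_iff)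
      show "\<forall>\<^sub>F n in sequentially. norm (nm ((X' n \<oplus> Y' n) \<ominus> (X n \<oplus> Y n))) \<le> nm (X' n \<ominus> X n) + nm (Y' n \<ominus> Y n)"
        using mem norm_triangle by (simp add: add_diff_add norm_nonneg)
    qed
  qed (use X Y cls_nonempty in blast)+
  then show ?thesis by (simp add: completion_def cls_def)
qed

text \<open>Independence of the representative and of the simple approximation, in one estimate of
  the same shape as for \<open>Cauchy_mult\<close>.\<close>

lemma cls_mult_cong:
  assumes f: "f \<in> Linf m" and s: "s \<in> simple_approx m f" and t: "t \<in> simple_approx m f"
    and X: "Cauchy X" and Y: "Cauchy Y" and XY: "cls X = cls Y"
  shows "cls (\<lambda>n. s n \<star> X n) = cls (\<lambda>n. t n \<star> Y n)"
proof (subst cls_eq_iff[OF Cauchy_mult[OF f s X] Cauchy_mult[OF f t Y]], rule LIMSEQ_I)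
  fix e :: real assume e: "0 < e"
  note mem = Cauchy_mem[OF X] Cauchy_mem[OF Y]
  note ss = simple_approx_simple[OF s] simple_approx_simple[OF t]
  obtain B where B: "0 \<le> B" "\<forall>\<^sub>F n in sequentially. nm (Y n) \<le> B" by (rule Cauchy_bounded[OF Y])
  obtain c where c: "0 \<le> c" "\<forall>\<^sub>F n in sequentially. AE x in m. \<bar>s n x\<bar> \<le> c" by (rule simple_approx_bounded[OF f s])
  obtain d where d: "0 < d" "(c + 2 * B) * d < e" by (rule ex_small_factor[of "c + 2 * B" e]) (use c B e in auto)
  then have d: "0 < d" "c * d + 2 * d * B < e" by (simp_all add: algebra_simps)
  have "(\<lambda>n. nm (X n \<ominus> Y n)) \<longlonglongrightarrow> 0" using XY X Y by (simp add: cls_eq_iff)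
  then have "\<forall>\<^sub>F n in sequentially. nm (X n \<ominus> Y n) < d" using d by (intro order_tendstoD) auto
  then have "\<forall>\<^sub>F n in sequentially. nm (s n \<star> X n \<ominus> t n \<star> Y n) < e"
    using B(2) c(2) simple_approx_close[OF s d(1)] simple_approx_close[OF t d(1)]
  proof eventually_elim
    case (elim n)
    have "AE x in m. \<bar>s n x - t n x\<bar> \<le> 2 * d" using elim(4,5) by eventually_elim auto
    then have "nm (s n \<star> X n \<ominus> t n \<star> Y n) \<le> c * nm (X n \<ominus> Y n) + 2 * d * nm (Y n)"
      using elim ss by (intro norm_mult_diff_le mem) auto
    also have "\<dots> \<le> c * d + 2 * d * B"
      using elim c d by (intro add_mono mult_left_mono) auto
    finally show ?case using d by simp
  qed
  then show "\<exists>L. \<forall>n\<ge>L. norm (nm (s n \<star> X n \<ominus> t n \<star> Y n) - 0) < e"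
    using mem ss by (auto simp: eventually_sequentially norm_nonneg)
qed

lemma C_mult: 
  assumes X: "Cauchy X" and f: "f \<in> Linf m" and s: "s \<in> simple_approx m f"
  shows "mmult C f (cls X) = cls (\<lambda>n. s n \<star> X n)"
proof -
  have "(\<Union>Y\<in>cls X. \<Union>t\<in>simple_approx m f. cls (\<lambda>n. t n \<star> Y n)) = cls (\<lambda>n. s n \<star> X n)"
  proof (rule UN_const2)
    fix Y t assume Y: "Y \<in> cls X" and t: "t \<in> simple_approx m f"
    then show "cls (\<lambda>n. t n \<star> Y n) = cls (\<lambda>n. s n \<star> X n)"
      using X by (intro cls_mult_cong[OF f t s]) (auto simp: mem_cls_iff)
  qed (use X cls_nonempty s in blast)+
  then show ?thesis by (simp add: completion_def cls_def)
qed

lemma C_scale: assumes X: "Cauchy X" shows "mscale C c (cls X) = cls (\<lambda>n. c \<odot> X n)"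
proof -
  have "cls (\<lambda>n. c \<odot> Y n) = cls (\<lambda>n. c \<odot> X n)" if "Y \<in> cls X" for Y
  proof -
    have Y: "Cauchy Y" "cls Y = cls X" using X that by (auto simp: mem_cls_iff)
    show ?thesis
      using cls_mult_cong[OF Linf_const simple_approx_const simple_approx_const Y(1) X Y(2), of c]
        Cauchy_mem[OF X] Cauchy_mem[OF Y(1)] by (simp add: scale_eq)
  qed
  then have "(\<Union>Y\<in>cls X. cls (\<lambda>n. c \<odot> Y n)) = cls (\<lambda>n. c \<odot> X n)"
    by (rule UN_const[OF cls_nonempty[OF X]])
  then show ?thesis by (simp add: completion_def cls_def)
qed

lemma C_zero: "mzero C = cls (\<lambda>_. \<zero>)"
  by (simp add: completion_def cls_def)

lemma C_diff: "\<lbrakk>Cauchy X; Cauchy Y\<rbrakk> \<Longrightarrow> mdiff C (cls X) (cls Y) = cls (\<lambda>n. X n \<ominus> Y n)"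
  by (simp add: mdiff_def C_scale C_add Cauchy_scale)

text \<open>By the reverse triangle inequality the pointwise norms along a Cauchy sequence are
  Cauchy in L^p, so a limit exists and the choice in the definition is meaningful. The choice
  guarantees convergence along some representative \<open>Y\<close>; the distance of
  \<open>X n\<close> and \<open>Y n\<close> tends to 0, which moves it to \<open>X\<close>.\<close>

lemma C_pnorm:
  assumes X: "Cauchy X"
  shows C_pnorm_in_Lp: "mpnorm C (cls X) \<in> Lp m p"
    and C_pnorm_lim: "(\<lambda>n. Lp_norm m p (\<lambda>x. pn (X n) x - mpnorm C (cls X) x)) \<longlonglongrightarrow> 0"
proof -
  let ?R = "\<lambda>G. G \<in> Lp m p \<and> (\<exists>Y\<in>cls X. (\<lambda>n. Lp_norm m p (\<lambda>x. pn (Y n) x - G x)) \<longlonglongrightarrow> 0)"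
  have pd: "Lp_norm m p (\<lambda>x. pn u x - pn v x) \<le> nm (u \<ominus> v)" if "u \<in> V" "v \<in> V" for u v
    using that pnorm_rev_triangle[OF that]
    by (simp add: norm_eq_Lp_norm) (intro Lp_norm_mono[OF p1] pnorm_in_Lp, auto elim!: eventually_mono)
  obtain G where G: "G \<in> Lp m p" "(\<lambda>n. Lp_norm m p (\<lambda>x. pn (X n) x - G x)) \<longlonglongrightarrow> 0"
  proof (rule Lp_complete[OF p1])
    show "pn (X n) \<in> Lp m p" for n by (rule pnorm_in_Lp[OF Cauchy_mem[OF X]])
    show "\<exists>K. \<forall>i\<ge>K. \<forall>j\<ge>K. Lp_norm m p (\<lambda>x. pn (X i) x - pn (X j) x) < e" if "0 < e" for e
      using CauchyD[OF X that] pd[OF Cauchy_mem[OF X] Cauchy_mem[OF X]] by (meson order.strict_trans1)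
  qed
  have "?R G" using G mem_cls_iff[OF X] X by blast
  then have R: "?R (mpnorm C (cls X))"
    by (simp add: completion_def) (rule someI[of ?R])
  then show L: "mpnorm C (cls X) \<in> Lp m p" by simp
  obtain Y where Y: "Y \<in> cls X" "(\<lambda>n. Lp_norm m p (\<lambda>x. pn (Y n) x - mpnorm C (cls X) x)) \<longlonglongrightarrow> 0" using R by blast
  have cY: "Cauchy Y" and "cls X = cls Y" using Y(1) X by (auto simp: mem_cls_iff)
  then have XY: "(\<lambda>n. nm (X n \<ominus> Y n)) \<longlonglongrightarrow> 0" using X by (simp add: cls_eq_iff)
  show "(\<lambda>n. Lp_norm m p (\<lambda>x. pn (X n) x - mpnorm C (cls X) x)) \<longlonglongrightarrow> 0"
  proof (rule Lim_null_comparison)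
    show "(\<lambda>n. nm (X n \<ominus> Y n) + Lp_norm m p (\<lambda>x. pn (Y n) x - mpnorm C (cls X) x)) \<longlonglongrightarrow> 0"
      using tendsto_add[OF XY Y(2)] by simp
    have "Lp_norm m p (\<lambda>x. pn (X n) x - mpnorm C (cls X) x)
        \<le> nm (X n \<ominus> Y n) + Lp_norm m p (\<lambda>x. pn (Y n) x - mpnorm C (cls X) x)" for n
      using Lp_norm_diff_triangle[OF p1 pnorm_in_Lp[OF Cauchy_mem[OF X]] pnorm_in_Lp[OF Cauchy_mem[OF cY]] L, of n n]
        pd[OF Cauchy_mem[OF X] Cauchy_mem[OF cY], of n n] by simp
    then show "\<forall>\<^sub>F n in sequentially. norm (Lp_norm m p (\<lambda>x. pn (X n) x - mpnorm C (cls X) x))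
        \<le> nm (X n \<ominus> Y n) + Lp_norm m p (\<lambda>x. pn (Y n) x - mpnorm C (cls X) x)"
      by (simp add: Lp_norm_nonneg[OF p1])
  qed
qed

lemma C_pnorm_unique:
  assumes X: "Cauchy X" and G: "G \<in> Lp m p" and lim: "(\<lambda>n. Lp_norm m p (\<lambda>x. pn (X n) x - G x)) \<longlonglongrightarrow> 0"
  shows "AE x in m. mpnorm C (cls X) x = G x"
  by (rule Lp_limit_unique[OF p1 pnorm_in_Lp[OF Cauchy_mem[OF X]] C_pnorm_in_Lp[OF X] G C_pnorm_lim[OF X] lim])

lemma C_norm_lim: assumes X: "Cauchy X" shows "(\<lambda>n. nm (X n)) \<longlonglongrightarrow> Lp_norm m p (mpnorm C (cls X))"
  using Lp_norm_tendsto[OF p1 pnorm_in_Lp[OF Cauchy_mem[OF X]] C_pnorm_in_Lp[OF X] C_pnorm_lim[OF X]] Cauchy_mem[OF X]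
  by (simp add: norm_eq_Lp_norm)

lemma C_norm: assumes X: "Cauchy X" shows "mnorm C (cls X) = Lp_norm m p (mpnorm C (cls X))"
proof -
  have "(THE c. \<exists>Y\<in>cls X. (\<lambda>n. nm (Y n)) \<longlonglongrightarrow> c) = Lp_norm m p (mpnorm C (cls X))"
  proof (rule the_equality)
    show "\<exists>Y\<in>cls X. (\<lambda>n. nm (Y n)) \<longlonglongrightarrow> Lp_norm m p (mpnorm C (cls X))"
      using C_norm_lim[OF X] mem_cls_iff[OF X] X by blast
    fix c assume "\<exists>Y\<in>cls X. (\<lambda>n. nm (Y n)) \<longlonglongrightarrow> c"
    then obtain Y where Y: "Y \<in> cls X" "(\<lambda>n. nm (Y n)) \<longlonglongrightarrow> c" by blast
    then have "Cauchy Y" "cls X = cls Y" using X by (auto simp: mem_cls_iff)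
    then show "c = Lp_norm m p (mpnorm C (cls X))" using C_norm_lim[of Y] Y(2) by (auto intro: LIMSEQ_unique)
  qed
  then show ?thesis by (simp add: completion_def)
qed

lemma C_pnorm_nonneg: assumes X: "Cauchy X" shows "AE x in m. 0 \<le> mpnorm C (cls X) x"
  by (rule Lp_limit_mono[OF p1 Lp_zero[OF p1] pnorm_in_Lp[OF Cauchy_mem[OF X]] Lp_zero[OF p1] C_pnorm_in_Lp[OF X]
        pnorm_nonneg[OF Cauchy_mem[OF X]] Lp_limit_const[OF p1] C_pnorm_lim[OF X]])

lemma C_pnorm_triangle:
  assumes X: "Cauchy X" and Y: "Cauchy Y"
  shows "AE x in m. mpnorm C (cls (\<lambda>n. X n \<oplus> Y n)) x \<le> mpnorm C (cls X) x + mpnorm C (cls Y) x"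
proof -
  note mem = Cauchy_mem[OF X] Cauchy_mem[OF Y]
  note L = C_pnorm_in_Lp[OF X] C_pnorm_in_Lp[OF Y]
  note LX = pnorm_in_Lp[OF mem(1)] and LY = pnorm_in_Lp[OF mem(2)]
  have le: "AE x in m. pn (X n \<oplus> Y n) x \<le> pn (X n) x + pn (Y n) x" for n by (intro pnorm_triangle mem)
  show ?thesis
    by (rule Lp_limit_mono[OF p1 pnorm_in_Lp[OF Cauchy_mem[OF Cauchy_add[OF X Y]]] Lp_add[OF p1 LX LY]
          C_pnorm_in_Lp[OF Cauchy_add[OF X Y]] Lp_add[OF p1 L] le C_pnorm_lim[OF Cauchy_add[OF X Y]]
          Lp_limit_add[OF p1 LX LY L C_pnorm_lim[OF X] C_pnorm_lim[OF Y]]])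
qed

lemma C_pnorm_mult:
  assumes X: "Cauchy X" and f: "f \<in> Linf m" and s: "s \<in> simple_approx m f"
  shows "AE x in m. mpnorm C (cls (\<lambda>n. s n \<star> X n)) x = \<bar>f x\<bar> * mpnorm C (cls X) x"
proof (rule C_pnorm_unique[OF Cauchy_mult[OF f s X]])
  let ?a = "mpnorm C (cls X)"
  have a: "?a \<in> Lp m p" by (rule C_pnorm_in_Lp[OF X])
  note mem = Cauchy_mem[OF X] and ss = simple_approx_simple[OF s]
  have af: "(\<lambda>x. \<bar>f x\<bar>) \<in> Linf m" using f by (auto simp: Linf_def)
  have asn: "(\<lambda>x. \<bar>s n x\<bar>) \<in> Linf m" for n using simple_function_Linf[OF ss[of n]] by (auto simp: Linf_def)
  show fa: "(\<lambda>x. \<bar>f x\<bar> * ?a x) \<in> Lp m p" by (rule Lp_mult_Linf[OF p1 af a])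
  obtain c where c: "0 \<le> c" "\<forall>\<^sub>F n in sequentially. AE x in m. \<bar>s n x\<bar> \<le> c" by (rule simple_approx_bounded[OF f s])
  show "(\<lambda>n. Lp_norm m p (\<lambda>x. pn (s n \<star> X n) x - \<bar>f x\<bar> * ?a x)) \<longlonglongrightarrow> 0"
  proof (rule LIMSEQ_I)
    fix e :: real assume e: "0 < e"
    obtain d where d: "0 < d" "(c + Lp_norm m p ?a) * d < e"
      by (rule ex_small_factor[of "c + Lp_norm m p ?a" e]) (use c Lp_norm_nonneg[OF p1, of m ?a] e in auto)
    then have d: "0 < d" "c * d + d * Lp_norm m p ?a < e" by (simp_all add: algebra_simps)
    have "\<forall>\<^sub>F n in sequentially. Lp_norm m p (\<lambda>x. pn (X n) x - ?a x) < d"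
      using C_pnorm_lim[OF X] d by (intro order_tendstoD) auto
    then have "\<forall>\<^sub>F n in sequentially. Lp_norm m p (\<lambda>x. pn (s n \<star> X n) x - \<bar>f x\<bar> * ?a x) < e"
      using c(2) simple_approx_close[OF s d(1)]
    proof eventually_elim
      case (elim n)
      have u: "(\<lambda>x. c * (pn (X n) x - ?a x)) \<in> Lp m p" and v: "(\<lambda>x. d * ?a x) \<in> Lp m p"
        by (intro Lp_scale Lp_diff p1 pnorm_in_Lp mem a)+
      have "AE x in m. pn (s n \<star> X n) x = \<bar>s n x\<bar> * pn (X n) x" by (rule pnorm_mult) (use ss mem in auto)
      then have "AE x in m. \<bar>pn (s n \<star> X n) x - \<bar>f x\<bar> * ?a x\<bar> \<le> \<bar>\<bar>c * (pn (X n) x - ?a x)\<bar> + \<bar>d * ?a x\<bar>\<bar>"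
        using elim(2,3)
      proof eventually_elim
        case (elim x)
        \<comment> \<open>The error of the product is split into the error of the norm, weighted by
          the bounded multiplier, and the uniform error of the multiplier, weighted by the limit
          norm.\<close>
        have "pn (s n \<star> X n) x - \<bar>f x\<bar> * ?a x = \<bar>s n x\<bar> * (pn (X n) x - ?a x) + (\<bar>s n x\<bar> - \<bar>f x\<bar>) * ?a x"
          using elim(1) by (simp add: algebra_simps)
        then have "\<bar>pn (s n \<star> X n) x - \<bar>f x\<bar> * ?a x\<bar> \<le> \<bar>s n x\<bar> * \<bar>pn (X n) x - ?a x\<bar> + \<bar>\<bar>s n x\<bar> - \<bar>f x\<bar>\<bar> * \<bar>?a x\<bar>"
          using abs_triangle_ineq[of "\<bar>s n x\<bar> * (pn (X n) x - ?a x)" "(\<bar>s n x\<bar> - \<bar>f x\<bar>) * ?a x"] by (simp add: abs_mult)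
        also have "\<dots> \<le> c * \<bar>pn (X n) x - ?a x\<bar> + d * \<bar>?a x\<bar>"
          using elim(2,3) by (intro add_mono mult_right_mono) auto
        finally show ?case using c d by (simp add: abs_mult)
      qed
      then have "Lp_norm m p (\<lambda>x. pn (s n \<star> X n) x - \<bar>f x\<bar> * ?a x)
          \<le> Lp_norm m p (\<lambda>x. \<bar>c * (pn (X n) x - ?a x)\<bar> + \<bar>d * ?a x\<bar>)"
      proof (rule Lp_norm_mono[OF p1])
        show "(\<lambda>x. pn (s n \<star> X n) x - \<bar>f x\<bar> * ?a x) \<in> borel_measurable m"
          using ss mem by (intro Lp_measurable[OF p1] Lp_diff p1 pnorm_in_Lp fa) auto
      qed (intro Lp_add Lp_abs p1 u v)
      also have "\<dots> \<le> c * Lp_norm m p (\<lambda>x. pn (X n) x - ?a x) + d * Lp_norm m p ?a"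
        using Lp_norm_triangle[OF p1 Lp_abs[OF p1 u] Lp_abs[OF p1 v]] c(1) d(1)
        by (simp only: Lp_norm_abs[OF p1] Lp_norm_scale[OF p1] abs_of_nonneg abs_of_pos)
      also have "\<dots> \<le> c * d + d * Lp_norm m p ?a" using elim(1) c d(1) by (intro add_mono mult_left_mono) auto
      finally show ?case using d by simp
    qed
    then show "\<exists>K. \<forall>n\<ge>K. norm (Lp_norm m p (\<lambda>x. pn (s n \<star> X n) x - \<bar>f x\<bar> * ?a x) - 0) < e"
      by (auto simp: eventually_sequentially Lp_norm_nonneg[OF p1])
  qed
qed

lemma premodule_completion: "premodule m p (Linf m) C"
proof (rule premodule.intro)
  note mem = Cauchy_mem
  have cong: "cls X = cls Y" if "X = Y" for X Y using that by simp
  show "1 < p" by (rule p1)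
  show "Linf m \<subseteq> Linf m" by simp
  show "(\<lambda>_. c) \<in> Linf m" for c by (rule Linf_const)
  show "indicator A \<in> Linf m" if "A \<in> sets m" for A using that by (rule Linf_indicator)
  show add_S: "(\<lambda>x. f x + h x) \<in> Linf m" if "f \<in> Linf m" "h \<in> Linf m" for f h using that by (rule Linf_add)
  show mult_S: "(\<lambda>x. f x * h x) \<in> Linf m" if "f \<in> Linf m" "h \<in> Linf m" for f h using that by (rule Linf_mult)
  show "mzero C \<in> mcarrier C" by (simp add: C_zero cls_in_C Cauchy_const)
  show "madd C A B \<in> mcarrier C" if "A \<in> mcarrier C" "B \<in> mcarrier C" for A B
    using that by (elim mem_CE) (simp add: C_add cls_in_C Cauchy_add)
  show "mmult C f A \<in> mcarrier C" if f: "f \<in> Linf m" and A: "A \<in> mcarrier C" for f A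
  proof -
    obtain s where s: "s \<in> simple_approx m f" using simple_approx_nonempty[OF f] by blast
    show ?thesis using A by (elim mem_CE) (simp add: C_mult[OF _ f s] cls_in_C Cauchy_mult[OF f s])
  qed
  show "madd C (madd C A B) G = madd C A (madd C B G)" if "A \<in> mcarrier C" "B \<in> mcarrier C" "G \<in> mcarrier C" for A B G
    using that by (elim mem_CE) (simp add: C_add Cauchy_add add_assoc mem)
  show "madd C A B = madd C B A" if AB: "A \<in> mcarrier C" "B \<in> mcarrier C" for A B
  proof -
    obtain X where X: "Cauchy X" "A = cls X" by (rule mem_CE[OF AB(1)])
    obtain Y where Y: "Cauchy Y" "B = cls Y" by (rule mem_CE[OF AB(2)])
    have "(\<lambda>n. X n \<oplus> Y n) = (\<lambda>n. Y n \<oplus> X n)" using X Y add_commute mem by (intro ext) blast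
    then show ?thesis using X Y by (simp add: C_add)
  qed
  show "madd C A (mzero C) = A" if "A \<in> mcarrier C" for A
    using that by (elim mem_CE) (simp add: C_add C_zero Cauchy_const mem)
  show "mmult C f (madd C A B) = madd C (mmult C f A) (mmult C f B)"
    if f: "f \<in> Linf m" and AB: "A \<in> mcarrier C" "B \<in> mcarrier C" for f A B
  proof -
    obtain s where s: "s \<in> simple_approx m f" using simple_approx_nonempty[OF f] by blast
    show ?thesis using AB simple_approx_simple[OF s]
      by (elim mem_CE) (simp add: C_mult[OF _ f s] C_add Cauchy_mult[OF f s] Cauchy_add mult_add_right mem)
  qed
  show "mmult C (\<lambda>x. f x + h x) A = madd C (mmult C f A) (mmult C h A)"
    if f: "f \<in> Linf m" and h: "h \<in> Linf m" and A: "A \<in> mcarrier C" for f h A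
  proof -
    obtain s where s: "s \<in> simple_approx m f" using simple_approx_nonempty[OF f] by blast
    obtain t where t: "t \<in> simple_approx m h" using simple_approx_nonempty[OF h] by blast
    show ?thesis using A simple_approx_simple[OF s] simple_approx_simple[OF t]
      by (elim mem_CE) (simp add: C_mult[OF _ f s] C_mult[OF _ h t] C_mult[OF _ add_S[OF f h] simple_approx_add[OF s t]]
          C_add Cauchy_mult[OF f s] Cauchy_mult[OF h t] mult_add_left mem)
  qed
  show "mmult C f (mmult C h A) = mmult C (\<lambda>x. f x * h x) A"
    if f: "f \<in> Linf m" and h: "h \<in> Linf m" and A: "A \<in> mcarrier C" for f h A
  proof -
    obtain s where s: "s \<in> simple_approx m f" using simple_approx_nonempty[OF f] by blast
    obtain t where t: "t \<in> simple_approx m h" using simple_approx_nonempty[OF h] by blast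
    show ?thesis using A simple_approx_simple[OF s] simple_approx_simple[OF t]
      by (elim mem_CE) (simp add: C_mult[OF _ f s] C_mult[OF _ h t] C_mult[OF _ mult_S[OF f h] simple_approx_mult[OF f h s t]]
          Cauchy_mult[OF h t] mult_mult mem)
  qed
  show "mmult C (\<lambda>_. 1) A = A" if "A \<in> mcarrier C" for A
    using that by (elim mem_CE) (simp add: C_mult[OF _ Linf_const simple_approx_const] mult_one mem)
  show "mscale C c A = mmult C (\<lambda>_. c) A" if "A \<in> mcarrier C" for c A
    using that by (elim mem_CE) (simp add: C_mult[OF _ Linf_const simple_approx_const] C_scale scale_eq mem)
  show "mpnorm C A \<in> Lp m p" if "A \<in> mcarrier C" for A
    using that by (elim mem_CE) (simp add: C_pnorm_in_Lp)
  show "AE x in m. 0 \<le> mpnorm C A x" if "A \<in> mcarrier C" for A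
    using that by (elim mem_CE) (simp add: C_pnorm_nonneg)
  show "AE x in m. mpnorm C (madd C A B) x \<le> mpnorm C A x + mpnorm C B x" if "A \<in> mcarrier C" "B \<in> mcarrier C" for A B
    using that by (elim mem_CE) (simp add: C_add C_pnorm_triangle)
  show "AE x in m. mpnorm C (mmult C f A) x = \<bar>f x\<bar> * mpnorm C A x" if f: "f \<in> Linf m" and A: "A \<in> mcarrier C" for f A
  proof -
    obtain s where s: "s \<in> simple_approx m f" using simple_approx_nonempty[OF f] by blast
    show ?thesis using A by (elim mem_CE) (simp add: C_mult[OF _ f s] C_pnorm_mult[OF _ f s])
  qed
  show "mnorm C A = Lp_norm m p (mpnorm C A)" if "A \<in> mcarrier C" for A
    using that by (elim mem_CE) (simp add: C_norm)
  show "A = mzero C" if A: "A \<in> mcarrier C" and z: "AE x in m. mpnorm C A x = 0" for A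
  proof -
    obtain X where X: "Cauchy X" "A = cls X" using A by (rule mem_CE)
    have "Lp_norm m p (mpnorm C (cls X)) = 0"
      using z X by (subst Lp_norm_eq_0_iff[OF p1 C_pnorm_in_Lp]) auto
    then have "(\<lambda>n. nm (X n)) \<longlonglongrightarrow> 0" using C_norm_lim[OF X(1)] by simp
    then show ?thesis using X by (simp add: C_zero cls_eq_iff Cauchy_const mem)
  qed
qed

abbreviation embed where "embed \<equiv> completion_embed N"

lemma embed_eq: "embed v = cls (\<lambda>_. v)"
  by (simp add: completion_embed_def cls_def)

lemma embed_in_C: "v \<in> V \<Longrightarrow> embed v \<in> mcarrier C"
  by (simp add: embed_eq cls_in_C Cauchy_const)

lemma C_norm_diff_lim:
  assumes X: "Cauchy X" and Y: "Cauchy Y"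
  shows "(\<lambda>n. nm (X n \<ominus> Y n)) \<longlonglongrightarrow> mnorm C (mdiff C (cls X) (cls Y))"
  using C_norm_lim[OF Cauchy_diff[OF X Y]] C_norm[OF Cauchy_diff[OF X Y]] by (simp add: C_diff X Y)

lemma embed_approx:
  assumes X: "Cauchy X"
  shows "mconverges C (\<lambda>n. embed (X n)) (cls X)"
  unfolding mconverges_def
proof (rule LIMSEQ_I)
  fix e :: real assume "0 < e"
  then have "0 < e/2" by simp
  then obtain K where K: "\<forall>i\<ge>K. \<forall>j\<ge>K. nm (X i \<ominus> X j) < e/2" using CauchyD[OF X] by blast
  interpret C: premodule m p "Linf m" C by (rule premodule_completion)
  have "mnorm C (mdiff C (embed (X n)) (cls X)) \<le> e/2" if "K \<le> n" for n
    unfolding embed_eq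
  proof (rule LIMSEQ_le_const2[OF C_norm_diff_lim[OF Cauchy_const[OF Cauchy_mem[OF X]] X]])
    show "\<exists>N. \<forall>j\<ge>N. nm (X n \<ominus> X j) \<le> e/2" using K that by (auto intro!: exI[of _ K] less_imp_le)
  qed
  then show "\<exists>K. \<forall>n\<ge>K. norm (mnorm C (mdiff C (embed (X n)) (cls X)) - 0) < e"
    using \<open>0 < e\<close> C.norm_nonneg[OF C.diff_closed[OF embed_in_C[OF Cauchy_mem[OF X]] cls_in_C[OF X]]]
    by (intro exI[of _ K]) fastforce
qed

lemma embed_norm_diff: "u \<in> V \<Longrightarrow> v \<in> V \<Longrightarrow> mnorm C (mdiff C (embed u) (embed v)) = nm (u \<ominus> v)"
  using C_norm_diff_lim[OF Cauchy_const Cauchy_const, of u v] by (simp add: embed_eq LIMSEQ_const_iff)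

text \<open>Embedded elements are dense, so the n-th term of a Cauchy sequence of classes is within
  1 / (n + 1) of some embedded \<open>Y n\<close>. The embedding is isometric, hence
  \<open>Y\<close> is Cauchy, and its class is the limit.\<close>

theorem complete_completion: "complete_module m p C"
proof (intro complete_module.intro premodule_completion complete_module_axioms.intro)
  interpret C: premodule m p "Linf m" C by (rule premodule_completion)
  fix A assume A: "mCauchy C A"
  then have AC: "A n \<in> mcarrier C" for n by (simp add: mCauchy_def)
  have "\<exists>v\<in>V. mnorm C (mdiff C (A n) (embed v)) < inverse (Suc n)" for n
  proof -
    obtain X where X: "Cauchy X" "A n = cls X" using AC by (rule mem_CE)
    have "\<forall>\<^sub>F k in sequentially. mnorm C (mdiff C (embed (X k)) (cls X)) < inverse (Suc n)"
      using embed_approx[OF X(1)] unfolding mconverges_def by (intro order_tendstoD) auto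
    then obtain k where "mnorm C (mdiff C (embed (X k)) (cls X)) < inverse (Suc n)"
      using eventually_happens'[OF sequentially_bot] by blast
    then show ?thesis
      using C.norm_diff_commute[OF embed_in_C[OF Cauchy_mem[OF X(1)]] cls_in_C[OF X(1)], of k] X Cauchy_mem[OF X(1)] by auto
  qed
  then obtain Y where Y: "\<And>n. Y n \<in> V" "\<And>n. mnorm C (mdiff C (A n) (embed (Y n))) < inverse (Suc n)" by metis
  note eY = embed_in_C[OF Y(1)]
  have lim: "(\<lambda>n. mnorm C (mdiff C (A n) (embed (Y n)))) \<longlonglongrightarrow> 0"
    by (rule Lim_null_comparison[OF _ LIMSEQ_inverse_real_of_nat])
      (use Y(2) C.norm_nonneg[OF C.diff_closed[OF AC eY]] in \<open>simp add: less_imp_le\<close>)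
  have CY: "Cauchy Y"
    unfolding mCauchy_def
  proof (intro conjI allI impI Y(1))
    fix e :: real assume "0 < e"
    then have e: "0 < e/3" by simp
    obtain K where K: "\<forall>i\<ge>K. \<forall>j\<ge>K. mnorm C (mdiff C (A i) (A j)) < e/3"
      using A e unfolding mCauchy_def by blast
    obtain L where L: "\<And>n. L \<le> n \<Longrightarrow> mnorm C (mdiff C (A n) (embed (Y n))) < e/3"
      using order_tendstoD(2)[OF lim e] by (auto simp: eventually_sequentially)
    show "\<exists>K. \<forall>i\<ge>K. \<forall>j\<ge>K. nm (Y i \<ominus> Y j) < e"
    proof (intro exI[of _ "max K L"] allI impI)
      fix i j assume ij: "max K L \<le> i" "max K L \<le> j"
      have "nm (Y i \<ominus> Y j) = mnorm C (mdiff C (embed (Y i)) (embed (Y j)))" by (simp add: embed_norm_diff Y)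
      also have "\<dots> \<le> mnorm C (mdiff C (embed (Y i)) (A i)) + mnorm C (mdiff C (A i) (embed (Y j)))"
        by (rule C.norm_diff_triangle[OF eY AC eY])
      also have "\<dots> \<le> mnorm C (mdiff C (embed (Y i)) (A i)) + (mnorm C (mdiff C (A i) (A j)) + mnorm C (mdiff C (A j) (embed (Y j))))"
        using C.norm_diff_triangle[OF AC AC eY] by simp
      also have "mnorm C (mdiff C (embed (Y i)) (A i)) = mnorm C (mdiff C (A i) (embed (Y i)))"
        by (rule C.norm_diff_commute[OF eY AC])
      also have "mnorm C (mdiff C (A i) (embed (Y i))) + (mnorm C (mdiff C (A i) (A j)) + mnorm C (mdiff C (A j) (embed (Y j)))) < e/3 + (e/3 + e/3)"
        using K L ij by (intro add_strict_mono) auto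
      finally show "nm (Y i \<ominus> Y j) < e" by simp
    qed
  qed
  have "mconverges C A (cls Y)"
    unfolding mconverges_def
  proof (rule Lim_null_comparison)
    show "(\<lambda>n. mnorm C (mdiff C (A n) (embed (Y n))) + mnorm C (mdiff C (embed (Y n)) (cls Y))) \<longlonglongrightarrow> 0"
      using tendsto_add[OF lim embed_approx[OF CY, unfolded mconverges_def]] by simp
    show "\<forall>\<^sub>F n in sequentially. norm (mnorm C (mdiff C (A n) (cls Y)))
        \<le> mnorm C (mdiff C (A n) (embed (Y n))) + mnorm C (mdiff C (embed (Y n)) (cls Y))"
      using C.norm_diff_triangle[OF AC eY cls_in_C[OF CY]] C.norm_nonneg[OF C.diff_closed[OF AC cls_in_C[OF CY]]] by simp
  qed
  then show "\<exists>v\<in>mcarrier C. mconverges C A v" using cls_in_C[OF CY] by blast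
qed

end

section \<open>The universal property of generated modules\<close>

lemma (in simple_premodule) embed_add: "\<lbrakk>u \<in> V; v \<in> V\<rbrakk> \<Longrightarrow> embed (u \<oplus> v) = madd C (embed u) (embed v)"
  by (simp add: embed_eq C_add Cauchy_const)

lemma (in simple_premodule) embed_scale: "v \<in> V \<Longrightarrow> embed (c \<odot> v) = mscale C c (embed v)"
  by (simp add: embed_eq C_scale Cauchy_const)

lemma (in simple_premodule) embed_diff: "\<lbrakk>u \<in> V; v \<in> V\<rbrakk> \<Longrightarrow> embed (u \<ominus> v) = mdiff C (embed u) (embed v)"
  by (simp add: embed_eq C_diff Cauchy_const)

lemma (in simple_premodule) embed_pnorm: "v \<in> V \<Longrightarrow> AE x in m. mpnorm C (embed v) x = pn v x"
  unfolding embed_eq by (rule C_pnorm_unique) (auto simp: Cauchy_const pnorm_in_Lp Lp_norm_zero[OF p1])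

text \<open>Extension of an isometric map from a dense subspace by limits. Compatibility with simple
  multipliers is enough, since a bounded function is a uniform limit of simple ones and
  multiplication is jointly continuous.\<close>

lemma (in simple_premodule) extend_isometry:
  fixes N' :: "('a, 'w) nmodule" and T0 :: "'v \<Rightarrow> 'w"
  assumes N': "complete_module m p N'"
    and mem: "\<And>v. v \<in> V \<Longrightarrow> T0 v \<in> mcarrier N'"
    and add: "\<And>u v. u \<in> V \<Longrightarrow> v \<in> V \<Longrightarrow> T0 (u \<oplus> v) = madd N' (T0 u) (T0 v)"
    and mult: "\<And>s v. simple_function m s \<Longrightarrow> v \<in> V \<Longrightarrow> T0 (s \<star> v) = mmult N' s (T0 v)"
    and iso: "\<And>v. v \<in> V \<Longrightarrow> AE x in m. mpnorm N' (T0 v) x = pn v x"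
  obtains T where "\<And>A. A \<in> mcarrier C \<Longrightarrow> T A \<in> mcarrier N'"
    "\<And>A B. A \<in> mcarrier C \<Longrightarrow> B \<in> mcarrier C \<Longrightarrow> T (madd C A B) = madd N' (T A) (T B)"
    "\<And>f A. f \<in> Linf m \<Longrightarrow> A \<in> mcarrier C \<Longrightarrow> T (mmult C f A) = mmult N' f (T A)"
    "\<And>A. A \<in> mcarrier C \<Longrightarrow> AE x in m. mpnorm N' (T A) x = mpnorm C A x"
    "\<And>v. v \<in> V \<Longrightarrow> T (embed v) = T0 v"
proof -
  interpret N': complete_module m p N' by (rule N')
  have nm0: "mnorm N' (T0 v) = nm v" if v: "v \<in> V" for v
    using iso[OF v] v mem[OF v] by (simp add: norm_eq_Lp_norm N'.norm_eq_Lp_norm Lp_norm_cong_AE[OF p1])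
  have diff0: "T0 (u \<ominus> v) = mdiff N' (T0 u) (T0 v)" if "u \<in> V" "v \<in> V" for u v
    using that mult[of "\<lambda>_. -1" v] mem by (simp add: mdiff_def add scale_eq N'.scale_eq)
  have ndiff: "mnorm N' (mdiff N' (T0 u) (T0 v)) = nm (u \<ominus> v)" if "u \<in> V" "v \<in> V" for u v
    using that nm0[of "u \<ominus> v"] by (simp add: diff0)
  have CT: "mCauchy N' (\<lambda>n. T0 (X n))" if X: "Cauchy X" for X
    using X mem by (auto simp: mCauchy_def ndiff)
  \<comment> \<open>The limit along any representative of the class; isometry makes all
    representatives give the same one, so the description is unique.\<close>
  define T where "T A = (THE v. v \<in> mcarrier N' \<and> (\<exists>X\<in>A. mconverges N' (\<lambda>n. T0 (X n)) v))" for A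
  have T: "T (cls X) \<in> mcarrier N' \<and> mconverges N' (\<lambda>n. T0 (X n)) (T (cls X))" if X: "Cauchy X" for X
  proof -
    obtain v where v: "v \<in> mcarrier N'" "mconverges N' (\<lambda>n. T0 (X n)) v" using N'.complete[OF CT[OF X]] by blast
    have "T (cls X) = v"
      unfolding T_def
    proof (rule the_equality)
      show "v \<in> mcarrier N' \<and> (\<exists>X\<in>cls X. mconverges N' (\<lambda>n. T0 (X n)) v)" using v mem_cls_iff[OF X] X by blast
      fix w assume "w \<in> mcarrier N' \<and> (\<exists>X\<in>cls X. mconverges N' (\<lambda>n. T0 (X n)) w)"
      then obtain Y where w: "w \<in> mcarrier N'" and Y: "Y \<in> cls X" "mconverges N' (\<lambda>n. T0 (Y n)) w" by blast
      have cY: "Cauchy Y" "cls X = cls Y" using Y(1) X by (auto simp: mem_cls_iff)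
      note memXY = Cauchy_mem[OF X] Cauchy_mem[OF cY(1)]
      have XY: "(\<lambda>n. nm (X n \<ominus> Y n)) \<longlonglongrightarrow> 0" using cY X by (simp add: cls_eq_iff)
      have "mconverges N' (\<lambda>n. T0 (X n)) w"
        unfolding mconverges_def
      proof (rule Lim_null_comparison)
        show "(\<lambda>n. nm (X n \<ominus> Y n) + mnorm N' (mdiff N' (T0 (Y n)) w)) \<longlonglongrightarrow> 0"
          using tendsto_add[OF XY Y(2)[unfolded mconverges_def]] by simp
        show "\<forall>\<^sub>F n in sequentially. norm (mnorm N' (mdiff N' (T0 (X n)) w)) \<le> nm (X n \<ominus> Y n) + mnorm N' (mdiff N' (T0 (Y n)) w)"
        proof (intro always_eventually allI)
          fix n
          show "norm (mnorm N' (mdiff N' (T0 (X n)) w)) \<le> nm (X n \<ominus> Y n) + mnorm N' (mdiff N' (T0 (Y n)) w)"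
            using N'.norm_diff_triangle[OF mem[OF memXY(1)[of n]] mem[OF memXY(2)[of n]] w] ndiff[OF memXY(1)[of n] memXY(2)[of n]]
              N'.norm_nonneg[OF N'.diff_closed[OF mem[OF memXY(1)[of n]] w]] by simp
        qed
      qed
      then show "w = v" using N'.mconverges_unique[OF mem[OF memXY(1)] w v(1) _ v(2)] by blast
    qed
    then show ?thesis using v by simp
  qed
  note Tmem = T[THEN conjunct1] and Tlim = T[THEN conjunct2]
  have Tuniq: "T (cls X) = v" if X: "Cauchy X" and v: "v \<in> mcarrier N'" "mconverges N' (\<lambda>n. T0 (X n)) v" for X v
    by (rule N'.mconverges_unique[OF mem[OF Cauchy_mem[OF X]] Tmem[OF X] v(1) Tlim[OF X] v(2)])
  show ?thesis
  proof (rule that)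
    show "T A \<in> mcarrier N'" if "A \<in> mcarrier C" for A
      using that by (elim mem_CE) (simp add: Tmem)
    show "T (madd C A B) = madd N' (T A) (T B)" if AB: "A \<in> mcarrier C" "B \<in> mcarrier C" for A B
    proof -
      obtain X where X: "Cauchy X" "A = cls X" by (rule mem_CE[OF AB(1)])
      obtain Y where Y: "Cauchy Y" "B = cls Y" by (rule mem_CE[OF AB(2)])
      note m' = Cauchy_mem[OF X(1)] Cauchy_mem[OF Y(1)]
      have "mconverges N' (\<lambda>n. madd N' (T0 (X n)) (T0 (Y n))) (madd N' (T (cls X)) (T (cls Y)))"
        by (rule N'.mconverges_add) (use X Y m' mem Tmem Tlim in auto)
      then show ?thesis
        using X Y m' Tmem by (simp add: C_add, intro Tuniq Cauchy_add) (auto simp: add)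
    qed
    show "T (mmult C f A) = mmult N' f (T A)" if f: "f \<in> Linf m" and A: "A \<in> mcarrier C" for f A
    proof -
      obtain X where X: "Cauchy X" "A = cls X" by (rule mem_CE[OF A])
      obtain s where s: "s \<in> simple_approx m f" using simple_approx_nonempty[OF f] by blast
      note ss = simple_approx_simple[OF s]
      note m' = Cauchy_mem[OF X(1)]
      let ?v = "T (cls X)"
      have v: "?v \<in> mcarrier N'" by (rule Tmem[OF X(1)])
      obtain c where c: "0 \<le> c" "\<forall>\<^sub>F n in sequentially. AE x in m. \<bar>s n x\<bar> \<le> c" by (rule simple_approx_bounded[OF f s])
      have "mconverges N' (\<lambda>n. mmult N' (s n) (T0 (X n))) (mmult N' f ?v)"
        unfolding mconverges_def
      proof (rule LIMSEQ_I)
        fix e :: real assume e: "0 < e"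
        obtain d where d: "0 < d" "(c + mnorm N' ?v) * d < e"
          by (rule ex_small_factor[of "c + mnorm N' ?v" e]) (use c N'.norm_nonneg[OF v] e in auto)
        have "\<forall>\<^sub>F n in sequentially. mnorm N' (mdiff N' (T0 (X n)) ?v) < d"
          using Tlim[OF X(1)] d unfolding mconverges_def by (intro order_tendstoD) auto
        then have "\<forall>\<^sub>F n in sequentially. mnorm N' (mdiff N' (mmult N' (s n) (T0 (X n))) (mmult N' f ?v)) < e"
          using c(2) simple_approx_close[OF s d(1)]
        proof eventually_elim
          case (elim n)
          have "mnorm N' (mdiff N' (mmult N' (s n) (T0 (X n))) (mmult N' f ?v))
              \<le> c * mnorm N' (mdiff N' (T0 (X n)) ?v) + d * mnorm N' ?v"
            using elim f simple_function_Linf[OF ss] by (intro N'.norm_mult_diff_le mem m' v) auto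
          also have "\<dots> \<le> c * d + d * mnorm N' ?v" using elim c d(1) by (intro add_mono mult_left_mono) auto
          finally show ?case using d by (simp add: algebra_simps)
        qed
        moreover have "0 \<le> mnorm N' (mdiff N' (mmult N' (s n) (T0 (X n))) (mmult N' f ?v))" for n
          using simple_function_Linf[OF ss] f v mem[OF m'] by (intro N'.norm_nonneg) auto
        ultimately show "\<exists>K. \<forall>n\<ge>K. norm (mnorm N' (mdiff N' (mmult N' (s n) (T0 (X n))) (mmult N' f ?v)) - 0) < e"
          by (auto simp: eventually_sequentially)
      qed
      then show ?thesis
        using X m' f v by (simp add: C_mult[OF _ f s], intro Tuniq Cauchy_mult[OF f s]) (auto simp: mult[OF ss])
    qed
    show "AE x in m. mpnorm N' (T A) x = mpnorm C A x" if A: "A \<in> mcarrier C" for A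
    proof -
      obtain X where X: "Cauchy X" "A = cls X" by (rule mem_CE[OF A])
      note m' = Cauchy_mem[OF X(1)]
      have "(\<lambda>n. Lp_norm m p (\<lambda>x. mpnorm N' (T0 (X n)) x - mpnorm N' (T (cls X)) x)) \<longlonglongrightarrow> 0"
        by (rule N'.mconverges_pnorm) (use mem m' Tmem Tlim X in auto)
      moreover have "Lp_norm m p (\<lambda>x. mpnorm N' (T0 (X n)) x - mpnorm N' (T (cls X)) x)
          = Lp_norm m p (\<lambda>x. pn (X n) x - mpnorm N' (T (cls X)) x)" for n
        using iso[OF m'[of n]] mem[OF m'[of n]] m'[of n] Tmem[OF X(1)]
        by (intro Lp_norm_cong_AE p1 borel_measurable_diff) (auto elim!: eventually_mono)
      ultimately have "AE x in m. mpnorm C (cls X) x = mpnorm N' (T (cls X)) x"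
        by (intro C_pnorm_unique X N'.pnorm_in_Lp Tmem) simp
      then show ?thesis using X(2) by (auto elim: eventually_mono)
    qed
    show "T (embed v) = T0 v" if "v \<in> V" for v
      unfolding embed_eq by (rule Tuniq) (use that mem in \<open>auto simp: Cauchy_const N'.mconverges_const\<close>)
  qed
qed

section \<open>The generated module, its differential and its universal property\<close>

context subadditive_functional
begin

sublocale pre: simple_premodule m p M
  by (rule simple_premodule.intro[OF premodule_Pfm_quotient])

abbreviation G where "G \<equiv> generated_module m p D g"
abbreviation dif where "dif \<equiv> generated_diff m p D g"

lemma G_eq: "G = completion m p M"
  by (simp add: generated_module_def)

lemma dif_eq: "dif f = pre.embed (cls (single_family m f))"
  by (simp add: generated_diff_def cls_def)

theorem complete_generated: "complete_module m p G"
  unfolding G_eq by (rule pre.complete_completion)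

lemma dif_in_G: "f \<in> D \<Longrightarrow> dif f \<in> mcarrier G"
  by (simp add: dif_eq G_eq pre.embed_in_C cls_in_M P_single)

lemma dif_add: "\<lbrakk>f \<in> D; h \<in> D\<rbrakk> \<Longrightarrow> dif (\<lambda>x. f x + h x) = madd G (dif f) (dif h)"
proof -
  assume fh: "f \<in> D" "h \<in> D"
  have "cls (single_family m (\<lambda>x. f x + h x)) = cls (Pfm_add (single_family m f) (single_family m h))"
    by (rule cls_cong) (use fh in \<open>auto simp: P_single D_add P_add family_at_single family_at_add[OF P_partition P_partition]\<close>)
  then show ?thesis using fh by (simp add: dif_eq G_eq pre.embed_add[symmetric] cls_in_M P_single M_add)
qed

lemma dif_scale: "f \<in> D \<Longrightarrow> dif (\<lambda>x. c * f x) = mscale G c (dif f)"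
proof -
  assume f: "f \<in> D"
  have "cls (single_family m (\<lambda>x. c * f x)) = cls (Pfm_scale c (single_family m f))"
    by (rule cls_cong) (use f in \<open>auto simp: P_single D_scale P_scale family_at_single family_at_scale[OF P_partition]\<close>)
  then show ?thesis using f by (simp add: dif_eq G_eq pre.embed_scale[symmetric] cls_in_M P_single M_scale)
qed

lemma dif_pnorm: "f \<in> D \<Longrightarrow> AE x in m. mpnorm G (dif f) x = g f x"
proof -
  assume f: "f \<in> D"
  show ?thesis
    using pre.embed_pnorm[OF cls_in_M[OF P_single[OF f]]] M_pnorm[OF P_single[OF f]] AE_space
    unfolding dif_eq G_eq by eventually_elim (simp add: family_at_single)
qed

lemma M_diff_pnorm:
  assumes F: "F \<in> P" and H: "H \<in> P"
  shows "AE x in m. mpnorm M (mdiff M (cls F) (cls H)) x = g (\<lambda>y. family_at F x y - family_at H x y) x"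
proof -
  have eq: "mdiff M (cls F) (cls H) = cls (Pfm_add F (Pfm_scale (-1) H))"
    by (simp add: mdiff_def M_scale M_add F H P_scale)
  show ?thesis
    unfolding eq using M_pnorm[OF P_add[OF F P_scale[OF H, of "-1"]]] AE_space
    by eventually_elim (simp add: family_at_add[OF P_partition P_partition] family_at_scale[OF P_partition] F H P_scale)
qed

text \<open>On its i-th set a family prescribes the i-th function, so there its class is the
  differential of that function. This is how pieces of families are traced back to
  differentials.\<close>

lemma embed_cls_eq_dif:
  assumes F: "F \<in> P"
  shows "mmult G (indicator (snd (F i))) (pre.embed (cls F)) = mmult G (indicator (snd (F i))) (dif (fst (F i)))"
proof -
  interpret G: complete_module m p G by (rule complete_generated)
  have fD: "fst (F i) \<in> D" and A: "snd (F i) \<in> sets m"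
    using P_mem[OF F] P_partition[OF F] by (auto simp: borel_partition_def)
  note c = cls_in_M[OF F] cls_in_M[OF P_single[OF fD]]
  have "AE x in m. mpnorm G (mdiff G (pre.embed (cls F)) (dif (fst (F i)))) x
      = g (\<lambda>y. family_at F x y - family_at (single_family m (fst (F i))) x y) x"
    using pre.embed_pnorm[OF pre.diff_closed[OF c]] M_diff_pnorm[OF F P_single[OF fD]]
    unfolding dif_eq G_eq pre.embed_diff[OF c, symmetric] by eventually_elim simp
  then have "AE x in m. x \<in> snd (F i) \<longrightarrow> mpnorm G (mdiff G (pre.embed (cls F)) (dif (fst (F i)))) x = 0"
    using g_zero AE_space by eventually_elim (auto simp: family_at_single family_at_eq[OF P_partition[OF F]])
  then show ?thesis
    using G.indicator_mult_eq_iff[OF _ dif_in_G[OF fD] A] pre.embed_in_C[OF c(1)] by (simp add: G_eq)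
qed

text \<open>The differentials generate the module: a family class coincides piecewise with
  differentials and belongs to \<open>W\<close> by the partition lemma, and such classes are
  dense.\<close>

lemma closed_subspace_dif_eq:
  assumes W: "closed_subspace m G W" and dW: "\<And>f. f \<in> D \<Longrightarrow> dif f \<in> W"
  shows "W = mcarrier G"
proof
  interpret G: complete_module m p G by (rule complete_generated)
  show "W \<subseteq> mcarrier G" using W by (simp add: closed_subspace_def)
  have emb: "pre.embed (cls F) \<in> W" if F: "F \<in> P" for F
  proof (rule G.closed_subspace_partition[OF W])
    have part: "borel_partition m (\<lambda>i. snd (F i))" by (rule P_partition[OF F])
    show "snd (F i) \<in> sets m" for i using part by (simp add: borel_partition_def)
    show "(\<Union>i. snd (F i)) = space m" using part by (simp add: borel_partition_def)
    show "pre.embed (cls F) \<in> mcarrier G" using pre.embed_in_C[OF cls_in_M[OF F]] by (simp add: G_eq)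
    show "mmult G (indicator (snd (F i))) (pre.embed (cls F)) \<in> W" for i
      unfolding embed_cls_eq_dif[OF F] using part
      by (intro closed_subspaceD(4)[OF W] dW P_mem F Linf_indicator) (simp add: borel_partition_def)
  qed
  show "mcarrier G \<subseteq> W"
  proof
    fix A assume A: "A \<in> mcarrier G"
    then obtain X where X: "mCauchy M X" "A = pre.cls X" unfolding G_eq by (rule pre.mem_CE)
    have "pre.embed (X n) \<in> W" for n
      using pre.Cauchy_mem[OF X(1), of n] emb by (elim mem_ME) simp
    moreover have "mconverges G (\<lambda>n. pre.embed (X n)) A"
      using pre.embed_approx[OF X(1)] by (simp add: G_eq X(2))
    ultimately show "A \<in> W" by (rule closed_subspaceD(5)[OF W A])
  qed
qed

text \<open>A complete module with a linear map \<open>L\<close> whose pointwise norm is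
  \<open>g\<close>, generated by the values of \<open>L\<close>, is the generated module up to
  isometry. A family is sent to the element glued from the values of \<open>L\<close> on its pieces,
  and this isometry is extended to the completion.\<close>

theorem generated_module_universal:
  fixes N :: "('a, 'w) nmodule" and L :: "('a \<Rightarrow> real) \<Rightarrow> 'w"
  assumes N: "complete_module m p N"
    and L_mem: "\<And>f. f \<in> D \<Longrightarrow> L f \<in> mcarrier N"
    and L_add: "\<And>f h. f \<in> D \<Longrightarrow> h \<in> D \<Longrightarrow> L (\<lambda>x. f x + h x) = madd N (L f) (L h)"
    and L_scale: "\<And>c f. f \<in> D \<Longrightarrow> L (\<lambda>x. c * f x) = mscale N c (L f)"
    and L_pnorm: "\<And>f. f \<in> D \<Longrightarrow> AE x in m. mpnorm N (L f) x = g f x"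
    and gen: "\<And>W. closed_subspace m N W \<Longrightarrow> (\<And>f. f \<in> D \<Longrightarrow> L f \<in> W) \<Longrightarrow> W = mcarrier N"
  shows "Lp_module_isomorphic m p G N"
proof -
  interpret N: complete_module m p N by (rule N)
  interpret G: complete_module m p G by (rule complete_generated)
  have L_diff: "L (\<lambda>x. f x - h x) = mdiff N (L f) (L h)" if "f \<in> D" "h \<in> D" for f h
    using that L_add[of f "\<lambda>x. -1 * h x"] L_scale[of h "-1"] D_scale[of h "-1"] by (simp add: mdiff_def)
  \<comment> \<open>\<open>rep F v\<close> says that \<open>v\<close> equals \<open>L\<close> of the
    i-th function on the i-th set, expressed through the function prescribed at each point so that
    the indices disappear.\<close>
  define rep where "rep F v \<longleftrightarrow> v \<in> mcarrier N \<and> (AE x in m. mpnorm N (mdiff N v (L (family_at F x))) x = 0)" for F v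
  have rep_mem: "v \<in> mcarrier N" if "rep F v" for F v using that by (simp add: rep_def)
  have rep_ex: "\<exists>v. rep F v" if F: "F \<in> P" for F
  proof -
    have part: "borel_partition m (\<lambda>i. snd (F i))" by (rule P_partition[OF F])
    let ?A = "\<lambda>i. snd (F i)" and ?L = "\<lambda>i. L (fst (F i))"
    have A: "?A i \<in> sets m" for i using part by (simp add: borel_partition_def)
    have disj: "disjoint_family ?A" using part by (simp add: borel_partition_def)
    have LN: "?L i \<in> mcarrier N" for i by (intro L_mem P_mem F)
    let ?s = "msum N (\<lambda>i. mmult N (indicator (?A i)) (?L i))"
    have s: "?s n \<in> mcarrier N" for n by (rule N.msum_closed) (simp add: A LN)
    have "AE x in m. \<forall>i. mpnorm N (mmult N (indicator (?A i)) (?L i)) x = indicator (?A i) x * g (fst (F i)) x"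
      unfolding AE_all_countable
    proof
      fix i
      show "AE x in m. mpnorm N (mmult N (indicator (?A i)) (?L i)) x = indicator (?A i) x * g (fst (F i)) x"
        using N.pnorm_mult[OF N.S_indicator[OF A] LN, of i i] L_pnorm[OF P_mem[OF F], of i] by eventually_elim simp
    qed
    note pm = this
    have "AE x in m. \<forall>i. 0 \<le> g (fst (F i)) x" unfolding AE_all_countable using g_nonneg P_mem[OF F] by blast
    note gn = this
    \<comment> \<open>At most one piece contributes at each point, so the partial sums stay below
      the slope of the family, which is in L^p. This is the uniform bound that glueing asks
      for.\<close>
    have bd: "AE x in m. mpnorm N (?s n) x \<le> (if x \<in> (\<Union>i<n. ?A i) then g (family_at F x) x else 0)" for n
    proof (induction n)
      case 0
      have "AE x in m. mpnorm N (mzero N) x = 0" by (rule N.pnorm_zero)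
      then show ?case by (rule eventually_mono) simp
    next
      case (Suc n)
      have "AE x in m. mpnorm N (?s (Suc n)) x \<le> mpnorm N (?s n) x + mpnorm N (mmult N (indicator (?A n)) (?L n)) x"
        using N.pnorm_triangle[OF s, of "mmult N (indicator (?A n)) (?L n)" n] A LN by simp
      then show ?case
        using Suc pm gn
      proof eventually_elim
        case (elim x)
        show ?case
        proof (cases "x \<in> ?A n")
          case True
          then have "x \<notin> (\<Union>i<n. ?A i)" using disjoint_familyD[OF disj True] by blast
          then show ?thesis using elim True family_at_eq[OF part True] by (auto simp: lessThan_Suc)
        next
          case False
          then show ?thesis using elim by (auto simp: lessThan_Suc)
        qed
      qed
    qed
    have "mnorm N (?s n) \<le> Lp_norm m p (\<lambda>x. g (family_at F x) x)" for n
    proof (rule N.norm_mono[OF s P_in_Lp[OF F]])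
      show "AE x in m. mpnorm N (?s n) x \<le> g (family_at F x) x"
        using bd[of n] gn
      proof eventually_elim
        case (elim x)
        have "0 \<le> g (family_at F x) x" using elim(2) by (simp add: family_at_def)
        then show ?case using elim(1) by (auto split: if_splits)
      qed
    qed
    note bound = this
    obtain v where "v \<in> mcarrier N" "mconverges N ?s v"
      and "\<And>i. mmult N (indicator (?A i)) v = mmult N (indicator (?A i)) (?L i)"
      by (rule N.glueing_disjoint[of ?L ?A, OF LN A disj bound]) (rule that)
    note v = this(1,3)
    have "AE x in m. \<forall>i. x \<in> ?A i \<longrightarrow> mpnorm N (mdiff N v (?L i)) x = 0"
      unfolding AE_all_countable using N.indicator_mult_eq_iff[OF v(1) LN A] v(2) by blast
    then have "AE x in m. mpnorm N (mdiff N v (L (family_at F x))) x = 0"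
      using AE_space
    proof eventually_elim
      case (elim x)
      obtain i where i: "x \<in> ?A i" by (rule borel_partitionE[OF part elim(2)])
      then show ?case using elim(1) family_at_eq[OF part i] by simp
    qed
    then show ?thesis using v(1) by (auto simp: rep_def)
  qed
  \<comment> \<open>This identity makes the assignment well defined on classes: equivalent families
    give elements at pointwise distance 0. The inner estimate is proved for fixed functions and then
    spread over the families.\<close>
  have rep_diff: "AE x in m. mpnorm N (mdiff N v w) x = g (\<lambda>y. family_at F x y - family_at H x y) x"
    if F: "F \<in> P" "rep F v" and H: "H \<in> P" "rep H w" for F H v w
  proof -
    note vw = rep_mem[OF F(2)] rep_mem[OF H(2)]
    have "AE x in m. \<bar>mpnorm N (mdiff N v w) x - g (\<lambda>y. family_at F x y - family_at H x y) x\<bar>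
        \<le> mpnorm N (mdiff N v (L (family_at F x))) x + mpnorm N (mdiff N w (L (family_at H x))) x"
    proof (rule AE_family[OF F(1) H(1) F(1)])
      fix f h k assume fh: "f \<in> D" "h \<in> D" "k \<in> D"
      note Lm = L_mem[OF fh(1)] L_mem[OF fh(2)]
      show "AE x in m. \<bar>mpnorm N (mdiff N v w) x - g (\<lambda>y. f y - h y) x\<bar> \<le> mpnorm N (mdiff N v (L f)) x + mpnorm N (mdiff N w (L h)) x"
        using L_pnorm[OF D_diff[OF fh(1,2)]] N.pnorm_diff_triangle[OF vw(1) Lm(1) vw(2)] N.pnorm_diff_triangle[OF Lm(1,2) vw(2)]
          N.pnorm_diff_triangle[OF Lm(1) vw(1) Lm(2)] N.pnorm_diff_triangle[OF vw Lm(2)]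
          N.pnorm_diff_commute[OF vw(1) Lm(1)] N.pnorm_diff_commute[OF vw(2) Lm(2)]
        unfolding L_diff[OF fh(1,2)] by eventually_elim linarith
    qed
    then show ?thesis using F(2) H(2) unfolding rep_def by (elim conjE) (elim AE_mp, auto)
  qed
  have rep_pnorm: "AE x in m. mpnorm N v x = g (family_at F x) x" if F: "F \<in> P" "rep F v" for F v
  proof -
    note v = rep_mem[OF F(2)]
    have "AE x in m. \<bar>mpnorm N v x - g (family_at F x) x\<bar> \<le> mpnorm N (mdiff N v (L (family_at F x))) x"
    proof (rule AE_family[OF F(1) F(1) F(1)])
      fix f h k assume f: "f \<in> D"
      show "AE x in m. \<bar>mpnorm N v x - g f x\<bar> \<le> mpnorm N (mdiff N v (L f)) x"
        using N.pnorm_rev_triangle[OF v L_mem[OF f]] L_pnorm[OF f] by eventually_elim simp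
    qed
    then show ?thesis using F(2) unfolding rep_def by (elim conjE) (elim AE_mp, auto)
  qed
  have rep_add: "rep (Pfm_add F H) (madd N v w)"
    if F: "F \<in> P" "rep F v" and H: "H \<in> P" "rep H w" for F H v w
  proof -
    note vw = rep_mem[OF F(2)] rep_mem[OF H(2)]
    have le: "AE x in m. mpnorm N (mdiff N (madd N v w) (L (\<lambda>y. family_at F x y + family_at H x y))) x
        \<le> mpnorm N (mdiff N v (L (family_at F x))) x + mpnorm N (mdiff N w (L (family_at H x))) x"
    proof (rule AE_family[OF F(1) H(1) F(1)])
      fix f h k assume fh: "f \<in> D" "h \<in> D" "k \<in> D"
      note Lm = L_mem[OF fh(1)] L_mem[OF fh(2)]
      show "AE x in m. mpnorm N (mdiff N (madd N v w) (L (\<lambda>y. f y + h y))) x \<le> mpnorm N (mdiff N v (L f)) x + mpnorm N (mdiff N w (L h)) x"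
        unfolding L_add[OF fh(1,2)] N.add_diff_add[OF vw Lm]
        by (rule N.pnorm_triangle) (use vw Lm in auto)
    qed
    have pos: "AE x in m. 0 \<le> mpnorm N (mdiff N (madd N v w) (L (\<lambda>y. family_at F x y + family_at H x y))) x"
      by (rule AE_family[OF F(1) H(1) F(1)]) (intro N.pnorm_nonneg N.diff_closed N.add_closed vw L_mem D_add)
    have "AE x in m. mpnorm N (mdiff N v (L (family_at F x))) x = 0" "AE x in m. mpnorm N (mdiff N w (L (family_at H x))) x = 0"
      using F(2) H(2) by (auto simp: rep_def)
    then have "AE x in m. mpnorm N (mdiff N (madd N v w) (L (family_at (Pfm_add F H) x))) x = 0"
      using le pos AE_space by eventually_elim (simp add: family_at_add[OF P_partition[OF F(1)] P_partition[OF H(1)]])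
    then show ?thesis using vw by (simp add: rep_def)
  qed
  have rep_mult: "rep (Pfm_mult a B F) (mmult N s v)"
    if F: "F \<in> P" "rep F v" and s: "simple_function m s" and aB: "(a, B) \<in> simple_reps m s" for F v s a B
  proof -
    note v = rep_mem[OF F(2)] and sL = simple_function_Linf[OF s]
    \<comment> \<open>The transfer to varying coefficients needs a statement with a constant c in
      place of s x; the extra term with s x - c is the price for comparing s v with c v, and it
      vanishes when s x is substituted for c.\<close>
    have le: "AE x in m. mpnorm N (mdiff N (mmult N s v) (L (\<lambda>y. s x * family_at F x y))) x
        \<le> \<bar>s x - s x\<bar> * mpnorm N v x + \<bar>s x\<bar> * mpnorm N (mdiff N v (L (family_at F x))) x"
    proof (rule AE_family_simple[OF s F(1) F(1), where R = "\<lambda>c f h x. mpnorm N (mdiff N (mmult N s v) (L (\<lambda>y. c * f y))) x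
        \<le> \<bar>s x - c\<bar> * mpnorm N v x + \<bar>c\<bar> * mpnorm N (mdiff N v (L f)) x"])
      fix c f h assume f: "f \<in> D"
      note Lf = L_mem[OF f]
      have cv: "mscale N c v \<in> mcarrier N" "mmult N s v \<in> mcarrier N" "mscale N c (L f) \<in> mcarrier N" using v Lf sL by auto
      have "AE x in m. mpnorm N (mdiff N (mmult N s v) (mscale N c v)) x = \<bar>s x - c\<bar> * mpnorm N v x"
        using N.pnorm_diff_mult[OF sL N.S_const v] by (simp add: N.scale_eq v)
      moreover have "AE x in m. mpnorm N (mdiff N (mscale N c v) (mscale N c (L f))) x = \<bar>c\<bar> * mpnorm N (mdiff N v (L f)) x"
        using N.pnorm_scale[OF N.diff_closed[OF v Lf], of c] by (simp add: N.scale_diff_right v Lf)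
      ultimately show "AE x in m. mpnorm N (mdiff N (mmult N s v) (L (\<lambda>y. c * f y))) x
        \<le> \<bar>s x - c\<bar> * mpnorm N v x + \<bar>c\<bar> * mpnorm N (mdiff N v (L f)) x"
        unfolding L_scale[OF f] using N.pnorm_diff_triangle[OF cv(2) cv(1) cv(3)] by eventually_elim simp
    qed
    have pos: "AE x in m. 0 \<le> mpnorm N (mdiff N (mmult N s v) (L (\<lambda>y. s x * family_at F x y))) x"
      by (rule AE_family_simple[OF s F(1) F(1), where R = "\<lambda>c f h x. 0 \<le> mpnorm N (mdiff N (mmult N s v) (L (\<lambda>y. c * f y))) x"])
        (intro N.pnorm_nonneg N.diff_closed N.mult_closed sL v L_mem D_scale)
    have "AE x in m. mpnorm N (mdiff N v (L (family_at F x))) x = 0" using F(2) by (simp add: rep_def)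
    then have "AE x in m. mpnorm N (mdiff N (mmult N s v) (L (family_at (Pfm_mult a B F) x))) x = 0"
      using le pos AE_space by eventually_elim (simp add: family_at_mult[OF P_partition[OF F(1)] aB])
    then show ?thesis using v sL by (simp add: rep_def)
  qed
  define T0 where "T0 E = (SOME v. \<exists>F\<in>P. E = cls F \<and> rep F v)" for E
  have T0: "T0 (cls F) = v" if F: "F \<in> P" "rep F v" for F v
  proof -
    have "\<exists>H\<in>P. cls F = cls H \<and> rep H (T0 (cls F))"
      unfolding T0_def by (rule someI[of "\<lambda>v. \<exists>H\<in>P. cls F = cls H \<and> rep H v"]) (use F in blast)
    then obtain H where H: "H \<in> P" "cls F = cls H" "rep H (T0 (cls F))" by blast
    have "AE x in m. mpnorm N (mdiff N (T0 (cls F)) v) x = 0"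
      using rep_diff[OF H(1,3) F] cls_eq_iff[OF H(1) F(1), THEN iffD1, OF H(2)[symmetric]] by eventually_elim simp
    then show ?thesis using N.eq_iff_pnorm[OF rep_mem[OF H(3)] rep_mem[OF F(2)]] by simp
  qed
  obtain T where T: "\<And>A. A \<in> mcarrier (completion m p M) \<Longrightarrow> T A \<in> mcarrier N"
    "\<And>A B. A \<in> mcarrier (completion m p M) \<Longrightarrow> B \<in> mcarrier (completion m p M) \<Longrightarrow> T (madd (completion m p M) A B) = madd N (T A) (T B)"
    "\<And>f A. f \<in> Linf m \<Longrightarrow> A \<in> mcarrier (completion m p M) \<Longrightarrow> T (mmult (completion m p M) f A) = mmult N f (T A)"
    "\<And>A. A \<in> mcarrier (completion m p M) \<Longrightarrow> AE x in m. mpnorm N (T A) x = mpnorm (completion m p M) A x"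
    "\<And>v. v \<in> mcarrier M \<Longrightarrow> T (pre.embed v) = T0 v"
  proof (rule pre.extend_isometry[OF N, of T0])
    show "T0 v \<in> mcarrier N" if v: "v \<in> mcarrier M" for v
    proof -
      obtain F where F: "F \<in> P" "v = cls F" by (rule mem_ME[OF v])
      obtain w where "rep F w" using rep_ex[OF F(1)] by blast
      then show ?thesis using T0[OF F(1)] F(2) rep_mem by simp
    qed
    show "T0 (madd M u v) = madd N (T0 u) (T0 v)" if u: "u \<in> mcarrier M" and v: "v \<in> mcarrier M" for u v
    proof -
      obtain F where F: "F \<in> P" "u = cls F" by (rule mem_ME[OF u])
      obtain H where H: "H \<in> P" "v = cls H" by (rule mem_ME[OF v])
      obtain a where a: "rep F a" using rep_ex[OF F(1)] by blast
      obtain b where b: "rep H b" using rep_ex[OF H(1)] by blast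
      show ?thesis
        using T0[OF P_add[OF F(1) H(1)] rep_add[OF F(1) a H(1) b]] T0[OF F(1) a] T0[OF H(1) b] F H by (simp add: M_add)
    qed
    show "T0 (mmult M s v) = mmult N s (T0 v)" if s: "simple_function m s" and v: "v \<in> mcarrier M" for s v
    proof -
      obtain F where F: "F \<in> P" "v = cls F" by (rule mem_ME[OF v])
      obtain b where b: "rep F b" using rep_ex[OF F(1)] by blast
      obtain aB where "aB \<in> simple_reps m s" using simple_reps_nonempty[OF s] by blast
      then have aB: "(fst aB, snd aB) \<in> simple_reps m s" by simp
      show ?thesis
        using T0[OF P_mult[OF F(1) s aB] rep_mult[OF F(1) b s aB]] T0[OF F(1) b] F by (simp add: M_mult[OF F(1) s aB])
    qed
    show "AE x in m. mpnorm N (T0 v) x = mpnorm M v x" if v: "v \<in> mcarrier M" for v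
    proof -
      obtain F where F: "F \<in> P" "v = cls F" by (rule mem_ME[OF v])
      obtain b where b: "rep F b" using rep_ex[OF F(1)] by blast
      show ?thesis unfolding F(2) T0[OF F(1) b] using rep_pnorm[OF F(1) b] M_pnorm[OF F(1)] by eventually_elim simp
    qed
  qed (rule that)
  note T = T[folded G_eq]
  have T_scale: "T (mscale G c A) = mscale N c (T A)" if "A \<in> mcarrier G" for c A
    using that T(1,3) by (simp add: G.scale_eq N.scale_eq N.S_const)
  have T_diff: "T (mdiff G A B) = mdiff N (T A) (T B)" if "A \<in> mcarrier G" "B \<in> mcarrier G" for A B
    using that by (simp add: mdiff_def T(2) T_scale)
  have T_norm: "mnorm N (T A) = mnorm G A" if A: "A \<in> mcarrier G" for A
    using T(4)[OF A] A T(1)[OF A] by (simp add: G.norm_eq_Lp_norm N.norm_eq_Lp_norm Lp_norm_cong_AE[OF p1])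
  have T_dif: "T (dif f) = L f" if f: "f \<in> D" for f
  proof -
    have "AE x in m. mpnorm N (mdiff N (L f) (L (family_at (single_family m f) x))) x = 0"
      using N.pnorm_zero AE_space by eventually_elim (simp add: family_at_single L_mem f)
    then have "rep (single_family m f) (L f)" by (simp add: rep_def L_mem f)
    then show ?thesis unfolding dif_eq using T(5) T0 cls_in_M P_single f by simp
  qed
  have inj: "inj_on T (mcarrier G)"
  proof (rule inj_onI)
    fix A B assume AB: "A \<in> mcarrier G" "B \<in> mcarrier G" "T A = T B"
    have "mnorm G (mdiff G A B) = 0"
      using T_norm[of "mdiff G A B"] T_diff[OF AB(1,2)] AB T(1) by simp
    then show "A = B" using AB by (simp add: G.norm_eq_zero G.diff_eq_zero_iff)
  qed
  \<comment> \<open>The image of a complete module under an isometry is complete, hence closed. It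
    contains every value of \<open>L\<close>, so by the generation hypothesis it is
    everything.\<close>
  have surj: "T ` mcarrier G = mcarrier N"
  proof (rule gen)
    show "L f \<in> T ` mcarrier G" if "f \<in> D" for f using imageI[OF dif_in_G[OF that], of T] by (simp add: T_dif[OF that])
    show "closed_subspace m N (T ` mcarrier G)"
    proof (rule closed_subspaceI)
      show "T ` mcarrier G \<subseteq> mcarrier N" using T(1) by blast
      have "T (mzero G) = mzero N"
        using T_norm[of "mzero G"] T(1)[of "mzero G"] by (simp add: N.norm_eq_zero)
      then show "mzero N \<in> T ` mcarrier G" by (metis G.zero_closed imageI)
      show "madd N u v \<in> T ` mcarrier G" if uv: "u \<in> T ` mcarrier G" "v \<in> T ` mcarrier G" for u v
      proof -
        obtain A B where AB: "A \<in> mcarrier G" "B \<in> mcarrier G" "u = T A" "v = T B" using uv by blast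
        show ?thesis unfolding AB(3,4) T(2)[OF AB(1,2), symmetric] by (intro imageI G.add_closed AB)
      qed
      show "mmult N f v \<in> T ` mcarrier G" if f: "f \<in> Linf m" and v: "v \<in> T ` mcarrier G" for f v
      proof -
        obtain A where A: "A \<in> mcarrier G" "v = T A" using v by blast
        show ?thesis unfolding A(2) T(3)[OF f A(1), symmetric] by (intro imageI G.mult_closed f A)
      qed
      show "v \<in> T ` mcarrier G"
        if v: "v \<in> mcarrier N" and X: "\<And>n. X n \<in> T ` mcarrier G" and lim: "mconverges N X v" for X v
      proof -
        have "\<forall>n. \<exists>A. A \<in> mcarrier G \<and> X n = T A" using X by blast
        from choice[OF this] obtain A where A: "\<And>n. A n \<in> mcarrier G" "\<And>n. X n = T (A n)" by blast
        have "mCauchy N X" by (rule N.mconverges_Cauchy[OF _ v lim]) (use A T(1) in auto)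
        moreover have eq: "mnorm N (mdiff N (X i) (T B)) = mnorm G (mdiff G (A i) B)" if "B \<in> mcarrier G" for i B
          using T_norm[of "mdiff G (A i) B"] A that by (simp add: T_diff)
        ultimately have "mCauchy G A" using A eq[OF A(1)] unfolding mCauchy_def by simp
        then obtain B where B: "B \<in> mcarrier G" "mconverges G A B" using G.complete by blast
        then have "mconverges N X (T B)" unfolding mconverges_def by (simp add: eq)
        then have "v = T B" using N.mconverges_unique[OF _ v T(1)[OF B(1)] lim] A T(1) by simp
        then show ?thesis using B by blast
      qed
    qed
  qed
  show ?thesis
    unfolding Lp_module_isomorphic_def
    using G.Lp_normed_module N.Lp_normed_module inj surj T T_scale T_norm
    by (intro conjI exI[of _ T]) (auto simp: bij_betw_def)
qed

end

section \<open>Separation of points from convex sets\<close>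

context premodule
begin

text \<open>Homogeneity is asked for only as an inequality with positive factors, which is what
  infima of such functionals satisfy at once; equality and the value at zero follow by scaling
  back.\<close>

definition sublinear :: "('v \<Rightarrow> real) \<Rightarrow> bool" where
  "sublinear q \<longleftrightarrow> (\<forall>u\<in>V. \<forall>v\<in>V. q (u \<oplus> v) \<le> q u + q v) \<and> (\<forall>c>0. \<forall>v\<in>V. q (c \<odot> v) \<le> c * q v)"

lemma sublinearD:
  assumes "sublinear q"
  shows "u \<in> V \<Longrightarrow> v \<in> V \<Longrightarrow> q (u \<oplus> v) \<le> q u + q v" "0 < c \<Longrightarrow> v \<in> V \<Longrightarrow> q (c \<odot> v) \<le> c * q v"
  using assms by (auto simp: sublinear_def)

lemma sublinear_zero: assumes q: "sublinear q" shows "q \<zero> = 0"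
  using sublinearD(2)[OF q, of 2 \<zero>] sublinearD(2)[OF q, of "1/2" \<zero>] by simp

lemma sublinear_scale: assumes q: "sublinear q" and c: "0 < c" and v: "v \<in> V" shows "q (c \<odot> v) = c * q v"
proof (rule antisym)
  show "q (c \<odot> v) \<le> c * q v" by (rule sublinearD(2)[OF q c v])
  have "q v \<le> (1 / c) * q (c \<odot> v)"
    using sublinearD(2)[OF q, of "1 / c" "c \<odot> v"] c v by (simp add: scale_scale)
  then show "c * q v \<le> q (c \<odot> v)" using c by (simp add: field_simps)
qed

lemma add_uminus: "v \<in> V \<Longrightarrow> v \<oplus> (-1) \<odot> v = \<zero>"
  using diff_self[of v] by (simp add: mdiff_def)

lemma add_uminus_cancel: "x \<in> V \<Longrightarrow> w \<in> V \<Longrightarrow> (x \<oplus> w) \<oplus> (-1) \<odot> x = w"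
  using add_diff_add[of x w x \<zero>] by (simp add: mdiff_def[of N "x \<oplus> w" x])

lemma sublinear_lower:
  assumes q: "sublinear q" and q0: "\<And>v. v \<in> V \<Longrightarrow> q v \<le> q0 v" and v: "v \<in> V"
  shows "- q0 ((-1) \<odot> v) \<le> q v"
  using sublinearD(1)[OF q v scale_closed[OF v], of "-1"] add_uminus[OF v] sublinear_zero[OF q] q0[OF scale_closed[OF v], of "-1"]
  by simp

text \<open>A minimal sublinear functional below a given one is linear, so no extension from subspaces is needed.\<close>

lemma Hahn_Banach:
  assumes q0: "sublinear q0"
  obtains \<phi> where "\<And>u v. u \<in> V \<Longrightarrow> v \<in> V \<Longrightarrow> \<phi> (u \<oplus> v) = \<phi> u + \<phi> v"
    "\<And>c v. v \<in> V \<Longrightarrow> \<phi> (c \<odot> v) = c * \<phi> v" "\<And>v. v \<in> V \<Longrightarrow> \<phi> v \<le> q0 v"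
proof -
  define A where "A = {q. sublinear q \<and> (\<forall>v\<in>V. q v \<le> q0 v) \<and> (\<forall>v. v \<notin> V \<longrightarrow> q v = 0)}"
  define R where "R q q' \<longleftrightarrow> (\<forall>v. q' v \<le> q v)" for q q' :: "'v \<Rightarrow> real"
  have AD: "sublinear q" "\<And>v. v \<in> V \<Longrightarrow> q v \<le> q0 v" "\<And>v. v \<notin> V \<Longrightarrow> q v = 0" if "q \<in> A" for q
    using that by (auto simp: A_def)
  \<comment> \<open>Functionals are set to 0 outside the carrier, so that agreement on the carrier
    is equality and the pointwise order is antisymmetric.\<close>
  have cut: "sublinear (\<lambda>v. if v \<in> V then q v else 0)" if "sublinear q" for q
    using that by (simp add: sublinear_def)
  have "\<exists>q\<in>A. \<forall>q'\<in>A. R q q' \<longrightarrow> q' = q"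
  proof (rule predicate_Zorn)
    show "partial_order_on A (relation_of R A)"
      by (rule partial_order_on_relation_ofI) (auto simp: R_def fun_eq_iff intro: order_trans antisym)
    fix C assume C: "C \<in> Chains (relation_of R A)"
    have CA: "q \<in> A" if "q \<in> C" for q using C that by (auto simp: Chains_def relation_of_def)
    have comp: "R q q' \<or> R q' q" if "q \<in> C" "q' \<in> C" for q q' using C that by (auto simp: Chains_def relation_of_def)
    show "\<exists>u\<in>A. \<forall>a\<in>C. R a u"
    proof (cases "C = {}")
      case True
      have "(\<lambda>v. if v \<in> V then q0 v else 0) \<in> A" using cut[OF q0] by (simp add: A_def)
      then show ?thesis using True by blast
    next
      case False
      \<comment> \<open>The lower bound of a chain is its pointwise infimum. It is finite because
        every functional below \<open>q0\<close> is at least minus \<open>q0\<close> of the negated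
        argument.\<close>
      define u where "u v = (INF q\<in>C. q v)" for v
      have bdd: "bdd_below ((\<lambda>q. q v) ` C)" for v
      proof (cases "v \<in> V")
        case True
        have "- q0 ((-1) \<odot> v) \<le> q v" if "q \<in> C" for q
          using sublinear_lower[OF AD(1,2)[OF CA[OF that]] True] .
        then show ?thesis by (intro bdd_belowI2[where m = "- q0 ((-1) \<odot> v)"])
      next
        case False
        then have "0 \<le> q v" if "q \<in> C" for q using AD(3)[OF CA[OF that]] by simp
        then show ?thesis by (rule bdd_belowI2)
      qed
      have u_le: "u v \<le> q v" if "q \<in> C" for q v unfolding u_def by (rule cINF_lower[OF bdd that])
      have u_ge: "a \<le> u v" if "\<And>q. q \<in> C \<Longrightarrow> a \<le> q v" for a v unfolding u_def by (rule cINF_greatest[OF False that])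
      have "sublinear u"
        unfolding sublinear_def
      proof (intro conjI ballI allI impI)
        fix v w assume vw: "v \<in> V" "w \<in> V"
        \<comment> \<open>Comparability in the chain supplies one functional that is below q at v
          and below q' at w, so its subadditivity bounds the mixed sum.\<close>
        have *: "u (v \<oplus> w) \<le> q v + q' w" if q: "q \<in> C" "q' \<in> C" for q q'
        proof -
          obtain r where r: "r \<in> C" "r v \<le> q v" "r w \<le> q' w"
            using comp[OF q] q by (auto simp: R_def)
          then show ?thesis using u_le[OF r(1), of "v \<oplus> w"] sublinearD(1)[OF AD(1)[OF CA[OF r(1)]] vw] by linarith
        qed
        have "u (v \<oplus> w) - q v \<le> u w" if "q \<in> C" for q by (rule u_ge) (use *[OF that] in \<open>simp add: algebra_simps\<close>)
        then have "u (v \<oplus> w) - u w \<le> u v" by (intro u_ge) (simp add: algebra_simps)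
        then show "u (v \<oplus> w) \<le> u v + u w" by simp
      next
        fix c :: real and v assume c: "0 < c" and v: "v \<in> V"
        have "u (c \<odot> v) / c \<le> q v" if "q \<in> C" for q
          using u_le[OF that, of "c \<odot> v"] sublinearD(2)[OF AD(1)[OF CA[OF that]] c v] c by (simp add: field_simps)
        then have "u (c \<odot> v) / c \<le> u v" by (rule u_ge)
        then show "u (c \<odot> v) \<le> c * u v" using c by (simp add: field_simps)
      qed
      moreover obtain q1 where "q1 \<in> C" using False by blast
      moreover from this have "u v \<le> q0 v" if "v \<in> V" for v using u_le AD(2)[OF CA] that by (meson order_trans)
      moreover have "u v = 0" if "v \<notin> V" for v
      proof (rule antisym)
        have "q v = 0" if "q \<in> C" for q using AD(3)[OF CA[OF that] \<open>v \<notin> V\<close>] .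
        then show "0 \<le> u v" by (intro u_ge) (metis order_refl)
        show "u v \<le> 0" using u_le[OF \<open>q1 \<in> C\<close>, of v] AD(3)[OF CA[OF \<open>q1 \<in> C\<close>] that] by simp
      qed
      ultimately have "u \<in> A" by (simp add: A_def)
      then show ?thesis using u_le by (auto simp: R_def)
    qed
  qed
  then obtain \<phi> where \<phi>: "\<phi> \<in> A" and min: "\<And>q. q \<in> A \<Longrightarrow> (\<And>v. q v \<le> \<phi> v) \<Longrightarrow> q = \<phi>"
    by (auto simp: R_def)
  note sl = AD(1)[OF \<phi>]
  have super: "\<phi> x + \<phi> y \<le> \<phi> (x \<oplus> y)" if x: "x \<in> V" and y: "y \<in> V" for x y
  proof -
    \<comment> \<open>Pushing the functional down in direction \<open>y\<close>: \<open>r\<close> is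
      sublinear and at most \<open>\<phi>\<close>, so minimality makes them equal, and the term t =
      1 of the infimum gives superadditivity.\<close>
    define r where "r x = (INF t\<in>{0..}. \<phi> (x \<oplus> t \<odot> y) - t * \<phi> y)" for x
    have low: "- \<phi> ((-1) \<odot> x) \<le> \<phi> (x \<oplus> t \<odot> y) - t * \<phi> y" if x: "x \<in> V" and t: "0 \<le> t" for x t
    proof -
      have "t \<odot> y = (x \<oplus> t \<odot> y) \<oplus> (-1) \<odot> x"
        using x y by (simp add: add_uminus_cancel)
      then have "\<phi> (t \<odot> y) \<le> \<phi> (x \<oplus> t \<odot> y) + \<phi> ((-1) \<odot> x)"
        using sublinearD(1)[OF sl, of "x \<oplus> t \<odot> y" "(-1) \<odot> x"] x y by simp
      moreover have "\<phi> (t \<odot> y) = t * \<phi> y"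
        using t sublinear_scale[OF sl _ y, of t] sublinear_zero[OF sl] y by (cases "t = 0") auto
      ultimately show ?thesis by simp
    qed
    have r_le: "r x \<le> \<phi> (x \<oplus> t \<odot> y) - t * \<phi> y" if "x \<in> V" "0 \<le> t" for x t
      unfolding r_def by (rule cINF_lower) (use low[OF that(1)] that in \<open>auto intro!: bdd_belowI2[where m = "- \<phi> ((-1) \<odot> x)"]\<close>)
    have r_ge: "a \<le> r x" if "\<And>t. 0 \<le> t \<Longrightarrow> a \<le> \<phi> (x \<oplus> t \<odot> y) - t * \<phi> y" for a x
      unfolding r_def by (rule cINF_greatest) (use that in auto)
    have "sublinear r"
      unfolding sublinear_def
    proof (intro conjI ballI allI impI)
      fix v w assume vw: "v \<in> V" "w \<in> V"
      have *: "r (v \<oplus> w) \<le> (\<phi> (v \<oplus> s \<odot> y) - s * \<phi> y) + (\<phi> (w \<oplus> t \<odot> y) - t * \<phi> y)" if st: "0 \<le> s" "0 \<le> t" for s t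
      proof -
        have "(v \<oplus> w) \<oplus> (s + t) \<odot> y = (v \<oplus> s \<odot> y) \<oplus> (w \<oplus> t \<odot> y)"
          using vw y by (simp add: scale_add_left add_ac)
        then show ?thesis
          using r_le[of "v \<oplus> w" "s + t"] sublinearD(1)[OF sl, of "v \<oplus> s \<odot> y" "w \<oplus> t \<odot> y"] vw y st
          by (simp add: algebra_simps)
      qed
      have "r (v \<oplus> w) - (\<phi> (v \<oplus> s \<odot> y) - s * \<phi> y) \<le> r w" if "0 \<le> s" for s
        by (rule r_ge) (use *[OF that] in \<open>simp add: algebra_simps\<close>)
      then have "r (v \<oplus> w) - r w \<le> r v" by (intro r_ge) (simp add: algebra_simps)
      then show "r (v \<oplus> w) \<le> r v + r w" by simp
    next
      fix c :: real and v assume c: "0 < c" and v: "v \<in> V"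
      have "r (c \<odot> v) / c \<le> \<phi> (v \<oplus> t \<odot> y) - t * \<phi> y" if t: "0 \<le> t" for t
      proof -
        have "c \<odot> v \<oplus> (c * t) \<odot> y = c \<odot> (v \<oplus> t \<odot> y)" using v y by (simp add: scale_add_right scale_scale)
        then have "r (c \<odot> v) \<le> c * (\<phi> (v \<oplus> t \<odot> y) - t * \<phi> y)"
          using r_le[of "c \<odot> v" "c * t"] c t v y sublinear_scale[OF sl c, of "v \<oplus> t \<odot> y"] by (simp add: algebra_simps)
        then show ?thesis using c by (simp add: field_simps)
      qed
      then have "r (c \<odot> v) / c \<le> r v" by (rule r_ge)
      then show "r (c \<odot> v) \<le> c * r v" using c by (simp add: field_simps)
    qed
    moreover have r\<phi>: "r v \<le> \<phi> v" if "v \<in> V" for v using r_le[OF that, of 0] that y by simp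
    ultimately have "(\<lambda>v. if v \<in> V then r v else 0) \<in> A"
      using cut[of r] AD(2)[OF \<phi>] by (auto simp: A_def intro: order_trans)
    then have "(\<lambda>v. if v \<in> V then r v else 0) = \<phi>"
      by (rule min) (use r\<phi> AD(3)[OF \<phi>] in auto)
    from fun_cong[OF this, of x] have "r x = \<phi> x" using x by simp
    then show ?thesis using r_le[OF x, of 1] y by simp
  qed
  have add: "\<phi> (u \<oplus> v) = \<phi> u + \<phi> v" if "u \<in> V" "v \<in> V" for u v
    using super[OF that] sublinearD(1)[OF sl that] by simp
  have "\<phi> (c \<odot> v) = c * \<phi> v" if v: "v \<in> V" for c v
  proof -
    have neg: "\<phi> ((-1) \<odot> w) = - \<phi> w" if "w \<in> V" for w
      using add[OF that scale_closed[OF that], of "-1"] add_uminus[OF that] sublinear_zero[OF sl] by simp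
    consider "0 < c" | "c = 0" | "c < 0" by linarith
    then show ?thesis
    proof cases
      case 3
      have "\<phi> (c \<odot> v) = - \<phi> ((- c) \<odot> v)"
        using neg[OF scale_closed[OF v], of "- c"] v by (simp add: scale_scale)
      then show ?thesis using sublinear_scale[OF sl _ v, of "- c"] 3 by simp
    qed (use v sublinear_zero[OF sl] sublinear_scale[OF sl _ v] in auto)
  qed
  then show ?thesis using that add AD(2)[OF \<phi>] by blast
qed

text \<open>The functional \<open>q\<close> is the infimum over t \<ge> 0 and k in K of the norm of
  v + t (k - x) minus t d. The distance hypothesis keeps it above minus the norm, t = 0 keeps it
  below the norm, and t = 1 gives q (x - k) \<le> - d. A linear functional below \<open>q\<close> is
  therefore bounded and exceeds its value at \<open>x\<close> by at least \<open>d\<close> on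
  \<open>K\<close>.\<close>

lemma separation:
  assumes K: "K \<subseteq> V" "K \<noteq> {}" and x: "x \<in> V" and d: "0 < d" "\<And>k. k \<in> K \<Longrightarrow> d \<le> nm (k \<ominus> x)"
    and convex: "\<And>u v t. u \<in> K \<Longrightarrow> v \<in> K \<Longrightarrow> 0 \<le> t \<Longrightarrow> t \<le> 1 \<Longrightarrow> t \<odot> u \<oplus> (1 - t) \<odot> v \<in> K"
  obtains \<phi> where "bounded_functional N \<phi>" "\<And>k. k \<in> K \<Longrightarrow> \<phi> x + d \<le> \<phi> k"
proof -
  let ?I = "{0..} \<times> K"
  define q where "q v = (INF (t, k)\<in>?I. nm (v \<oplus> t \<odot> (k \<ominus> x)) - t * d)" for v
  have KV: "k \<in> V" if "k \<in> K" for k using K that by blast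
  have low: "- nm v \<le> nm (v \<oplus> t \<odot> (k \<ominus> x)) - t * d" if v: "v \<in> V" and t: "0 \<le> t" and k: "k \<in> K" for v t k
  proof -
    have kx: "k \<ominus> x \<in> V" using KV[OF k] x by simp
    have "t \<odot> (k \<ominus> x) = (v \<oplus> t \<odot> (k \<ominus> x)) \<oplus> (-1) \<odot> v"
      using v kx by (simp add: add_uminus_cancel)
    then have "nm (t \<odot> (k \<ominus> x)) \<le> nm (v \<oplus> t \<odot> (k \<ominus> x)) + nm v"
      using norm_triangle[of "v \<oplus> t \<odot> (k \<ominus> x)" "(-1) \<odot> v"] norm_scale[OF v, of "-1"] v kx by simp
    moreover have "t * d \<le> nm (t \<odot> (k \<ominus> x))"
      using d(2)[OF k] t norm_scale[OF kx, of t] by (simp add: mult_left_mono)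
    ultimately show ?thesis by simp
  qed
  have q_le: "q v \<le> nm (v \<oplus> t \<odot> (k \<ominus> x)) - t * d" if "v \<in> V" "0 \<le> t" "k \<in> K" for v t k
  proof -
    have "bdd_below ((\<lambda>(t, k). nm (v \<oplus> t \<odot> (k \<ominus> x)) - t * d) ` ?I)"
      by (rule bdd_belowI2[where m = "- nm v"]) (use low[OF that(1)] in auto)
    from cINF_lower[OF this, of "(t, k)"] show ?thesis using that by (simp add: q_def)
  qed
  have q_ge: "a \<le> q v" if "\<And>t k. 0 \<le> t \<Longrightarrow> k \<in> K \<Longrightarrow> a \<le> nm (v \<oplus> t \<odot> (k \<ominus> x)) - t * d" for a v
    unfolding q_def by (rule cINF_greatest) (use that K in auto)
  \<comment> \<open>Convexity of \<open>K\<close> enters here: a sum of two multiples of elements of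
    K - x is a single multiple of such an element, which makes \<open>q\<close> subadditive.\<close>
  have comb: "\<exists>k\<in>K. s \<odot> (k1 \<ominus> x) \<oplus> t \<odot> (k2 \<ominus> x) = (s + t) \<odot> (k \<ominus> x)"
    if st: "0 \<le> s" "0 \<le> t" and k: "k1 \<in> K" "k2 \<in> K" for s t k1 k2
  proof (cases "s + t = 0")
    case True
    then have "s = 0" "t = 0" using st by auto
    then show ?thesis using k KV x by (intro bexI[of _ k1]) auto
  next
    case False
    define a where "a = s / (s + t)"
    have a: "0 \<le> a" "a \<le> 1" "(s + t) * a = s" "(s + t) * (1 - a) = t"
      using st False by (auto simp: a_def field_simps)
    have kx: "k1 \<ominus> x \<in> V" "k2 \<ominus> x \<in> V" using KV k x by auto
    have kv: "k1 \<in> V" "k2 \<in> V" using KV k by auto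
    let ?k = "a \<odot> k1 \<oplus> (1 - a) \<odot> k2"
    have "?k \<ominus> x = ?k \<ominus> (a \<odot> x \<oplus> (1 - a) \<odot> x)" using x scale_add_left[of x a "1 - a"] by simp
    also have "\<dots> = a \<odot> (k1 \<ominus> x) \<oplus> (1 - a) \<odot> (k2 \<ominus> x)"
      using kv x by (simp add: add_diff_add scale_diff_right)
    finally have "(s + t) \<odot> (?k \<ominus> x) = s \<odot> (k1 \<ominus> x) \<oplus> t \<odot> (k2 \<ominus> x)"
      using kx a by (simp add: scale_add_right scale_scale)
    then show ?thesis using convex[OF k a(1,2)] by (intro bexI[of _ ?k]) auto
  qed
  have "sublinear q"
    unfolding sublinear_def
  proof (intro conjI ballI allI impI)
    fix v w assume vw: "v \<in> V" "w \<in> V"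
    have *: "q (v \<oplus> w) \<le> (nm (v \<oplus> s \<odot> (k1 \<ominus> x)) - s * d) + (nm (w \<oplus> t \<odot> (k2 \<ominus> x)) - t * d)"
      if st: "0 \<le> s" "0 \<le> t" and k: "k1 \<in> K" "k2 \<in> K" for s t k1 k2
    proof -
      obtain k where kk: "k \<in> K" "s \<odot> (k1 \<ominus> x) \<oplus> t \<odot> (k2 \<ominus> x) = (s + t) \<odot> (k \<ominus> x)" using comb[OF st k] by blast
      have kx: "s \<odot> (k1 \<ominus> x) \<in> V" "t \<odot> (k2 \<ominus> x) \<in> V" using KV k x by auto
      have "(v \<oplus> w) \<oplus> (s + t) \<odot> (k \<ominus> x) = (v \<oplus> s \<odot> (k1 \<ominus> x)) \<oplus> (w \<oplus> t \<odot> (k2 \<ominus> x))"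
        unfolding kk(2)[symmetric] using vw kx by (simp add: add_ac)
      then show ?thesis
        using q_le[of "v \<oplus> w" "s + t" k] norm_triangle[of "v \<oplus> s \<odot> (k1 \<ominus> x)" "w \<oplus> t \<odot> (k2 \<ominus> x)"] vw kx st kk
        by (simp add: algebra_simps)
    qed
    have "q (v \<oplus> w) - (nm (v \<oplus> s \<odot> (k1 \<ominus> x)) - s * d) \<le> q w" if "0 \<le> s" "k1 \<in> K" for s k1
      by (rule q_ge) (use *[OF that(1) _ that(2)] in \<open>simp add: algebra_simps\<close>)
    then have "q (v \<oplus> w) - q w \<le> q v" by (intro q_ge) (simp add: algebra_simps)
    then show "q (v \<oplus> w) \<le> q v + q w" by simp
  next
    fix c :: real and v assume c: "0 < c" and v: "v \<in> V"
    have "q (c \<odot> v) / c \<le> nm (v \<oplus> t \<odot> (k \<ominus> x)) - t * d" if t: "0 \<le> t" and k: "k \<in> K" for t k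
    proof -
      have kx: "k \<ominus> x \<in> V" using KV k x by auto
      have "c \<odot> v \<oplus> (c * t) \<odot> (k \<ominus> x) = c \<odot> (v \<oplus> t \<odot> (k \<ominus> x))" using v kx by (simp add: scale_add_right scale_scale)
      then have "q (c \<odot> v) \<le> c * (nm (v \<oplus> t \<odot> (k \<ominus> x)) - t * d)"
        using q_le[of "c \<odot> v" "c * t" k] c t v kx k norm_scale[of "v \<oplus> t \<odot> (k \<ominus> x)" c] by (simp add: algebra_simps)
      then show ?thesis using c by (simp add: field_simps)
    qed
    then have "q (c \<odot> v) / c \<le> q v" by (rule q_ge)
    then show "q (c \<odot> v) \<le> c * q v" using c by (simp add: field_simps)
  qed
  then obtain \<phi> where \<phi>: "\<And>u v. u \<in> V \<Longrightarrow> v \<in> V \<Longrightarrow> \<phi> (u \<oplus> v) = \<phi> u + \<phi> v"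
    "\<And>c v. v \<in> V \<Longrightarrow> \<phi> (c \<odot> v) = c * \<phi> v" "\<And>v. v \<in> V \<Longrightarrow> \<phi> v \<le> q v"
    by (rule Hahn_Banach) (rule that)
  obtain k0 where k0: "k0 \<in> K" using K by blast
  have \<phi>_le: "\<phi> v \<le> nm v" if "v \<in> V" for v
    using \<phi>(3)[OF that] q_le[OF that order_refl k0] that KV[OF k0] x by simp
  have "\<bar>\<phi> v\<bar> \<le> 1 * nm v" if v: "v \<in> V" for v
    using \<phi>_le[OF v] \<phi>_le[OF scale_closed[OF v], of "-1"] \<phi>(2)[OF v, of "-1"] norm_scale[OF v, of "-1"] by simp
  then have "bounded_functional N \<phi>" using \<phi>(1,2) unfolding bounded_functional_def by blast
  moreover have "\<phi> x + d \<le> \<phi> k" if k: "k \<in> K" for k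
  proof -
    have "(x \<ominus> k) \<oplus> 1 \<odot> (k \<ominus> x) = \<zero>" using KV[OF k] x by (simp add: diff_add_diff)
    then have "\<phi> (x \<ominus> k) \<le> - d"
      using \<phi>(3)[of "x \<ominus> k"] q_le[of "x \<ominus> k" 1 k] k KV[OF k] x by simp
    moreover have "\<phi> (x \<ominus> k) = \<phi> x - \<phi> k"
      using KV[OF k] x \<phi>(1)[of x "(-1) \<odot> k"] \<phi>(2)[of k "-1"] by (simp add: mdiff_def)
    ultimately show ?thesis by simp
  qed
  ultimately show ?thesis using that by blast
qed

end

section \<open>The Lipschitz module\<close>

lemma lip_nonneg: "0 \<le> lip f x"
  by (simp add: lip_def)

lemma lip_leI:
  assumes "0 \<le> a" and ev: "\<forall>\<^sub>F y in at x. \<bar>f y - f x\<bar> \<le> a * dist y x"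
  shows "lip f x \<le> a"
proof -
  have "\<forall>\<^sub>F y in at x. ennreal (\<bar>f y - f x\<bar> / dist y x) \<le> ennreal a"
    using ev eventually_neq_at_within[of x x UNIV]
    by eventually_elim (auto simp: divide_le_eq intro!: ennreal_leI)
  then have "Limsup (at x) (\<lambda>y. ennreal (\<bar>f y - f x\<bar> / dist y x)) \<le> ennreal a"
    by (rule Limsup_bounded)
  then have "lip f x \<le> enn2real (ennreal a)" unfolding lip_def by (intro enn2real_mono) auto
  then show ?thesis using assms(1) by simp
qed

lemma lipschitz_quotient_le:
  assumes "C-lipschitz_on UNIV f"
  shows "\<bar>f y - f x\<bar> \<le> C * dist y x"
  using lipschitz_onD[OF assms, of y x] by (simp add: dist_real_def)

text \<open>The Lipschitz bound makes the upper limit finite; an infinite one would be turned into 0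
  by \<open>enn2real\<close>, and the estimate would be lost.\<close>

lemma lip_eventually:
  fixes f :: "'a::metric_space \<Rightarrow> real"
  assumes f: "C-lipschitz_on UNIV f" and e: "0 < e"
  shows "\<forall>\<^sub>F y in at x. \<bar>f y - f x\<bar> \<le> (lip f x + e) * dist y x"
proof -
  let ?L = "Limsup (at x) (\<lambda>y. ennreal (\<bar>f y - f x\<bar> / dist y x))"
  have C: "0 \<le> C" using f by (rule lipschitz_on_nonneg)
  have "\<forall>\<^sub>F y in at x. ennreal (\<bar>f y - f x\<bar> / dist y x) \<le> ennreal C"
    using eventually_neq_at_within[of x x UNIV]
    by eventually_elim (use lipschitz_quotient_le[OF f] in \<open>auto simp: divide_le_eq intro!: ennreal_leI\<close>)
  then have "?L \<le> ennreal C" by (rule Limsup_bounded)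
  then have "?L < top" using ennreal_less_top order.strict_trans1 by blast
  then have L: "?L = ennreal (lip f x)" by (simp add: lip_def)
  have "?L < ennreal (lip f x + e)" unfolding L using e lip_nonneg[of f x] by (simp add: ennreal_less_iff)
  then have "\<forall>\<^sub>F y in at x. ennreal (\<bar>f y - f x\<bar> / dist y x) < ennreal (lip f x + e)" by (rule Limsup_lessD)
  then show ?thesis
    using eventually_neq_at_within[of x x UNIV]
  proof eventually_elim
    case (elim y)
    then have "\<bar>f y - f x\<bar> / dist y x \<le> lip f x + e" by (simp add: ennreal_less_iff)
    then show ?case using elim by (simp add: divide_le_eq)
  qed
qed

lemma lip_add_le:
  assumes f: "C-lipschitz_on UNIV f" and h: "K-lipschitz_on UNIV h"
  shows "lip (\<lambda>y. f y + h y) x \<le> lip f x + lip h x"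
proof (rule field_le_epsilon)
  fix e :: real assume "0 < e"
  then have e: "0 < e/2" by simp
  show "lip (\<lambda>y. f y + h y) x \<le> lip f x + lip h x + e"
  proof (rule lip_leI)
    show "0 \<le> lip f x + lip h x + e" using lip_nonneg[of f x] lip_nonneg[of h x] \<open>0 < e\<close> by simp
    show "\<forall>\<^sub>F y in at x. \<bar>f y + h y - (f x + h x)\<bar> \<le> (lip f x + lip h x + e) * dist y x"
      using lip_eventually[OF f e, of x] lip_eventually[OF h e, of x]
      by eventually_elim (auto simp: algebra_simps abs_if split: if_splits)
  qed
qed

lemma lip_scale_le:
  assumes f: "C-lipschitz_on UNIV f"
  shows "lip (\<lambda>y. c * f y) x \<le> \<bar>c\<bar> * lip f x"
proof (rule field_le_epsilon)
  fix e :: real assume e: "0 < e"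
  obtain d where d: "0 < d" "\<bar>c\<bar> * d < e" by (rule ex_small_factor[of "\<bar>c\<bar>" e]) (use e in auto)
  show "lip (\<lambda>y. c * f y) x \<le> \<bar>c\<bar> * lip f x + e"
  proof (rule lip_leI)
    show "0 \<le> \<bar>c\<bar> * lip f x + e" using lip_nonneg[of f x] e by simp
    show "\<forall>\<^sub>F y in at x. \<bar>c * f y - c * f x\<bar> \<le> (\<bar>c\<bar> * lip f x + e) * dist y x"
      using lip_eventually[OF f d(1), of x]
    proof eventually_elim
      case (elim y)
      have "\<bar>c * f y - c * f x\<bar> = \<bar>c\<bar> * \<bar>f y - f x\<bar>" by (simp add: abs_mult flip: right_diff_distrib)
      also have "\<dots> \<le> \<bar>c\<bar> * ((lip f x + d) * dist y x)" using elim by (intro mult_left_mono) auto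
      also have "\<dots> = (\<bar>c\<bar> * lip f x + \<bar>c\<bar> * d) * dist y x" by (simp add: algebra_simps)
      also have "\<dots> \<le> (\<bar>c\<bar> * lip f x + e) * dist y x" using d by (intro mult_right_mono) auto
      finally show ?case .
    qed
  qed
qed

lemma lipschitz_scale:
  fixes f :: "'a::metric_space \<Rightarrow> real"
  assumes f: "C-lipschitz_on UNIV f"
  shows "(\<bar>c\<bar> * C)-lipschitz_on UNIV (\<lambda>x. c * f x)"
  using lipschitz_on_cmult_real[OF f, of c] by simp

lemma lip_scale:
  assumes f: "C-lipschitz_on UNIV f"
  shows "lip (\<lambda>y. c * f y) x = \<bar>c\<bar> * lip f x"
proof (rule antisym[OF lip_scale_le[OF f]])
  show "\<bar>c\<bar> * lip f x \<le> lip (\<lambda>y. c * f y) x"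
  proof (cases "c = 0")
    case False
    have "lip f x = lip (\<lambda>y. (1 / c) * (c * f y)) x" using False by simp
    also have "\<dots> \<le> \<bar>1 / c\<bar> * lip (\<lambda>y. c * f y) x" by (rule lip_scale_le[OF lipschitz_scale[OF f]])
    finally show ?thesis using False by (simp add: abs_divide field_simps)
  qed (simp add: lip_nonneg)
qed

text \<open>For a \<ge> 0 the set where the slope exceeds \<open>a\<close> is a countable union over
  k of countable intersections over n of the open sets \<open>U n b\<close> with b = a + 1 / (k +
  1): difference quotients above \<open>b\<close> occur at arbitrarily small distances.\<close>

lemma lip_measurable:
  fixes f :: "'a::metric_space \<Rightarrow> real"
  assumes f: "C-lipschitz_on UNIV f"
  shows "lip f \<in> borel_measurable borel"
proof (subst borel_measurable_iff_greater, intro allI)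
  fix a :: real
  have cf: "continuous_on UNIV f" using f by (rule lipschitz_on_continuous_on)
  \<comment> \<open>For each fixed y the two conditions on x are open. The strict second inequality
    already rules out y = x.\<close>
  define U where "U n b = {x. \<exists>y. dist y x < inverse (Suc n) \<and> b * dist y x < \<bar>f y - f x\<bar>}" for n :: nat and b
  have U: "open (U n b)" for n b
  proof -
    have "U n b = (\<Union>y. {x. dist y x < inverse (Suc n)} \<inter> {x. b * dist y x < \<bar>f y - f x\<bar>})"
      by (auto simp: U_def)
    moreover have "open {x. dist y x < inverse (Suc n)}" "open {x. b * dist y x < \<bar>f y - f x\<bar>}" for y
      by (intro open_Collect_less continuous_intros cf)+
    ultimately show ?thesis by (simp add: open_Int open_UN)
  qed
  show "{x \<in> space borel. a < lip f x} \<in> sets borel"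
  proof (cases "0 \<le> a")
    case False
    then have "{x \<in> space borel. a < lip f x} = UNIV" using lip_nonneg[of f] by (auto intro: less_le_trans[of a 0])
    then show ?thesis by simp
  next
    case a: True
    have "a < lip f x \<longleftrightarrow> (\<exists>k. \<forall>n. x \<in> U n (a + inverse (Suc k)))" for x
    proof
      assume "a < lip f x"
      then obtain k where k: "inverse (Suc k) < lip f x - a" using reals_Archimedean[of "lip f x - a"] by auto
      have "x \<in> U n (a + inverse (Suc k))" for n
      proof (rule ccontr)
        assume nU: "x \<notin> U n (a + inverse (Suc k))"
        have "\<bar>f y - f x\<bar> \<le> (a + inverse (Suc k)) * dist y x" if "dist y x < inverse (Suc n)" for y
          using nU that unfolding U_def mem_Collect_eq by (meson not_le)
        then have "\<forall>\<^sub>F y in at x. \<bar>f y - f x\<bar> \<le> (a + inverse (Suc k)) * dist y x"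
          unfolding eventually_at by (intro exI[of _ "inverse (Suc n)"]) auto
        then have "lip f x \<le> a + inverse (Suc k)" using a by (intro lip_leI) auto
        then show False using k by simp
      qed
      then show "\<exists>k. \<forall>n. x \<in> U n (a + inverse (Suc k))" by blast
    next
      assume "\<exists>k. \<forall>n. x \<in> U n (a + inverse (Suc k))"
      then obtain k where k: "\<And>n. x \<in> U n (a + inverse (Suc k))" by blast
      show "a < lip f x"
      proof (rule ccontr)
        assume "\<not> a < lip f x"
        then have le: "lip f x \<le> a" by simp
        have e: "0 < inverse (real (Suc k))" by simp
        obtain d where d: "0 < d" "\<And>y. y \<noteq> x \<Longrightarrow> dist y x < d \<Longrightarrow> \<bar>f y - f x\<bar> \<le> (lip f x + inverse (Suc k)) * dist y x"
          using lip_eventually[OF f e, of x] unfolding eventually_at by auto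
        obtain n where n: "inverse (Suc n) < d" using reals_Archimedean[OF d(1)] by auto
        obtain y where y: "dist y x < inverse (Suc n)" "(a + inverse (Suc k)) * dist y x < \<bar>f y - f x\<bar>"
          using k[of n] by (auto simp: U_def)
        have "y \<noteq> x" using y(2) by auto
        then have "\<bar>f y - f x\<bar> \<le> (lip f x + inverse (Suc k)) * dist y x" using d(2) y(1) n by simp
        also have "\<dots> \<le> (a + inverse (Suc k)) * dist y x" using le by (intro mult_right_mono) auto
        finally show False using y(2) by simp
      qed
    qed
    then have "{x \<in> space borel. a < lip f x} = (\<Union>k. \<Inter>n. U n (a + inverse (Suc k)))"
      by (simp add: set_eq_iff del: of_nat_Suc)
    also have "\<dots> \<in> sets borel" using U by (intro sets.countable_UN sets.countable_INT) auto
    finally show ?thesis .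
  qed
qed

lemma subadditive_lip:
  fixes m :: "'a::metric_space measure"
  assumes p1: "1 < p" and sets: "sets m = sets borel"
  shows "subadditive_functional m p (D_lip m p) lip"
proof
  have meas: "lip f \<in> borel_measurable m" if "C-lipschitz_on UNIV f" for f C
    using lip_measurable[OF that] measurable_cong_sets[OF sets refl] by blast
  show "1 < p" by (rule p1)
  have z: "0-lipschitz_on UNIV (\<lambda>x::'a. 0::real)" by (simp add: lipschitz_on_def)
  have "lip (\<lambda>x::'a. 0) = (\<lambda>x. 0)"
  proof
    fix x :: 'a
    show "lip (\<lambda>x. 0) x = 0" using lip_scale[OF z, of 0 x] by simp
  qed
  then show "(\<lambda>x. 0) \<in> D_lip m p" using z Lp_zero[OF p1] by (auto simp: D_lip_def)
  show "lip f \<in> Lp m p" if "f \<in> D_lip m p" for f using that by (simp add: D_lip_def)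
  show "AE x in m. 0 \<le> lip f x" for f by (simp add: lip_nonneg)
  show "(\<lambda>x. f x + h x) \<in> D_lip m p" "AE x in m. lip (\<lambda>y. f y + h y) x \<le> lip f x + lip h x"
    if fh: "f \<in> D_lip m p" "h \<in> D_lip m p" for f h
  proof -
    obtain C where f: "C-lipschitz_on UNIV f" "lip f \<in> Lp m p" using fh(1) by (auto simp: D_lip_def)
    obtain K where h: "K-lipschitz_on UNIV h" "lip h \<in> Lp m p" using fh(2) by (auto simp: D_lip_def)
    note le = lip_add_le[OF f(1) h(1)] and L = lipschitz_on_add[OF f(1) h(1)]
    have "lip (\<lambda>y. f y + h y) \<in> Lp m p"
    proof (rule Lp_bound[OF p1 Lp_add[OF p1 f(2) h(2)] meas[OF L]])
      show "AE x in m. \<bar>lip (\<lambda>y. f y + h y) x\<bar> \<le> \<bar>lip f x + lip h x\<bar>"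
        using le lip_nonneg[of "\<lambda>y. f y + h y"] by (intro AE_I2) (smt (verit))
    qed
    then show "(\<lambda>x. f x + h x) \<in> D_lip m p" using L by (auto simp: D_lip_def)
    show "AE x in m. lip (\<lambda>y. f y + h y) x \<le> lip f x + lip h x" using le by simp
  qed
  show "(\<lambda>x. c * f x) \<in> D_lip m p" "AE x in m. lip (\<lambda>y. c * f y) x = \<bar>c\<bar> * lip f x" if f: "f \<in> D_lip m p" for f c
  proof -
    obtain C where f: "C-lipschitz_on UNIV f" "lip f \<in> Lp m p" using f by (auto simp: D_lip_def)
    note eq = lip_scale[OF f(1), of c]
    then have "lip (\<lambda>y. c * f y) = (\<lambda>x. \<bar>c\<bar> * lip f x)" by (intro ext)
    then show "(\<lambda>x. c * f x) \<in> D_lip m p"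
      using lipschitz_scale[OF f(1), of c] Lp_scale[OF p1 f(2), of "\<bar>c\<bar>"] by (auto simp: D_lip_def)
    show "AE x in m. lip (\<lambda>y. c * f y) x = \<bar>c\<bar> * lip f x" using eq by simp
  qed
qed

section \<open>The cotangent module as a quotient\<close>

locale weakly_reflexive_space =
  fixes m :: "'a::metric_space measure" and p :: real
  assumes p1: "1 < p" and sets_m: "sets m = sets borel" and wr: "weakly_reflexive m p"
begin

abbreviation N where "N \<equiv> Lp_lip m p"
abbreviation d where "d \<equiv> d_lip m p"
abbreviation D where "D \<equiv> D_lip m p"

sublocale lf: subadditive_functional m p "D_lip m p" lip
  by (rule subadditive_lip[OF p1 sets_m])

lemma N_eq: "N = lf.G" and d_eq: "d = lf.dif"
  by (simp_all add: Lp_lip_def d_lip_def)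

sublocale N: complete_module m p "Lp_lip m p"
  unfolding N_eq by (rule lf.complete_generated)

lemma d_mem: "f \<in> D \<Longrightarrow> d f \<in> mcarrier N"
  and d_add: "f \<in> D \<Longrightarrow> h \<in> D \<Longrightarrow> d (\<lambda>x. f x + h x) = madd N (d f) (d h)"
  and d_scale: "f \<in> D \<Longrightarrow> d (\<lambda>x. c * f x) = mscale N c (d f)"
  and d_pnorm: "f \<in> D \<Longrightarrow> AE x in m. mpnorm N (d f) x = lip f x"
  unfolding N_eq d_eq by (fact lf.dif_in_G lf.dif_add lf.dif_scale lf.dif_pnorm)+

lemma closed_subspace_d: "closed_subspace m N W \<Longrightarrow> (\<And>f. f \<in> D \<Longrightarrow> d f \<in> W) \<Longrightarrow> W = mcarrier N"
  unfolding N_eq d_eq by (rule lf.closed_subspace_dif_eq)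

lemma lip_in_Lp: "f \<in> D \<Longrightarrow> lip f \<in> Lp m p"
  by (simp add: D_lip_def)

lemma D_measurable: "f \<in> D \<Longrightarrow> f \<in> borel_measurable m"
proof -
  assume "f \<in> D"
  then obtain C where "C-lipschitz_on UNIV f" by (auto simp: D_lip_def)
  then have "f \<in> borel_measurable borel"
    by (intro borel_measurable_continuous_onI lipschitz_on_continuous_on)
  then show ?thesis using measurable_cong_sets[OF sets_m refl] by blast
qed

lemma d_norm: "f \<in> D \<Longrightarrow> mnorm N (d f) = Lp_norm m p (lip f)"
  using d_pnorm[of f] d_mem[of f] lip_in_Lp[of f]
  by (simp add: N.norm_eq_Lp_norm Lp_norm_cong_AE[OF p1] Lp_measurable[OF p1])

section \<open>Limit forms and their existence in the relaxed domain\<close>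

definition limit_forms :: "('a \<Rightarrow> real) \<Rightarrow> 'a generated set" where
  "limit_forms f = {\<omega> \<in> mcarrier N. \<exists>F. (\<forall>n. F n \<in> D) \<and> L0_converges m F f \<and> mconverges N (\<lambda>n. d (F n)) \<omega>}"

lemma limit_formsI:
  "\<lbrakk>\<omega> \<in> mcarrier N; \<And>n. F n \<in> D; L0_converges m F f; mconverges N (\<lambda>n. d (F n)) \<omega>\<rbrakk> \<Longrightarrow> \<omega> \<in> limit_forms f"
  by (auto simp: limit_forms_def)

lemma limit_formsE:
  assumes "\<omega> \<in> limit_forms f"
  obtains F where "\<And>n. F n \<in> D" "L0_converges m F f" "mconverges N (\<lambda>n. d (F n)) \<omega>"
  using assms by (auto simp: limit_forms_def)

lemma limit_forms_mem: "\<omega> \<in> limit_forms f \<Longrightarrow> \<omega> \<in> mcarrier N"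
  by (simp add: limit_forms_def)

lemma limit_forms_add:
  assumes "\<omega> \<in> limit_forms f" "\<eta> \<in> limit_forms h"
  shows "madd N \<omega> \<eta> \<in> limit_forms (\<lambda>x. f x + h x)"
proof -
  note mem = assms[THEN limit_forms_mem]
  obtain F where F: "\<And>n. F n \<in> D" "L0_converges m F f" "mconverges N (\<lambda>n. d (F n)) \<omega>" by (rule limit_formsE[OF assms(1)]) (rule that)
  obtain H where H: "\<And>n. H n \<in> D" "L0_converges m H h" "mconverges N (\<lambda>n. d (H n)) \<eta>" by (rule limit_formsE[OF assms(2)]) (rule that)
  show ?thesis
  proof (rule limit_formsI)
    show "L0_converges m (\<lambda>n x. F n x + H n x) (\<lambda>x. f x + h x)"
      using F(2) H(2) unfolding L0_converges_def by eventually_elim (rule tendsto_add)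
    show "mconverges N (\<lambda>n. d (\<lambda>x. F n x + H n x)) (madd N \<omega> \<eta>)"
      using N.mconverges_add[OF d_mem[OF F(1)] mem(1) d_mem[OF H(1)] mem(2) F(3) H(3)] by (simp add: d_add F H)
  qed (use mem F H in \<open>auto intro: lf.D_add\<close>)
qed

lemma limit_forms_scale:
  assumes "\<omega> \<in> limit_forms f"
  shows "mscale N c \<omega> \<in> limit_forms (\<lambda>x. c * f x)"
proof -
  note mem = assms[THEN limit_forms_mem]
  obtain F where F: "\<And>n. F n \<in> D" "L0_converges m F f" "mconverges N (\<lambda>n. d (F n)) \<omega>" by (rule limit_formsE[OF assms(1)]) (rule that)
  show ?thesis
  proof (rule limit_formsI)
    show "L0_converges m (\<lambda>n x. c * F n x) (\<lambda>x. c * f x)"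
      using F(2) unfolding L0_converges_def by eventually_elim (rule tendsto_mult_left)
    show "mconverges N (\<lambda>n. d (\<lambda>x. c * F n x)) (mscale N c \<omega>)"
      using N.mconverges_scale[OF d_mem[OF F(1)] mem F(3)] by (simp add: d_scale F)
  qed (use mem F in \<open>auto intro: lf.D_scale\<close>)
qed

lemma limit_forms_diff: "\<omega> \<in> limit_forms f \<Longrightarrow> \<eta> \<in> limit_forms f \<Longrightarrow> mdiff N \<omega> \<eta> \<in> limit_forms (\<lambda>x. 0)"
  using limit_forms_add[of \<omega> f "mscale N (-1) \<eta>" "\<lambda>x. -1 * f x"] limit_forms_scale[of \<eta> f "-1"] by (simp add: mdiff_def)

lemma limit_forms_d: "f \<in> D \<Longrightarrow> d f \<in> limit_forms f"
  by (rule limit_formsI[where F = "\<lambda>_. f"]) (auto simp: d_mem L0_converges_def intro: N.mconverges_const)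

lemma limit_forms_add_zero: "\<omega> \<in> limit_forms f \<Longrightarrow> \<sigma> \<in> limit_forms (\<lambda>x. 0) \<Longrightarrow> madd N \<omega> \<sigma> \<in> limit_forms f"
  using limit_forms_add[of \<omega> f \<sigma> "\<lambda>x. 0"] by simp

lemma zero_in_limit_forms: "mzero N \<in> limit_forms (\<lambda>x. 0)"
  using limit_forms_d[OF lf.D_zero] d_scale[OF lf.D_zero, of 0] d_mem[OF lf.D_zero] by simp

text \<open>Mazur's lemma. Instead of explicit convex combinations of the tail of a sequence, the convex set of
  separation consists of the functions sharing the estimates that convex combinations inherit.\<close>

lemma limit_form_exists:
  assumes F: "\<And>n. F n \<in> D" and f: "f \<in> borel_measurable m" and lim: "L0_converges m F f"
    and bd: "\<And>n. Lp_norm m p (lip (F n)) \<le> C"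
  obtains \<omega> h u where "\<omega> \<in> limit_forms f" "\<And>n. h n \<in> D" "mconverges N (\<lambda>n. d (h n)) \<omega>"
    "\<And>n::nat. u n \<in> Lp m p" "\<And>n. AE x in m. lip (h n) x \<le> u n x"
    "\<And>\<phi> c. bounded_functional (Lp_space m p) \<phi> \<Longrightarrow> (\<lambda>n. \<phi> (lip (F n))) \<longlonglongrightarrow> c \<Longrightarrow> (\<lambda>n. \<phi> (u n)) \<longlonglongrightarrow> c"
proof -
  have "\<forall>n. mnorm N (d (F n)) \<le> C" using bd F by (simp add: d_norm)
  then obtain r \<omega> where r: "strict_mono (r :: nat \<Rightarrow> nat)" and w: "mweakly_converges N (\<lambda>n. d (F (r n))) \<omega>"
    using wr F f lim unfolding weakly_reflexive_def by blast
  have \<omega>: "\<omega> \<in> mcarrier N" using w by (simp add: mweakly_converges_def)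
  let ?b = "bounded_functional (Lp_space m p)"
  \<comment> \<open>Majorants of the slope of h. The slope of a convex combination is only bounded
    by the combination of slopes, so weak convergence has to be tracked for the majorant. Every
    bound of the form |\<phi> - c| \<le> e on the tail of slopes passes to convex combinations and
    thus to members of \<open>U\<close>.\<close>
  define U where "U n h = {u \<in> Lp m p. (AE x in m. lip h x \<le> u x) \<and>
    (\<forall>\<phi> c e. ?b \<phi> \<and> (\<forall>k\<ge>n. \<bar>\<phi> (lip (F (r k))) - c\<bar> \<le> e) \<longrightarrow> \<bar>\<phi> u - c\<bar> \<le> e)}" for n h
  \<comment> \<open>The pointwise condition has the same form: any interval around f x that contains
    the tail of values contains h x. Both conditions are preserved by convex combinations, so
    \<open>K n\<close> is convex and contains the tail from n on.\<close>
  define K where "K n = {h \<in> D. (\<forall>x e. (\<forall>k\<ge>n. \<bar>F (r k) x - f x\<bar> \<le> e) \<longrightarrow> \<bar>h x - f x\<bar> \<le> e) \<and> U n h \<noteq> {}}" for n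
  have FK: "F (r k) \<in> K n" if "n \<le> k" for n k
  proof -
    have "lip (F (r k)) \<in> U n (F (r k))" using that F lip_in_Lp by (auto simp: U_def)
    then show ?thesis using that F by (auto simp: K_def)
  qed
  have avg: "\<bar>t * a + (1 - t) * b - c\<bar> \<le> e" if "\<bar>a - c\<bar> \<le> e" "\<bar>b - c\<bar> \<le> e" "0 \<le> t" "t \<le> 1" for t a b c e :: real
  proof -
    have "t * a + (1 - t) * b - c = t * (a - c) + (1 - t) * (b - c)" by (simp add: algebra_simps)
    also have "\<bar>\<dots>\<bar> \<le> t * \<bar>a - c\<bar> + (1 - t) * \<bar>b - c\<bar>"
      using that abs_triangle_ineq[of "t * (a - c)" "(1 - t) * (b - c)"] by (simp add: abs_mult)
    also have "\<dots> \<le> t * e + (1 - t) * e" using that by (intro add_mono mult_left_mono) auto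
    finally show ?thesis by (simp add: algebra_simps)
  qed
  have conv: "(\<lambda>x. t * h x + (1 - t) * h' x) \<in> K n" if h: "h \<in> K n" "h' \<in> K n" and t: "0 \<le> t" "t \<le> 1" for n h h' t
  proof -
    obtain u where u: "u \<in> U n h" using h by (auto simp: K_def)
    obtain u' where u': "u' \<in> U n h'" using h by (auto simp: K_def)
    have uL: "u \<in> Lp m p" "u' \<in> Lp m p" using u u' by (auto simp: U_def)
    have hD: "h \<in> D" "h' \<in> D" using h by (auto simp: K_def)
    have "(\<lambda>x. t * u x + (1 - t) * u' x) \<in> U n (\<lambda>x. t * h x + (1 - t) * h' x)"
      unfolding U_def
    proof (intro CollectI conjI allI impI)
      show "(\<lambda>x. t * u x + (1 - t) * u' x) \<in> Lp m p" by (intro Lp_add Lp_scale p1 uL)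
      have "AE x in m. lip h x \<le> u x" "AE x in m. lip h' x \<le> u' x" using u u' by (auto simp: U_def)
      then show "AE x in m. lip (\<lambda>x. t * h x + (1 - t) * h' x) x \<le> t * u x + (1 - t) * u' x"
        using lf.g_add[OF lf.D_scale[OF hD(1), of t] lf.D_scale[OF hD(2), of "1 - t"]] lf.g_scale[OF hD(1), of t] lf.g_scale[OF hD(2), of "1 - t"]
      proof eventually_elim
        case (elim x)
        have "t * lip h x \<le> t * u x" "(1 - t) * lip h' x \<le> (1 - t) * u' x" using elim t by (auto intro: mult_left_mono)
        then show ?case using elim t by simp
      qed
      fix \<phi> c e assume *: "?b \<phi> \<and> (\<forall>k\<ge>n. \<bar>\<phi> (lip (F (r k))) - c\<bar> \<le> e)"
      have "\<phi> (\<lambda>x. t * u x + (1 - t) * u' x) = t * \<phi> u + (1 - t) * \<phi> u'"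
        using * uL Lp_scale[OF p1 uL(1), of t] Lp_scale[OF p1 uL(2), of "1 - t"] by (simp add: bounded_functional_Lp_iff[OF p1])
      moreover have "\<bar>\<phi> u - c\<bar> \<le> e" using u * unfolding U_def by blast
      moreover have "\<bar>\<phi> u' - c\<bar> \<le> e" using u' * unfolding U_def by blast
      ultimately show "\<bar>\<phi> (\<lambda>x. t * u x + (1 - t) * u' x) - c\<bar> \<le> e" using avg t by simp
    qed
    moreover have "\<bar>t * h x + (1 - t) * h' x - f x\<bar> \<le> e" if "\<forall>k\<ge>n. \<bar>F (r k) x - f x\<bar> \<le> e" for x e
      using h that t by (intro avg) (auto simp: K_def)
    moreover have "(\<lambda>x. t * h x + (1 - t) * h' x) \<in> D" using hD by (intro lf.D_add lf.D_scale)
    ultimately show ?thesis by (auto simp: K_def)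
  qed
  have KD: "h \<in> D" if "h \<in> K n" for h n using that by (simp add: K_def)
  \<comment> \<open>Mazur: were the differentials of \<open>K n\<close> at distance at least e from
    \<omega>, a separating functional would stay at least e above its value at \<omega> along the
    tail, against weak convergence.\<close>
  have close: "\<exists>h\<in>K n. mnorm N (mdiff N (d h) \<omega>) < e" if e: "0 < e" for n e
  proof (rule ccontr)
    assume "\<not> ?thesis"
    then have far: "e \<le> mnorm N (mdiff N v \<omega>)" if "v \<in> d ` K n" for v using that by (auto simp: not_less)
    obtain \<phi> where \<phi>: "bounded_functional N \<phi>" "\<And>v. v \<in> d ` K n \<Longrightarrow> \<phi> \<omega> + e \<le> \<phi> v"
    proof (rule N.separation[of "d ` K n" \<omega> e])
      show "d ` K n \<subseteq> mcarrier N" using d_mem KD by blast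
      show "d ` K n \<noteq> {}" using FK[OF order_refl] by blast
      show "madd N (mscale N t u) (mscale N (1 - t) v) \<in> d ` K n"
        if u: "u \<in> d ` K n" and v: "v \<in> d ` K n" and t: "0 \<le> t" "t \<le> 1" for u v t
      proof -
        obtain h h' where h: "h \<in> K n" "u = d h" "h' \<in> K n" "v = d h'" using u v by blast
        have "madd N (mscale N t u) (mscale N (1 - t) v) = d (\<lambda>x. t * h x + (1 - t) * h' x)"
          using KD[OF h(1)] KD[OF h(3)] by (simp add: h d_add d_scale lf.D_scale)
        then show ?thesis using imageI[OF conv[OF h(1,3) t], of d] by simp
      qed
    qed (use \<omega> e far in auto)
    have "(\<lambda>k. \<phi> (d (F (r k)))) \<longlonglongrightarrow> \<phi> \<omega>" using w \<phi>(1) by (simp add: mweakly_converges_def)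
    then have "\<phi> \<omega> + e \<le> \<phi> \<omega>"
      by (rule LIMSEQ_le_const) (use \<phi>(2) FK in \<open>auto intro!: exI[of _ n]\<close>)
    then show False using e by simp
  qed
  have "\<forall>n. \<exists>h. h \<in> K n \<and> mnorm N (mdiff N (d h) \<omega>) < inverse (Suc n)"
    using close[of "inverse (real (Suc n))" n for n] by (simp add: Bex_def)
  from choice[OF this] obtain h where h: "\<And>n. h n \<in> K n" "\<And>n. mnorm N (mdiff N (d (h n)) \<omega>) < inverse (Suc n)" by blast
  have hD: "h n \<in> D" for n using h(1) KD by blast
  have "\<forall>n. \<exists>u. u \<in> U n (h n)" using h(1) unfolding K_def by blast
  from choice[OF this] obtain u where u: "\<And>n. u n \<in> U n (h n)" by blast
  have lim_h: "mconverges N (\<lambda>n. d (h n)) \<omega>"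
    unfolding mconverges_def
  proof (rule Lim_null_comparison[OF _ LIMSEQ_inverse_real_of_nat], intro always_eventually allI)
    fix n
    show "norm (mnorm N (mdiff N (d (h n)) \<omega>)) \<le> inverse (real (Suc n))"
      using h(2)[of n] N.norm_nonneg[OF N.diff_closed[OF d_mem[OF hD] \<omega>], of n] by simp
  qed
  \<comment> \<open>At a point where the original sequence converges, the tail from n lies within
    any tolerance of f x for large n, and membership in \<open>K n\<close> passes this on to
    \<open>h n\<close>.\<close>
  have "L0_converges m h f"
    using lim unfolding L0_converges_def
  proof eventually_elim
    case (elim x)
    have sub: "(\<lambda>k. F (r k) x) \<longlonglongrightarrow> f x" using LIMSEQ_subseq_LIMSEQ[OF elim r] by (simp add: comp_def)
    show ?case
    proof (rule LIMSEQ_I)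
      fix e :: real assume "0 < e"
      then have e2: "0 < e/2" by simp
      obtain n0 where n0: "\<And>k. n0 \<le> k \<Longrightarrow> \<bar>F (r k) x - f x\<bar> < e/2"
        using LIMSEQ_D[OF sub e2] unfolding real_norm_def by blast
      show "\<exists>n0. \<forall>n\<ge>n0. norm (h n x - f x) < e"
      proof (intro exI[of _ n0] allI impI)
        fix n assume "n0 \<le> n"
        then have "\<forall>k\<ge>n. \<bar>F (r k) x - f x\<bar> \<le> e/2" using n0 by (auto intro: less_imp_le)
        then have "\<bar>h n x - f x\<bar> \<le> e/2" using h(1)[of n] unfolding K_def by blast
        then show "norm (h n x - f x) < e" using \<open>0 < e\<close> by simp
      qed
    qed
  qed
  then have lf: "\<omega> \<in> limit_forms f" using \<omega> hD lim_h by (intro limit_formsI) auto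
  have lim_u: "(\<lambda>n. \<phi> (u n)) \<longlonglongrightarrow> c" if \<phi>: "?b \<phi>" and c: "(\<lambda>n. \<phi> (lip (F n))) \<longlonglongrightarrow> c" for \<phi> c
  proof (rule LIMSEQ_I)
    fix e :: real assume "0 < e"
    then have e2: "0 < e/2" by simp
    have sub: "(\<lambda>k. \<phi> (lip (F (r k)))) \<longlonglongrightarrow> c" using LIMSEQ_subseq_LIMSEQ[OF c r] by (simp add: comp_def)
    obtain n0 where n0: "\<And>k. n0 \<le> k \<Longrightarrow> \<bar>\<phi> (lip (F (r k))) - c\<bar> < e/2"
      using LIMSEQ_D[OF sub e2] unfolding real_norm_def by blast
    show "\<exists>n0. \<forall>n\<ge>n0. norm (\<phi> (u n) - c) < e"
    proof (intro exI[of _ n0] allI impI)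
      fix n assume "n0 \<le> n"
      then have "\<forall>k\<ge>n. \<bar>\<phi> (lip (F (r k))) - c\<bar> \<le> e/2" using n0 by (auto intro: less_imp_le)
      then have "\<bar>\<phi> (u n) - c\<bar> \<le> e/2" using u[of n] \<phi> unfolding U_def by blast
      then show "norm (\<phi> (u n) - c) < e" using \<open>0 < e\<close> by simp
    qed
  qed
  have "u n \<in> Lp m p" "AE x in m. lip (h n) x \<le> u n x" for n using u[of n] by (auto simp: U_def)
  then show ?thesis by (rule that[OF lf hD lim_h _ _ lim_u])
qed

lemma limit_forms_nonempty:
  assumes "f \<in> D_relaxed m p"
  shows "limit_forms f \<noteq> {}"
proof -
  obtain F C where F: "f \<in> borel_measurable m" "\<And>n. F n \<in> D" "L0_converges m F f" "\<And>n. Lp_norm m p (lip (F n)) \<le> C"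
    using assms by (auto simp: D_relaxed_def)
  show ?thesis by (rule limit_form_exists[OF F(2,1,3,4)]) blast
qed

text \<open>Convergent differentials have bounded norms, which gives the converse direction.
  Thereafter the linear structure of the relaxed domain is read off from that of limit
  forms.\<close>

lemma D_relaxed_iff: "f \<in> D_relaxed m p \<longleftrightarrow> f \<in> borel_measurable m \<and> limit_forms f \<noteq> {}"
proof
  assume "f \<in> D_relaxed m p"
  then show "f \<in> borel_measurable m \<and> limit_forms f \<noteq> {}"
    using limit_forms_nonempty by (auto simp: D_relaxed_def)
next
  assume f: "f \<in> borel_measurable m \<and> limit_forms f \<noteq> {}"
  then obtain \<omega> where \<omega>: "\<omega> \<in> limit_forms f" by blast
  obtain F where F: "\<And>n. F n \<in> D" "L0_converges m F f" "mconverges N (\<lambda>n. d (F n)) \<omega>" by (rule limit_formsE[OF \<omega>]) (rule that)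
  have "(\<lambda>n. mnorm N (d (F n))) \<longlonglongrightarrow> mnorm N \<omega>"
    by (rule N.mconverges_norm[OF d_mem[OF F(1)] limit_forms_mem[OF \<omega>] F(3)])
  then have "Bseq (\<lambda>n. mnorm N (d (F n)))" by (intro convergent_imp_Bseq convergentI)
  then obtain C where C: "\<And>n. norm (mnorm N (d (F n))) \<le> C" unfolding Bseq_def by blast
  have "Lp_norm m p (lip (F n)) \<le> C" for n using C[of n] F(1) by (simp add: d_norm)
  then show "f \<in> D_relaxed m p" using f F by (auto simp: D_relaxed_def)
qed

section \<open>The relaxed slope as an essential infimum over limit forms\<close>

definition weak_slopes :: "('a \<Rightarrow> real) \<Rightarrow> ('a \<Rightarrow> real) set" where
  "weak_slopes f = {G. \<exists>F. (\<forall>n. F n \<in> D) \<and> L0_converges m F f \<and> mweakly_converges (Lp_space m p) (\<lambda>n. lip (F n)) G}"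

lemma lip_tendsto_pnorm:
  assumes F: "\<And>n. F n \<in> D" and \<omega>: "\<omega> \<in> mcarrier N" and lim: "mconverges N (\<lambda>n. d (F n)) \<omega>"
  shows "(\<lambda>n. Lp_norm m p (\<lambda>x. lip (F n) x - mpnorm N \<omega> x)) \<longlonglongrightarrow> 0"
proof -
  have "Lp_norm m p (\<lambda>x. mpnorm N (d (F n)) x - mpnorm N \<omega> x) = Lp_norm m p (\<lambda>x. lip (F n) x - mpnorm N \<omega> x)" for n
    using d_pnorm[OF F, of n] d_mem[OF F] \<omega> Lp_measurable[OF p1 lip_in_Lp[OF F]]
    by (intro Lp_norm_cong_AE p1 borel_measurable_diff) (auto elim!: eventually_mono)
  then show ?thesis using N.mconverges_pnorm[OF d_mem[OF F] \<omega> lim] by simp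
qed

text \<open>Strong convergence of the differentials gives strong, and so weak, L^p convergence of
  the slopes to the pointwise norm of the limit.\<close>

lemma pnorm_in_weak_slopes:
  assumes \<omega>: "\<omega> \<in> limit_forms f"
  shows "mpnorm N \<omega> \<in> weak_slopes f"
proof -
  note mem = limit_forms_mem[OF \<omega>]
  obtain F where F: "\<And>n. F n \<in> D" "L0_converges m F f" "mconverges N (\<lambda>n. d (F n)) \<omega>" by (rule limit_formsE[OF \<omega>]) (rule that)
  have "mweakly_converges (Lp_space m p) (\<lambda>n. lip (F n)) (mpnorm N \<omega>)"
    unfolding mweakly_converges_def
    using lip_in_Lp[OF F(1)] N.pnorm_in_Lp[OF mem]
      bounded_functional_Lp_tendsto[OF p1 _ lip_in_Lp[OF F(1)] N.pnorm_in_Lp[OF mem] lip_tendsto_pnorm[OF F(1) mem F(3)]]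
    by (auto simp: Lp_space_def)
  then show ?thesis using F by (auto simp: weak_slopes_def)
qed

text \<open>Weakly convergent slopes are bounded by the uniform boundedness argument, so Mazur's
  selection applies to the very sequence that defines G. The slopes of the selected functions
  converge to the norm of the limit form, and their majorants converge weakly to G.\<close>

lemma weak_slope_ge:
  assumes f: "f \<in> D_relaxed m p" and G: "G \<in> weak_slopes f"
  obtains \<omega> where "\<omega> \<in> limit_forms f" "AE x in m. mpnorm N \<omega> x \<le> G x"
proof -
  obtain F where F: "\<And>n. F n \<in> D" "L0_converges m F f" "mweakly_converges (Lp_space m p) (\<lambda>n. lip (F n)) G"
    using G by (auto simp: weak_slopes_def)
  have GL: "G \<in> Lp m p" using F(3) by (auto simp: mweakly_converges_def Lp_space_def)
  have weak: "(\<lambda>n. \<phi> (lip (F n))) \<longlonglongrightarrow> \<phi> G" if "bounded_functional (Lp_space m p) \<phi>" for \<phi>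
    using F(3) that by (simp add: mweakly_converges_def)
  have "\<exists>C. \<forall>n. Lp_norm m p (lip (F n)) \<le> C"
  proof (rule Lp_weakly_bounded_nonneg[OF p1 lip_in_Lp[OF F(1)]])
    show "AE x in m. 0 \<le> lip (F n) x" for n by (simp add: lip_nonneg)
    show "Bseq (\<lambda>n. \<phi> (lip (F n)))" if "bounded_functional (Lp_space m p) \<phi>" for \<phi>
      using weak[OF that] by (intro convergent_imp_Bseq convergentI)
  qed
  then obtain C where C: "\<And>n. Lp_norm m p (lip (F n)) \<le> C" by blast
  have fm: "f \<in> borel_measurable m" using f by (simp add: D_relaxed_def)
  obtain \<omega> h u where w: "\<omega> \<in> limit_forms f" "\<And>n. h n \<in> D" "mconverges N (\<lambda>n. d (h n)) \<omega>"
    and u: "\<And>n::nat. u n \<in> Lp m p" "\<And>n. AE x in m. lip (h n) x \<le> u n x"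
    "\<And>\<phi> c. bounded_functional (Lp_space m p) \<phi> \<Longrightarrow> (\<lambda>n. \<phi> (lip (F n))) \<longlonglongrightarrow> c \<Longrightarrow> (\<lambda>n. \<phi> (u n)) \<longlonglongrightarrow> c"
    by (rule limit_form_exists[OF F(1) fm F(2) C]) (rule that)
  note mem = limit_forms_mem[OF w(1)]
  have "AE x in m. mpnorm N \<omega> x \<le> G x"
  proof (rule Lp_weak_limit_mono[OF p1 lip_in_Lp[OF w(2)] u(1) N.pnorm_in_Lp[OF mem] GL u(2)])
    fix \<phi> assume b: "bounded_functional (Lp_space m p) \<phi>"
    show "(\<lambda>n. \<phi> (lip (h n))) \<longlonglongrightarrow> \<phi> (mpnorm N \<omega>)"
      by (rule bounded_functional_Lp_tendsto[OF p1 b lip_in_Lp[OF w(2)] N.pnorm_in_Lp[OF mem] lip_tendsto_pnorm[OF w(2) mem w(3)]])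
    show "(\<lambda>n. \<phi> (u n)) \<longlonglongrightarrow> \<phi> G" by (rule u(3)[OF b weak[OF b]])
  qed
  then show ?thesis using that w(1) by blast
qed

abbreviation R where "R \<equiv> relaxed_slope m p"

text \<open>Norms of limit forms are weak slopes, and every weak slope dominates such a norm, so
  both sets have the same lower bounds. From here on weak convergence is no longer involved.\<close>

lemma relaxed_slope_spec:
  assumes f: "f \<in> D_relaxed m p"
  shows R_in_Lp: "R f \<in> Lp m p"
    and R_le: "\<And>\<omega>. \<omega> \<in> limit_forms f \<Longrightarrow> AE x in m. R f x \<le> mpnorm N \<omega> x"
    and R_greatest: "\<And>H. H \<in> Lp m p \<Longrightarrow> (\<And>\<omega>. \<omega> \<in> limit_forms f \<Longrightarrow> AE x in m. H x \<le> mpnorm N \<omega> x) \<Longrightarrow> AE x in m. H x \<le> R f x"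
proof -
  have eq: "R f = Lp_ess_inf m p (weak_slopes f)" by (simp add: relaxed_slope_def weak_slopes_def)
  have 1: "weak_slopes f \<subseteq> Lp m p" by (auto simp: weak_slopes_def mweakly_converges_def Lp_space_def)
  have 2: "weak_slopes f \<noteq> {}" using limit_forms_nonempty[OF f] pnorm_in_weak_slopes by blast
  have 3: "AE x in m. 0 \<le> G x" if G: "G \<in> weak_slopes f" for G
  proof -
    obtain \<omega> where w: "\<omega> \<in> limit_forms f" "AE x in m. mpnorm N \<omega> x \<le> G x" by (rule weak_slope_ge[OF f G])
    show ?thesis using w(2) N.pnorm_nonneg[OF limit_forms_mem[OF w(1)]] by eventually_elim simp
  qed
  note S = Lp_ess_inf_spec[OF p1 1 2 3]
  show "R f \<in> Lp m p" unfolding eq by (rule S(1))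
  show "AE x in m. R f x \<le> mpnorm N \<omega> x" if "\<omega> \<in> limit_forms f" for \<omega>
    unfolding eq by (rule S(2)[OF _ pnorm_in_weak_slopes[OF that]])
  show "AE x in m. H x \<le> R f x"
    if H: "H \<in> Lp m p" "\<And>\<omega>. \<omega> \<in> limit_forms f \<Longrightarrow> AE x in m. H x \<le> mpnorm N \<omega> x" for H
    unfolding eq
  proof (rule S(3)[OF _ H(1)])
    fix G assume G: "G \<in> weak_slopes f"
    obtain \<omega> where w: "\<omega> \<in> limit_forms f" "AE x in m. mpnorm N \<omega> x \<le> G x" by (rule weak_slope_ge[OF f G])
    show "AE x in m. H x \<le> G x" using w(2) H(2)[OF w(1)] by eventually_elim simp
  qed
qed

text \<open>The vanishing infimum is phrased through lower bounds in L^p. Subtracting a known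
  function from a lower bound then allows one such argument to be run inside another.\<close>

definition null_forms :: "'a generated set" where
  "null_forms = {w \<in> mcarrier N. \<forall>H\<in>Lp m p. (\<forall>\<sigma>\<in>limit_forms (\<lambda>x. 0). AE x in m. H x \<le> mpnorm N (madd N w \<sigma>) x) \<longrightarrow> (AE x in m. H x \<le> 0)}"

lemma null_formsD:
  assumes "w \<in> null_forms" "H \<in> Lp m p" "\<And>\<sigma>. \<sigma> \<in> limit_forms (\<lambda>x. 0) \<Longrightarrow> AE x in m. H x \<le> mpnorm N (madd N w \<sigma>) x"
  shows "AE x in m. H x \<le> 0"
  using assms by (auto simp: null_forms_def)

lemma null_formsI:
  assumes "w \<in> mcarrier N"
    "\<And>H. H \<in> Lp m p \<Longrightarrow> (\<And>\<sigma>. \<sigma> \<in> limit_forms (\<lambda>x. 0) \<Longrightarrow> AE x in m. H x \<le> mpnorm N (madd N w \<sigma>) x) \<Longrightarrow> AE x in m. H x \<le> 0"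
  shows "w \<in> null_forms"
  using assms by (auto simp: null_forms_def)

lemma null_forms_mem: "w \<in> null_forms \<Longrightarrow> w \<in> mcarrier N"
  by (simp add: null_forms_def)

lemma limit_forms_uminus: "\<sigma> \<in> limit_forms (\<lambda>x. 0) \<Longrightarrow> mscale N c \<sigma> \<in> limit_forms (\<lambda>x. 0)"
  using limit_forms_scale[of \<sigma> "\<lambda>x. 0" c] by simp

lemma limit_forms_subset_null_forms: "limit_forms (\<lambda>x. 0) \<subseteq> null_forms"
proof
  fix w assume w: "w \<in> limit_forms (\<lambda>x. 0)"
  show "w \<in> null_forms"
  proof (rule null_formsI)
    show mem: "w \<in> mcarrier N" by (rule limit_forms_mem[OF w])
    fix H assume "\<And>\<sigma>. \<sigma> \<in> limit_forms (\<lambda>x. 0) \<Longrightarrow> AE x in m. H x \<le> mpnorm N (madd N w \<sigma>) x"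
    from this[OF limit_forms_uminus[OF w, of "-1"]] show "AE x in m. H x \<le> 0"
      using N.pnorm_zero by (simp add: N.add_uminus mem) (elim AE_mp, auto)
  qed
qed

text \<open>A lower bound \<open>H\<close> for the perturbations of \<open>v\<close>, lowered by |X
  n - v|, is a lower bound for those of \<open>X n\<close>. Hence H \<le> |X n - v| almost
  everywhere for each n, and the right-hand side tends to 0 in L^p.\<close>

lemma null_forms_closed:
  assumes v: "v \<in> mcarrier N" and X: "\<And>n. X n \<in> null_forms" and lim: "mconverges N X v"
  shows "v \<in> null_forms"
proof (rule null_formsI[OF v])
  note Xm = null_forms_mem[OF X]
  fix H assume H: "H \<in> Lp m p" and le: "\<And>\<sigma>. \<sigma> \<in> limit_forms (\<lambda>x. 0) \<Longrightarrow> AE x in m. H x \<le> mpnorm N (madd N v \<sigma>) x"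
  let ?G = "\<lambda>n. mpnorm N (mdiff N (X n) v)"
  have G: "?G n \<in> Lp m p" for n by (intro N.pnorm_in_Lp N.diff_closed Xm v)
  have HG: "AE x in m. H x \<le> ?G n x" for n
  proof -
    have "AE x in m. H x - ?G n x \<le> 0"
    proof (rule null_formsD[OF X[of n] Lp_diff[OF p1 H G]])
      fix \<sigma> assume \<sigma>: "\<sigma> \<in> limit_forms (\<lambda>x. 0)"
      note sm = limit_forms_mem[OF \<sigma>]
      have "mdiff N (madd N v \<sigma>) (madd N (X n) \<sigma>) = mdiff N v (X n)"
        using Xm v sm by (simp add: N.add_diff_add)
      then have "AE x in m. \<bar>mpnorm N (madd N v \<sigma>) x - mpnorm N (madd N (X n) \<sigma>) x\<bar> \<le> mpnorm N (mdiff N v (X n)) x"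
        using N.pnorm_rev_triangle[of "madd N v \<sigma>" "madd N (X n) \<sigma>"] Xm v sm by simp
      then show "AE x in m. H x - ?G n x \<le> mpnorm N (madd N (X n) \<sigma>) x"
        using le[OF \<sigma>] N.pnorm_diff_commute[OF v Xm, of n] by eventually_elim simp
    qed
    then show ?thesis by eventually_elim simp
  qed
  show "AE x in m. H x \<le> 0"
  proof (rule Lp_limit_mono[OF p1 H G H Lp_zero[OF p1] HG])
    show "(\<lambda>n::nat. Lp_norm m p (\<lambda>x. H x - H x)) \<longlonglongrightarrow> 0" by (rule Lp_limit_const[OF p1])
    show "(\<lambda>n. Lp_norm m p (\<lambda>x. ?G n x - 0)) \<longlonglongrightarrow> 0"
      using lim Xm v by (simp add: mconverges_def N.norm_eq_Lp_norm)
  qed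
qed

text \<open>The decisive step, since limit forms of zero are known to be stable only under real
  scalars. It works one value \<open>a\<close> of \<open>s\<close> at a time: where s = a, the norm
  of s w + a \<sigma> is |a| times that of w + \<sigma>, and a \<sigma> is an admissible
  perturbation.\<close>

lemma null_forms_simple_mult:
  assumes s: "simple_function m s" and w: "w \<in> null_forms"
  shows "mmult N s w \<in> null_forms"
proof (rule null_formsI)
  note wm = null_forms_mem[OF w] and sL = simple_function_Linf[OF s]
  show swm: "mmult N s w \<in> mcarrier N" using wm sL by simp
  fix H assume H: "H \<in> Lp m p" and le: "\<And>\<sigma>. \<sigma> \<in> limit_forms (\<lambda>x. 0) \<Longrightarrow> AE x in m. H x \<le> mpnorm N (madd N (mmult N s w) \<sigma>) x"
  have "AE x in m. s x = a \<longrightarrow> H x \<le> 0" if a: "a \<in> s ` space m" for a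
  proof (cases "a = 0")
    \<comment> \<open>The perturbation \<sigma> = 0 suffices, because s w has norm 0 where s
      vanishes.\<close>
    case True
    have "AE x in m. H x \<le> mpnorm N (mmult N s w) x"
      using le[OF zero_in_limit_forms] swm by simp
    then show ?thesis using N.pnorm_mult[OF sL wm] by eventually_elim (auto simp: True)
  next
    case False
    define A where "A = {x \<in> space m. s x = a}"
    have "A = s -` {a} \<inter> space m" by (auto simp: A_def)
    then have A: "A \<in> sets m" using s a by (auto simp: simple_function_def)
    \<comment> \<open>The lower bound divided by |a| and cut off outside the level set; it is then a
      lower bound for the perturbations of \<open>w\<close> on the whole space.\<close>
    define H' where "H' x = indicator A x * ((1 / \<bar>a\<bar>) * H x)" for x
    have H': "H' \<in> Lp m p" unfolding H'_def by (intro Lp_mult_indicator Lp_scale p1 H A)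
    have "AE x in m. H' x \<le> 0"
    proof (rule null_formsD[OF w H'])
      fix \<sigma> assume \<sigma>: "\<sigma> \<in> limit_forms (\<lambda>x. 0)"
      note sm = limit_forms_mem[OF \<sigma>]
      have "mscale N a (madd N w \<sigma>) = madd N (mscale N a w) (mscale N a \<sigma>)" using wm sm by (simp add: N.scale_add_right)
      then have "mdiff N (madd N (mmult N s w) (mscale N a \<sigma>)) (mscale N a (madd N w \<sigma>)) = mdiff N (mmult N s w) (mmult N (\<lambda>_. a) w)"
        using swm wm sm by (simp add: N.add_diff_add N.scale_eq)
      then have "AE x in m. \<bar>mpnorm N (madd N (mmult N s w) (mscale N a \<sigma>)) x - mpnorm N (mscale N a (madd N w \<sigma>)) x\<bar> \<le> \<bar>s x - a\<bar> * mpnorm N w x"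
        using N.pnorm_rev_triangle[of "madd N (mmult N s w) (mscale N a \<sigma>)" "mscale N a (madd N w \<sigma>)"]
          N.pnorm_diff_mult[OF sL N.S_const wm, of a] swm wm sm by simp (elim AE_mp, auto)
      then show "AE x in m. H' x \<le> mpnorm N (madd N w \<sigma>) x"
        using le[OF limit_forms_uminus[OF \<sigma>, of a]] N.pnorm_scale[OF N.add_closed[OF wm sm], of a] N.pnorm_nonneg[OF N.add_closed[OF wm sm]]
      proof eventually_elim
        case (elim x)
        show ?case
        proof (cases "x \<in> A")
          case True
          then have "H x \<le> \<bar>a\<bar> * mpnorm N (madd N w \<sigma>) x" using elim by (simp add: A_def)
          then show ?thesis using True False by (simp add: H'_def field_simps)
        qed (use elim in \<open>simp add: H'_def\<close>)
      qed
    qed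
    then show ?thesis
      using AE_space
    proof eventually_elim
      case (elim x)
      then show ?case using False by (auto simp: H'_def A_def divide_le_0_iff)
    qed
  qed
  moreover have "countable (s ` space m)" using s by (auto simp: simple_function_def intro: countable_finite)
  ultimately have "AE x in m. \<forall>a\<in>s ` space m. s x = a \<longrightarrow> H x \<le> 0" by (subst AE_ball_countable) auto
  then show "AE x in m. H x \<le> 0" using AE_space by eventually_elim auto
qed

text \<open>Sums are handled by two nested arguments: with \<sigma> fixed, H - |u + \<sigma>| is a
  lower bound for the perturbations of \<open>v\<close>, hence at most 0, and then \<sigma> varies.
  Bounded multipliers are uniform limits of simple ones, so closedness finishes that case.\<close>

lemma closed_subspace_null_forms: "closed_subspace m N null_forms"
proof (rule closed_subspaceI)
  show "null_forms \<subseteq> mcarrier N" using null_forms_mem by blast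
  show "mzero N \<in> null_forms" using limit_forms_subset_null_forms zero_in_limit_forms by blast
  show "v \<in> null_forms" if "v \<in> mcarrier N" "\<And>n. X n \<in> null_forms" "mconverges N X v" for X v
    using that by (rule null_forms_closed)
  show "madd N u v \<in> null_forms" if u: "u \<in> null_forms" and v: "v \<in> null_forms" for u v
  proof (rule null_formsI)
    note um = null_forms_mem[OF u] and vm = null_forms_mem[OF v]
    show "madd N u v \<in> mcarrier N" using um vm by simp
    fix H assume H: "H \<in> Lp m p" and le: "\<And>\<sigma>. \<sigma> \<in> limit_forms (\<lambda>x. 0) \<Longrightarrow> AE x in m. H x \<le> mpnorm N (madd N (madd N u v) \<sigma>) x"
    show "AE x in m. H x \<le> 0"
    proof (rule null_formsD[OF u H])
      fix \<sigma> assume \<sigma>: "\<sigma> \<in> limit_forms (\<lambda>x. 0)"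
      note sm = limit_forms_mem[OF \<sigma>]
      note Lu = N.pnorm_in_Lp[OF N.add_closed[OF um sm]]
      have "AE x in m. H x - mpnorm N (madd N u \<sigma>) x \<le> 0"
      proof (rule null_formsD[OF v Lp_diff[OF p1 H Lu]])
        fix \<tau> assume \<tau>: "\<tau> \<in> limit_forms (\<lambda>x. 0)"
        note tm = limit_forms_mem[OF \<tau>]
        have "madd N (madd N u v) (madd N \<sigma> \<tau>) = madd N (madd N u \<sigma>) (madd N v \<tau>)"
          using um vm sm tm by (simp add: N.add_ac)
        then show "AE x in m. H x - mpnorm N (madd N u \<sigma>) x \<le> mpnorm N (madd N v \<tau>) x"
          using le[OF limit_forms_add_zero[OF \<sigma> \<tau>]] N.pnorm_triangle[OF N.add_closed[OF um sm] N.add_closed[OF vm tm]]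
          by simp (elim AE_mp, auto)
      qed
      then show "AE x in m. H x \<le> mpnorm N (madd N u \<sigma>) x" by eventually_elim simp
    qed
  qed
  show "mmult N f v \<in> null_forms" if f: "f \<in> Linf m" and v: "v \<in> null_forms" for f v
  proof -
    note vm = null_forms_mem[OF v]
    obtain s where s: "s \<in> simple_approx m f" using simple_approx_nonempty[OF f] by blast
    note ss = simple_approx_simple[OF s]
    show ?thesis
    proof (rule null_forms_closed)
      show "mmult N f v \<in> mcarrier N" using f vm by simp
      show "mmult N (s n) v \<in> null_forms" for n by (rule null_forms_simple_mult[OF ss v])
      show "mconverges N (\<lambda>n. mmult N (s n) v) (mmult N f v)"
        unfolding mconverges_def
      proof (rule LIMSEQ_I)
        fix e :: real assume e: "0 < e"
        obtain c where c: "0 < c" "mnorm N v * c < e" by (rule ex_small_factor[OF N.norm_nonneg[OF vm] e])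
        have "\<forall>\<^sub>F n in sequentially. mnorm N (mdiff N (mmult N (s n) v) (mmult N f v)) < e"
          using simple_approx_close[OF s c(1)]
        proof eventually_elim
          case (elim n)
          have sf: "(\<lambda>x. s n x - f x) \<in> Linf m" by (rule N.S_diff[OF simple_function_Linf[OF ss] f])
          have "mnorm N (mdiff N (mmult N (s n) v) (mmult N f v)) \<le> c * mnorm N v"
            using N.norm_mult_le[OF sf vm elim] N.mult_diff_left[OF simple_function_Linf[OF ss] f vm, of n] by simp
          then show ?case using c by (simp add: mult.commute)
        qed
        moreover have "0 \<le> mnorm N (mdiff N (mmult N (s n) v) (mmult N f v))" for n
          using simple_function_Linf[OF ss] f vm by (intro N.norm_nonneg) auto
        ultimately show "\<exists>K. \<forall>n\<ge>K. norm (mnorm N (mdiff N (mmult N (s n) v) (mmult N f v)) - 0) < e"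
          by (auto simp: eventually_sequentially)
      qed
    qed
  qed
qed

text \<open>For every limit form \<sigma> of zero, R f \<le> |\<omega> + \<sigma>| \<le> |\<omega> +
  w| + |\<sigma> - w|. So R f - |\<omega> + w| is a lower bound for the perturbations of - w and
  cannot be positive.\<close>

lemma R_le_add_null:
  assumes f: "f \<in> D_relaxed m p" and \<omega>: "\<omega> \<in> limit_forms f" and w: "w \<in> null_forms"
  shows "AE x in m. R f x \<le> mpnorm N (madd N \<omega> w) x"
proof -
  note om = limit_forms_mem[OF \<omega>] and wm = null_forms_mem[OF w]
  have w': "mscale N (-1) w \<in> null_forms"
    by (rule N.closed_subspace_scale[OF closed_subspace_null_forms w])
  have "AE x in m. R f x - mpnorm N (madd N \<omega> w) x \<le> 0"
  proof (rule null_formsD[OF w' Lp_diff[OF p1 R_in_Lp[OF f] N.pnorm_in_Lp[OF N.add_closed[OF om wm]]]])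
    fix \<sigma> assume \<sigma>: "\<sigma> \<in> limit_forms (\<lambda>x. 0)"
    note sm = limit_forms_mem[OF \<sigma>]
    have "madd N (madd N \<omega> w) (madd N (mscale N (-1) w) \<sigma>) = madd N \<omega> (madd N (madd N w (mscale N (-1) w)) \<sigma>)"
      using om wm sm by (simp add: N.add_assoc)
    also have "\<dots> = madd N \<omega> \<sigma>" using om wm sm by (simp only: N.add_uminus) simp
    finally have eq: "madd N (madd N \<omega> w) (madd N (mscale N (-1) w) \<sigma>) = madd N \<omega> \<sigma>" .
    show "AE x in m. R f x - mpnorm N (madd N \<omega> w) x \<le> mpnorm N (madd N (mscale N (-1) w) \<sigma>) x"
      using R_le[OF f limit_forms_add_zero[OF \<omega> \<sigma>]]
        N.pnorm_triangle[of "madd N \<omega> w" "madd N (mscale N (-1) w) \<sigma>"] om wm sm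
      unfolding eq by simp (elim AE_mp, auto)
  qed
  then show ?thesis by eventually_elim simp
qed

section \<open>The submodule generated by the limit forms of zero, and the quotient by it\<close>

abbreviation W where "W \<equiv> Lp_lip0 m p"

lemma W_eq: "W = generated_submodule m p N (limit_forms (\<lambda>x. 0))"
  by (simp add: Lp_lip0_def limit_forms_def)

lemma limit_forms_carrier: "limit_forms f \<subseteq> mcarrier N"
  using limit_forms_mem by blast

lemma closed_subspace_W: "closed_subspace m N W"
  unfolding W_eq by (rule N.closed_subspace_generated[OF limit_forms_carrier])

lemma limit_forms_subset_W: "limit_forms (\<lambda>x. 0) \<subseteq> W"
  unfolding W_eq by (rule N.generated_submodule_superset)

lemma W_subset_null_forms: "W \<subseteq> null_forms"
  unfolding W_eq by (rule N.generated_submodule_least[OF closed_subspace_null_forms limit_forms_subset_null_forms])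

sublocale quot: module_quotient m p "Lp_lip m p" "Lp_lip0 m p"
  by unfold_locales (rule closed_subspace_W)

definition rep :: "('a \<Rightarrow> real) \<Rightarrow> 'a generated" where
  "rep f = (SOME \<omega>. \<omega> \<in> limit_forms f)"

lemma rep_mem: "f \<in> D_relaxed m p \<Longrightarrow> rep f \<in> limit_forms f"
  unfolding rep_def using limit_forms_nonempty[of f] by (simp add: some_in_eq)

lemma coset_eq: "\<lbrakk>\<omega> \<in> limit_forms f; \<eta> \<in> limit_forms f\<rbrakk> \<Longrightarrow> quot.coset \<omega> = quot.coset \<eta>"
  using limit_forms_diff limit_forms_subset_W by (subst quot.coset_eq_iff) (auto intro: limit_forms_mem)

text \<open>All limit forms of \<open>f\<close> lie in one coset, so its pointwise norm is at most
  their essential infimum. Conversely every element of the coset differs from \<omega> by a member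
  of \<open>null_forms\<close> and therefore stays above the relaxed slope.\<close>

lemma coset_pnorm:
  assumes f: "f \<in> D_relaxed m p" and \<omega>: "\<omega> \<in> limit_forms f"
  shows "AE x in m. mpnorm quot.Q (quot.coset \<omega>) x = R f x"
proof -
  note om = limit_forms_mem[OF \<omega>]
  have "AE x in m. mpnorm quot.Q (quot.coset \<omega>) x \<le> R f x"
  proof (rule R_greatest[OF f quot.Q_pnorm_in_Lp[OF om]])
    fix \<eta> assume \<eta>: "\<eta> \<in> limit_forms f"
    show "AE x in m. mpnorm quot.Q (quot.coset \<omega>) x \<le> mpnorm N \<eta> x"
      using quot.Q_pnorm_le_self[OF limit_forms_mem[OF \<eta>]] coset_eq[OF \<omega> \<eta>] by simp
  qed
  moreover have "AE x in m. R f x \<le> mpnorm quot.Q (quot.coset \<omega>) x"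
  proof (rule quot.Q_pnorm_greatest[OF om R_in_Lp[OF f]])
    fix u assume "u \<in> quot.coset \<omega>"
    then have u: "u \<in> mcarrier N" "mdiff N u \<omega> \<in> W" using om by (simp_all add: quot.mem_coset_iff)
    then show "AE x in m. R f x \<le> mpnorm N u x"
      using R_le_add_null[OF f \<omega>, of "mdiff N u \<omega>"] W_subset_null_forms om by auto
  qed
  ultimately show ?thesis by eventually_elim simp
qed

lemma D_relaxed_zero: "(\<lambda>x. 0) \<in> D_relaxed m p"
  unfolding D_relaxed_iff using zero_in_limit_forms by auto

lemma D_relaxed_add:
  assumes "f \<in> D_relaxed m p" "h \<in> D_relaxed m p"
  shows "(\<lambda>x. f x + h x) \<in> D_relaxed m p"
proof -
  have "madd N (rep f) (rep h) \<in> limit_forms (\<lambda>x. f x + h x)" using assms by (intro limit_forms_add rep_mem)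
  then show ?thesis using assms by (auto simp: D_relaxed_iff)
qed

lemma D_relaxed_scale:
  assumes "f \<in> D_relaxed m p"
  shows "(\<lambda>x. c * f x) \<in> D_relaxed m p"
proof -
  have "mscale N c (rep f) \<in> limit_forms (\<lambda>x. c * f x)" using assms by (intro limit_forms_scale rep_mem)
  then show ?thesis using assms by (auto simp: D_relaxed_iff)
qed

lemma D_subset_relaxed: "f \<in> D \<Longrightarrow> f \<in> D_relaxed m p"
  unfolding D_relaxed_iff using limit_forms_d D_measurable by auto

text \<open>Subadditivity and homogeneity are inherited from the pointwise norm of the quotient,
  with which the relaxed slope agrees on the cosets of limit forms.\<close>

lemma subadditive_relaxed_slope: "subadditive_functional m p (D_relaxed m p) R"
proof
  show "1 < p" by (rule p1)
  show "AE x in m. 0 \<le> R f x" if f: "f \<in> D_relaxed m p" for f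
    using coset_pnorm[OF f rep_mem[OF f]] quot.Q_pnorm_nonneg[OF limit_forms_mem[OF rep_mem[OF f]]] by eventually_elim simp
  show "AE x in m. R (\<lambda>y. f y + h y) x \<le> R f x + R h x" if f: "f \<in> D_relaxed m p" and h: "h \<in> D_relaxed m p" for f h
    using coset_pnorm[OF f rep_mem[OF f]] coset_pnorm[OF h rep_mem[OF h]]
      coset_pnorm[OF D_relaxed_add[OF f h] limit_forms_add[OF rep_mem[OF f] rep_mem[OF h]]]
      quot.Q_pnorm_triangle[OF limit_forms_mem[OF rep_mem[OF f]] limit_forms_mem[OF rep_mem[OF h]]]
    by eventually_elim simp
  show "AE x in m. R (\<lambda>y. c * f y) x = \<bar>c\<bar> * R f x" if f: "f \<in> D_relaxed m p" for f c
    using coset_pnorm[OF f rep_mem[OF f]] coset_pnorm[OF D_relaxed_scale[OF f] limit_forms_scale[OF rep_mem[OF f]], of c]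
      quot.Q_pnorm_mult[OF N.S_const limit_forms_mem[OF rep_mem[OF f]], of c]
    unfolding N.scale_eq[OF limit_forms_mem[OF rep_mem[OF f]]] by eventually_elim simp
qed (simp_all add: D_relaxed_zero D_relaxed_add D_relaxed_scale R_in_Lp)

sublocale rs: subadditive_functional m p "D_relaxed m p" "relaxed_slope m p"
  by (rule subadditive_relaxed_slope)

text \<open>The universal property for the map taking \<open>f\<close> to the coset of its limit
  forms. The map is linear because the coset does not depend on the limit form chosen.\<close>

theorem cotangent_isomorphic_quotient: "Lp_module_isomorphic m p (Lp_cotangent m p) quot.Q"
  unfolding Lp_cotangent_def
proof (rule rs.generated_module_universal[where L = "\<lambda>f. quot.coset (rep f)"])
  show Qc: "complete_module m p quot.Q" by (rule quot.complete_quotient)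
  note rm = limit_forms_mem[OF rep_mem]
  show "quot.coset (rep f) \<in> mcarrier quot.Q" if "f \<in> D_relaxed m p" for f using rm[OF that] by simp
  show "quot.coset (rep (\<lambda>x. f x + h x)) = madd quot.Q (quot.coset (rep f)) (quot.coset (rep h))"
    if f: "f \<in> D_relaxed m p" and h: "h \<in> D_relaxed m p" for f h
    using coset_eq[OF rep_mem[OF D_relaxed_add[OF f h]] limit_forms_add[OF rep_mem[OF f] rep_mem[OF h]]] rm[OF f] rm[OF h]
    by (simp add: quot.Q_add)
  show "quot.coset (rep (\<lambda>x. c * f x)) = mscale quot.Q c (quot.coset (rep f))" if f: "f \<in> D_relaxed m p" for c f
    using coset_eq[OF rep_mem[OF D_relaxed_scale[OF f]] limit_forms_scale[OF rep_mem[OF f]]] rm[OF f] by (simp add: quot.Q_scale)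
  show "AE x in m. mpnorm quot.Q (quot.coset (rep f)) x = R f x" if f: "f \<in> D_relaxed m p" for f
    by (rule coset_pnorm[OF f rep_mem[OF f]])
  fix Y assume Y: "closed_subspace m quot.Q Y" and LY: "\<And>f. f \<in> D_relaxed m p \<Longrightarrow> quot.coset (rep f) \<in> Y"
  note YD = closed_subspaceD[OF Y]
  \<comment> \<open>Generation is pulled back along the projection: the preimage of \<open>Y\<close>
    is a closed subspace containing every differential, so it is the whole Lipschitz module.\<close>
  define X where "X = {v \<in> mcarrier N. quot.coset v \<in> Y}"
  have "X = mcarrier N"
  proof (rule closed_subspace_d)
    show "d f \<in> X" if f: "f \<in> D" for f
      using LY[OF D_subset_relaxed[OF f]] coset_eq[OF rep_mem[OF D_subset_relaxed[OF f]] limit_forms_d[OF f]] d_mem[OF f]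
      by (simp add: X_def)
    show "closed_subspace m N X"
    proof (rule closed_subspaceI)
      show "X \<subseteq> mcarrier N" by (auto simp: X_def)
      show "mzero N \<in> X" using YD(2) by (simp add: X_def quot.Q_zero)
      show "madd N u v \<in> X" if "u \<in> X" "v \<in> X" for u v
        using that YD(3)[of "quot.coset u" "quot.coset v"] by (simp add: X_def quot.Q_add)
      show "mmult N f v \<in> X" if "f \<in> Linf m" "v \<in> X" for f v
        using that YD(4)[of f "quot.coset v"] by (simp add: X_def quot.Q_mult)
      show "v \<in> X" if v: "v \<in> mcarrier N" and Z: "\<And>n. Z n \<in> X" and lim: "mconverges N Z v" for Z v
      proof -
        have Zm: "Z n \<in> mcarrier N" "quot.coset (Z n) \<in> Y" for n using Z by (auto simp: X_def)
        interpret Qm: complete_module m p quot.Q by (rule Qc)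
        have "mconverges quot.Q (\<lambda>n. quot.coset (Z n)) (quot.coset v)"
          unfolding mconverges_def
        proof (rule Lim_null_comparison[OF _ lim[unfolded mconverges_def]], intro always_eventually allI)
          fix n
          show "norm (mnorm quot.Q (mdiff quot.Q (quot.coset (Z n)) (quot.coset v))) \<le> mnorm N (mdiff N (Z n) v)"
            using Zm(1)[of n] v quot.Q_norm_le[of "mdiff N (Z n) v"] Qm.norm_nonneg[of "quot.coset (mdiff N (Z n) v)"]
            by (simp add: quot.Q_diff)
        qed
        then have "quot.coset v \<in> Y" by (rule YD(5)[OF quot.coset_in_Q[OF v] Zm(2)])
        then show ?thesis using v by (simp add: X_def)
      qed
    qed
  qed
  then show "Y = mcarrier quot.Q" using YD(1) by (auto simp: X_def quot.carrier_Q)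
qed

text \<open>Closability says that zero is the only limit form of the zero function; since {0} is
  itself a submodule, this is the same as triviality of the generated one.\<close>

lemma closable_iff: "d_lip_closable m p \<longleftrightarrow> W = {mzero N}"
proof
  assume "d_lip_closable m p"
  then have "limit_forms (\<lambda>x. 0) \<subseteq> {mzero N}"
    unfolding d_lip_closable_def limit_forms_def by blast
  then have "W \<subseteq> {mzero N}" unfolding W_eq by (rule N.generated_submodule_least[OF N.closed_subspace_zero])
  then show "W = {mzero N}" using closed_subspaceD(2)[OF closed_subspace_W] by blast
next
  assume "W = {mzero N}"
  then have "limit_forms (\<lambda>x. 0) \<subseteq> {mzero N}" using limit_forms_subset_W by blast
  then show "d_lip_closable m p"
    unfolding d_lip_closable_def limit_forms_def by blast
qed

section \<open>The closable case\<close>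

context
  assumes closable: "d_lip_closable m p"
begin

lemma limit_forms_unique:
  assumes "\<omega> \<in> limit_forms f" "\<eta> \<in> limit_forms f"
  shows "\<omega> = \<eta>"
  using limit_forms_diff[OF assms] limit_forms_subset_W closable[unfolded closable_iff]
    N.diff_eq_zero_iff[OF assms[THEN limit_forms_mem]] by blast

text \<open>Each function now has at most one limit form, so the essential infimum runs over a
  single function.\<close>

lemma pnorm_eq_R:
  assumes f: "f \<in> D_relaxed m p" and \<omega>: "\<omega> \<in> limit_forms f"
  shows "AE x in m. mpnorm N \<omega> x = R f x"
proof -
  have "AE x in m. mpnorm N \<omega> x \<le> R f x"
    by (rule R_greatest[OF f N.pnorm_in_Lp[OF limit_forms_mem[OF \<omega>]]]) (use limit_forms_unique[OF \<omega>] in auto)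
  then show ?thesis using R_le[OF f \<omega>] by eventually_elim simp
qed

theorem closable_slope: "f \<in> D \<Longrightarrow> AE x in m. R f x = lip f x"
  using pnorm_eq_R[OF D_subset_relaxed limit_forms_d, of f] d_pnorm[of f] by (simp, elim AE_mp) auto

text \<open>Obtained from the universal property with the unique limit form of \<open>f\<close> as
  its image, which bypasses the quotient by {0}. Generation is immediate because the limit form of a
  function in \<open>D\<close> is its own differential.\<close>

theorem closable_isomorphic: "Lp_module_isomorphic m p (Lp_cotangent m p) N"
  unfolding Lp_cotangent_def
proof (rule rs.generated_module_universal[where L = rep])
  show "complete_module m p N" by unfold_locales
  show "rep f \<in> mcarrier N" if "f \<in> D_relaxed m p" for f by (rule limit_forms_mem[OF rep_mem[OF that]])
  show "rep (\<lambda>x. f x + h x) = madd N (rep f) (rep h)" if f: "f \<in> D_relaxed m p" and h: "h \<in> D_relaxed m p" for f h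
    by (rule limit_forms_unique[OF rep_mem[OF D_relaxed_add[OF f h]] limit_forms_add[OF rep_mem[OF f] rep_mem[OF h]]])
  show "rep (\<lambda>x. c * f x) = mscale N c (rep f)" if f: "f \<in> D_relaxed m p" for c f
    by (rule limit_forms_unique[OF rep_mem[OF D_relaxed_scale[OF f]] limit_forms_scale[OF rep_mem[OF f]]])
  show "AE x in m. mpnorm N (rep f) x = R f x" if f: "f \<in> D_relaxed m p" for f
    by (rule pnorm_eq_R[OF f rep_mem[OF f]])
  fix Y assume Y: "closed_subspace m N Y" and LY: "\<And>f. f \<in> D_relaxed m p \<Longrightarrow> rep f \<in> Y"
  show "Y = mcarrier N"
  proof (rule closed_subspace_d[OF Y])
    fix f assume f: "f \<in> D"
    show "d f \<in> Y"
      using LY[OF D_subset_relaxed[OF f]] limit_forms_unique[OF rep_mem[OF D_subset_relaxed[OF f]] limit_forms_d[OF f]] by simp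
  qed
qed

end

end

theorem theorem3p7:
  fixes m :: "'a::complete_space measure" and p :: real
  assumes "radon_measure m"
    and "1 < p"
    and "weakly_reflexive m p"
  shows "submodule m p (Lp_lip m p) (Lp_lip0 m p) \<and>
    Lp_module_isomorphic m p (Lp_cotangent m p)
      (quotient_module m p (Lp_lip m p) (Lp_lip0 m p)) \<and>
    (d_lip_closable m p \<longleftrightarrow> Lp_lip0 m p = {mzero (Lp_lip m p)}) \<and>
    (d_lip_closable m p \<longrightarrow>
      Lp_module_isomorphic m p (Lp_cotangent m p) (Lp_lip m p) \<and>
      (\<forall>f\<in>D_lip m p. AE x in m. relaxed_slope m p f x = lip f x))"
proof -
  interpret weakly_reflexive_space m p
    using assms by unfold_locales (simp_all add: radon_measure_def)
  show ?thesis
    using closed_subspace_W cotangent_isomorphic_quotient closable_iff closable_isomorphic closable_slope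
    by (simp add: N.submodule_iff)
qed

end
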